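(* Let $M\ge4$. There exist $\eta_{ap},\delta_{ap}\in(0,1]$ and $C_{ap}>0$, depending only on $M$ and the parameters, such that if $T>0$ and $(u,p,\theta,K)$ is a smooth solution of (P) on $[0,T]\times\mathbb T^3$ with $u(t)$ of mean zero for all $t$, $J_{eq}+K(0,x)$ having spectrum $\{\lambda,\lambda,\nu\}$ for every $x$, and $$(\mathcal E_M+\mathcal F_M)(0)\le\eta_{ap},\qquad \sup_{0\le t\le T}\mathcal E_M(t)+\int_0^T\overline{\mathcal D}_M\le\delta_{ap},$$ then $$\sup_{0\le t\le T}\Big(\mathcal E_{low}(t)(1+t)^{2M-2}+\overline{\mathcal E}_M(t)+\frac{\mathcal F_M(t)}{1+t}\Big)+\int_0^T\mathcal D_M\le C_{ap}(\overline{\mathcal E}_M+\mathcal F_M)(0)$$ and $$\sup_{0\le t\le T}\mathcal E_M^{(K)}(t)\le C_{ap}(\mathcal E_M+\mathcal F_M)(0).$$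
   Context: Let $\mathbb{T}^3=\mathbb{R}^3/\mathbb{Z}^3$. Fix constants $\mu,\kappa,\alpha,\beta,\gamma>0$, $\tau>0$ and $\nu>\lambda>0$; set $\tilde\alpha=\alpha+\tfrac43\beta$, $\tilde\gamma=\beta+\gamma$, $\tilde\tau=\tau/(2\kappa)$, $\omega_{eq}=\tilde\tau e_3$, $J_{eq}=\mathrm{diag}(\lambda,\lambda,\nu)$. $\mathrm{ten}\,w$ is the antisymmetric matrix with $(\mathrm{ten}\,w)v=w\times v$; $\Omega_{eq}=\mathrm{ten}\,\omega_{eq}$, $\Theta=\mathrm{ten}\,\theta$, $[A,B]=AB-BA$. System (P): $\partial_t u+(u\cdot\nabla)u=(\mu+\kappa/2)\Delta u+\kappa\nabla\times\theta-\nabla p$, $\nabla\cdot u=0$, $(J_{eq}+K)(\partial_t\theta+(u\cdot\nabla)\theta)+(\omega_{eq}+\theta)\times\big((J_{eq}+K)(\omega_{eq}+\theta)\big)=\kappa\nabla\times u-2\kappa\theta+(\tilde\alpha-\tilde\gamma)\nabla(\nabla\cdot\theta)+\tilde\gamma\Delta\theta$, $\partial_t K+(u\cdot\nabla)K=[\Omega_{eq}+\Theta,J_{eq}+K]$, $K$ symmetric. $a=(K_{13},K_{23})$. Parabolic norms: $\partial^\alpha=\partial_t^{\alpha_0}\partial_x^{\bar\alpha}$, $|\alpha|_P=2\alpha_0+|\bar\alpha|$, $\|f\|_{P^k}^2=\sum_{|\alpha|_P\le k}\|\partial^\alpha f\|_{L^2}^2$, squared norms of tuples add. Functionals: $\overline{\mathcal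 E}_M=\|(u,\theta,a)\|_{P^{2M}}^2$; $\mathcal E_{low}=\|(u,\theta,a)\|_{P^2}^2+\|\partial_t a\|_{H^1}^2+\|\partial_t^2a\|_{L^2}^2$; $\mathcal E^{(K)}_M=\|K\|_{H^{2M-3}}^2+\|\partial_tK\|_{H^{2M-3}}^2+\|\partial_t^2K\|_{H^{2M-3}}^2+\sum_{j=3}^M\|\partial_t^jK\|_{H^{2M-2j+2}}^2$; $\mathcal E_M=\overline{\mathcal E}_M+\mathcal E_M^{(K)}$; $\mathcal F_M=\|K\|_{H^{2M+1}}^2+\|\partial_tK\|_{H^{2M}}^2+\|\partial_t^2K\|_{H^{2M-2}}^2$; $\overline{\mathcal D}_M=\|(u,\theta)\|_{P^{2M+1}}^2$; $\mathcal D_M=\overline{\mathcal D}_M+\sum_{j=0}^3\|\partial_t^ja\|_{H^{2M-j-1}}^2+\sum_{j=4}^M\|\partial_t^ja\|_{H^{2M-2j+3}}^2$. *)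

theory Defs
  imports "HOL-Analysis.Analysis"
begin

text \<open>Directions of differentiation: time, or one of the three space coordinates.
  Fields are functions of time t and x in R^3 (periodic in x, i.e. functions on T^3).\<close>
datatype dirn = Dt | Dx 3

definition pder :: "real \<Rightarrow> dirn \<Rightarrow> (real \<Rightarrow> real^3 \<Rightarrow> 'a::real_normed_vector)
    \<Rightarrow> real \<Rightarrow> real^3 \<Rightarrow> 'a" where
  "pder T d g = (case d of
      Dt \<Rightarrow> (\<lambda>t x. vector_derivative (\<lambda>s. g s x) (at t within {0..T}))
    | Dx i \<Rightarrow> (\<lambda>t x. vector_derivative (\<lambda>h. g t (x + h *\<^sub>R axis i 1)) (at 0)))"

definition pders :: "real \<Rightarrow> dirn list \<Rightarrow> (real \<Rightarrow> real^3 \<Rightarrow> 'a::real_normed_vector)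
    \<Rightarrow> real \<Rightarrow> real^3 \<Rightarrow> 'a" where
  "pders T ds g = foldr (pder T) ds g"

definition smooth_on :: "real \<Rightarrow> (real \<Rightarrow> real^3 \<Rightarrow> 'a::real_normed_vector) \<Rightarrow> bool" where
  "smooth_on T g \<longleftrightarrow> (\<forall>ds. 
      (\<forall>t\<in>{0..T}. \<forall>x. (\<lambda>s. pders T ds g s x) differentiable (at t within {0..T})) \<and>
      (\<forall>i. \<forall>t\<in>{0..T}. \<forall>x. (\<lambda>h. pders T ds g t (x + h *\<^sub>R axis i 1)) differentiable (at 0)) \<and>
      continuous_on ({0..T} \<times> UNIV) (\<lambda>(t,x). pders T ds g t x))"

definition periodic :: "(real \<Rightarrow> real^3 \<Rightarrow> 'a) \<Rightarrow> bool" where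
  "periodic g \<longleftrightarrow> (\<forall>t x i. g t (x + axis i 1) = g t x)"

definition ptd :: "real \<Rightarrow> nat \<Rightarrow> (real \<Rightarrow> real^3 \<Rightarrow> 'a::real_normed_vector)
    \<Rightarrow> real \<Rightarrow> real^3 \<Rightarrow> 'a" where
  "ptd T j g = (pder T Dt ^^ j) g"

definition sder :: "real \<Rightarrow> nat \<times> nat \<times> nat \<Rightarrow> (real \<Rightarrow> real^3 \<Rightarrow> 'a::real_normed_vector)
    \<Rightarrow> real \<Rightarrow> real^3 \<Rightarrow> 'a" where
  "sder T a g = (case a of (a1,a2,a3) \<Rightarrow>
      (pder T (Dx 1) ^^ a1) ((pder T (Dx 2) ^^ a2) ((pder T (Dx 3) ^^ a3) g)))"

definition conv :: "real \<Rightarrow> (real \<Rightarrow> real^3 \<Rightarrow> real^3) \<Rightarrow> (real \<Rightarrow> real^3 \<Rightarrow> 'a::real_normed_vector)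
    \<Rightarrow> real \<Rightarrow> real^3 \<Rightarrow> 'a" where
  "conv T u v t x = (\<Sum>i\<in>UNIV. (u t x $ i) *\<^sub>R pder T (Dx i) v t x)"

definition lap :: "real \<Rightarrow> (real \<Rightarrow> real^3 \<Rightarrow> 'a::real_normed_vector) \<Rightarrow> real \<Rightarrow> real^3 \<Rightarrow> 'a" where
  "lap T v t x = (\<Sum>i\<in>UNIV. pder T (Dx i) (pder T (Dx i) v) t x)"

definition grad :: "real \<Rightarrow> (real \<Rightarrow> real^3 \<Rightarrow> real) \<Rightarrow> real \<Rightarrow> real^3 \<Rightarrow> real^3" where
  "grad T p t x = (\<chi> i. pder T (Dx i) p t x)"

definition divg :: "real \<Rightarrow> (real \<Rightarrow> real^3 \<Rightarrow> real^3) \<Rightarrow> real \<Rightarrow> real^3 \<Rightarrow> real" where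
  "divg T v t x = (\<Sum>i\<in>UNIV. pder T (Dx i) (\<lambda>s y. v s y $ i) t x)"

definition curl :: "real \<Rightarrow> (real \<Rightarrow> real^3 \<Rightarrow> real^3) \<Rightarrow> real \<Rightarrow> real^3 \<Rightarrow> real^3" where
  "curl T v t x = (let d = (\<lambda>i j. pder T (Dx i) (\<lambda>s y. v s y $ j) t x) in
      vector [d 2 3 - d 3 2, d 3 1 - d 1 3, d 1 2 - d 2 1])"

definition ten :: "real^3 \<Rightarrow> real^3^3" where
  "ten w = matrix (\<lambda>v. cross3 w v)"

definition Jeq :: "real \<Rightarrow> real \<Rightarrow> real^3^3" where
  "Jeq lam nu = (\<chi> i j. if i = j then (if i = 3 then nu else lam) else 0)"

definition omega_eq :: "real \<Rightarrow> real \<Rightarrow> real^3" where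
  "omega_eq tau kappa = vector [0, 0, tau / (2 * kappa)]"

definition aK :: "(real \<Rightarrow> real^3 \<Rightarrow> real^3^3) \<Rightarrow> real \<Rightarrow> real^3 \<Rightarrow> real^2" where
  "aK K t x = vector [K t x $ 1 $ 3, K t x $ 2 $ 3]"

definition system_P :: "real \<Rightarrow> real \<Rightarrow> real \<Rightarrow> real \<Rightarrow> real \<Rightarrow> real \<Rightarrow> real \<Rightarrow> real \<Rightarrow>
    real \<Rightarrow> (real \<Rightarrow> real^3 \<Rightarrow> real^3) \<Rightarrow> (real \<Rightarrow> real^3 \<Rightarrow> real) \<Rightarrow>
    (real \<Rightarrow> real^3 \<Rightarrow> real^3) \<Rightarrow> (real \<Rightarrow> real^3 \<Rightarrow> real^3^3) \<Rightarrow> bool" where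
  "system_P mu kappa alpha beta gamma tau lam nu T u p \<theta> K \<longleftrightarrow>
    (let at' = alpha + 4/3 * beta; gt = beta + gamma; J = Jeq lam nu;
         w = omega_eq tau kappa in
    \<forall>t\<in>{0..T}. \<forall>x.
      pder T Dt u t x + conv T u u t x
        = (mu + kappa/2) *\<^sub>R lap T u t x + kappa *\<^sub>R curl T \<theta> t x - grad T p t x \<and>
      divg T u t x = 0 \<and>
      (J + K t x) *v (pder T Dt \<theta> t x + conv T u \<theta> t x)
        + cross3 (w + \<theta> t x) ((J + K t x) *v (w + \<theta> t x))
        = kappa *\<^sub>R curl T u t x - (2 * kappa) *\<^sub>R \<theta> t x
          + (at' - gt) *\<^sub>R grad T (divg T \<theta>) t x + gt *\<^sub>R lap T \<theta> t x \<and>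
      pder T Dt K t x + conv T u K t x
        = (ten w + ten (\<theta> t x)) ** (J + K t x) - (J + K t x) ** (ten w + ten (\<theta> t x)) \<and>
      transpose (K t x) = K t x)"

definition L2sq :: "(real^3 \<Rightarrow> 'a::real_normed_vector) \<Rightarrow> real" where
  "L2sq f = integral (cbox 0 1) (\<lambda>x. (norm (f x))\<^sup>2)"

definition Hs_sq :: "real \<Rightarrow> nat \<Rightarrow> (real \<Rightarrow> real^3 \<Rightarrow> 'a::real_normed_vector) \<Rightarrow> real \<Rightarrow> real" where
  "Hs_sq T s g t = (\<Sum>a\<in>{(a1,a2,a3). a1 + a2 + a3 \<le> s}. L2sq (sder T a g t))"

definition Psq :: "real \<Rightarrow> nat \<Rightarrow> (real \<Rightarrow> real^3 \<Rightarrow> 'a::real_normed_vector) \<Rightarrow> real \<Rightarrow> real" where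
  "Psq T k g t = (\<Sum>(a0,a)\<in>{(a0,a1,a2,a3). 2 * a0 + a1 + a2 + a3 \<le> k}.
      L2sq (sder T a (ptd T a0 g) t))"

definition Ebar where
  "Ebar T M u \<theta> K t = Psq T (2*M) u t + Psq T (2*M) \<theta> t + Psq T (2*M) (aK K) t"

definition Elow where
  "Elow T u \<theta> K t = Psq T 2 u t + Psq T 2 \<theta> t + Psq T 2 (aK K) t
     + Hs_sq T 1 (ptd T 1 (aK K)) t + Hs_sq T 0 (ptd T 2 (aK K)) t"

definition EK where
  "EK T M K t = Hs_sq T (2*M-3) K t + Hs_sq T (2*M-3) (ptd T 1 K) t
     + Hs_sq T (2*M-3) (ptd T 2 K) t
     + (\<Sum>j\<in>{3..M}. Hs_sq T (2*M-2*j+2) (ptd T j K) t)"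

definition Efull where
  "Efull T M u \<theta> K t = Ebar T M u \<theta> K t + EK T M K t"

definition Ffun where
  "Ffun T M K t = Hs_sq T (2*M+1) K t + Hs_sq T (2*M) (ptd T 1 K) t
     + Hs_sq T (2*M-2) (ptd T 2 K) t"

definition Dbar where
  "Dbar T M u \<theta> t = Psq T (2*M+1) u t + Psq T (2*M+1) \<theta> t"

definition Dfull where
  "Dfull T M u \<theta> K t = Dbar T M u \<theta> t
     + (\<Sum>j\<in>{0..3}. Hs_sq T (2*M-j-1) (ptd T j (aK K)) t)
     + (\<Sum>j\<in>{4..M}. Hs_sq T (2*M-2*j+3) (ptd T j (aK K)) t)"

end

theory Submission
  imports Defs
begin

text \<open>Only spatial derivatives are estimated by energies.  For \<open>s = 2, \<dots>, 2 M\<close> the functional \<open>Y\<^sub>s\<close> is the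
  squared \<open>H\<^sup>s\<close> norm of \<open>(u, \<theta>, a)\<close>, suitably weighted, plus a small multiple of the scalar product of
  \<open>J \<theta>\<close> with a rotation of \<open>a\<close> in \<open>H\<^bsup>s-1\<^esup>\<close>.  The cross term makes \<open>a\<close> dissipative, with a loss of one
  derivative: \<open>Y\<^sub>s' \<le> - c DD\<^sub>s\<^sup>2 + \<dots>\<close> with \<open>DD\<^sub>s\<close> the norm of \<open>(u, \<theta>)\<close> in \<open>H\<^bsup>s+1\<^esup>\<close> and of \<open>a\<close> in \<open>H\<^bsup>s-1\<^esup>\<close>.
  Since \<open>Y\<^sub>s \<le> C DD\<^sub>s\<^sub>+\<^sub>1\<^sup>2\<close>, the sum of the \<open>Y\<^sub>s\<close> with weights \<open>(\<rho> (1 + t))\<^bsup>2M-s\<^esup>\<close> is a Lyapunov functional: the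
  derivative of the weight at level \<open>s\<close> is absorbed at level \<open>s + 1\<close>.  This yields the decay
  rate without any interpolation.  The only products that are not small are those with the top
  norm of \<open>K\<close>, which grows like \<open>sqrt (1 + t)\<close>; the weighted dissipation of the level below pays for them,
  and adding a multiple of \<open>\<parallel>K\<parallel>\<^sup>2 / (1 + t)\<close> to the functional closes a continuity argument.  The time
  derivatives are then read off the equations; the pressure drops out because its gradient is
  orthogonal to the divergence free time derivatives of \<open>u\<close>.\<close>

section \<open>Calculus of smooth fields\<close>

text \<open>Two fields are identified if they agree on the time interval: \<^term>\<open>pder T Dt f\<close> is
  arbitrary outside of \<^term>\<open>{0..T}\<close>.\<close>

definition eqT :: "real \<Rightarrow> (real \<Rightarrow> real^3 \<Rightarrow> 'a) \<Rightarrow> (real \<Rightarrow> real^3 \<Rightarrow> 'a) \<Rightarrow> bool" where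
  "eqT T f g \<longleftrightarrow> (\<forall>t\<in>{0..T}. \<forall>x. f t x = g t x)"

lemma eqT_refl [simp]: "eqT T f f"
  by (simp add: eqT_def)

lemma eqT_sym: "eqT T f g \<Longrightarrow> eqT T g f"
  by (simp add: eqT_def)

lemma eqT_trans [trans]: "eqT T f g \<Longrightarrow> eqT T g h \<Longrightarrow> eqT T f h"
  by (simp add: eqT_def)

lemma eqTD: "eqT T f g \<Longrightarrow> t \<in> {0..T} \<Longrightarrow> f t x = g t x"
  by (simp add: eqT_def)

lemma eqT_fun: "eqT T f g \<Longrightarrow> t \<in> {0..T} \<Longrightarrow> f t = g t"
  by (auto simp add: eqT_def)

lemma pder_cong:
  assumes "eqT T f g"
  shows "eqT T (pder T d f) (pder T d g)"
proof -
  have "pder T d f t x = pder T d g t x" if t: "t \<in> {0..T}" for t x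
  proof (cases d)
    case Dt
    have *: "((\<lambda>s. f s x) has_vector_derivative D) (at t within {0..T}) \<longleftrightarrow>
        ((\<lambda>s. g s x) has_vector_derivative D) (at t within {0..T})" for D
      using has_vector_derivative_transform[OF t, of "\<lambda>s. f s x" "\<lambda>s. g s x" D]
        has_vector_derivative_transform[OF t, of "\<lambda>s. g s x" "\<lambda>s. f s x" D] assms
      by (auto simp: eqT_def)
    show ?thesis
      unfolding Dt pder_def vector_derivative_def using * by simp
  next
    case (Dx i)
    have "(\<lambda>h. f t (x + h *\<^sub>R axis i 1)) = (\<lambda>h. g t (x + h *\<^sub>R axis i 1))"
      using assms t by (auto simp: eqT_def)
    then show ?thesis by (simp add: Dx pder_def)
  qed
  then show ?thesis by (simp add: eqT_def)
qed

lemma pders_Nil [simp]: "pders T [] f = f"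
  by (simp add: pders_def)

lemma pders_Cons [simp]: "pders T (d # ds) f = pder T d (pders T ds f)"
  by (simp add: pders_def)

lemma pders_append: "pders T (ds @ es) f = pders T ds (pders T es f)"
  by (simp add: pders_def)

lemma pders_cong: "eqT T f g \<Longrightarrow> eqT T (pders T ds f) (pders T ds g)"
  by (induction ds) (auto intro: pder_cong)

definition smper :: "real \<Rightarrow> (real \<Rightarrow> real^3 \<Rightarrow> 'a::real_normed_vector) \<Rightarrow> bool" where
  "smper T f \<longleftrightarrow> T > 0 \<and> smooth_on T f \<and> periodic f"

lemma smooth_on_pder: "smooth_on T f \<Longrightarrow> smooth_on T (pder T d f)"
proof -
  assume f: "smooth_on T f"
  have "pders T ds (pder T d f) = pders T (ds @ [d]) f" for ds
    by (simp add: pders_append)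
  then show ?thesis using f unfolding smooth_on_def by metis
qed

lemma periodic_pder: "periodic f \<Longrightarrow> periodic (pder T d f)"
proof (cases d)
  case (Dx i)
  assume p: "periodic f"
  have "x + axis j 1 + h *\<^sub>R axis i 1 = (x + h *\<^sub>R axis i 1) + axis j 1" for x :: "real^3" and j h
    by (simp add: algebra_simps)
  then have "f t (x + axis j 1 + h *\<^sub>R axis i 1) = f t (x + h *\<^sub>R axis i 1)" for t x j h
    using p by (metis periodic_def)
  then show ?thesis by (simp add: Dx periodic_def pder_def)
qed (simp add: periodic_def pder_def)

lemma smper_pder: "smper T f \<Longrightarrow> smper T (pder T d f)"
  by (simp add: smper_def smooth_on_pder periodic_pder)

lemma smper_pders: "smper T f \<Longrightarrow> smper T (pders T ds f)"
  by (induction ds) (auto intro: smper_pder)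

lemma smooth_on_Dt:
  assumes "smooth_on T f" "t \<in> {0..T}"
  shows "((\<lambda>s. f s x) has_vector_derivative pder T Dt f t x) (at t within {0..T})"
proof -
  have "(\<lambda>s. pders T [] f s x) differentiable (at t within {0..T})"
    using assms unfolding smooth_on_def by blast
  then show ?thesis by (simp add: pder_def vector_derivative_works)
qed

lemma smooth_on_Dx0:
  assumes "smooth_on T f" "t \<in> {0..T}"
  shows "((\<lambda>h. f t (x + h *\<^sub>R axis i 1)) has_vector_derivative pder T (Dx i) f t x) (at 0)"
proof -
  have "(\<lambda>h. pders T [] f t (x + h *\<^sub>R axis i 1)) differentiable (at 0)"
    using assms unfolding smooth_on_def by blast
  then show ?thesis by (simp add: pder_def vector_derivative_works)
qed

lemma smooth_on_Dx:
  assumes "smooth_on T f" "t \<in> {0..T}"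
  shows "((\<lambda>h. f t (x + h *\<^sub>R axis i 1)) has_vector_derivative
    pder T (Dx i) f t (x + h *\<^sub>R axis i 1)) (at h within S)"
proof -
  have 1: "((\<lambda>h'. f t ((x + h *\<^sub>R axis i 1) + h' *\<^sub>R axis i 1)) has_vector_derivative
    pder T (Dx i) f t (x + h *\<^sub>R axis i 1)) (at (h - h))"
    using smooth_on_Dx0[OF assms] by simp
  have 2: "((\<lambda>k. k - h) has_vector_derivative 1) (at h)"
    by (auto intro!: derivative_eq_intros)
  have "((\<lambda>h'. f t ((x + h *\<^sub>R axis i 1) + h' *\<^sub>R axis i 1)) \<circ> (\<lambda>k. k - h) has_vector_derivative
    1 *\<^sub>R pder T (Dx i) f t (x + h *\<^sub>R axis i 1)) (at h)"
    by (rule vector_diff_chain_at[OF 2]) (use 1 in simp)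
  moreover have "(\<lambda>h'. f t ((x + h *\<^sub>R axis i 1) + h' *\<^sub>R axis i 1)) \<circ> (\<lambda>k. k - h) =
      (\<lambda>h. f t (x + h *\<^sub>R axis i 1))"
    by (auto simp: algebra_simps o_def)
  ultimately show ?thesis by (auto intro: has_vector_derivative_at_within)
qed

lemma smooth_on_continuous:
  "smooth_on T f \<Longrightarrow> continuous_on ({0..T} \<times> UNIV) (\<lambda>(t,x). f t x)"
  unfolding smooth_on_def by (metis pders_Nil)

lemma smooth_on_continuous_compose:
  assumes "smooth_on T f" "continuous_on S g" "continuous_on S h" "\<And>s. s \<in> S \<Longrightarrow> g s \<in> {0..T}"
  shows "continuous_on S (\<lambda>s. f (g s) (h s))"
proof -
  have "continuous_on S (\<lambda>s. (\<lambda>(t,x). f t x) (g s, h s))"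
    by (rule continuous_on_compose2[OF smooth_on_continuous[OF assms(1)]])
       (use assms in \<open>auto intro!: continuous_intros\<close>)
  then show ?thesis by simp
qed

lemma pder_Dt_eqI:
  assumes "T > 0" "t \<in> {0..T}" "((\<lambda>s. f s x) has_vector_derivative D) (at t within {0..T})"
  shows "pder T Dt f t x = D"
  using vector_derivative_within_cbox[of 0 T t "\<lambda>s. f s x" D] assms by (simp add: pder_def)

lemma pder_Dx_eqI:
  assumes "((\<lambda>h. f t (x + h *\<^sub>R axis i 1)) has_vector_derivative D) (at 0)"
  shows "pder T (Dx i) f t x = D"
  using vector_derivative_at[OF assms] by (simp add: pder_def)

lemma smooth_on_coinduct:
  fixes f :: "real \<Rightarrow> real^3 \<Rightarrow> 'a::real_normed_vector"
  assumes P: "P f"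
    and t: "\<And>g t x. P g \<Longrightarrow> t \<in> {0..T} \<Longrightarrow> (\<lambda>s. g s x) differentiable (at t within {0..T})"
    and x: "\<And>g t x i. P g \<Longrightarrow> t \<in> {0..T} \<Longrightarrow> (\<lambda>h. g t (x + h *\<^sub>R axis i 1)) differentiable (at 0)"
    and c: "\<And>g. P g \<Longrightarrow> continuous_on ({0..T} \<times> UNIV) (\<lambda>(t,x). g t x)"
    and step: "\<And>g d. P g \<Longrightarrow> \<exists>h. P h \<and> eqT T (pder T d g) h"
  shows "smooth_on T f"
proof -
  have ex: "\<exists>h. P h \<and> eqT T (pders T ds f) h" for ds
  proof (induction ds)
    case (Cons d ds)
    then obtain h where "P h" "eqT T (pders T ds f) h" by blast
    then show ?case using step[of h d] by (metis eqT_trans pder_cong pders_Cons)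
  qed (use P in auto)
  show ?thesis
    unfolding smooth_on_def
  proof (intro allI conjI ballI)
    fix ds
    obtain h where h: "P h" "eqT T (pders T ds f) h" using ex by blast
    fix t x assume tt: "t \<in> {0..T}"
    show "(\<lambda>s. pders T ds f s x) differentiable (at t within {0..T})"
      using t[OF h(1) tt, of x] h(2)
        has_derivative_transform[OF tt, of "\<lambda>s. pders T ds f s x" "\<lambda>s. h s x"]
      by (auto simp: eqT_def differentiable_def)
  next
    fix ds i t x assume tt: "t \<in> {0..T}"
    obtain h where h: "P h" "eqT T (pders T ds f) h" using ex by blast
    show "(\<lambda>h. pders T ds f t (x + h *\<^sub>R axis i 1)) differentiable (at 0)"
      using x[OF h(1) tt] h(2) tt by (simp add: eqT_def)
  next
    fix ds
    obtain h where h: "P h" "eqT T (pders T ds f) h" using ex by blast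
    show "continuous_on ({0..T} \<times> UNIV) (\<lambda>(t, x). pders T ds f t x)"
      by (rule continuous_on_eq[OF c[OF h(1)]]) (use h(2) in \<open>auto simp: eqT_def\<close>)
  qed
qed

lemma pder_bilinear:
  assumes B: "bounded_bilinear B" and T: "T > 0" and f: "smooth_on T f" and g: "smooth_on T g"
  shows "eqT T (pder T d (\<lambda>t x. B (f t x) (g t x)))
    (\<lambda>t x. B (f t x) (pder T d g t x) + B (pder T d f t x) (g t x))"
proof -
  interpret bounded_bilinear B by (rule B)
  show ?thesis unfolding eqT_def
  proof (intro ballI allI, cases d)
    fix t x assume t: "t \<in> {0..T}"
    case Dt
    show "pder T d (\<lambda>t x. B (f t x) (g t x)) t x = B (f t x) (pder T d g t x) + B (pder T d f t x) (g t x)"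
      unfolding Dt by (rule pder_Dt_eqI[OF T t])
        (rule has_vector_derivative[OF smooth_on_Dt[OF f t] smooth_on_Dt[OF g t]])
  next
    fix t x i assume t: "t \<in> {0..T}" and i: "d = Dx i"
    show "pder T d (\<lambda>t x. B (f t x) (g t x)) t x = B (f t x) (pder T d g t x) + B (pder T d f t x) (g t x)"
      unfolding i using has_vector_derivative[OF smooth_on_Dx0[OF f t] smooth_on_Dx0[OF g t]]
      by (intro pder_Dx_eqI) simp
  qed
qed

lemma pder_linear:
  assumes B: "bounded_linear L" and T: "T > 0" and f: "smooth_on T f"
  shows "eqT T (pder T d (\<lambda>t x. L (f t x))) (\<lambda>t x. L (pder T d f t x))"
proof -
  interpret bounded_linear L by (rule B)
  show ?thesis unfolding eqT_def
  proof (intro ballI allI, cases d)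
    fix t x assume t: "t \<in> {0..T}"
    case Dt
    show "pder T d (\<lambda>t x. L (f t x)) t x = L (pder T d f t x)"
      unfolding Dt by (rule pder_Dt_eqI[OF T t])
        (rule has_vector_derivative[OF smooth_on_Dt[OF f t]])
  next
    fix t x i assume t: "t \<in> {0..T}" and i: "d = Dx i"
    show "pder T d (\<lambda>t x. L (f t x)) t x = L (pder T d f t x)"
      unfolding i by (rule pder_Dx_eqI, rule has_vector_derivative[OF smooth_on_Dx0[OF f t]])
  qed
qed

lemma pder_add:
  assumes T: "T > 0" and f: "smooth_on T f" and g: "smooth_on T g"
  shows "eqT T (pder T d (\<lambda>t x. f t x + g t x)) (\<lambda>t x. pder T d f t x + pder T d g t x)"
  unfolding eqT_def
proof (intro ballI allI, cases d)
  fix t x assume t: "t \<in> {0..T}"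
  case Dt
  show "pder T d (\<lambda>t x. f t x + g t x) t x = pder T d f t x + pder T d g t x"
    unfolding Dt by (rule pder_Dt_eqI[OF T t])
      (rule has_vector_derivative_add[OF smooth_on_Dt[OF f t] smooth_on_Dt[OF g t]])
next
  fix t x i assume t: "t \<in> {0..T}" and i: "d = Dx i"
  show "pder T d (\<lambda>t x. f t x + g t x) t x = pder T d f t x + pder T d g t x"
    unfolding i by (rule pder_Dx_eqI,
        rule has_vector_derivative_add[OF smooth_on_Dx0[OF f t] smooth_on_Dx0[OF g t]])
qed

lemma pder_const: "T > 0 \<Longrightarrow> eqT T (pder T d (\<lambda>t x. c)) (\<lambda>t x. 0)"
  by (cases d) (auto simp: eqT_def intro!: pder_Dt_eqI pder_Dx_eqI)

text \<open>Being closed under differentiation, this class consists of smooth fields; this replaces a Leibniz formula.\<close>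

inductive bilsum :: "('a::real_normed_vector \<Rightarrow> 'b::real_normed_vector \<Rightarrow> 'c::real_normed_vector)
    \<Rightarrow> real \<Rightarrow> (real \<Rightarrow> real^3 \<Rightarrow> 'c) \<Rightarrow> bool" for B T where
  prod: "smooth_on T f \<Longrightarrow> smooth_on T g \<Longrightarrow> bilsum B T (\<lambda>t x. B (f t x) (g t x))"
| add: "bilsum B T p \<Longrightarrow> bilsum B T q \<Longrightarrow> bilsum B T (\<lambda>t x. p t x + q t x)"

lemma bilsum_regular:
  assumes B: "bounded_bilinear B" and "bilsum B T h"
  shows "(\<forall>t\<in>{0..T}. \<forall>x. (\<lambda>s. h s x) differentiable (at t within {0..T})) \<and>
     (\<forall>i. \<forall>t\<in>{0..T}. \<forall>x. (\<lambda>k. h t (x + k *\<^sub>R axis i 1)) differentiable (at 0)) \<and>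
     continuous_on ({0..T} \<times> UNIV) (\<lambda>(t,x). h t x)"
  using assms(2)
proof induction
  case (prod f g)
  interpret bounded_bilinear B by (rule B)
  show ?case
  proof (intro conjI allI ballI)
    fix t x assume t: "t \<in> {0..T}"
    show "(\<lambda>s. B (f s x) (g s x)) differentiable at t within {0..T}"
      using has_vector_derivative[OF smooth_on_Dt[OF prod(1) t] smooth_on_Dt[OF prod(2) t]]
      by (rule differentiableI_vector)
  next
    fix i t x assume t: "t \<in> {0..T}"
    show "(\<lambda>k. B (f t (x + k *\<^sub>R axis i 1)) (g t (x + k *\<^sub>R axis i 1))) differentiable at 0"
      using has_vector_derivative[OF smooth_on_Dx0[OF prod(1) t] smooth_on_Dx0[OF prod(2) t]]
      by (rule differentiableI_vector)
  next
    show "continuous_on ({0..T} \<times> UNIV) (\<lambda>(t, x). B (f t x) (g t x))"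
      using continuous_on[OF smooth_on_continuous[OF prod(1)] smooth_on_continuous[OF prod(2)]]
      by (simp add: case_prod_unfold)
  qed
next
  case (add p q)
  then show ?case
    by (auto simp: case_prod_unfold intro!: continuous_intros)
qed

lemma bilsum_pder:
  assumes B: "bounded_bilinear B" and T: "T > 0" and "bilsum B T h"
  shows "smooth_on T h"
proof -
  have reg: "\<exists>h'. bilsum B T h' \<and> eqT T (pder T d h) h'" if "bilsum B T h" for h d
    using that
  proof induction
    case (prod f g)
    show ?case
      using bilsum.add[OF bilsum.prod[OF prod(1) smooth_on_pder[OF prod(2)]]
          bilsum.prod[OF smooth_on_pder[OF prod(1)] prod(2)]] pder_bilinear[OF B T prod] by blast
  next
    case (add p q)
    obtain p' q' where pq: "bilsum B T p'" "eqT T (pder T d p) p'" "bilsum B T q'" "eqT T (pder T d q) q'"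
      using add by blast
    have "pder T d (\<lambda>t x. p t x + q t x) t x = pder T d p t x + pder T d q t x"
      if t: "t \<in> {0..T}" for t x
    proof (cases d)
      case Dt
      show ?thesis unfolding Dt using bilsum_regular[OF B add(1)] bilsum_regular[OF B add(2)] t
        by (intro pder_Dt_eqI[OF T t] has_vector_derivative_add) (auto simp: pder_def vector_derivative_works)
    next
      case (Dx i)
      show ?thesis unfolding Dx using bilsum_regular[OF B add(1)] bilsum_regular[OF B add(2)] t
        by (intro pder_Dx_eqI has_vector_derivative_add) (auto simp: pder_def vector_derivative_works)
    qed
    then have "eqT T (pder T d (\<lambda>t x. p t x + q t x)) (\<lambda>t x. p' t x + q' t x)"
      using pq(2,4) by (auto simp: eqT_def)
    then show ?case using bilsum.add[OF pq(1,3)] by blast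
  qed
  show ?thesis
    by (rule smooth_on_coinduct[of "bilsum B T"]) (use assms(3) bilsum_regular[OF B] reg in blast)+
qed

lemma smooth_on_bilinear:
  "bounded_bilinear B \<Longrightarrow> T > 0 \<Longrightarrow> smooth_on T f \<Longrightarrow> smooth_on T g \<Longrightarrow>
    smooth_on T (\<lambda>t x. B (f t x) (g t x))"
  by (rule bilsum_pder[OF _ _ bilsum.prod])

lemma smooth_on_linear:
  assumes L: "bounded_linear L" and T: "T > 0" and f: "smooth_on T f"
  shows "smooth_on T (\<lambda>t x. L (f t x))"
proof (rule smooth_on_coinduct[of "\<lambda>g. \<exists>f. smooth_on T f \<and> g = (\<lambda>t x. L (f t x))"])
  interpret bounded_linear L by (rule L)
  show "\<exists>f'. smooth_on T f' \<and> (\<lambda>t x. L (f t x)) = (\<lambda>t x. L (f' t x))" using f by blast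
  fix g assume "\<exists>f. smooth_on T f \<and> g = (\<lambda>t x. L (f t x))"
  then obtain f where f: "smooth_on T f" and g: "g = (\<lambda>t x. L (f t x))" by blast
  show "(\<lambda>s. g s x) differentiable at t within {0..T}" if "t \<in> {0..T}" for t x
    unfolding g using has_vector_derivative[OF smooth_on_Dt[OF f that]] by (rule differentiableI_vector)
  show "(\<lambda>h. g t (x + h *\<^sub>R axis i 1)) differentiable at 0" if "t \<in> {0..T}" for t x i
    unfolding g using has_vector_derivative[OF smooth_on_Dx0[OF f that]] by (rule differentiableI_vector)
  show "continuous_on ({0..T} \<times> UNIV) (\<lambda>(t, x). g t x)"
    unfolding g using continuous_on[OF smooth_on_continuous[OF f]] by (simp add: case_prod_unfold)
  show "\<exists>h. (\<exists>f. smooth_on T f \<and> h = (\<lambda>t x. L (f t x))) \<and> eqT T (pder T d g) h" for d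
    unfolding g using pder_linear[OF L T f] smooth_on_pder[OF f] by blast
qed

lemma smooth_on_const:
  fixes c :: "'a::real_normed_vector"
  assumes "T > 0"
  shows "smooth_on T (\<lambda>t x. c)"
proof (rule smooth_on_coinduct[of "\<lambda>g. \<exists>c::'a. g = (\<lambda>t x. c)"])
  fix g :: "real \<Rightarrow> real^3 \<Rightarrow> 'a" and d assume "\<exists>c. g = (\<lambda>t x. c)"
  then show "\<exists>h. (\<exists>c. h = (\<lambda>t x. c)) \<and> eqT T (pder T d g) h"
    using pder_const[OF assms] by blast
qed (auto simp: case_prod_unfold)

lemma smooth_on_add:
  assumes T: "T > 0" and f: "smooth_on T f" and g: "smooth_on T g"
  shows "smooth_on T (\<lambda>t x. f t x + g t x)"
  using bilsum_pder[OF bounded_bilinear_scaleR T bilsum.add[OF bilsum.prod bilsum.prod],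
      of "\<lambda>t x. 1" f "\<lambda>t x. 1" g] smooth_on_const[OF T, of "1::real"] f g by simp

lemma smper_bilinear:
  "bounded_bilinear B \<Longrightarrow> smper T f \<Longrightarrow> smper T g \<Longrightarrow> smper T (\<lambda>t x. B (f t x) (g t x))"
  by (auto simp: smper_def periodic_def intro: smooth_on_bilinear)

lemma smper_linear: "bounded_linear L \<Longrightarrow> smper T f \<Longrightarrow> smper T (\<lambda>t x. L (f t x))"
  by (auto simp: smper_def periodic_def intro: smooth_on_linear)

lemma smper_add: "smper T f \<Longrightarrow> smper T g \<Longrightarrow> smper T (\<lambda>t x. f t x + g t x)"
  by (auto simp: smper_def periodic_def intro: smooth_on_add)

lemma smper_const: "T > 0 \<Longrightarrow> smper T (\<lambda>t x. c)"
  by (auto simp: smper_def periodic_def intro: smooth_on_const)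

lemma smper_uminus: "smper T f \<Longrightarrow> smper T (\<lambda>t x. - f t x)"
  using smper_linear[OF bounded_linear_minus[OF bounded_linear_ident]] by blast

lemma smper_diff: "smper T f \<Longrightarrow> smper T g \<Longrightarrow> smper T (\<lambda>t x. f t x - g t x)"
  using smper_add[OF _ smper_uminus, of T f g] by simp

lemma smper_sum: "T > 0 \<Longrightarrow> (\<And>i. i \<in> I \<Longrightarrow> smper T (f i)) \<Longrightarrow> smper T (\<lambda>t x. \<Sum>i\<in>I. f i t x)"
  by (induction I rule: infinite_finite_induct) (auto intro: smper_const smper_add)

lemma smper_scaleR: "smper T f \<Longrightarrow> smper T (\<lambda>t x. c *\<^sub>R f t x)"
  using smper_linear[OF bounded_linear_scaleR_right] by blast

lemma pders_linear:
  assumes "bounded_linear L" "smper T f"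
  shows "eqT T (pders T ds (\<lambda>t x. L (f t x))) (\<lambda>t x. L (pders T ds f t x))"
proof (induction ds)
  case (Cons d ds)
  have "smper T (pders T ds f)" using assms smper_pders by blast
  then show ?case
    using pder_cong[OF Cons] pder_linear[OF assms(1), of T "pders T ds f" d]
    by (auto simp: smper_def intro: eqT_trans)
qed simp

lemma pders_add:
  assumes "smper T f" "smper T g"
  shows "eqT T (pders T ds (\<lambda>t x. f t x + g t x)) (\<lambda>t x. pders T ds f t x + pders T ds g t x)"
proof (induction ds)
  case (Cons d ds)
  have "smper T (pders T ds f)" "smper T (pders T ds g)" using assms smper_pders by blast+
  then show ?case
    using pder_cong[OF Cons] pder_add[of T "pders T ds f" "pders T ds g" d]
    by (auto simp: smper_def intro: eqT_trans)
qed simp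

lemma pders_uminus:
  "smper T f \<Longrightarrow> eqT T (pders T ds (\<lambda>t x. - f t x)) (\<lambda>t x. - pders T ds f t x)"
  using pders_linear[OF bounded_linear_minus[OF bounded_linear_ident]] by blast

lemma pders_scaleR:
  "smper T f \<Longrightarrow> eqT T (pders T ds (\<lambda>t x. c *\<^sub>R f t x)) (\<lambda>t x. c *\<^sub>R pders T ds f t x)"
  using pders_linear[OF bounded_linear_scaleR_right] by blast

lemma pders_diff:
  assumes "smper T f" "smper T g"
  shows "eqT T (pders T ds (\<lambda>t x. f t x - g t x)) (\<lambda>t x. pders T ds f t x - pders T ds g t x)"
  using pders_add[OF assms(1) smper_uminus[OF assms(2)], of ds] pders_uminus[OF assms(2), of ds]
  by (simp add: eqT_def)

lemma pders_sum:
  assumes "finite I" "T > 0" "\<And>i. i \<in> I \<Longrightarrow> smper T (f i)"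
  shows "eqT T (pders T ds (\<lambda>t x. \<Sum>i\<in>I. f i t x)) (\<lambda>t x. \<Sum>i\<in>I. pders T ds (f i) t x)"
  using assms
proof (induction I rule: finite_induct)
  case empty
  have "eqT T (pders T ds (\<lambda>t x. 0)) (\<lambda>t x. 0)"
    by (induction ds) (use empty pder_const pder_cong eqT_trans in \<open>auto, blast\<close>)
  then show ?case by simp
next
  case (insert i I)
  have "eqT T (pders T ds (\<lambda>t x. f i t x + (\<Sum>i\<in>I. f i t x)))
      (\<lambda>t x. pders T ds (f i) t x + pders T ds (\<lambda>t x. \<Sum>i\<in>I. f i t x) t x)"
    by (rule pders_add) (use insert in \<open>auto intro!: smper_sum\<close>)
  then show ?case using insert by (simp add: eqT_def)
qed

lemma pders_bilinear_snoc:
  assumes "bounded_bilinear B" "smper T f" "smper T g"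
  shows "eqT T (pders T (ds @ [d]) (\<lambda>t x. B (f t x) (g t x)))
    (\<lambda>t x. pders T ds (\<lambda>t x. B (f t x) (pder T d g t x)) t x
         + pders T ds (\<lambda>t x. B (pder T d f t x) (g t x)) t x)"
proof -
  have "eqT T (pders T (ds @ [d]) (\<lambda>t x. B (f t x) (g t x)))
      (pders T ds (\<lambda>t x. B (f t x) (pder T d g t x) + B (pder T d f t x) (g t x)))"
    unfolding pders_append using assms
    by (intro pders_cong) (auto simp: smper_def intro: pder_bilinear)
  also have "eqT T \<dots> (\<lambda>t x. pders T ds (\<lambda>t x. B (f t x) (pder T d g t x)) t x
         + pders T ds (\<lambda>t x. B (pder T d f t x) (g t x)) t x)"
    by (intro pders_add smper_bilinear[OF assms(1)] smper_pder assms)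
  finally show ?thesis .
qed

subsection \<open>Symmetry of mixed partial derivatives\<close>

lemma mixed_derivatives_eq:
  fixes \<phi> :: "real \<Rightarrow> real \<Rightarrow> 'a::banach"
  assumes U: "a0 < a1" and a: "a \<in> {a0..a1}" and V: "b0 < b1" and b: "b \<in> {b0..b1}"
    and d1: "\<And>a b. a \<in> {a0..a1} \<Longrightarrow> b \<in> {b0..b1} \<Longrightarrow> ((\<lambda>a. \<phi> a b) has_vector_derivative \<phi>1 a b) (at a within {a0..a1})"
    and d2: "\<And>a b. a \<in> {a0..a1} \<Longrightarrow> b \<in> {b0..b1} \<Longrightarrow> ((\<lambda>b. \<phi> a b) has_vector_derivative \<phi>2 a b) (at b within {b0..b1})"
    and d21: "\<And>a b. a \<in> {a0..a1} \<Longrightarrow> b \<in> {b0..b1} \<Longrightarrow> ((\<lambda>a. \<phi>2 a b) has_vector_derivative \<phi>21 a b) (at a within {a0..a1})"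
    and d12: "((\<lambda>b. \<phi>1 a b) has_vector_derivative \<phi>12) (at b within {b0..b1})"
    and c2: "continuous_on ({a0..a1} \<times> {b0..b1}) (\<lambda>(a,b). \<phi>2 a b)"
    and c21: "continuous_on ({a0..a1} \<times> {b0..b1}) (\<lambda>(a,b). \<phi>21 a b)"
  shows "\<phi>12 = \<phi>21 a b"
proof -
  have c2': "continuous_on {b0..b'} (\<phi>2 a')" if "a' \<in> {a0..a1}" "b' \<in> {b0..b1}" for a' b'
    using continuous_on_compose2[OF c2, of "{b0..b'}" "\<lambda>b. (a', b)"] that
    by (force intro: continuous_intros)
  have c21': "continuous_on {b0..b1} (\<phi>21 a)"
    using continuous_on_compose2[OF c21, of "{b0..b1}" "\<lambda>b. (a, b)"] a
    by (force intro: continuous_intros)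
  have ftc: "integral {b0..b'} (\<phi>2 a') = \<phi> a' b' - \<phi> a' b0" if "a' \<in> {a0..a1}" "b' \<in> {b0..b1}" for a' b'
    by (intro integral_unique fundamental_theorem_of_calculus)
       (use that in \<open>auto intro!: has_vector_derivative_within_subset[OF d2]\<close>)
  have der: "\<phi>1 a b' - \<phi>1 a b0 = integral {b0..b'} (\<phi>21 a)" if b': "b' \<in> {b0..b1}" for b'
  proof -
    have 1: "((\<lambda>a'. integral (cbox b0 b') (\<phi>2 a')) has_vector_derivative integral (cbox b0 b') (\<phi>21 a))
        (at a within {a0..a1})"
    proof (rule leibniz_rule_vector_derivative)
      show "((\<lambda>a'. \<phi>2 a' t) has_vector_derivative \<phi>21 x t) (at x within {a0..a1})"
        if "x \<in> {a0..a1}" "t \<in> cbox b0 b'" for x t using that b' d21 by auto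
      show "\<phi>2 x integrable_on cbox b0 b'" if "x \<in> {a0..a1}" for x
        using integrable_continuous_real[OF c2'[OF that b']] by simp
      show "continuous_on ({a0..a1} \<times> cbox b0 b') (\<lambda>(x, t). \<phi>21 x t)"
        by (rule continuous_on_subset[OF c21]) (use b' in auto)
    qed (use a in auto)
    have 2: "((\<lambda>a'. \<phi> a' b' - \<phi> a' b0) has_vector_derivative \<phi>1 a b' - \<phi>1 a b0) (at a within {a0..a1})"
      using d1[OF a b'] d1[OF a, of b0] V by (intro has_vector_derivative_diff) auto
    have 3: "((\<lambda>a'. \<phi> a' b' - \<phi> a' b0) has_vector_derivative integral (cbox b0 b') (\<phi>21 a)) (at a within {a0..a1})"
      by (rule has_vector_derivative_transform[OF a _ 1]) (use ftc b' in simp)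
    show ?thesis
      using vector_derivative_within_cbox[of a0 a1 a] U a 2 3 by (metis box_real(2))
  qed
  have 4: "((\<lambda>b'. integral {b0..b'} (\<phi>21 a) + \<phi>1 a b0) has_vector_derivative \<phi>21 a b + 0) (at b within {b0..b1})"
    by (intro has_vector_derivative_add integral_has_vector_derivative c21' b) simp
  have "((\<lambda>b. \<phi>1 a b) has_vector_derivative \<phi>21 a b) (at b within {b0..b1})"
    by (rule has_vector_derivative_transform[OF b _ 4[simplified]]) (metis der diff_add_cancel)
  then show ?thesis
    using vector_derivative_within_cbox[of b0 b1 b] V b d12 by (metis box_real(2))
qed

lemma pder_commute_Dx:
  fixes f :: "real \<Rightarrow> real^3 \<Rightarrow> 'a::banach"
  assumes T: "T > 0" and f: "smooth_on T f" and t: "t \<in> {0..T}"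
  shows "pder T (Dx i) (pder T d f) t x = pder T d (pder T (Dx i) f) t x"
proof (cases d)
  case Dt
  show ?thesis unfolding Dt
  proof (rule mixed_derivatives_eq[where \<phi> = "\<lambda>s h. f s (x + h *\<^sub>R axis i 1)" and ?a0.0=0 and ?a1.0=T
        and a=t and ?b0.0="-1" and ?b1.0=1 and b=0
        and ?\<phi>1.0="\<lambda>s h. pder T Dt f s (x + h *\<^sub>R axis i 1)"
        and ?\<phi>2.0="\<lambda>s h. pder T (Dx i) f s (x + h *\<^sub>R axis i 1)"
        and ?\<phi>21.0="\<lambda>s h. pder T Dt (pder T (Dx i) f) s (x + h *\<^sub>R axis i 1)", simplified (no_asm)])
    show "continuous_on ({0..T} \<times> {- 1..1}) (\<lambda>(a, b). pder T (Dx i) f a (x + b *\<^sub>R axis i 1))"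
      unfolding case_prod_unfold
      by (rule smooth_on_continuous_compose[OF smooth_on_pder[OF f]]) (auto intro!: continuous_intros)
    show "continuous_on ({0..T} \<times> {- 1..1}) (\<lambda>(a, b). pder T Dt (pder T (Dx i) f) a (x + b *\<^sub>R axis i 1))"
      unfolding case_prod_unfold
      by (rule smooth_on_continuous_compose[OF smooth_on_pder[OF smooth_on_pder[OF f]]]) (auto intro!: continuous_intros)
    show "((\<lambda>b. pder T Dt f t (x + b *\<^sub>R axis i 1)) has_vector_derivative pder T (Dx i) (pder T Dt f) t x)
     (at 0 within {- 1..1})"
      using smooth_on_Dx[OF smooth_on_pder[OF f] t, where x=x and i=i and h=0] by simp
  qed (use T t in \<open>auto intro!: smooth_on_Dt smooth_on_Dx smooth_on_pder f\<close>)
next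
  case (Dx j)
  show ?thesis unfolding Dx
  proof (rule mixed_derivatives_eq[where \<phi> = "\<lambda>k h. f t (x + k *\<^sub>R axis j 1 + h *\<^sub>R axis i 1)" and ?a0.0="-1" and ?a1.0=1
        and a=0 and ?b0.0="-1" and ?b1.0=1 and b=0
        and ?\<phi>1.0="\<lambda>k h. pder T (Dx j) f t (x + k *\<^sub>R axis j 1 + h *\<^sub>R axis i 1)"
        and ?\<phi>2.0="\<lambda>k h. pder T (Dx i) f t (x + k *\<^sub>R axis j 1 + h *\<^sub>R axis i 1)"
        and ?\<phi>21.0="\<lambda>k h. pder T (Dx j) (pder T (Dx i) f) t (x + k *\<^sub>R axis j 1 + h *\<^sub>R axis i 1)", simplified (no_asm)])
    have sw: "(\<lambda>k. g t (x + k *\<^sub>R axis j 1 + h *\<^sub>R axis i 1)) = (\<lambda>k. g t ((x + h *\<^sub>R axis i 1) + k *\<^sub>R axis j 1))"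
      for g :: "real \<Rightarrow> real^3 \<Rightarrow> 'a" and h by (simp add: algebra_simps)
    have D: "((\<lambda>k. g t (x + k *\<^sub>R axis j 1 + h *\<^sub>R axis i 1)) has_vector_derivative
       pder T (Dx j) g t (x + k *\<^sub>R axis j 1 + h *\<^sub>R axis i 1)) (at k within {-1..1})"
      if "smooth_on T g" for g h k
      using smooth_on_Dx[OF that t, of "x + h *\<^sub>R axis i 1" j k] unfolding sw by (simp add: algebra_simps)
    show "((\<lambda>a. f t (x + a *\<^sub>R axis j 1 + b *\<^sub>R axis i 1)) has_vector_derivative
        pder T (Dx j) f t (x + a *\<^sub>R axis j 1 + b *\<^sub>R axis i 1)) (at a within {- 1..1})" for a b
      by (rule D[OF f])
    show "((\<lambda>a. pder T (Dx i) f t (x + a *\<^sub>R axis j 1 + b *\<^sub>R axis i 1)) has_vector_derivative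
        pder T (Dx j) (pder T (Dx i) f) t (x + a *\<^sub>R axis j 1 + b *\<^sub>R axis i 1)) (at a within {- 1..1})" for a b
      by (rule D[OF smooth_on_pder[OF f]])
    show "continuous_on ({- 1..1} \<times> {- 1..1}) (\<lambda>(a, b). pder T (Dx i) f t (x + a *\<^sub>R axis j 1 + b *\<^sub>R axis i 1))"
      unfolding case_prod_unfold
      by (rule smooth_on_continuous_compose[OF smooth_on_pder[OF f]]) (use t in \<open>auto intro!: continuous_intros\<close>)
    show "continuous_on ({- 1..1} \<times> {- 1..1}) (\<lambda>(a, b). pder T (Dx j) (pder T (Dx i) f) t (x + a *\<^sub>R axis j 1 + b *\<^sub>R axis i 1))"
      unfolding case_prod_unfold
      by (rule smooth_on_continuous_compose[OF smooth_on_pder[OF smooth_on_pder[OF f]]]) (use t in \<open>auto intro!: continuous_intros\<close>)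
    show "((\<lambda>b. pder T (Dx j) f t (x + 0 *\<^sub>R axis j 1 + b *\<^sub>R axis i 1)) has_vector_derivative
        pder T (Dx i) (pder T (Dx j) f) t x) (at 0 within {- 1..1})"
      using smooth_on_Dx[OF smooth_on_pder[OF f] t, where x=x and i=i and h=0] by simp
  qed (auto intro!: smooth_on_Dx f t)
qed

lemma pder_commute:
  fixes f :: "real \<Rightarrow> real^3 \<Rightarrow> 'a::banach"
  assumes f: "smper T f"
  shows "eqT T (pder T d (pder T e f)) (pder T e (pder T d f))"
proof (cases d)
  case (Dx i)
  then show ?thesis using pder_commute_Dx[of T f] f by (auto simp: eqT_def smper_def)
next
  case Dt
  show ?thesis
  proof (cases e)
    case (Dx i)
    then show ?thesis using pder_commute_Dx[of T f] f by (auto simp: eqT_def smper_def)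
  qed (simp add: Dt)
qed

lemma pders_pder_commute:
  fixes f :: "real \<Rightarrow> real^3 \<Rightarrow> 'a::banach"
  assumes f: "smper T f"
  shows "eqT T (pders T ds (pder T d f)) (pder T d (pders T ds f))"
proof (induction ds)
  case (Cons e ds)
  have "eqT T (pder T e (pders T ds (pder T d f))) (pder T e (pder T d (pders T ds f)))"
    by (rule pder_cong[OF Cons])
  also have "eqT T \<dots> (pder T d (pder T e (pders T ds f)))"
    by (rule pder_commute[OF smper_pders[OF f]])
  finally show ?case by simp
qed simp

lemma pders_mset_cong:
  fixes f :: "real \<Rightarrow> real^3 \<Rightarrow> 'a::banach"
  assumes f: "smper T f" and "mset ds = mset es"
  shows "eqT T (pders T ds f) (pders T es f)"
  using assms(2)
proof (induction ds arbitrary: es)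
  case (Cons d ds)
  then have "d \<in> set es" by (metis list.set_intros(1) mset_eq_setD)
  then obtain es1 es2 where es: "es = es1 @ d # es2" by (meson split_list)
  then have "mset ds = mset (es1 @ es2)" using Cons.prems by simp
  then have "eqT T (pders T ds f) (pders T (es1 @ es2) f)" by (rule Cons.IH)
  then have "eqT T (pders T (d # ds) f) (pder T d (pders T es1 (pders T es2 f)))"
    by (simp add: pders_append pder_cong)
  also have "eqT T \<dots> (pders T es1 (pder T d (pders T es2 f)))"
    by (rule eqT_sym[OF pders_pder_commute[OF smper_pders[OF f]]])
  finally show ?case by (simp add: es pders_append)
qed simp

lemma pders_commute:
  fixes f :: "real \<Rightarrow> real^3 \<Rightarrow> 'a::banach"
  assumes f: "smper T f"
  shows "eqT T (pders T ds (pders T es f)) (pders T es (pders T ds f))"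
  using pders_mset_cong[OF f, of "ds @ es" "es @ ds"] by (simp add: pders_append)

lemma ptd_pders: "ptd T j f = pders T (replicate j Dt) f"
  by (induction j) (simp_all add: ptd_def)

lemma funpow_pder_pders: "(pder T d ^^ j) f = pders T (replicate j d) f"
  by (induction j) simp_all

lemma sder_pders: "sder T (a1,a2,a3) f =
    pders T (replicate a1 (Dx 1) @ replicate a2 (Dx 2) @ replicate a3 (Dx 3)) f"
  by (simp add: sder_def funpow_pder_pders pders_append)


section \<open>Means and directional averages of periodic functions\<close>

definition per3 :: "(real^3 \<Rightarrow> 'a) \<Rightarrow> bool" where
  "per3 \<phi> \<longleftrightarrow> (\<forall>x i. \<phi> (x + axis i 1) = \<phi> x)"

definition cper :: "(real^3 \<Rightarrow> 'a::topological_space) \<Rightarrow> bool" where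
  "cper \<phi> \<longleftrightarrow> continuous_on UNIV \<phi> \<and> per3 \<phi>"

abbreviation (input) mean :: "(real^3 \<Rightarrow> 'a::banach) \<Rightarrow> 'a" where
  "mean \<phi> \<equiv> integral (cbox 0 1) \<phi>"

definition Av :: "3 \<Rightarrow> (real^3 \<Rightarrow> 'a::banach) \<Rightarrow> real^3 \<Rightarrow> 'a" where
  "Av i \<phi> x = integral {0..1} (\<lambda>h. \<phi> (x + h *\<^sub>R axis i 1))"

lemma smper_cper: "smper T f \<Longrightarrow> t \<in> {0..T} \<Longrightarrow> cper (f t)"
  unfolding smper_def cper_def
  using smooth_on_continuous_compose[of T f UNIV "\<lambda>_. t" "\<lambda>x. x"]
  by (auto simp: per3_def periodic_def)

lemma cper_cont: "cper \<phi> \<Longrightarrow> continuous_on S \<phi>"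
  by (auto simp: cper_def intro: continuous_on_subset)

lemma cper_compose: "cper \<phi> \<Longrightarrow> continuous_on UNIV g \<Longrightarrow> cper (\<lambda>x. g (\<phi> x))"
  by (auto simp: cper_def per3_def intro: continuous_on_compose2)

lemma cper_add: "cper \<phi> \<Longrightarrow> cper \<zeta> \<Longrightarrow> cper (\<lambda>x. \<phi> x + \<zeta> x :: 'a::real_normed_vector)"
  by (auto simp: cper_def per3_def intro: continuous_intros)

lemma cper_diff: "cper \<phi> \<Longrightarrow> cper \<zeta> \<Longrightarrow> cper (\<lambda>x. \<phi> x - \<zeta> x :: 'a::real_normed_vector)"
  by (auto simp: cper_def per3_def intro: continuous_intros)

lemma cper_mult: "cper \<phi> \<Longrightarrow> cper \<zeta> \<Longrightarrow> cper (\<lambda>x. \<phi> x * \<zeta> x :: real)"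
  by (auto simp: cper_def per3_def intro: continuous_intros)

lemma cper_inner: "cper \<phi> \<Longrightarrow> cper \<zeta> \<Longrightarrow> cper (\<lambda>x. \<phi> x \<bullet> \<zeta> x :: real)"
  by (auto simp: cper_def per3_def intro: continuous_intros)

lemma cper_scaleR: "cper \<phi> \<Longrightarrow> cper (\<lambda>x. c *\<^sub>R \<phi> x :: 'a::real_normed_vector)"
  by (auto simp: cper_def per3_def intro: continuous_intros)

lemma cper_cmult: "cper \<phi> \<Longrightarrow> cper (\<lambda>x. c * \<phi> x :: real)"
  by (auto simp: cper_def per3_def intro: continuous_intros)

lemma cper_norm: "cper \<phi> \<Longrightarrow> cper (\<lambda>x. norm (\<phi> x))"
  by (auto simp: cper_def per3_def intro: continuous_intros)

lemma cper_power: "cper \<phi> \<Longrightarrow> cper (\<lambda>x. \<phi> x ^ n :: real)"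
  by (auto simp: cper_def per3_def intro: continuous_intros)

lemma cper_const: "cper (\<lambda>x. c)"
  by (auto simp: cper_def per3_def)

lemmas cper_intros = cper_add cper_diff cper_mult cper_inner cper_scaleR cper_cmult cper_norm cper_power cper_const

lemma cper_integrable: "cper \<phi> \<Longrightarrow> \<phi> integrable_on cbox a b" for \<phi> :: "real^3 \<Rightarrow> 'a::banach"
  by (intro integrable_continuous cper_cont)

lemma mean_mono: "cper \<phi> \<Longrightarrow> cper \<zeta> \<Longrightarrow> (\<And>x. \<phi> x \<le> \<zeta> x) \<Longrightarrow> mean \<phi> \<le> mean \<zeta>" for \<phi> \<zeta> :: "real^3 \<Rightarrow> real"
  by (intro integral_le cper_integrable) auto

lemma content_unit_cube [simp]: "measure lborel (cbox 0 (1::real^3)) = 1"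
  by (subst content_cbox_cart) (auto simp: interval_ne_empty_cart)

lemma mean_const [simp]: "mean (\<lambda>x. c) = c"
  by simp

lemma mean_add: "cper \<phi> \<Longrightarrow> cper \<zeta> \<Longrightarrow> mean (\<lambda>x. \<phi> x + \<zeta> x) = mean \<phi> + mean \<zeta>"
  for \<phi> \<zeta> :: "real^3 \<Rightarrow> 'a::banach"
  by (intro integral_add cper_integrable)

lemma mean_diff: "cper \<phi> \<Longrightarrow> cper \<zeta> \<Longrightarrow> mean (\<lambda>x. \<phi> x - \<zeta> x) = mean \<phi> - mean \<zeta>"
  for \<phi> \<zeta> :: "real^3 \<Rightarrow> 'a::banach"
  by (intro integral_diff cper_integrable)

lemma mean_nonneg: "(\<And>x. 0 \<le> \<phi> x) \<Longrightarrow> cper \<phi> \<Longrightarrow> 0 \<le> mean \<phi>" for \<phi> :: "real^3 \<Rightarrow> real"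
  by (intro integral_nonneg cper_integrable) auto

lemma line_cont: "cper \<phi> \<Longrightarrow> continuous_on S (\<lambda>h. \<phi> (x + h *\<^sub>R axis i 1))"
  unfolding cper_def by (rule continuous_on_compose2) (auto intro!: continuous_intros)

lemma line_integrable: "cper \<phi> \<Longrightarrow> (\<lambda>h. \<phi> (x + h *\<^sub>R axis i 1)) integrable_on {a..b}"
  for \<phi> :: "real^3 \<Rightarrow> 'a::banach"
  by (intro integrable_continuous_real line_cont)

lemma mem_cbox_axis:
  "x \<in> cbox (a *\<^sub>R axis i 1) (1 + b *\<^sub>R axis i 1 :: real^3) \<longleftrightarrow>
    (\<forall>j. j \<noteq> i \<longrightarrow> 0 \<le> x$j \<and> x$j \<le> 1) \<and> a \<le> x$i \<and> x$i \<le> 1 + b"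
proof -
  have "(a *\<^sub>R axis i 1 :: real^3) $ j = (if j = i then a else 0)" for j a
    by (simp add: axis_def)
  then have "x \<in> cbox (a *\<^sub>R axis i 1) (1 + b *\<^sub>R axis i 1 :: real^3) \<longleftrightarrow>
    (\<forall>j. (if j = i then a else 0) \<le> x$j \<and> x$j \<le> 1 + (if j = i then b else 0))"
    by (simp add: mem_box_cart)
  then show ?thesis by auto
qed

lemma mean_shift:
  fixes \<phi> :: "real^3 \<Rightarrow> 'a::banach"
  assumes \<phi>: "cper \<phi>" and h: "h \<in> {0..1}"
  shows "mean (\<lambda>x. \<phi> (x + h *\<^sub>R axis i 1)) = mean \<phi>"
proof -
  let ?e = "axis i 1 :: real^3"
  have e: "?e \<in> Basis" by (simp add: axis_in_Basis_iff)
  note int = cper_integrable[OF \<phi>]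
  have "mean (\<lambda>x. \<phi> (x + h *\<^sub>R ?e)) = integral (cbox (h *\<^sub>R ?e) (1 + h *\<^sub>R ?e)) \<phi>"
    using integral_shift_cbox[of "h *\<^sub>R ?e" "h *\<^sub>R ?e" "1 + h *\<^sub>R ?e" \<phi>] by simp
  also have "\<dots> = integral (cbox (h *\<^sub>R ?e) (1 + h *\<^sub>R ?e) \<inter> {x. x \<bullet> ?e \<le> 1}) \<phi>
       + integral (cbox (h *\<^sub>R ?e) (1 + h *\<^sub>R ?e) \<inter> {x. x \<bullet> ?e \<ge> 1}) \<phi>"
    by (rule integral_split[OF int e])
  finally have eq: "mean (\<lambda>x. \<phi> (x + h *\<^sub>R ?e)) =
      integral (cbox (h *\<^sub>R ?e) (1 + h *\<^sub>R ?e) \<inter> {x. x \<bullet> ?e \<le> 1}) \<phi>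
       + integral (cbox (h *\<^sub>R ?e) (1 + h *\<^sub>R ?e) \<inter> {x. x \<bullet> ?e \<ge> 1}) \<phi>" .
  have s1: "cbox (h *\<^sub>R ?e) (1 + h *\<^sub>R ?e) \<inter> {x. x \<bullet> ?e \<le> 1} = cbox 0 1 \<inter> {x. x \<bullet> ?e \<ge> h}"
    using h by (auto simp: mem_cbox_axis[of _ h i h] mem_cbox_axis[of _ 0 i 0, simplified] inner_axis)
  have s2: "cbox (h *\<^sub>R ?e) (1 + h *\<^sub>R ?e) \<inter> {x. x \<bullet> ?e \<ge> 1} = cbox ?e (1 + h *\<^sub>R ?e)"
    using h by (auto simp: mem_cbox_axis[of _ h i h] mem_cbox_axis[of _ 1 i h, simplified] inner_axis)
  have s3: "integral (cbox ?e (1 + h *\<^sub>R ?e)) \<phi> = integral (cbox 0 (1 + h *\<^sub>R ?e - ?e)) \<phi>"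
    using integral_shift_cbox[of ?e ?e "1 + h *\<^sub>R ?e" \<phi>] \<phi> by (simp add: cper_def per3_def)
  have 1: "1 + h *\<^sub>R ?e - ?e = 1 + (h - 1) *\<^sub>R ?e" by (simp add: scaleR_left_diff_distrib)
  have s4: "cbox 0 (1 + h *\<^sub>R ?e - ?e) = cbox 0 1 \<inter> {x. x \<bullet> ?e \<le> h}"
    unfolding 1 using h
    by (auto simp: mem_cbox_axis[of _ 0 i "h - 1", simplified] mem_cbox_axis[of _ 0 i 0, simplified] inner_axis)
  show ?thesis
    unfolding eq s1 s2 s3 s4 integral_split[OF int[of 0 1] e, of h] by (rule add.commute)
qed

lemma continuous_on_Av:
  assumes "cper \<phi>"
  shows "continuous_on UNIV (Av i \<phi>)"
proof -
  have "continuous_on (UNIV \<times> cbox 0 1) (\<lambda>(x, h). \<phi> (x + h *\<^sub>R axis i 1))"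
    unfolding case_prod_unfold
    by (rule continuous_on_compose2[of UNIV \<phi>]) (use assms in \<open>auto simp: cper_def intro!: continuous_intros\<close>)
  from integral_continuous_on_param[OF this] show ?thesis
    by (simp add: Av_def[abs_def])
qed

lemma cper_Av: "cper \<phi> \<Longrightarrow> cper (Av i \<phi>)"
proof -
  assume \<phi>: "cper \<phi>"
  have "x + axis j 1 + h *\<^sub>R axis i 1 = x + h *\<^sub>R axis i 1 + axis j 1" for x :: "real^3" and j h
    by simp
  then have "\<phi> (x + axis j 1 + h *\<^sub>R axis i 1) = \<phi> (x + h *\<^sub>R axis i 1)" for x j h
    using \<phi> by (metis cper_def per3_def)
  then show ?thesis using continuous_on_Av[OF \<phi>] by (simp add: cper_def per3_def Av_def)
qed

definition indep :: "3 \<Rightarrow> (real^3 \<Rightarrow> 'a) \<Rightarrow> bool" where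
  "indep i \<phi> \<longleftrightarrow> (\<forall>x s. \<phi> (x + s *\<^sub>R axis i 1) = \<phi> x)"

lemma per3_int: "per3 \<phi> \<Longrightarrow> \<phi> (x + of_int n *\<^sub>R axis i 1) = \<phi> x"
proof (induction n rule: int_induct[where k=0])
  case (step1 n)
  have "x + of_int (n + 1) *\<^sub>R axis i 1 = (x + of_int n *\<^sub>R axis i 1) + axis i 1"
    by (simp add: algebra_simps)
  then show ?case using step1 by (metis per3_def)
next
  case (step2 n)
  have "(x + of_int (n - 1) *\<^sub>R axis i 1) + axis i 1 = x + of_int n *\<^sub>R axis i 1"
    by (simp add: algebra_simps)
  then show ?case using step2 by (metis per3_def)
qed simp

lemma indep_Av:
  fixes \<phi> :: "real^3 \<Rightarrow> 'a::banach"
  assumes \<phi>: "cper \<phi>"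
  shows "indep i (Av i \<phi>)"
proof -
  have 01: "Av i \<phi> (x + s *\<^sub>R axis i 1) = Av i \<phi> x" if s: "s \<in> {0..1}" for s x
  proof -
    let ?\<psi> = "\<lambda>r. \<phi> (x + r *\<^sub>R axis i 1)"
    have per: "?\<psi> (r + 1) = ?\<psi> r" for r
    proof -
      have "x + (r + 1) *\<^sub>R axis i 1 = (x + r *\<^sub>R axis i 1) + axis i 1" by (simp add: algebra_simps)
      then show ?thesis using \<phi> by (metis cper_def per3_def)
    qed
    have "Av i \<phi> (x + s *\<^sub>R axis i 1) = integral {0..1} (\<lambda>h. ?\<psi> (h + s))"
      by (simp add: Av_def algebra_simps)
    also have "\<dots> = integral {s..1+s} ?\<psi>"
      using integral_shift_real_ivl[of s s "1+s" ?\<psi>] by simp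
    also have "\<dots> = integral {s..1} ?\<psi> + integral {1..1+s} ?\<psi>"
      using s by (intro Henstock_Kurzweil_Integration.integral_combine[symmetric] line_integrable[OF \<phi>]) auto
    also have "integral {1..1+s} ?\<psi> = integral {0..s} ?\<psi>"
      using integral_shift_real_ivl[of 1 1 "1+s" ?\<psi>] by (simp add: per)
    also have "integral {s..1} ?\<psi> + integral {0..s} ?\<psi> = integral {0..1} ?\<psi>"
      using s Henstock_Kurzweil_Integration.integral_combine[of 0 s 1 ?\<psi>] line_integrable[OF \<phi>, of x i 0 1] by (simp add: add.commute)
    finally show ?thesis by (simp add: Av_def)
  qed
  have "Av i \<phi> (x + s *\<^sub>R axis i 1) = Av i \<phi> x" for s x
  proof -
    have "x + s *\<^sub>R axis i 1 = (x + of_int \<lfloor>s\<rfloor> *\<^sub>R axis i 1) + frac s *\<^sub>R axis i 1"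
      by (simp add: frac_def algebra_simps)
    then show ?thesis
      using 01[of "frac s" "x + of_int \<lfloor>s\<rfloor> *\<^sub>R axis i 1"] per3_int[of "Av i \<phi>" x "\<lfloor>s\<rfloor>" i] cper_Av[OF \<phi>, of i]
      by (simp add: cper_def less_imp_le[OF frac_lt_1] add.assoc)
  qed
  then show ?thesis by (simp add: indep_def)
qed

lemma indep_Av_other:
  assumes "indep j \<phi>"
  shows "indep j (Av i \<phi>)"
proof -
  have "\<phi> (x + s *\<^sub>R axis j 1 + h *\<^sub>R axis i 1) = \<phi> (x + h *\<^sub>R axis i 1)" for x s h
  proof -
    have "x + s *\<^sub>R axis j 1 + h *\<^sub>R axis i 1 = x + h *\<^sub>R axis i 1 + s *\<^sub>R axis j 1" by simp
    then show ?thesis using assms by (metis indep_def)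
  qed
  then show ?thesis by (simp add: indep_def Av_def)
qed

lemma mean_Av:
  fixes \<phi> :: "real^3 \<Rightarrow> 'a::banach"
  assumes \<phi>: "cper \<phi>"
  shows "mean (Av i \<phi>) = mean \<phi>"
proof -
  have "continuous_on (cbox (0,0) (1,1)) (\<lambda>(x, h). \<phi> (x + h *\<^sub>R axis i 1))"
    unfolding case_prod_unfold
    by (rule continuous_on_compose2[of UNIV \<phi>]) (use \<phi> in \<open>auto simp: cper_def intro!: continuous_intros\<close>)
  then have "mean (\<lambda>x. integral (cbox 0 1) (\<lambda>h. \<phi> (x + h *\<^sub>R axis i 1)))
     = integral (cbox 0 1) (\<lambda>h. mean (\<lambda>x. \<phi> (x + h *\<^sub>R axis i 1)))"
    by (rule integral_swap_continuous)
  also have "\<dots> = integral (cbox 0 1) (\<lambda>h::real. mean \<phi>)"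
    by (rule Henstock_Kurzweil_Integration.integral_cong, rule mean_shift[OF \<phi>]) simp
  finally show ?thesis by (simp add: Av_def[abs_def])
qed

lemma indep_all_const:
  assumes "indep 1 \<phi>" "indep 2 \<phi>" "indep 3 \<phi>"
  shows "\<phi> x = \<phi> 0"
proof -
  have "x = 0 + x$1 *\<^sub>R axis 1 1 + x$2 *\<^sub>R axis 2 1 + x$3 *\<^sub>R axis 3 1"
    by (simp add: vec_eq_iff forall_3 axis_def)
  then show ?thesis using assms by (metis indep_def)
qed

lemma Av3_mean:
  fixes \<phi> :: "real^3 \<Rightarrow> 'a::banach"
  assumes \<phi>: "cper \<phi>"
  shows "Av 1 (Av 2 (Av 3 \<phi>)) x = mean \<phi>" and "Av 3 (Av 1 (Av 2 \<phi>)) x = mean \<phi>"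
proof -
  have *: "\<zeta> x = mean \<phi>" if "indep 1 \<zeta>" "indep 2 \<zeta>" "indep 3 \<zeta>" "mean \<zeta> = mean \<phi>" for \<zeta> x
  proof -
    have "mean \<zeta> = mean (\<lambda>x. \<zeta> 0)" by (intro Henstock_Kurzweil_Integration.integral_cong indep_all_const that(1-3))
    then show ?thesis using that(4) indep_all_const[OF that(1-3)] by simp
  qed
  show "Av 1 (Av 2 (Av 3 \<phi>)) x = mean \<phi>" "Av 3 (Av 1 (Av 2 \<phi>)) x = mean \<phi>"
    by (rule *; simp add: indep_Av indep_Av_other cper_Av \<phi> mean_Av)+
qed

lemma Av_mono:
  fixes \<phi> \<zeta> :: "real^3 \<Rightarrow> real"
  assumes "cper \<phi>" "cper \<zeta>" "\<And>x. \<phi> x \<le> \<zeta> x"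
  shows "Av i \<phi> x \<le> Av i \<zeta> x"
  unfolding Av_def by (intro integral_le line_integrable assms)

lemma Av_add: "cper \<phi> \<Longrightarrow> cper \<zeta> \<Longrightarrow> Av i (\<lambda>x. \<phi> x + \<zeta> x) x = Av i \<phi> x + Av i \<zeta> x"
  for \<phi> \<zeta> :: "real^3 \<Rightarrow> 'a::banach"
  unfolding Av_def by (intro integral_add line_integrable)

lemma Av_diff: "cper \<phi> \<Longrightarrow> cper \<zeta> \<Longrightarrow> Av i (\<lambda>x. \<phi> x - \<zeta> x) x = Av i \<phi> x - Av i \<zeta> x"
  for \<phi> \<zeta> :: "real^3 \<Rightarrow> 'a::banach"
  unfolding Av_def by (intro integral_diff line_integrable)

lemma Av_cmult: "Av i (\<lambda>x. c * \<phi> x) x = c * Av i \<phi> x" for \<phi> :: "real^3 \<Rightarrow> real"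
  by (simp add: Av_def)

lemma Av_indep_mult: "indep i \<zeta> \<Longrightarrow> Av i (\<lambda>x. \<zeta> x * \<phi> x) x = \<zeta> x * Av i \<phi> x" for \<phi> \<zeta> :: "real^3 \<Rightarrow> real"
  by (simp add: Av_def indep_def)

lemma Av_norm_le: "cper \<phi> \<Longrightarrow> norm (Av i \<phi> x) \<le> Av i (\<lambda>x. norm (\<phi> x)) x" for \<phi> :: "real^3 \<Rightarrow> 'a::banach"
  unfolding Av_def
  by (intro Henstock_Kurzweil_Integration.integral_norm_bound_integral line_integrable cper_norm) auto

lemma Av_nonneg: "cper \<phi> \<Longrightarrow> (\<And>x. 0 \<le> \<phi> x) \<Longrightarrow> 0 \<le> Av i \<phi> x" for \<phi> :: "real^3 \<Rightarrow> real"
  unfolding Av_def by (intro integral_nonneg line_integrable)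

lemma Av_square_le:
  fixes \<phi> :: "real^3 \<Rightarrow> real"
  assumes \<phi>: "cper \<phi>"
  shows "(Av i \<phi> x)\<^sup>2 \<le> Av i (\<lambda>x. (\<phi> x)\<^sup>2) x"
proof -
  let ?\<psi> = "\<lambda>h. \<phi> (x + h *\<^sub>R axis i 1)" and ?m = "Av i \<phi> x"
  have "0 \<le> integral {0..1} (\<lambda>h. (?\<psi> h - ?m)\<^sup>2)"
    by (intro integral_nonneg integrable_continuous_real continuous_intros line_cont \<phi>) auto
  also have "integral {0..1} (\<lambda>h. (?\<psi> h - ?m)\<^sup>2) = integral {0..1} (\<lambda>h. (?\<psi> h)\<^sup>2 - 2 * ?m * ?\<psi> h + ?m\<^sup>2)"
    by (simp add: power2_diff algebra_simps)
  also have "\<dots> = integral {0..1} (\<lambda>h. (?\<psi> h)\<^sup>2) - 2 * ?m * integral {0..1} ?\<psi> + ?m\<^sup>2"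
    by (subst integral_add integral_diff;
        (intro integrable_continuous_real continuous_intros line_cont \<phi>)?)+ simp
  finally show ?thesis by (simp add: Av_def power2_eq_square)
qed

subsection \<open>Pointwise bounds by averages of derivatives\<close>

lemma Av_representation:
  fixes f :: "real \<Rightarrow> real^3 \<Rightarrow> 'a::banach"
  assumes f: "smper T f" and t: "t \<in> {0..T}"
  shows "norm (f t x - Av i (f t) x) \<le> Av i (\<lambda>y. norm (pder T (Dx i) f t y)) x"
proof -
  note sf = f[unfolded smper_def, THEN conjunct2, THEN conjunct1]
  let ?e = "axis i 1 :: real^3" and ?g = "pder T (Dx i) f t"
  have cg: "cper ?g" by (rule smper_cper[OF smper_pder[OF f] t])
  have cf: "cper (f t)" by (rule smper_cper[OF f t])
  have "((\<lambda>h. f t (x + h *\<^sub>R ?e) + (h - 1) *\<^sub>R ?g (x + h *\<^sub>R ?e)) has_integral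
      (1 - 1) *\<^sub>R f t (x + 1 *\<^sub>R ?e) - (0 - 1) *\<^sub>R f t (x + 0 *\<^sub>R ?e)) {0..1}"
  proof (rule fundamental_theorem_of_calculus)
    fix h assume "h \<in> {0..1::real}"
    have "((\<lambda>h. (h - 1) *\<^sub>R f t (x + h *\<^sub>R ?e)) has_vector_derivative
      ((h - 1) *\<^sub>R ?g (x + h *\<^sub>R ?e) + (1 - 0) *\<^sub>R f t (x + h *\<^sub>R ?e))) (at h within {0..1})"
      by (intro has_vector_derivative_scaleR smooth_on_Dx sf t)
         (auto intro!: derivative_eq_intros)
    then show "((\<lambda>h. (h - 1) *\<^sub>R f t (x + h *\<^sub>R ?e)) has_vector_derivative
      f t (x + h *\<^sub>R ?e) + (h - 1) *\<^sub>R ?g (x + h *\<^sub>R ?e)) (at h within {0..1})"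
      by (simp add: add.commute)
  qed simp
  then have "f t x = integral {0..1} (\<lambda>h. f t (x + h *\<^sub>R ?e) + (h - 1) *\<^sub>R ?g (x + h *\<^sub>R ?e))"
    by (simp add: integral_unique)
  also have "\<dots> = Av i (f t) x + integral {0..1} (\<lambda>h. (h - 1) *\<^sub>R ?g (x + h *\<^sub>R ?e))"
    unfolding Av_def
    by (intro integral_add integrable_continuous_real continuous_intros line_cont cf cg)
  finally have "norm (f t x - Av i (f t) x) = norm (integral {0..1} (\<lambda>h. (h - 1) *\<^sub>R ?g (x + h *\<^sub>R ?e)))"
    by simp
  also have "\<dots> \<le> integral {0..1} (\<lambda>h. norm (?g (x + h *\<^sub>R ?e)))"
    by (intro Henstock_Kurzweil_Integration.integral_norm_bound_integral integrable_continuous_real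
        continuous_intros line_cont cg) (auto simp: mult_left_le_one_le)
  finally show ?thesis by (simp add: Av_def)
qed

definition nsq :: "(real \<Rightarrow> real^3 \<Rightarrow> 'a::real_normed_vector) \<Rightarrow> real \<Rightarrow> real^3 \<Rightarrow> real" where
  "nsq f t x = (norm (f t x))\<^sup>2"

lemma nsq_nonneg [simp]: "0 \<le> nsq f t x"
  by (simp add: nsq_def)

lemma cper_nsq: "smper T f \<Longrightarrow> t \<in> {0..T} \<Longrightarrow> cper (nsq f t)"
  unfolding nsq_def[abs_def] by (intro cper_intros smper_cper)

lemma L2sq_mean: "L2sq (f t) = mean (nsq f t)"
  by (simp add: L2sq_def nsq_def[abs_def])

lemma nsq_le_Av:
  fixes f :: "real \<Rightarrow> real^3 \<Rightarrow> 'a::banach"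
  assumes f: "smper T f" and t: "t \<in> {0..T}"
  shows "nsq f t x \<le> 2 * Av i (\<lambda>y. nsq f t y + nsq (pder T (Dx i) f) t y) x"
proof -
  let ?g = "pder T (Dx i) f"
  note g = smper_pder[OF f, of "Dx i"]
  have c: "cper (f t)" "cper (?g t)" using f g t smper_cper by blast+
  have "norm (f t x) \<le> norm (Av i (f t) x) + norm (f t x - Av i (f t) x)"
    by (metis add.commute diff_add_cancel norm_triangle_ineq)
  also have "\<dots> \<le> Av i (\<lambda>y. norm (f t y)) x + Av i (\<lambda>y. norm (?g t y)) x"
    by (intro add_mono Av_norm_le c Av_representation[OF f t])
  also have "\<dots> = Av i (\<lambda>y. norm (f t y) + norm (?g t y)) x"
    by (rule Av_add[symmetric]; intro cper_intros c)
  finally have "nsq f t x \<le> (Av i (\<lambda>y. norm (f t y) + norm (?g t y)) x)\<^sup>2"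
    unfolding nsq_def by (intro power_mono) auto
  also have "\<dots> \<le> Av i (\<lambda>y. (norm (f t y) + norm (?g t y))\<^sup>2) x"
    by (intro Av_square_le cper_intros c)
  also have "\<dots> \<le> Av i (\<lambda>y. 2 * (nsq f t y + nsq ?g t y)) x"
  proof (intro Av_mono cper_intros cper_nsq[OF _ t] f g c)
    fix x show "(norm (f t x) + norm (?g t x))\<^sup>2 \<le> 2 * (nsq f t x + nsq ?g t x)"
      using sum_squares_bound[of "norm (f t x)" "norm (?g t x)"]
      by (simp add: nsq_def power2_sum algebra_simps)
  qed
  finally show ?thesis by (simp only: Av_cmult)
qed

definition Q1 :: "real \<Rightarrow> 3 \<Rightarrow> (real \<Rightarrow> real^3 \<Rightarrow> 'a::real_normed_vector) \<Rightarrow> real \<Rightarrow> real^3 \<Rightarrow> real" where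
  "Q1 T i f t x = nsq f t x + nsq (pder T (Dx i) f) t x"

definition Q2 :: "real \<Rightarrow> 3 \<Rightarrow> 3 \<Rightarrow> (real \<Rightarrow> real^3 \<Rightarrow> 'a::real_normed_vector) \<Rightarrow> real \<Rightarrow> real^3 \<Rightarrow> real" where
  "Q2 T i j f t x = Q1 T i f t x + Q1 T i (pder T (Dx j) f) t x"

definition Q3 :: "real \<Rightarrow> 3 \<Rightarrow> 3 \<Rightarrow> 3 \<Rightarrow> (real \<Rightarrow> real^3 \<Rightarrow> 'a::real_normed_vector) \<Rightarrow> real \<Rightarrow> real^3 \<Rightarrow> real" where
  "Q3 T i j k f t x = Q2 T i j f t x + Q2 T i j (pder T (Dx k) f) t x"

lemma cper_Q:
  assumes "smper T f" "t \<in> {0..T}"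
  shows "cper (Q1 T i f t)" "cper (Q2 T i j f t)" "cper (Q3 T i j k f t)"
  unfolding Q1_def[abs_def] Q2_def[abs_def] Q3_def[abs_def]
  by (intro cper_intros cper_nsq[OF _ assms(2)] smper_pder assms(1))+

lemma nsq_le_Av1:
  fixes f :: "real \<Rightarrow> real^3 \<Rightarrow> 'a::banach"
  assumes f: "smper T f" and t: "t \<in> {0..T}"
  shows "nsq f t x \<le> 2 * Av i (Q1 T i f t) x"
  using nsq_le_Av[OF f t] by (simp add: Q1_def[abs_def])

lemma Q1_le_Av:
  fixes f :: "real \<Rightarrow> real^3 \<Rightarrow> 'a::banach"
  assumes f: "smper T f" and t: "t \<in> {0..T}"
  shows "Q1 T i f t x \<le> 2 * Av j (\<lambda>y. Q1 T i f t y + Q1 T i (pder T (Dx j) f) t y) x"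
proof -
  have "Q1 T i f t x \<le> 2 * Av j (\<lambda>y. nsq f t y + nsq (pder T (Dx j) f) t y) x
    + 2 * Av j (\<lambda>y. nsq (pder T (Dx i) f) t y + nsq (pder T (Dx j) (pder T (Dx i) f)) t y) x"
    unfolding Q1_def by (intro add_mono nsq_le_Av f t smper_pder)
  also have "nsq (pder T (Dx j) (pder T (Dx i) f)) t = nsq (pder T (Dx i) (pder T (Dx j) f)) t"
    using eqTD[OF pder_commute[OF f] t] by (auto simp: nsq_def)
  also have "2 * Av j (\<lambda>y. nsq f t y + nsq (pder T (Dx j) f) t y) x
    + 2 * Av j (\<lambda>y. nsq (pder T (Dx i) f) t y + nsq (pder T (Dx i) (pder T (Dx j) f)) t y) x
    = 2 * Av j (\<lambda>y. Q1 T i f t y + Q1 T i (pder T (Dx j) f) t y) x"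
    unfolding distrib_left[symmetric]
    by (subst Av_add[symmetric]; (intro cper_intros cper_nsq[OF _ t] smper_pder f)?)
       (simp add: Q1_def algebra_simps)
  finally show ?thesis .
qed

lemma nsq_le_Av2:
  fixes f :: "real \<Rightarrow> real^3 \<Rightarrow> 'a::banach"
  assumes f: "smper T f" and t: "t \<in> {0..T}"
  shows "nsq f t x \<le> 4 * Av i (Av j (Q2 T i j f t)) x"
proof -
  have "nsq f t x \<le> 2 * Av i (Q1 T i f t) x" by (rule nsq_le_Av1[OF f t])
  also have "\<dots> \<le> 2 * Av i (\<lambda>x. 2 * Av j (Q2 T i j f t) x) x"
    by (intro mult_left_mono Av_mono cper_intros cper_Av cper_Q[OF _ t] smper_pder f)
       (use Q1_le_Av[OF f t] in \<open>auto simp: Q2_def[abs_def]\<close>)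
  finally show ?thesis by (simp add: Av_cmult)
qed

lemma nsq_le_mean3:
  fixes f :: "real \<Rightarrow> real^3 \<Rightarrow> 'a::banach"
  assumes f: "smper T f" and t: "t \<in> {0..T}"
  shows "nsq f t x \<le> 8 * mean (Q3 T 1 2 3 f t)"
proof -
  have "Q2 T 1 2 f t y \<le> 2 * Av 3 (Q3 T 1 2 3 f t) y" for y
  proof -
    have "Q2 T 1 2 f t y \<le> 2 * Av 3 (\<lambda>y. Q1 T 1 f t y + Q1 T 1 (pder T (Dx 3) f) t y) y
       + 2 * Av 3 (\<lambda>y. Q1 T 1 (pder T (Dx 2) f) t y + Q1 T 1 (pder T (Dx 3) (pder T (Dx 2) f)) t y) y"
      unfolding Q2_def by (intro add_mono Q1_le_Av f t smper_pder)
    also have "Q1 T 1 (pder T (Dx 3) (pder T (Dx 2) f)) t = Q1 T 1 (pder T (Dx 2) (pder T (Dx 3) f)) t"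
      using eqTD[OF pder_commute[OF f] t] eqTD[OF pder_cong[OF pder_commute[OF f]] t]
      by (auto simp: Q1_def nsq_def)
    also have "2 * Av 3 (\<lambda>y. Q1 T 1 f t y + Q1 T 1 (pder T (Dx 3) f) t y) y
       + 2 * Av 3 (\<lambda>y. Q1 T 1 (pder T (Dx 2) f) t y + Q1 T 1 (pder T (Dx 2) (pder T (Dx 3) f)) t y) y
       = 2 * Av 3 (Q3 T 1 2 3 f t) y"
      unfolding distrib_left[symmetric]
      by (subst Av_add[symmetric]; (intro cper_intros cper_Q[OF _ t] smper_pder f)?)
         (simp add: Q3_def[abs_def] Q2_def[abs_def] algebra_simps)
    finally show ?thesis .
  qed
  then have "4 * Av 1 (Av 2 (Q2 T 1 2 f t)) x \<le> 4 * Av 1 (Av 2 (\<lambda>x. 2 * Av 3 (Q3 T 1 2 3 f t) x)) x"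
    by (intro mult_left_mono Av_mono cper_Av cper_Q[OF _ t] cper_intros f) auto
  also have "Av 2 (\<lambda>x. 2 * Av 3 (Q3 T 1 2 3 f t) x) = (\<lambda>x. 2 * Av 2 (Av 3 (Q3 T 1 2 3 f t)) x)"
    by (simp add: Av_cmult fun_eq_iff)
  also have "4 * Av 1 (\<lambda>x. 2 * Av 2 (Av 3 (Q3 T 1 2 3 f t)) x) x = 8 * mean (Q3 T 1 2 3 f t)"
    using Av3_mean(1)[OF cper_Q(3)[OF f t]] by (simp add: Av_cmult)
  finally show ?thesis using nsq_le_Av2[OF f t, of x 1 2] by linarith
qed

text \<open>The two intermediate product estimates put two coordinate directions on one factor
  and the third one on the other factor, so that the product of the bounds can be integrated by Fubini.\<close>

lemma mean_nsq_prod_21: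
  fixes f :: "real \<Rightarrow> real^3 \<Rightarrow> 'a::banach" and g :: "real \<Rightarrow> real^3 \<Rightarrow> 'b::banach"
  assumes f: "smper T f" and g: "smper T g" and t: "t \<in> {0..T}"
  shows "mean (\<lambda>x. nsq f t x * nsq g t x) \<le> 8 * mean (Q2 T 1 2 f t) * mean (Q1 T 3 g t)"
proof -
  let ?a = "Av 1 (Av 2 (Q2 T 1 2 f t))" and ?b = "Av 3 (Q1 T 3 g t)"
  note c = cper_Av cper_Q[OF _ t] f g cper_intros cper_nsq[OF _ t]
  have nn: "0 \<le> Q2 T 1 2 f t x" "0 \<le> Q1 T 3 g t x" for x
    by (auto simp: Q2_def Q1_def)
  have pos: "0 \<le> ?a x" "0 \<le> ?b x" for x
    by (intro Av_nonneg c nn)+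
  have "mean (\<lambda>x. nsq f t x * nsq g t x) \<le> mean (\<lambda>x. 8 * (?b x * ?a x))"
  proof (rule mean_mono)
    fix x
    have "nsq f t x * nsq g t x \<le> (4 * ?a x) * (2 * ?b x)"
      using pos by (intro mult_mono nsq_le_Av2 nsq_le_Av1 f g t) auto
    then show "nsq f t x * nsq g t x \<le> 8 * (?b x * ?a x)" by (simp add: mult_ac)
  qed (intro c)+
  also have "\<dots> = 8 * mean (\<lambda>x. ?b x * ?a x)" by simp
  also have "mean (\<lambda>x. ?b x * ?a x) = mean (Av 3 (\<lambda>x. ?b x * ?a x))"
    by (rule mean_Av[symmetric]; intro c)
  also have "Av 3 (\<lambda>x. ?b x * ?a x) = (\<lambda>x. ?b x * mean (Q2 T 1 2 f t))"
    by (rule ext, subst Av_indep_mult) (auto intro!: indep_Av c simp: Av3_mean(2)[OF cper_Q(2)[OF f t]])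
  also have "mean \<dots> = mean ?b * mean (Q2 T 1 2 f t)" by simp
  also have "mean ?b = mean (Q1 T 3 g t)" by (intro mean_Av c)
  finally show ?thesis by (simp add: mult_ac)
qed

lemma mean_nsq_prod_30:
  fixes f :: "real \<Rightarrow> real^3 \<Rightarrow> 'a::banach" and g :: "real \<Rightarrow> real^3 \<Rightarrow> 'b::banach"
  assumes f: "smper T f" and g: "smper T g" and t: "t \<in> {0..T}"
  shows "mean (\<lambda>x. nsq f t x * nsq g t x) \<le> 8 * mean (Q3 T 1 2 3 f t) * mean (nsq g t)"
proof -
  have "mean (\<lambda>x. nsq f t x * nsq g t x) \<le> mean (\<lambda>x. 8 * mean (Q3 T 1 2 3 f t) * nsq g t x)"
    by (intro mean_mono cper_intros cper_nsq[OF _ t] f g t mult_right_mono nsq_le_mean3) auto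
  then show ?thesis by simp
qed

subsection \<open>Poincare inequality and integration by parts\<close>

lemma mean_pder_Dx:
  fixes f :: "real \<Rightarrow> real^3 \<Rightarrow> 'a::banach"
  assumes f: "smper T f" and t: "t \<in> {0..T}"
  shows "mean (pder T (Dx i) f t) = 0"
proof -
  have "Av i (pder T (Dx i) f t) x = 0" for x
  proof -
    have "((\<lambda>h. pder T (Dx i) f t (x + h *\<^sub>R axis i 1)) has_integral
       f t (x + 1 *\<^sub>R axis i 1) - f t (x + 0 *\<^sub>R axis i 1)) {0..1}"
      by (intro fundamental_theorem_of_calculus smooth_on_Dx t)
         (use f in \<open>auto simp: smper_def\<close>)
    then show ?thesis using f by (simp add: integral_unique Av_def smper_def periodic_def)
  qed
  then have "Av i (pder T (Dx i) f t) = (\<lambda>x. 0)" by auto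
  then show ?thesis using mean_Av[OF smper_cper[OF smper_pder[OF f] t], of i "Dx i"] by simp
qed

lemma poincare:
  fixes f :: "real \<Rightarrow> real^3 \<Rightarrow> 'a::banach"
  assumes f: "smper T f" and t: "t \<in> {0..T}" and m: "mean (f t) = 0"
  shows "L2sq (f t) \<le> 3 * (\<Sum>i\<in>UNIV. L2sq (pder T (Dx i) f t))"
proof -
  let ?\<phi> = "f t" and ?g = "\<lambda>i. pder T (Dx i) f"
  have cf: "cper ?\<phi>" by (rule smper_cper[OF f t])
  have g: "smper T (?g i)" for i by (rule smper_pder[OF f])
  have cg: "cper (?g i t)" for i by (rule smper_cper[OF g t])
  note c = cf cg cper_Av cper_intros cper_nsq[OF g t]
  let ?N = "\<lambda>i x. norm (?g i t x)"
  have sq: "(Av i \<psi> x)\<^sup>2 \<le> Av i (\<lambda>x. (\<psi> x)\<^sup>2) x" if "cper \<psi>" for \<psi> :: "real^3 \<Rightarrow> real" and i x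
    by (rule Av_square_le[OF that])
  have b: "nsq f t x \<le> 3 * (Av 1 (nsq (?g 1) t) x + Av 1 (Av 2 (nsq (?g 2) t)) x
     + Av 1 (Av 2 (Av 3 (nsq (?g 3) t))) x)" for x
  proof -
    let ?d2 = "\<lambda>x. ?\<phi> x - Av 2 ?\<phi> x" and ?d3 = "\<lambda>x. ?\<phi> x - Av 3 ?\<phi> x"
    have 1: "norm (?\<phi> x - Av 1 ?\<phi> x) \<le> Av 1 (?N 1) x" by (rule Av_representation[OF f t])
    have "norm (Av 1 ?\<phi> x - Av 1 (Av 2 ?\<phi>) x) = norm (Av 1 ?d2 x)"
      by (simp add: Av_diff c)
    also have "\<dots> \<le> Av 1 (\<lambda>x. norm (?d2 x)) x" by (intro Av_norm_le c)
    also have "\<dots> \<le> Av 1 (Av 2 (?N 2)) x"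
      by (intro Av_mono c Av_representation[OF f t])
    finally have 2: "norm (Av 1 ?\<phi> x - Av 1 (Av 2 ?\<phi>) x) \<le> Av 1 (Av 2 (?N 2)) x" .
    have "Av 1 (Av 2 ?\<phi>) x - Av 1 (Av 2 (Av 3 ?\<phi>)) x = Av 1 (Av 2 ?d3) x"
      by (subst Av_diff[symmetric]; (intro c)?)
         (simp add: Av_diff[OF cf cper_Av[OF cf], abs_def])
    then have "norm (Av 1 (Av 2 ?\<phi>) x - Av 1 (Av 2 (Av 3 ?\<phi>)) x) \<le> Av 1 (\<lambda>x. norm (Av 2 ?d3 x)) x"
      using Av_norm_le[of "Av 2 ?d3" 1 x] by (simp add: c)
    also have "\<dots> \<le> Av 1 (Av 2 (\<lambda>x. norm (?d3 x))) x"
      by (intro Av_mono Av_norm_le c)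
    also have "\<dots> \<le> Av 1 (Av 2 (Av 3 (?N 3))) x"
      by (intro Av_mono c Av_representation[OF f t])
    finally have 3: "norm (Av 1 (Av 2 ?\<phi>) x) \<le> Av 1 (Av 2 (Av 3 (?N 3))) x"
      by (simp add: Av3_mean(1)[OF cf] m)
    let ?A = "Av 1 (?N 1) x" and ?B = "Av 1 (Av 2 (?N 2)) x" and ?C = "Av 1 (Av 2 (Av 3 (?N 3))) x"
    have "norm (?\<phi> x) \<le> norm (?\<phi> x - Av 1 ?\<phi> x) + norm (Av 1 ?\<phi> x - Av 1 (Av 2 ?\<phi>) x) + norm (Av 1 (Av 2 ?\<phi>) x)"
      by (rule order_trans[OF _ order_trans[OF norm_triangle_ineq add_right_mono[OF norm_triangle_ineq]]]) simp
    then have "norm (f t x) \<le> ?A + ?B + ?C" using 1 2 3 by linarith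
    then have "nsq f t x \<le> (?A + ?B + ?C)\<^sup>2" unfolding nsq_def by (intro power_mono) auto
    also have "\<dots> \<le> 3 * (?A\<^sup>2 + ?B\<^sup>2 + ?C\<^sup>2)"
      using sum_squares_bound[of ?A ?B] sum_squares_bound[of ?B ?C] sum_squares_bound[of ?A ?C]
      by (simp add: power2_sum algebra_simps)
    finally have abc: "nsq f t x \<le> 3 * (?A\<^sup>2 + ?B\<^sup>2 + ?C\<^sup>2)" .
    have a1: "?A\<^sup>2 \<le> Av 1 (nsq (?g 1) t) x"
      using sq[of "?N 1" 1 x] by (simp add: c nsq_def[abs_def])
    have a2: "?B\<^sup>2 \<le> Av 1 (Av 2 (nsq (?g 2) t)) x"
    proof -
      have "?B\<^sup>2 \<le> Av 1 (\<lambda>x. (Av 2 (?N 2) x)\<^sup>2) x" by (intro sq c)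
      also have "\<dots> \<le> Av 1 (Av 2 (nsq (?g 2) t)) x"
        by (intro Av_mono c) (use sq[of "?N 2" 2] in \<open>simp add: c nsq_def[abs_def]\<close>)
      finally show ?thesis .
    qed
    have a3: "?C\<^sup>2 \<le> Av 1 (Av 2 (Av 3 (nsq (?g 3) t))) x"
    proof -
      have "?C\<^sup>2 \<le> Av 1 (\<lambda>x. (Av 2 (Av 3 (?N 3)) x)\<^sup>2) x" by (intro sq c)
      also have "\<dots> \<le> Av 1 (Av 2 (\<lambda>x. (Av 3 (?N 3) x)\<^sup>2)) x"
        by (intro Av_mono c sq)
      also have "\<dots> \<le> Av 1 (Av 2 (Av 3 (nsq (?g 3) t))) x"
        by (intro Av_mono c) (use sq[of "?N 3" 3] in \<open>simp add: c nsq_def[abs_def]\<close>)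
      finally show ?thesis .
    qed
    show ?thesis
      by (rule order_trans[OF abc]) (intro mult_left_mono add_mono a1 a2 a3, simp)
  qed
  have "L2sq (f t) \<le> mean (\<lambda>x. 3 * (Av 1 (nsq (?g 1) t) x + Av 1 (Av 2 (nsq (?g 2) t)) x
     + Av 1 (Av 2 (Av 3 (nsq (?g 3) t))) x))"
    unfolding L2sq_mean by (intro mean_mono b c cper_nsq[OF f t])
  also have "\<dots> = 3 * (mean (nsq (?g 1) t) + mean (nsq (?g 2) t) + mean (nsq (?g 3) t))"
    by (simp add: mean_add mean_Av c)
  finally show ?thesis by (simp add: L2sq_mean sum_3)
qed

subsection \<open>Scalar products and norms of time slices\<close>

definition ip :: "(real^3 \<Rightarrow> 'a::euclidean_space) \<Rightarrow> (real^3 \<Rightarrow> 'a) \<Rightarrow> real" where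
  "ip \<phi> \<zeta> = mean (\<lambda>x. \<phi> x \<bullet> \<zeta> x)"

definition L2n :: "(real^3 \<Rightarrow> 'a::euclidean_space) \<Rightarrow> real" where
  "L2n \<phi> = sqrt (L2sq \<phi>)"

lemma L2sq_ip: "L2sq \<phi> = ip \<phi> \<phi>"
  by (simp add: L2sq_def ip_def power2_norm_eq_inner)

lemma ip_commute: "ip \<phi> \<zeta> = ip \<zeta> \<phi>"
  by (simp add: ip_def inner_commute)

lemma ip_add_left: "cper \<phi> \<Longrightarrow> cper \<zeta> \<Longrightarrow> cper \<psi> \<Longrightarrow> ip (\<lambda>x. \<phi> x + \<zeta> x) \<psi> = ip \<phi> \<psi> + ip \<zeta> \<psi>"
  by (simp add: ip_def inner_add_left mean_add cper_inner)

lemma ip_add_right: "cper \<phi> \<Longrightarrow> cper \<zeta> \<Longrightarrow> cper \<psi> \<Longrightarrow> ip \<psi> (\<lambda>x. \<phi> x + \<zeta> x) = ip \<psi> \<phi> + ip \<psi> \<zeta>"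
  by (simp add: ip_commute[of \<psi>] ip_add_left)

lemma ip_diff_left: "cper \<phi> \<Longrightarrow> cper \<zeta> \<Longrightarrow> cper \<psi> \<Longrightarrow> ip (\<lambda>x. \<phi> x - \<zeta> x) \<psi> = ip \<phi> \<psi> - ip \<zeta> \<psi>"
  by (simp add: ip_def inner_diff_left mean_diff cper_inner)

lemma ip_scaleR_left [simp]: "ip (\<lambda>x. c *\<^sub>R \<phi> x) \<zeta> = c * ip \<phi> \<zeta>"
  by (simp add: ip_def)

lemma ip_scaleR_right [simp]: "ip \<phi> (\<lambda>x. c *\<^sub>R \<zeta> x) = c * ip \<phi> \<zeta>"
  by (simp add: ip_def)

lemma ip_uminus_left [simp]: "ip (\<lambda>x. - \<phi> x) \<zeta> = - ip \<phi> \<zeta>"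
  by (simp add: ip_def)

lemma ip_uminus_right [simp]: "ip \<phi> (\<lambda>x. - \<zeta> x) = - ip \<phi> \<zeta>"
  by (simp add: ip_def)

lemma L2sq_nonneg [simp]: "0 \<le> L2sq \<phi>"
  unfolding L2sq_def
  by (cases "(\<lambda>x. (norm (\<phi> x))\<^sup>2) integrable_on cbox 0 1")
     (auto simp: not_integrable_integral intro: integral_nonneg)

lemma L2n_nonneg [simp]: "0 \<le> L2n \<phi>"
  by (simp add: L2n_def)

lemma L2n_sq [simp]: "(L2n \<phi>)\<^sup>2 = L2sq \<phi>"
  by (simp add: L2n_def)

lemma ip_Cauchy_Schwarz:
  assumes \<phi>: "cper \<phi>" and \<zeta>: "cper \<zeta>"
  shows "\<bar>ip \<phi> \<zeta>\<bar> \<le> L2n \<phi> * L2n \<zeta>"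
proof -
  have q: "0 \<le> L2sq \<phi> + 2 * s * ip \<phi> \<zeta> + s\<^sup>2 * L2sq \<zeta>" for s
  proof -
    have "0 \<le> ip (\<lambda>x. \<phi> x + s *\<^sub>R \<zeta> x) (\<lambda>x. \<phi> x + s *\<^sub>R \<zeta> x)"
      using L2sq_nonneg[of "\<lambda>x. \<phi> x + s *\<^sub>R \<zeta> x"] by (simp add: L2sq_ip)
    also have "\<dots> = L2sq \<phi> + 2 * s * ip \<phi> \<zeta> + s\<^sup>2 * L2sq \<zeta>"
      by (simp add: ip_add_left ip_add_right cper_intros \<phi> \<zeta> L2sq_ip ip_commute[of \<zeta> \<phi>] power2_eq_square algebra_simps)
    finally show ?thesis .
  qed
  have "(ip \<phi> \<zeta>)\<^sup>2 \<le> L2sq \<phi> * L2sq \<zeta>"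
  proof (cases "L2sq \<zeta> = 0")
    case True
    have "ip \<phi> \<zeta> = 0"
    proof (rule ccontr)
      assume n: "ip \<phi> \<zeta> \<noteq> 0"
      show False using q[of "- (L2sq \<phi> + 1) / (2 * ip \<phi> \<zeta>)"] n by (simp add: True field_simps)
    qed
    then show ?thesis by simp
  next
    case False
    then have pos: "L2sq \<zeta> > 0" by (simp add: less_le)
    have "0 \<le> L2sq \<phi> - (ip \<phi> \<zeta>)\<^sup>2 / L2sq \<zeta>"
      using q[of "- ip \<phi> \<zeta> / L2sq \<zeta>"] False by (simp add: power2_eq_square field_simps)
    then show ?thesis using pos by (simp add: field_simps)
  qed
  then have "sqrt ((ip \<phi> \<zeta>)\<^sup>2) \<le> sqrt (L2sq \<phi> * L2sq \<zeta>)" by (rule real_sqrt_le_mono)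
  then show ?thesis by (simp add: L2n_def real_sqrt_mult)
qed

lemma L2n_triangle:
  assumes \<phi>: "cper \<phi>" and \<zeta>: "cper \<zeta>"
  shows "L2n (\<lambda>x. \<phi> x + \<zeta> x) \<le> L2n \<phi> + L2n \<zeta>"
proof -
  have "(L2n (\<lambda>x. \<phi> x + \<zeta> x))\<^sup>2 = L2sq \<phi> + 2 * ip \<phi> \<zeta> + L2sq \<zeta>"
    by (simp add: L2sq_ip ip_add_left ip_add_right cper_intros \<phi> \<zeta> ip_commute[of \<zeta> \<phi>])
  also have "\<dots> \<le> (L2n \<phi> + L2n \<zeta>)\<^sup>2"
    using ip_Cauchy_Schwarz[OF \<phi> \<zeta>] by (simp add: power2_sum L2n_def)
  finally show ?thesis by (rule power2_le_imp_le) simp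
qed

lemma L2n_linear_le:
  assumes \<phi>: "cper \<phi>" and L: "bounded_linear L" and K: "\<And>v. norm (L v) \<le> K * norm v" "0 \<le> K"
  shows "L2n (\<lambda>x. L (\<phi> x)) \<le> K * L2n \<phi>"
proof -
  have "cper (\<lambda>x. L (\<phi> x))"
    by (rule cper_compose[OF \<phi>]) (rule linear_continuous_on[OF L])
  then have "L2sq (\<lambda>x. L (\<phi> x)) \<le> mean (\<lambda>x. K\<^sup>2 * (norm (\<phi> x))\<^sup>2)"
    unfolding L2sq_def using K
    by (intro mean_mono cper_intros \<phi>) (simp_all flip: power_mult_distrib)
  also have "\<dots> = K\<^sup>2 * L2sq \<phi>" by (simp add: L2sq_def)
  finally show ?thesis unfolding L2n_def
    using K(2) by (metis abs_of_nonneg real_sqrt_abs real_sqrt_le_mono real_sqrt_mult)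
qed

lemma ip_by_parts:
  assumes f: "smper T f" and g: "smper T g" and t: "t \<in> {0..T}"
  shows "ip (pder T (Dx i) f t) (g t) = - ip (f t) (pder T (Dx i) g t)"
proof -
  have T: "T > 0" using f by (simp add: smper_def)
  have fg: "smper T (\<lambda>t x. f t x \<bullet> g t x)"
    by (rule smper_bilinear[OF bounded_bilinear_inner f g])
  have "0 = mean (pder T (Dx i) (\<lambda>t x. f t x \<bullet> g t x) t)"
    by (rule mean_pder_Dx[OF fg t, symmetric])
  also have "pder T (Dx i) (\<lambda>t x. f t x \<bullet> g t x) t = (\<lambda>x. f t x \<bullet> pder T (Dx i) g t x + pder T (Dx i) f t x \<bullet> g t x)"
    using f g T t by (intro eqT_fun[OF pder_bilinear[OF bounded_bilinear_inner]]) (auto simp: smper_def)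
  also have "mean \<dots> = ip (f t) (pder T (Dx i) g t) + ip (pder T (Dx i) f t) (g t)"
    unfolding ip_def by (intro mean_add cper_intros smper_cper[OF _ t] smper_pder f g)
  finally show ?thesis by simp
qed

lemma ip_has_derivative:
  assumes f: "smper T f" and g: "smper T g" and t: "t \<in> {0..T}"
  shows "((\<lambda>t. ip (f t) (g t)) has_real_derivative
    ip (pder T Dt f t) (g t) + ip (f t) (pder T Dt g t)) (at t within {0..T})"
proof -
  have T: "T > 0" and sf: "smooth_on T f" and sg: "smooth_on T g"
    using f g by (simp_all add: smper_def)
  let ?h = "\<lambda>t x. f t x \<bullet> pder T Dt g t x + pder T Dt f t x \<bullet> g t x"
  have fg: "smooth_on T (\<lambda>t x. f t x \<bullet> g t x)"
    by (rule smooth_on_bilinear[OF bounded_bilinear_inner T sf sg])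
  have "((\<lambda>t. mean (\<lambda>x. f t x \<bullet> g t x)) has_vector_derivative mean (?h t)) (at t within {0..T})"
  proof (rule leibniz_rule_vector_derivative)
    show "((\<lambda>s. f s x \<bullet> g s x) has_vector_derivative ?h s x) (at s within {0..T})"
      if "s \<in> {0..T}" for s x
      by (rule bounded_bilinear.has_vector_derivative[OF bounded_bilinear_inner
            smooth_on_Dt[OF sf that] smooth_on_Dt[OF sg that]])
    show "(\<lambda>x. f s x \<bullet> g s x) integrable_on cbox 0 1" if "s \<in> {0..T}" for s
      by (intro cper_integrable cper_intros smper_cper[OF f that] smper_cper[OF g that])
    show "continuous_on ({0..T} \<times> cbox 0 1) (\<lambda>(s, x). ?h s x)"
      unfolding case_prod_unfold
      by (intro continuous_intros smooth_on_continuous_compose[OF sf] smooth_on_continuous_compose[OF sg]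
          smooth_on_continuous_compose[OF smooth_on_pder[OF sf]]
          smooth_on_continuous_compose[OF smooth_on_pder[OF sg]]) auto
  qed (use t in auto)
  moreover have "mean (?h t) = ip (pder T Dt f t) (g t) + ip (f t) (pder T Dt g t)"
    unfolding ip_def by (subst mean_add; (intro cper_intros smper_cper[OF _ t] smper_pder f g)?) simp
  ultimately show ?thesis
    by (simp add: ip_def[abs_def] has_real_derivative_iff_has_vector_derivative)
qed


section \<open>Sobolev norms and product estimates\<close>

definition SL :: "nat \<Rightarrow> dirn list set" where
  "SL n = {ds. set ds \<subseteq> range Dx \<and> length ds \<le> n}"

definition hn :: "real \<Rightarrow> nat \<Rightarrow> (real \<Rightarrow> real^3 \<Rightarrow> 'a::euclidean_space) \<Rightarrow> real \<Rightarrow> real" where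
  "hn T n f t = (\<Sum>ds\<in>SL n. L2n (pders T ds f t))"

lemma finite_SL [simp]: "finite (SL n)"
proof -
  have "finite (range Dx)" by simp
  from finite_lists_length_le[OF this, of n] show ?thesis by (simp add: SL_def)
qed

lemma SL_mono: "m \<le> n \<Longrightarrow> SL m \<subseteq> SL n"
  by (auto simp: SL_def)

lemma Nil_SL [simp]: "[] \<in> SL n"
  by (simp add: SL_def)

lemma hn_nonneg [simp]: "0 \<le> hn T n f t"
  by (auto simp: hn_def intro: sum_nonneg)

lemma hn_mono: "m \<le> n \<Longrightarrow> hn T m f t \<le> hn T n f t"
  unfolding hn_def by (intro sum_mono2 SL_mono) auto

lemma L2n_le_hn: "ds \<in> SL n \<Longrightarrow> L2n (pders T ds f t) \<le> hn T n f t"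
  unfolding hn_def by (intro member_le_sum) auto

lemma L2n_le_hn0: "L2n (f t) \<le> hn T n f t"
  using L2n_le_hn[of "[]"] by simp

lemma sum_L2sq_le_hn:
  assumes "S \<subseteq> SL n"
  shows "(\<Sum>ds\<in>S. L2sq (pders T ds f t)) \<le> (hn T n f t)\<^sup>2"
proof -
  have S: "finite S" using assms finite_SL finite_subset by blast
  have "(\<Sum>ds\<in>S. L2sq (pders T ds f t)) \<le> (\<Sum>ds\<in>S. L2n (pders T ds f t) * hn T n f t)"
    using assms by (intro sum_mono) (auto simp flip: L2n_sq simp: power2_eq_square intro!: mult_left_mono L2n_le_hn)
  also have "\<dots> = (\<Sum>ds\<in>S. L2n (pders T ds f t)) * hn T n f t" by (simp add: sum_distrib_right)
  also have "\<dots> \<le> hn T n f t * hn T n f t"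
    by (intro mult_right_mono hn_nonneg) (unfold hn_def, intro sum_mono2 assms finite_SL L2n_nonneg)
  finally show ?thesis by (simp add: power2_eq_square)
qed

lemma hn_cong: "eqT T f g \<Longrightarrow> t \<in> {0..T} \<Longrightarrow> hn T n f t = hn T n g t"
  unfolding hn_def by (intro sum.cong refl, subst eqT_fun[OF pders_cong]) auto

lemma hn_pder:
  "hn T n (pder T (Dx i) f) t \<le> hn T (Suc n) f t"
proof -
  have "hn T n (pder T (Dx i) f) t = (\<Sum>ds\<in>(\<lambda>ds. ds @ [Dx i]) ` SL n. L2n (pders T ds f t))"
    unfolding hn_def by (subst sum.reindex) (auto simp: inj_on_def pders_append)
  also have "\<dots> \<le> hn T (Suc n) f t"
    unfolding hn_def by (intro sum_mono2 finite_SL) (auto simp: SL_def)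
  finally show ?thesis .
qed

lemma hn_pders: "set ds \<subseteq> range Dx \<Longrightarrow> hn T n (pders T ds f) t \<le> hn T (n + length ds) f t"
proof (induction ds arbitrary: n)
  case (Cons d ds)
  then obtain i where "d = Dx i" by auto
  then have "hn T n (pders T (d # ds) f) t \<le> hn T (Suc n) (pders T ds f) t"
    by (simp add: hn_pder)
  also have "\<dots> \<le> hn T (Suc n + length ds) f t" by (rule Cons.IH) (use Cons.prems in simp)
  finally show ?case by simp
qed simp

lemma hn_add:
  assumes "smper T f" "smper T g" "t \<in> {0..T}"
  shows "hn T n (\<lambda>t x. f t x + g t x) t \<le> hn T n f t + hn T n g t"
  unfolding hn_def sum.distrib[symmetric]
proof (rule sum_mono)
  fix ds
  have "pders T ds (\<lambda>t x. f t x + g t x) t = (\<lambda>x. pders T ds f t x + pders T ds g t x)"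
    by (rule eqT_fun[OF pders_add[OF assms(1,2)] assms(3)])
  then show "L2n (pders T ds (\<lambda>t x. f t x + g t x) t) \<le> L2n (pders T ds f t) + L2n (pders T ds g t)"
    by (simp add: L2n_triangle smper_cper[OF smper_pders assms(3)] assms(1,2))
qed

lemma hn_linear:
  assumes "bounded_linear L"
  shows "\<exists>C\<ge>0. \<forall>T f t n. smper T f \<longrightarrow> t \<in> {0..T} \<longrightarrow> hn T n (\<lambda>t x. L (f t x)) t \<le> C * hn T n f t"
proof -
  obtain C where C: "C > 0" "\<And>v. norm (L v) \<le> norm v * C"
    using bounded_linear.pos_bounded[OF assms] by blast
  have "hn T n (\<lambda>t x. L (f t x)) t \<le> C * hn T n f t" if f: "smper T f" and t: "t \<in> {0..T}" for T f t n
    unfolding hn_def sum_distrib_left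
  proof (rule sum_mono)
    fix ds
    have "pders T ds (\<lambda>t x. L (f t x)) t = (\<lambda>x. L (pders T ds f t x))"
      by (rule eqT_fun[OF pders_linear[OF assms f] t])
    then show "L2n (pders T ds (\<lambda>t x. L (f t x)) t) \<le> C * L2n (pders T ds f t)"
      using L2n_linear_le[OF smper_cper[OF smper_pders[OF f] t] assms, of C ds] C by (simp add: mult.commute)
  qed
  then show ?thesis using C by (intro exI[of _ C]) auto
qed

lemma hn_uminus: "smper T f \<Longrightarrow> t \<in> {0..T} \<Longrightarrow> hn T n (\<lambda>t x. - f t x) t = hn T n f t"
  unfolding hn_def
  by (intro sum.cong refl, subst eqT_fun[OF pders_uminus]) (auto simp: L2n_def L2sq_def)

lemma hn_diff:
  assumes "smper T f" "smper T g" "t \<in> {0..T}"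
  shows "hn T n (\<lambda>t x. f t x - g t x) t \<le> hn T n f t + hn T n g t"
  using hn_add[OF assms(1) smper_uminus[OF assms(2)] assms(3), of n] hn_uminus[OF assms(2,3)] by simp

lemma hn_sum:
  fixes f :: "'i \<Rightarrow> real \<Rightarrow> real^3 \<Rightarrow> 'b::euclidean_space"
  assumes "finite I" "\<And>i. i \<in> I \<Longrightarrow> smper T (f i)" "t \<in> {0..T}" "T > 0"
  shows "hn T n (\<lambda>t x. \<Sum>i\<in>I. f i t x) t \<le> (\<Sum>i\<in>I. hn T n (f i) t)"
  using assms(1,2)
proof (induction I rule: finite_induct)
  case empty
  have "pders T ds (\<lambda>t x. 0 :: 'b) t = (\<lambda>x. 0)" for ds
    using eqT_fun[OF pders_sum[of "{}" T "\<lambda>_ t x. 0" ds] assms(3)] assms(4) by simp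
  then show ?case by (simp add: hn_def L2n_def L2sq_def)
next
  case (insert i I)
  then have "hn T n (\<lambda>t x. f i t x + (\<Sum>i\<in>I. f i t x)) t \<le> hn T n (f i) t + hn T n (\<lambda>t x. \<Sum>i\<in>I. f i t x) t"
    using assms by (intro hn_add smper_sum) auto
  then show ?case using insert by simp
qed

subsection \<open>The product law\<close>

lemma mean_Q_le_hn:
  fixes f :: "real \<Rightarrow> real^3 \<Rightarrow> 'a::euclidean_space"
  assumes f: "smper T f" and t: "t \<in> {0..T}"
  shows "mean (Q1 T i f t) \<le> (hn T 1 f t)\<^sup>2"
    and "mean (Q2 T 1 2 f t) \<le> (hn T 2 f t)\<^sup>2"
    and "mean (Q3 T 1 2 3 f t) \<le> (hn T 3 f t)\<^sup>2"
proof -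
  note c = cper_intros cper_nsq[OF _ t] smper_pder f
  have 1: "mean (Q1 T i f t) = L2sq (f t) + L2sq (pder T (Dx i) f t)" if "smper T f" for f :: "real \<Rightarrow> real^3 \<Rightarrow> 'a" and i
    unfolding Q1_def[abs_def] L2sq_mean by (intro mean_add c that)
  have 2: "mean (Q2 T i j f t) = mean (Q1 T i f t) + mean (Q1 T i (pder T (Dx j) f) t)" if "smper T f" for f :: "real \<Rightarrow> real^3 \<Rightarrow> 'a" and i j
    unfolding Q2_def[abs_def] by (intro mean_add cper_Q[OF _ t] smper_pder that)
  have 3: "mean (Q3 T i j k f t) = mean (Q2 T i j f t) + mean (Q2 T i j (pder T (Dx k) f) t)" for i j k
    unfolding Q3_def[abs_def] by (intro mean_add cper_Q[OF _ t] smper_pder f)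
  have "mean (Q1 T i f t) = (\<Sum>ds\<in>{[], [Dx i]}. L2sq (pders T ds f t))"
    by (simp add: 1 f)
  also have "\<dots> \<le> (hn T 1 f t)\<^sup>2" by (intro sum_L2sq_le_hn) (auto simp: SL_def)
  finally show "mean (Q1 T i f t) \<le> (hn T 1 f t)\<^sup>2" .
  have "mean (Q2 T 1 2 f t) = (\<Sum>ds\<in>{[], [Dx 1], [Dx 2], [Dx 1, Dx 2]}. L2sq (pders T ds f t))"
    by (simp add: 1 2 f smper_pder)
  also have "\<dots> \<le> (hn T 2 f t)\<^sup>2" by (intro sum_L2sq_le_hn) (auto simp: SL_def)
  finally show "mean (Q2 T 1 2 f t) \<le> (hn T 2 f t)\<^sup>2" .
  have "mean (Q3 T 1 2 3 f t) = (\<Sum>ds\<in>{[], [Dx 1], [Dx 2], [Dx 1, Dx 2], [Dx 3], [Dx 1, Dx 3],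
      [Dx 2, Dx 3], [Dx 1, Dx 2, Dx 3]}. L2sq (pders T ds f t))"
    by (simp add: 1 2 3 f smper_pder)
  also have "\<dots> \<le> (hn T 3 f t)\<^sup>2" by (intro sum_L2sq_le_hn) (auto simp: SL_def)
  finally show "mean (Q3 T 1 2 3 f t) \<le> (hn T 3 f t)\<^sup>2" .
qed

lemma mean_nsq_prod_le:
  fixes f :: "real \<Rightarrow> real^3 \<Rightarrow> 'a::euclidean_space" and g :: "real \<Rightarrow> real^3 \<Rightarrow> 'b::euclidean_space"
  assumes f: "smper T f" and g: "smper T g" and t: "t \<in> {0..T}" and p: "p \<le> 3"
  shows "mean (\<lambda>x. nsq f t x * nsq g t x) \<le> 8 * (hn T p f t * hn T (3 - p) g t)\<^sup>2"
proof -
  have a: "mean (\<lambda>x. nsq f t x * nsq g t x) \<le> 8 * ((hn T 2 f t)\<^sup>2 * (hn T 1 g t)\<^sup>2)"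
    and b: "mean (\<lambda>x. nsq f t x * nsq g t x) \<le> 8 * ((hn T 3 f t)\<^sup>2 * (hn T 0 g t)\<^sup>2)"
    if f: "smper T f" and g: "smper T g"
    for f :: "real \<Rightarrow> real^3 \<Rightarrow> 'c::euclidean_space" and g :: "real \<Rightarrow> real^3 \<Rightarrow> 'd::euclidean_space"
  proof -
    have "0 \<le> mean (Q1 T 3 g t)" "0 \<le> mean (Q2 T 1 2 f t)" "0 \<le> mean (Q3 T 1 2 3 f t)"
      by (intro mean_nonneg cper_Q[OF _ t] f g; simp add: Q1_def Q2_def Q3_def)+
    then have "8 * (mean (Q2 T 1 2 f t) * mean (Q1 T 3 g t)) \<le> 8 * ((hn T 2 f t)\<^sup>2 * (hn T 1 g t)\<^sup>2)"
      "8 * (mean (Q3 T 1 2 3 f t) * mean (nsq g t)) \<le> 8 * ((hn T 3 f t)\<^sup>2 * (hn T 0 g t)\<^sup>2)"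
      using sum_L2sq_le_hn[of "{[]}" 0 T g t] mean_nonneg[OF nsq_nonneg cper_nsq[OF g t]]
      by (intro mult_left_mono mult_mono mean_Q_le_hn f g t; simp add: L2sq_mean)+
    then show "mean (\<lambda>x. nsq f t x * nsq g t x) \<le> 8 * ((hn T 2 f t)\<^sup>2 * (hn T 1 g t)\<^sup>2)"
      "mean (\<lambda>x. nsq f t x * nsq g t x) \<le> 8 * ((hn T 3 f t)\<^sup>2 * (hn T 0 g t)\<^sup>2)"
      using mean_nsq_prod_21[OF f g t] mean_nsq_prod_30[OF f g t] by simp_all
  qed
  have sw: "mean (\<lambda>x. nsq f t x * nsq g t x) = mean (\<lambda>x. nsq g t x * nsq f t x)"
    by (simp add: mult.commute)
  consider "p = 3" | "p = 2" | "p = 1" | "p = 0" using p by linarith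
  then show ?thesis
  proof cases
    case 1 then show ?thesis using b[OF f g] by (simp add: power_mult_distrib)
  next
    case 2 then show ?thesis using a[OF f g] by (simp add: power_mult_distrib)
  next
    case 3
    have "8 * ((hn T 2 g t)\<^sup>2 * (hn T 1 f t)\<^sup>2) = 8 * (hn T p f t * hn T (3 - p) g t)\<^sup>2"
      by (simp add: 3 power_mult_distrib)
    then show ?thesis using a[OF g f] by (subst sw) linarith
  next
    case 4
    have "8 * ((hn T 3 g t)\<^sup>2 * (hn T 0 f t)\<^sup>2) = 8 * (hn T p f t * hn T (3 - p) g t)\<^sup>2"
      by (simp add: 4 power_mult_distrib)
    then show ?thesis using b[OF g f] by (subst sw) linarith
  qed
qed

lemma L2n_bilinear:
  fixes B :: "'a::euclidean_space \<Rightarrow> 'b::euclidean_space \<Rightarrow> 'c::euclidean_space"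
  assumes B: "bounded_bilinear B"
  shows "\<exists>C\<ge>0. \<forall>T f g t p. smper T f \<longrightarrow> smper T g \<longrightarrow> t \<in> {0..T} \<longrightarrow> p \<le> 3 \<longrightarrow>
    L2n (\<lambda>x. B (f t x) (g t x)) \<le> C * (hn T p f t * hn T (3 - p) g t)"
proof -
  interpret bounded_bilinear B by (rule B)
  obtain K where K: "K > 0" "\<And>a b. norm (B a b) \<le> norm a * norm b * K" using pos_bounded by blast
  have "L2n (\<lambda>x. B (f t x) (g t x)) \<le> 3 * K * (hn T p f t * hn T (3 - p) g t)"
    if f: "smper T f" and g: "smper T g" and t: "t \<in> {0..T}" and p: "p \<le> 3" for T f g t p
  proof -
    let ?h = "hn T p f t * hn T (3 - p) g t"
    have "L2sq (\<lambda>x. B (f t x) (g t x)) \<le> mean (\<lambda>x. K\<^sup>2 * (nsq f t x * nsq g t x))"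
      unfolding L2sq_def
    proof (rule mean_mono)
      show "cper (\<lambda>x. (norm (B (f t x) (g t x)))\<^sup>2)"
        using smper_cper[OF smper_bilinear[OF B f g] t] by (intro cper_intros)
      show "cper (\<lambda>x. K\<^sup>2 * (nsq f t x * nsq g t x))"
        by (intro cper_intros cper_nsq[OF _ t] f g)
      show "(norm (B (f t x) (g t x)))\<^sup>2 \<le> K\<^sup>2 * (nsq f t x * nsq g t x)" for x
        using power_mono[OF K(2)[of "f t x" "g t x"], of 2] by (simp add: nsq_def power_mult_distrib mult_ac)
    qed
    also have "\<dots> = K\<^sup>2 * mean (\<lambda>x. nsq f t x * nsq g t x)" by simp
    also have "\<dots> \<le> K\<^sup>2 * (8 * ?h\<^sup>2)"
      by (intro mult_left_mono mean_nsq_prod_le f g t p) simp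
    also have "\<dots> \<le> (3 * K * ?h)\<^sup>2" by (simp add: power_mult_distrib mult_right_mono)
    finally have "L2n (\<lambda>x. B (f t x) (g t x)) \<le> sqrt ((3 * K * ?h)\<^sup>2)"
      unfolding L2n_def by (rule real_sqrt_le_mono)
    then show ?thesis using K by simp
  qed
  then show ?thesis using K by (intro exI[of _ "3 * K"]) auto
qed

lemma L2n_pders_bilinear:
  fixes B :: "'a::euclidean_space \<Rightarrow> 'b::euclidean_space \<Rightarrow> 'c::euclidean_space"
  assumes B: "bounded_bilinear B" and t: "t \<in> {0..T}"
  shows "smper T f \<Longrightarrow> smper T g \<Longrightarrow> set ds \<subseteq> range Dx \<Longrightarrow>
    (\<And>d1 d2. set d1 \<subseteq> range Dx \<Longrightarrow> set d2 \<subseteq> range Dx \<Longrightarrow> length d1 + length d2 = length ds \<Longrightarrow>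
      L2n (\<lambda>x. B (pders T d1 f t x) (pders T d2 g t x)) \<le> R) \<Longrightarrow>
    L2n (pders T ds (\<lambda>t x. B (f t x) (g t x)) t) \<le> 2 ^ length ds * R"
proof (induction ds arbitrary: f g rule: rev_induct)
  case Nil
  then show ?case using Nil(4)[of "[]" "[]"] by simp
next
  case (snoc d ds)
  let ?p = "\<lambda>t x. B (f t x) (pder T d g t x)" and ?q = "\<lambda>t x. B (pder T d f t x) (g t x)"
  have d: "d \<in> range Dx" using snoc by simp
  note sm = smper_pder[OF snoc(2)] smper_pder[OF snoc(3)] snoc(2,3)
  have "L2n (pders T ds ?p t) \<le> 2 ^ length ds * R"
    using d snoc(4) snoc(5)[of _ "_ @ [d]"] by (intro snoc.IH sm) (auto simp: pders_append)
  moreover have "L2n (pders T ds ?q t) \<le> 2 ^ length ds * R"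
    using d snoc(4) snoc(5)[of "_ @ [d]"] by (intro snoc.IH sm) (auto simp: pders_append)
  moreover have "pders T (ds @ [d]) (\<lambda>t x. B (f t x) (g t x)) t = (\<lambda>x. pders T ds ?p t x + pders T ds ?q t x)"
    by (rule eqT_fun[OF pders_bilinear_snoc[OF B snoc(2,3)] t])
  moreover have "L2n (\<lambda>x. pders T ds ?p t x + pders T ds ?q t x) \<le> L2n (pders T ds ?p t) + L2n (pders T ds ?q t)"
    by (intro L2n_triangle smper_cper[OF _ t] smper_pders smper_bilinear[OF B] sm)
  ultimately show ?case by simp
qed

lemma L2n_bilinear_orders:
  fixes B :: "'a::euclidean_space \<Rightarrow> 'b::euclidean_space \<Rightarrow> 'c::euclidean_space"
  assumes B: "bounded_bilinear B"
  shows "\<exists>C\<ge>0. \<forall>T f g t d1 d2 a b. smper T f \<longrightarrow> smper T g \<longrightarrow> t \<in> {0..T} \<longrightarrow>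
    set d1 \<subseteq> range Dx \<longrightarrow> set d2 \<subseteq> range Dx \<longrightarrow> length d1 \<le> a \<longrightarrow> length d2 \<le> b \<longrightarrow>
    length d1 + length d2 + 3 \<le> a + b \<longrightarrow>
    L2n (\<lambda>x. B (pders T d1 f t x) (pders T d2 g t x)) \<le> C * (hn T a f t * hn T b g t)"
proof -
  obtain C where C: "C \<ge> 0" "\<And>T f g t p. smper T f \<Longrightarrow> smper T g \<Longrightarrow> t \<in> {0..T} \<Longrightarrow> p \<le> 3 \<Longrightarrow>
    L2n (\<lambda>x. B (f t x) (g t x)) \<le> C * (hn T p f t * hn T (3 - p) g t)"
    using L2n_bilinear[OF B] by blast
  have "L2n (\<lambda>x. B (pders T d1 f t x) (pders T d2 g t x)) \<le> C * (hn T a f t * hn T b g t)"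
    if f: "smper T f" and g: "smper T g" and t: "t \<in> {0..T}" and d: "set d1 \<subseteq> range Dx" "set d2 \<subseteq> range Dx"
      and l: "length d1 \<le> a" "length d2 \<le> b" "length d1 + length d2 + 3 \<le> a + b" for T f g t d1 d2 a b
  proof -
    define p where "p = min 3 (a - length d1)"
    have p: "p \<le> 3" "p + length d1 \<le> a" "3 - p + length d2 \<le> b"
      using l by (auto simp: p_def min_def split: if_splits)
    have "L2n (\<lambda>x. B (pders T d1 f t x) (pders T d2 g t x)) \<le> C * (hn T p (pders T d1 f) t * hn T (3 - p) (pders T d2 g) t)"
      by (intro C(2) smper_pders f g t p)
    also have "\<dots> \<le> C * (hn T a f t * hn T b g t)"
      using hn_pders[OF d(1), of T p f t] hn_pders[OF d(2), of T "3-p" g t]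
        hn_mono[OF p(2), of T f t] hn_mono[OF p(3), of T g t]
      by (intro mult_left_mono mult_mono C) auto
    finally show ?thesis .
  qed
  then show ?thesis using C(1) by (intro exI[of _ C]) auto
qed

theorem product_tame:
  fixes B :: "'a::euclidean_space \<Rightarrow> 'b::euclidean_space \<Rightarrow> 'c::euclidean_space"
  assumes B: "bounded_bilinear B"
    and cov: "\<And>j. j \<le> n \<Longrightarrow> (j \<le> a1 \<and> n - j \<le> b1) \<or> (j \<le> a2 \<and> n - j \<le> b2)"
    and ab: "n + 3 \<le> a1 + b1" "n + 3 \<le> a2 + b2"
  shows "\<exists>C\<ge>0. \<forall>T f g t. smper T f \<longrightarrow> smper T g \<longrightarrow> t \<in> {0..T} \<longrightarrow>
    hn T n (\<lambda>t x. B (f t x) (g t x)) t \<le> C * (hn T a1 f t * hn T b1 g t + hn T a2 f t * hn T b2 g t)"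
proof -
  obtain C where C: "C \<ge> 0" "\<And>T f g t d1 d2 a b. smper T f \<Longrightarrow> smper T g \<Longrightarrow> t \<in> {0..T} \<Longrightarrow>
    set d1 \<subseteq> range Dx \<Longrightarrow> set d2 \<subseteq> range Dx \<Longrightarrow> length d1 \<le> a \<Longrightarrow> length d2 \<le> b \<Longrightarrow>
    length d1 + length d2 + 3 \<le> a + b \<Longrightarrow>
    L2n (\<lambda>x. B (pders T d1 f t x) (pders T d2 g t x)) \<le> C * (hn T a f t * hn T b g t)"
    using L2n_bilinear_orders[OF B] by (elim exE conjE) (rule that, assumption, simp)
  have "hn T n (\<lambda>t x. B (f t x) (g t x)) t \<le> (real (card (SL n)) * 2 ^ n * C) * (hn T a1 f t * hn T b1 g t + hn T a2 f t * hn T b2 g t)"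
    if f: "smper T f" and g: "smper T g" and t: "t \<in> {0..T}" for T f g t
  proof -
    let ?R = "C * (hn T a1 f t * hn T b1 g t + hn T a2 f t * hn T b2 g t)"
    have R: "0 \<le> ?R" using C by simp
    have "L2n (pders T ds (\<lambda>t x. B (f t x) (g t x)) t) \<le> 2 ^ n * ?R" if ds: "ds \<in> SL n" for ds
    proof -
      have "L2n (pders T ds (\<lambda>t x. B (f t x) (g t x)) t) \<le> 2 ^ length ds * ?R"
      proof (rule L2n_pders_bilinear[OF B t f g])
        show "set ds \<subseteq> range Dx" using ds by (simp add: SL_def)
        fix d1 d2 assume d: "set d1 \<subseteq> range Dx" "set d2 \<subseteq> range Dx" "length d1 + length d2 = length ds"
        then have len: "length d1 + length d2 \<le> n" using ds by (simp add: SL_def)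
        consider "length d1 \<le> a1" "length d2 \<le> b1" | "length d1 \<le> a2" "length d2 \<le> b2"
          using cov[of "length d1"] len by linarith
        then show "L2n (\<lambda>x. B (pders T d1 f t x) (pders T d2 g t x)) \<le> ?R"
        proof cases
          case 1
          have "L2n (\<lambda>x. B (pders T d1 f t x) (pders T d2 g t x)) \<le> C * (hn T a1 f t * hn T b1 g t)"
            using 1 len ab by (intro C(2) f g t d) auto
          also have "\<dots> \<le> ?R" using C by (intro mult_left_mono) auto
          finally show ?thesis .
        next
          case 2
          have "L2n (\<lambda>x. B (pders T d1 f t x) (pders T d2 g t x)) \<le> C * (hn T a2 f t * hn T b2 g t)"
            using 2 len ab by (intro C(2) f g t d) auto
          also have "\<dots> \<le> ?R" using C by (intro mult_left_mono) auto
          finally show ?thesis .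
        qed
      qed
      also have "\<dots> \<le> 2 ^ n * ?R"
        using ds R by (intro mult_right_mono power_increasing) (auto simp: SL_def)
      finally show ?thesis .
    qed
    then have "hn T n (\<lambda>t x. B (f t x) (g t x)) t \<le> real (card (SL n)) * (2 ^ n * ?R)"
      unfolding hn_def by (rule sum_bounded_above)
    then show ?thesis by (simp add: mult_ac)
  qed
  then show ?thesis using C(1) by (intro exI[of _ "real (card (SL n)) * 2 ^ n * C"]) auto
qed

subsection \<open>The transport term\<close>

lemma bounded_bilinear_component_scaleR:
  "bounded_bilinear (\<lambda>(w::real^3) (v::'a::euclidean_space). w $ i *\<^sub>R v)"
  by (rule bounded_bilinear.comp1[OF bounded_bilinear_scaleR bounded_linear_vec_nth])

lemma smper_conv: "smper T u \<Longrightarrow> smper T v \<Longrightarrow> smper T (conv T u v)"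
  for v :: "real \<Rightarrow> real^3 \<Rightarrow> 'a::euclidean_space"
  unfolding conv_def[abs_def]
  by (rule smper_sum, simp add: smper_def[of T u])
     (rule smper_bilinear[OF bounded_bilinear_component_scaleR _ smper_pder])

lemma hn_conv_le:
  fixes v :: "real \<Rightarrow> real^3 \<Rightarrow> 'a::euclidean_space"
  assumes "smper T u" "smper T v" "t \<in> {0..T}"
  shows "hn T n (conv T u v) t \<le> (\<Sum>i\<in>UNIV. hn T n (\<lambda>t x. u t x $ i *\<^sub>R pder T (Dx i) v t x) t)"
  unfolding conv_def[abs_def]
  by (intro hn_sum smper_bilinear[OF bounded_bilinear_component_scaleR] smper_pder assms)
     (use assms in \<open>auto simp: smper_def\<close>)

theorem conv_tame:
  assumes cov: "\<And>j. j \<le> n \<Longrightarrow> (j \<le> a1 \<and> Suc (n - j) \<le> b1) \<or> (j \<le> a2 \<and> Suc (n - j) \<le> b2)"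
    and ab: "n + 4 \<le> a1 + b1" "n + 4 \<le> a2 + b2" and b: "1 \<le> b1" "1 \<le> b2"
  shows "\<exists>C\<ge>0. \<forall>T u (v :: real \<Rightarrow> real^3 \<Rightarrow> 'a::euclidean_space) t. smper T u \<longrightarrow> smper T v \<longrightarrow> t \<in> {0..T} \<longrightarrow>
    hn T n (conv T u v) t \<le> C * (hn T a1 u t * hn T b1 v t + hn T a2 u t * hn T b2 v t)"
proof -
  have "\<exists>C. \<forall>i::3. C i \<ge> 0 \<and> (\<forall>T u (v :: real \<Rightarrow> real^3 \<Rightarrow> 'a) t. smper T u \<longrightarrow> smper T v \<longrightarrow> t \<in> {0..T} \<longrightarrow>
    hn T n (\<lambda>t x. u t x $ i *\<^sub>R v t x) t \<le> C i * (hn T a1 u t * hn T (b1 - 1) v t + hn T a2 u t * hn T (b2 - 1) v t))"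
  proof (intro choice allI)
    fix i :: 3
    have cov': "(j \<le> a1 \<and> n - j \<le> b1 - 1) \<or> (j \<le> a2 \<and> n - j \<le> b2 - 1)" if "j \<le> n" for j
      using cov[OF that] by linarith
    show "\<exists>C\<ge>0. \<forall>T u (v :: real \<Rightarrow> real^3 \<Rightarrow> 'a) t. smper T u \<longrightarrow> smper T v \<longrightarrow> t \<in> {0..T} \<longrightarrow>
      hn T n (\<lambda>t x. u t x $ i *\<^sub>R v t x) t \<le> C * (hn T a1 u t * hn T (b1 - 1) v t + hn T a2 u t * hn T (b2 - 1) v t)"
      by (rule product_tame[OF bounded_bilinear_component_scaleR cov']) (use ab b in auto)
  qed
  then obtain C where C: "\<And>i::3. C i \<ge> 0" "\<And>i T u (v :: real \<Rightarrow> real^3 \<Rightarrow> 'a) t. smper T u \<Longrightarrow> smper T v \<Longrightarrow> t \<in> {0..T} \<Longrightarrow>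
    hn T n (\<lambda>t x. u t x $ i *\<^sub>R v t x) t \<le> C i * (hn T a1 u t * hn T (b1 - 1) v t + hn T a2 u t * hn T (b2 - 1) v t)"
    apply (elim exE)
    subgoal for C by (rule that[of C]) auto
    done
  have "hn T n (conv T u v) t \<le> (\<Sum>i\<in>UNIV. C i) * (hn T a1 u t * hn T b1 v t + hn T a2 u t * hn T b2 v t)"
    if u: "smper T u" and v: "smper T v" and t: "t \<in> {0..T}" for T u t and v :: "real \<Rightarrow> real^3 \<Rightarrow> 'a"
  proof -
    have "hn T n (conv T u v) t \<le> (\<Sum>i\<in>UNIV. hn T n (\<lambda>t x. u t x $ i *\<^sub>R pder T (Dx i) v t x) t)"
      by (rule hn_conv_le[OF u v t])
    also have "\<dots> \<le> (\<Sum>i\<in>UNIV. C i * (hn T a1 u t * hn T b1 v t + hn T a2 u t * hn T b2 v t))"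
    proof (rule sum_mono)
      fix i :: 3
      have "hn T n (\<lambda>t x. u t x $ i *\<^sub>R pder T (Dx i) v t x) t
        \<le> C i * (hn T a1 u t * hn T (b1 - 1) (pder T (Dx i) v) t + hn T a2 u t * hn T (b2 - 1) (pder T (Dx i) v) t)"
        by (intro C u smper_pder v t)
      also have "\<dots> \<le> C i * (hn T a1 u t * hn T b1 v t + hn T a2 u t * hn T b2 v t)"
        using hn_pder[of T "b1 - 1" i v t] hn_pder[of T "b2 - 1" i v t] b
        by (intro mult_left_mono add_mono C) auto
      finally show "hn T n (\<lambda>t x. u t x $ i *\<^sub>R pder T (Dx i) v t x) t
        \<le> C i * (hn T a1 u t * hn T b1 v t + hn T a2 u t * hn T b2 v t)" .
    qed
    finally show ?thesis by (simp add: sum_distrib_right)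
  qed
  then show ?thesis using C(1) by (intro exI[of _ "\<Sum>i\<in>UNIV. C i"]) (auto intro: sum_nonneg)
qed

lemma pder_conv:
  fixes v :: "real \<Rightarrow> real^3 \<Rightarrow> 'a::euclidean_space"
  assumes u: "smper T u" and v: "smper T v"
  shows "eqT T (pder T d (conv T u v)) (\<lambda>t x. conv T (pder T d u) v t x + conv T u (pder T d v) t x)"
proof -
  let ?B = "\<lambda>i (w::real^3) (v::'a). w $ i *\<^sub>R v"
  have T: "T > 0" using u by (simp add: smper_def)
  note bb = bounded_bilinear_component_scaleR
  have 1: "eqT T (pder T d (\<lambda>t x. u t x $ i *\<^sub>R pder T (Dx i) v t x))
     (\<lambda>t x. u t x $ i *\<^sub>R pder T (Dx i) (pder T d v) t x + pder T d u t x $ i *\<^sub>R pder T (Dx i) v t x)" for i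
    using pder_bilinear[OF bb[of i] T, of u "pder T (Dx i) v" d] pder_commute[OF v, of d "Dx i"]
      u smper_pder[OF v, of "Dx i"] by (simp add: smper_def eqT_def)
  have "eqT T (pders T [d] (\<lambda>t x. \<Sum>i\<in>UNIV. u t x $ i *\<^sub>R pder T (Dx i) v t x))
     (\<lambda>t x. \<Sum>i\<in>UNIV. pders T [d] (\<lambda>t x. u t x $ i *\<^sub>R pder T (Dx i) v t x) t x)"
    by (rule pders_sum) (auto intro!: smper_bilinear[OF bb] smper_pder u v T)
  then show ?thesis using 1
    by (simp add: eqT_def conv_def[abs_def] sum.distrib add.commute)
qed

definition comm :: "real \<Rightarrow> dirn list \<Rightarrow> (real \<Rightarrow> real^3 \<Rightarrow> real^3) \<Rightarrow> (real \<Rightarrow> real^3 \<Rightarrow> 'a::euclidean_space) \<Rightarrow>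
    real \<Rightarrow> real^3 \<Rightarrow> 'a" where
  "comm T ds u v = (\<lambda>t x. pders T ds (conv T u v) t x - conv T u (pders T ds v) t x)"

lemma smper_comm: "smper T u \<Longrightarrow> smper T v \<Longrightarrow> smper T (comm T ds u v)"
  unfolding comm_def by (intro smper_diff smper_pders smper_conv)

lemma comm_snoc:
  assumes u: "smper T u" and v: "smper T v"
  shows "eqT T (comm T (ds @ [d]) u v) (\<lambda>t x. pders T ds (conv T (pder T d u) v) t x + comm T ds u (pder T d v) t x)"
proof -
  have "eqT T (pders T ds (pder T d (conv T u v)))
      (pders T ds (\<lambda>t x. conv T (pder T d u) v t x + conv T u (pder T d v) t x))"
    by (rule pders_cong[OF pder_conv[OF u v]])
  also have "eqT T \<dots> (\<lambda>t x. pders T ds (conv T (pder T d u) v) t x + pders T ds (conv T u (pder T d v)) t x)"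
    by (intro pders_add smper_conv smper_pder u v)
  finally show ?thesis by (simp add: eqT_def comm_def pders_append)
qed

lemma L2n_pders_comm:
  fixes v :: "real \<Rightarrow> real^3 \<Rightarrow> 'a::euclidean_space"
  assumes u: "smper T u" and t: "t \<in> {0..T}" and es: "set es \<subseteq> range Dx"
  shows "smper T v \<Longrightarrow> set ds \<subseteq> range Dx \<Longrightarrow>
    (\<And>i d1 d2. set d1 \<subseteq> range Dx \<Longrightarrow> set d2 \<subseteq> range Dx \<Longrightarrow> d1 \<noteq> [] \<Longrightarrow> length d1 + length d2 = length es + length ds \<Longrightarrow>
      L2n (\<lambda>x. pders T d1 u t x $ i *\<^sub>R pders T d2 (pder T (Dx i) v) t x) \<le> R) \<Longrightarrow>
    L2n (pders T es (comm T ds u v) t) \<le> real (length ds) * (3 * 2 ^ (length es + length ds) * R)"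
proof (induction ds arbitrary: v rule: rev_induct)
  case Nil
  have "comm T [] u v = (\<lambda>t x. 0)" by (simp add: comm_def)
  moreover have "pders T es (\<lambda>t x. 0::'a) t = (\<lambda>x. 0)"
    using eqT_fun[OF pders_sum[of "{}" T "\<lambda>_ t x. 0" es] t] u by (simp add: smper_def)
  ultimately show ?case by (simp add: L2n_def L2sq_def)
next
  case (snoc d ds)
  note bb = bounded_bilinear_component_scaleR
  have d: "d \<in> range Dx" using snoc by simp
  have T: "T > 0" using u by (simp add: smper_def)
  let ?n = "length es + length ds"
  have "L2n (\<lambda>x. pders T [d] u t x $ 1 *\<^sub>R pders T (es @ ds) (pder T (Dx 1) v) t x) \<le> R"
    using d es snoc(3) by (intro snoc(4)) auto
  then have R: "0 \<le> R" using L2n_nonneg order_trans by blast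
  have 1: "L2n (pders T (es @ ds) (conv T (pder T d u) v) t) \<le> 3 * 2 ^ ?n * R"
  proof -
    let ?c = "\<lambda>i t x. pder T d u t x $ i *\<^sub>R pder T (Dx i) v t x"
    have c: "smper T (?c i)" for i
      by (intro smper_bilinear[OF bb] smper_pder u snoc(2))
    have "L2n (pders T (es @ ds) (?c i) t) \<le> 2 ^ length (es @ ds) * R" for i
    proof (rule L2n_pders_bilinear[OF bb t])
      fix d1 d2 assume d12: "set d1 \<subseteq> range Dx" "set d2 \<subseteq> range Dx" "length d1 + length d2 = length (es @ ds)"
      show "L2n (\<lambda>x. pders T d1 (pder T d u) t x $ i *\<^sub>R pders T d2 (pder T (Dx i) v) t x) \<le> R"
        using snoc(4)[of "d1 @ [d]" d2 i] d12 d by (simp add: pders_append)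
    qed (use es snoc(3) u snoc(2) smper_pder in auto)
    then have b: "L2n (pders T (es @ ds) (?c i) t) \<le> 2 ^ ?n * R" for i by simp
    have "pders T (es @ ds) (conv T (pder T d u) v) t = (\<lambda>x. \<Sum>i\<in>UNIV. pders T (es @ ds) (?c i) t x)"
      unfolding conv_def[abs_def] by (rule eqT_fun[OF pders_sum t]) (auto intro: T c)
    moreover have "L2n (\<lambda>x. (pders T (es @ ds) (?c 1) t x + pders T (es @ ds) (?c 2) t x) + pders T (es @ ds) (?c 3) t x)
       \<le> (L2n (pders T (es @ ds) (?c 1) t) + L2n (pders T (es @ ds) (?c 2) t)) + L2n (pders T (es @ ds) (?c 3) t)"
      by (intro order_trans[OF L2n_triangle add_right_mono[OF L2n_triangle]] cper_add smper_cper[OF _ t] smper_pders c)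
    ultimately show ?thesis using b[of 1] b[of 2] b[of 3] by (simp add: sum_3)
  qed
  have 2: "L2n (pders T es (comm T ds u (pder T d v)) t) \<le> real (length ds) * (3 * 2 ^ ?n * R)"
  proof (rule snoc.IH[OF smper_pder[OF snoc(2)]])
    show "set ds \<subseteq> range Dx" using snoc(3) by simp
    fix i d1 d2 assume d12: "set d1 \<subseteq> range Dx" "set d2 \<subseteq> range Dx" "d1 \<noteq> []" "length d1 + length d2 = length es + length ds"
    have "pders T d2 (pder T (Dx i) (pder T d v)) t = pders T d2 (pder T d (pder T (Dx i) v)) t"
      by (rule eqT_fun[OF pders_cong[OF pder_commute[OF snoc(2)]] t])
    then show "L2n (\<lambda>x. pders T d1 u t x $ i *\<^sub>R pders T d2 (pder T (Dx i) (pder T d v)) t x) \<le> R"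
      using snoc(4)[of d1 "d2 @ [d]" i] d12 d by (simp add: pders_append)
  qed
  have "pders T es (comm T (ds @ [d]) u v) t = (\<lambda>x. pders T (es @ ds) (conv T (pder T d u) v) t x + pders T es (comm T ds u (pder T d v)) t x)"
  proof -
    have "eqT T (pders T es (comm T (ds @ [d]) u v)) (pders T es (\<lambda>t x. pders T ds (conv T (pder T d u) v) t x + comm T ds u (pder T d v) t x))"
      by (rule pders_cong[OF comm_snoc[OF u snoc(2)]])
    also have "eqT T \<dots> (\<lambda>t x. pders T es (pders T ds (conv T (pder T d u) v)) t x + pders T es (comm T ds u (pder T d v)) t x)"
      by (intro pders_add smper_pders smper_conv smper_comm smper_pder u snoc(2))
    finally show ?thesis using t by (auto simp: eqT_def pders_append)
  qed
  then have "L2n (pders T es (comm T (ds @ [d]) u v) t) \<le> 3 * 2 ^ ?n * R + real (length ds) * (3 * 2 ^ ?n * R)"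
    using L2n_triangle[of "pders T (es @ ds) (conv T (pder T d u) v) t" "pders T es (comm T ds u (pder T d v)) t"] 1 2
    by (simp add: smper_cper[OF _ t] smper_pders smper_conv smper_comm smper_pder u snoc(2))
  also have "\<dots> = real (length (ds @ [d])) * (3 * 2 ^ ?n * R)" by (simp add: algebra_simps)
  also have "\<dots> \<le> real (length (ds @ [d])) * (3 * 2 ^ (length es + length (ds @ [d])) * R)"
    using R by (intro mult_left_mono mult_right_mono power_increasing) auto
  finally show ?case .
qed

theorem comm_tame:
  assumes cov: "\<And>j. 1 \<le> j \<Longrightarrow> j \<le> n \<Longrightarrow> (j \<le> a1 \<and> Suc n - j \<le> b1) \<or> (j \<le> a2 \<and> Suc n - j \<le> b2)"
    and ab: "n + 4 \<le> a1 + b1" "n + 4 \<le> a2 + b2" and b: "1 \<le> b1" "1 \<le> b2"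
  shows "\<exists>C\<ge>0. \<forall>T u (v :: real \<Rightarrow> real^3 \<Rightarrow> 'a::euclidean_space) t es ds. smper T u \<longrightarrow> smper T v \<longrightarrow> t \<in> {0..T} \<longrightarrow>
    set es \<subseteq> range Dx \<longrightarrow> set ds \<subseteq> range Dx \<longrightarrow> length es + length ds \<le> n \<longrightarrow>
    L2n (pders T es (comm T ds u v) t) \<le> C * (hn T a1 u t * hn T b1 v t + hn T a2 u t * hn T b2 v t)"
proof -
  have "\<exists>C. \<forall>i::3. C i \<ge> 0 \<and> (\<forall>T u (v :: real \<Rightarrow> real^3 \<Rightarrow> 'a) t d1 d2 a b. smper T u \<longrightarrow> smper T v \<longrightarrow> t \<in> {0..T} \<longrightarrow>
    set d1 \<subseteq> range Dx \<longrightarrow> set d2 \<subseteq> range Dx \<longrightarrow> length d1 \<le> a \<longrightarrow> length d2 \<le> b \<longrightarrow>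
    length d1 + length d2 + 3 \<le> a + b \<longrightarrow>
    L2n (\<lambda>x. pders T d1 u t x $ i *\<^sub>R pders T d2 v t x) \<le> C i * (hn T a u t * hn T b v t))"
    by (intro choice allI L2n_bilinear_orders bounded_bilinear_component_scaleR)
  then obtain C where C: "\<And>i::3. C i \<ge> 0" "\<And>i T u (v :: real \<Rightarrow> real^3 \<Rightarrow> 'a) t d1 d2 a b. smper T u \<Longrightarrow> smper T v \<Longrightarrow> t \<in> {0..T} \<Longrightarrow>
    set d1 \<subseteq> range Dx \<Longrightarrow> set d2 \<subseteq> range Dx \<Longrightarrow> length d1 \<le> a \<Longrightarrow> length d2 \<le> b \<Longrightarrow>
    length d1 + length d2 + 3 \<le> a + b \<Longrightarrow>
    L2n (\<lambda>x. pders T d1 u t x $ i *\<^sub>R pders T d2 v t x) \<le> C i * (hn T a u t * hn T b v t)"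
    apply (elim exE)
    subgoal for C by (rule that[of C]) auto
    done
  define D where "D = (\<Sum>i\<in>UNIV. C i)"
  have CD: "C i \<le> D" for i unfolding D_def by (rule member_le_sum) (auto simp: C)
  have D: "0 \<le> D" using C(1)[of 1] CD[of 1] by linarith
  have "L2n (pders T es (comm T ds u v) t) \<le> (real n * (3 * 2 ^ n * D)) * (hn T a1 u t * hn T b1 v t + hn T a2 u t * hn T b2 v t)"
    if u: "smper T u" and v: "smper T v" and t: "t \<in> {0..T}" and es: "set es \<subseteq> range Dx" and ds: "set ds \<subseteq> range Dx"
      and len: "length es + length ds \<le> n"
    for T u t es ds and v :: "real \<Rightarrow> real^3 \<Rightarrow> 'a"
  proof -
    let ?X = "hn T a1 u t * hn T b1 v t + hn T a2 u t * hn T b2 v t"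
    have X: "0 \<le> ?X" by simp
    have "L2n (pders T es (comm T ds u v) t) \<le> real (length ds) * (3 * 2 ^ (length es + length ds) * (D * ?X))"
    proof (rule L2n_pders_comm[OF u t es v ds])
      fix i d1 d2 assume d: "set d1 \<subseteq> range Dx" "set d2 \<subseteq> range Dx" "d1 \<noteq> []" "length d1 + length d2 = length es + length ds"
      have l: "1 \<le> length d1" "length d1 + length d2 \<le> n" using d len by (auto simp: Suc_le_eq)
      have one: "L2n (\<lambda>x. pders T d1 u t x $ i *\<^sub>R pders T d2 (pder T (Dx i) v) t x) \<le> D * (hn T a u t * hn T b v t)"
        if "length d1 \<le> a" "Suc n - length d1 \<le> b" "n + 4 \<le> a + b" for a b
      proof -
        have "L2n (\<lambda>x. pders T d1 u t x $ i *\<^sub>R pders T d2 (pder T (Dx i) v) t x) \<le> C i * (hn T a u t * hn T (b - 1) (pder T (Dx i) v) t)"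
          using that l by (intro C smper_pder u v t d) auto
        also have "\<dots> \<le> D * (hn T a u t * hn T b v t)"
          using hn_pder[of T "b - 1" i v t] that l
          by (intro mult_mono CD D) auto
        finally show ?thesis .
      qed
      consider "length d1 \<le> a1" "Suc n - length d1 \<le> b1" | "length d1 \<le> a2" "Suc n - length d1 \<le> b2"
        using cov[of "length d1"] l by linarith
      then show "L2n (\<lambda>x. pders T d1 u t x $ i *\<^sub>R pders T d2 (pder T (Dx i) v) t x) \<le> D * ?X"
      proof cases
        case 1 show ?thesis
          by (rule order_trans[OF one[OF 1 ab(1)]]) (use D in \<open>intro mult_left_mono, auto\<close>)
      next
        case 2 show ?thesis
          by (rule order_trans[OF one[OF 2 ab(2)]]) (use D in \<open>intro mult_left_mono, auto\<close>)
      qed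
    qed
    also have "\<dots> \<le> real n * (3 * 2 ^ n * (D * ?X))"
      using D X len by (intro mult_mono power_increasing mult_nonneg_nonneg) auto
    finally show ?thesis by (simp add: mult_ac)
  qed
  then show ?thesis using D by (intro exI[of _ "real n * (3 * 2 ^ n * D)"]) auto
qed

lemma divg_component:
  assumes "smper T v" "t \<in> {0..T}"
  shows "pder T (Dx i) (\<lambda>s y. v s y $ j) t x = pder T (Dx i) v t x $ j"
  using assms by (intro eqTD[OF pder_linear[OF bounded_linear_vec_nth]]) (auto simp: smper_def)

lemma ip_conv_zero:
  fixes v :: "real \<Rightarrow> real^3 \<Rightarrow> 'a::euclidean_space"
  assumes u: "smper T u" and v: "smper T v" and t: "t \<in> {0..T}" and div: "\<And>x. divg T u t x = 0"
  shows "ip (conv T u v t) (v t) = 0"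
proof -
  let ?h = "\<lambda>t x. v t x \<bullet> v t x" and ?u = "\<lambda>i t x. u t x $ i"
  have T: "T > 0" using u by (simp add: smper_def)
  have h: "smper T ?h" by (rule smper_bilinear[OF bounded_bilinear_inner v v])
  have ui: "smper T (?u i)" for i by (rule smper_linear[OF bounded_linear_vec_nth u])
  have c: "cper (\<lambda>x. u t x $ i)" "cper (pder T (Dx i) ?h t)" "cper (pder T (Dx i) (?u i) t)" "cper (?h t)" for i
    using smper_cper[OF ui[of i] t] smper_cper[OF smper_pder[OF h] t] smper_cper[OF smper_pder[OF ui] t]
      smper_cper[OF h t] by blast+
  have "2 * ip (conv T u v t) (v t) = mean (\<lambda>x. \<Sum>i\<in>UNIV. u t x $ i * pder T (Dx i) ?h t x)"
  proof -
    have "pder T (Dx i) ?h t x = 2 * (pder T (Dx i) v t x \<bullet> v t x)" for i x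
      using eqTD[OF pder_bilinear[OF bounded_bilinear_inner T, of v v "Dx i"] t, of x] v
      by (simp add: smper_def inner_commute)
    then have "(\<lambda>x. \<Sum>i\<in>UNIV. u t x $ i * pder T (Dx i) ?h t x) = (\<lambda>x. 2 * (conv T u v t x \<bullet> v t x))"
      by (simp add: fun_eq_iff conv_def inner_sum_left sum_distrib_left mult_ac)
    then show ?thesis by (simp add: ip_def)
  qed
  also have "\<dots> = (\<Sum>i\<in>UNIV. ip (?u i t) (pder T (Dx i) ?h t))"
    by (subst integral_sum) (auto intro!: cper_integrable cper_mult c simp: ip_def)
  also have "\<dots> = (\<Sum>i\<in>UNIV. - ip (pder T (Dx i) (?u i) t) (?h t))"
    by (simp add: ip_by_parts[OF ui h t])
  also have "\<dots> = - mean (\<lambda>x. \<Sum>i\<in>UNIV. pder T (Dx i) (?u i) t x * ?h t x)"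
    by (subst integral_sum) (auto intro!: cper_integrable cper_mult c simp: ip_def sum_negf)
  also have "(\<lambda>x. \<Sum>i\<in>UNIV. pder T (Dx i) (?u i) t x * ?h t x) = (\<lambda>x. 0)"
    using div by (simp add: divg_def flip: sum_distrib_right)
  finally show ?thesis by simp
qed


section \<open>Constant coefficient differential operators\<close>

definition lin1 :: "real \<Rightarrow> (3 \<Rightarrow> 'a \<Rightarrow> 'b) \<Rightarrow> (real \<Rightarrow> real^3 \<Rightarrow> 'a::euclidean_space) \<Rightarrow>
    real \<Rightarrow> real^3 \<Rightarrow> 'b::euclidean_space" where
  "lin1 T L f t x = (\<Sum>i\<in>UNIV. L i (pder T (Dx i) f t x))"

lemma smper_pos: "smper T f \<Longrightarrow> T > 0"
  by (simp add: smper_def)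

lemma smper_lin1: "(\<And>i. bounded_linear (L i)) \<Longrightarrow> smper T f \<Longrightarrow> smper T (lin1 T L f)"
  unfolding lin1_def[abs_def]
  by (rule smper_sum, erule smper_pos, rule smper_linear, blast, erule smper_pder)

lemma lin1_cong: "eqT T f g \<Longrightarrow> eqT T (lin1 T L f) (lin1 T L g)"
  using pder_cong[of T f g] by (auto simp: eqT_def lin1_def)

lemma pders_lin1:
  assumes L: "\<And>i. bounded_linear (L i)" and f: "smper T f"
  shows "eqT T (pders T ds (lin1 T L f)) (lin1 T L (pders T ds f))"
proof -
  have "eqT T (pders T ds (\<lambda>t x. \<Sum>i\<in>UNIV. L i (pder T (Dx i) f t x)))
     (\<lambda>t x. \<Sum>i\<in>UNIV. pders T ds (\<lambda>t x. L i (pder T (Dx i) f t x)) t x)"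
    by (rule pders_sum) (auto intro!: smper_linear[OF L] smper_pder f smper_pos[OF f])
  moreover have "eqT T (pders T ds (\<lambda>t x. L i (pder T (Dx i) f t x))) (\<lambda>t x. L i (pder T (Dx i) (pders T ds f) t x))" for i
    using pders_linear[OF L[of i] smper_pder[OF f], of ds "Dx i"] pders_pder_commute[OF f, of ds "Dx i"]
    by (simp add: eqT_def)
  ultimately show ?thesis by (simp add: eqT_def lin1_def[abs_def])
qed

lemma hn_lin1:
  assumes L: "\<And>i. bounded_linear (L i)"
  shows "\<exists>C\<ge>0. \<forall>T f t n. smper T f \<longrightarrow> t \<in> {0..T} \<longrightarrow> hn T n (lin1 T L f) t \<le> C * hn T (Suc n) f t"
proof -
  have "\<exists>C. \<forall>i::3. C i \<ge> 0 \<and> (\<forall>T f t n. smper T f \<longrightarrow> t \<in> {0..T} \<longrightarrow> hn T n (\<lambda>t x. L i (f t x)) t \<le> C i * hn T n f t)"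
    by (intro choice allI hn_linear L)
  then obtain C where C: "\<And>i::3. C i \<ge> 0" "\<And>(i::3) T f t n. smper T f \<Longrightarrow> t \<in> {0..T} \<Longrightarrow> hn T n (\<lambda>t x. L i (f t x)) t \<le> C i * hn T n f t"
    by metis
  have "hn T n (lin1 T L f) t \<le> (\<Sum>i\<in>UNIV. C i) * hn T (Suc n) f t" if f: "smper T f" and t: "t \<in> {0..T}" for T f t n
  proof -
    have "hn T n (lin1 T L f) t \<le> (\<Sum>i\<in>UNIV. hn T n (\<lambda>t x. L i (pder T (Dx i) f t x)) t)"
      unfolding lin1_def[abs_def]
      by (rule hn_sum[OF _ _ t]) (auto intro!: smper_linear[OF L] smper_pder f smper_pos[OF f])
    also have "\<dots> \<le> (\<Sum>i\<in>UNIV. C i * hn T (Suc n) f t)"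
      by (intro sum_mono order_trans[OF C(2)[OF smper_pder[OF f] t]] mult_left_mono C(1) hn_pder)
    finally show ?thesis by (simp add: sum_distrib_right)
  qed
  then show ?thesis using C(1) by (intro exI[of _ "\<Sum>i\<in>UNIV. C i"]) (auto intro: sum_nonneg)
qed

lemma smper_lap: "smper T f \<Longrightarrow> smper T (lap T f)" for f :: "real \<Rightarrow> real^3 \<Rightarrow> 'a::euclidean_space"
  unfolding lap_def[abs_def] by (rule smper_sum, erule smper_pos) (intro smper_pder)

lemma pders_lap:
  fixes f :: "real \<Rightarrow> real^3 \<Rightarrow> 'a::euclidean_space"
  assumes f: "smper T f"
  shows "eqT T (pders T ds (lap T f)) (lap T (pders T ds f))"
proof -
  have 1: "eqT T (pders T ds (\<lambda>t x. \<Sum>i\<in>UNIV. pder T (Dx i) (pder T (Dx i) f) t x))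
     (\<lambda>t x. \<Sum>i\<in>UNIV. pders T ds (pder T (Dx i) (pder T (Dx i) f)) t x)"
    by (rule pders_sum) (auto intro!: smper_pder f smper_pos[OF f])
  have 2: "eqT T (pders T ds (pder T (Dx i) (pder T (Dx i) f))) (pder T (Dx i) (pder T (Dx i) (pders T ds f)))" for i
    using pders_commute[OF f, of ds "[Dx i, Dx i]"] by simp
  show ?thesis using 1 2 by (simp add: eqT_def lap_def[abs_def])
qed

lemma hn_lap:
  fixes f :: "real \<Rightarrow> real^3 \<Rightarrow> 'a::euclidean_space"
  assumes f: "smper T f" and t: "t \<in> {0..T}"
  shows "hn T n (lap T f) t \<le> 3 * hn T (n + 2) f t"
proof -
  have "hn T n (lap T f) t \<le> (\<Sum>i\<in>UNIV. hn T n (pder T (Dx i) (pder T (Dx i) f)) t)"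
    unfolding lap_def[abs_def] by (rule hn_sum[OF _ _ t]) (auto intro!: smper_pder f smper_pos[OF f])
  also have "\<dots> \<le> (\<Sum>i\<in>(UNIV::3 set). hn T (n + 2) f t)"
    using hn_pders[of "[Dx i, Dx i]" T n f t for i] by (intro sum_mono) (auto simp: numeral_2_eq_2)
  finally show ?thesis by simp
qed

lemma ip_sum_left:
  assumes "finite I" "\<And>i. i \<in> I \<Longrightarrow> cper (f i)" "cper g"
  shows "ip (\<lambda>x. \<Sum>i\<in>I. f i x) g = (\<Sum>i\<in>I. ip (f i) g)"
  unfolding ip_def inner_sum_left
  by (intro integral_sum cper_integrable cper_inner assms)

lemma ip_lin1_adjoint:
  assumes L: "\<And>i. bounded_linear (L i)" "\<And>i. bounded_linear (L' i)"
    and adj: "\<And>i a b. L i a \<bullet> b = a \<bullet> L' i b"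
    and f: "smper T f" and g: "smper T g" and t: "t \<in> {0..T}"
  shows "ip (lin1 T L f t) (g t) = - ip (f t) (lin1 T L' g t)"
proof -
  have cL: "cper (\<lambda>x. L i (pder T (Dx i) f t x))" "cper (\<lambda>x. L' i (pder T (Dx i) g t x))" for i
    using smper_cper[OF smper_linear[OF L(1) smper_pder[OF f]] t]
      smper_cper[OF smper_linear[OF L(2) smper_pder[OF g]] t] by blast+
  have "ip (lin1 T L f t) (g t) = (\<Sum>i\<in>UNIV. ip (\<lambda>x. L i (pder T (Dx i) f t x)) (g t))"
    unfolding lin1_def[abs_def] by (intro ip_sum_left cL smper_cper[OF g t]) auto
  also have "\<dots> = (\<Sum>i\<in>UNIV. ip (pder T (Dx i) f t) (\<lambda>x. L' i (g t x)))"
    by (simp add: ip_def adj)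
  also have "\<dots> = (\<Sum>i\<in>UNIV. - ip (f t) (\<lambda>x. L' i (pder T (Dx i) g t x)))"
  proof (rule sum.cong[OF refl])
    fix i
    have "pder T (Dx i) (\<lambda>t x. L' i (g t x)) t = (\<lambda>x. L' i (pder T (Dx i) g t x))"
      using g by (intro eqT_fun[OF pder_linear[OF L(2)] t]) (auto simp: smper_def)
    then show "ip (pder T (Dx i) f t) (\<lambda>x. L' i (g t x)) = - ip (f t) (\<lambda>x. L' i (pder T (Dx i) g t x))"
      using ip_by_parts[OF f smper_linear[OF L(2) g] t, of i i] by simp
  qed
  also have "\<dots> = - (\<Sum>i\<in>UNIV. ip (\<lambda>x. L' i (pder T (Dx i) g t x)) (f t))"
    by (simp add: sum_negf ip_commute[of "f t"])
  also have "(\<Sum>i\<in>UNIV. ip (\<lambda>x. L' i (pder T (Dx i) g t x)) (f t)) = ip (lin1 T L' g t) (f t)"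
    unfolding lin1_def[abs_def] by (intro ip_sum_left[symmetric] cL smper_cper[OF f t]) auto
  finally show ?thesis by (simp add: ip_commute)
qed

lemma ip_lap:
  fixes v :: "real \<Rightarrow> real^3 \<Rightarrow> 'a::euclidean_space"
  assumes v: "smper T v" and t: "t \<in> {0..T}"
  shows "ip (lap T v t) (v t) = - (\<Sum>i\<in>UNIV. L2sq (pder T (Dx i) v t))"
proof -
  have "ip (lap T v t) (v t) = (\<Sum>i\<in>UNIV. ip (pder T (Dx i) (pder T (Dx i) v) t) (v t))"
    unfolding lap_def[abs_def] by (intro ip_sum_left smper_cper[OF _ t] smper_pder v) auto
  then show ?thesis by (simp add: ip_by_parts[OF smper_pder[OF v] v t] L2sq_ip sum_negf)
qed

definition curlL :: "3 \<Rightarrow> real^3 \<Rightarrow> real^3" where "curlL i v = cross3 (axis i 1) v"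
definition divL :: "3 \<Rightarrow> real^3 \<Rightarrow> real" where "divL i v = v $ i"
definition gradL :: "3 \<Rightarrow> real \<Rightarrow> real^3" where "gradL i s = s *\<^sub>R axis i 1"

lemma bilinear_bounded: "bilinear f \<Longrightarrow> bounded_bilinear f"
  for f :: "'a::euclidean_space \<Rightarrow> 'b::euclidean_space \<Rightarrow> 'c::real_normed_vector"
  by (simp add: bilinear_conv_bounded_bilinear)

lemma linear_bounded: "linear f \<Longrightarrow> bounded_linear f"
  for f :: "'a::euclidean_space \<Rightarrow> 'b::real_normed_vector"
  by (simp add: linear_conv_bounded_linear)

lemma bounded_bilinear_cross3: "bounded_bilinear cross3"
  by (rule bilinear_bounded[OF bilinear_cross])

lemma bl_ops [simp]: "bounded_linear (curlL i)" "bounded_linear (divL i)" "bounded_linear (gradL i)"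
  unfolding curlL_def[abs_def] divL_def[abs_def] gradL_def[abs_def]
  by (rule bounded_bilinear.bounded_linear_right[OF bounded_bilinear_cross3]
      bounded_linear_vec_nth bounded_linear_scaleR_left)+

lemma grad_lin1: "grad T p = lin1 T gradL p"
  by (auto simp: fun_eq_iff grad_def lin1_def gradL_def vec_eq_iff axis_def if_distrib cong: if_cong)

lemma divg_lin1: "smper T v \<Longrightarrow> eqT T (divg T v) (lin1 T divL v)"
  by (simp add: eqT_def divg_def lin1_def divL_def divg_component)

lemma curl_lin1: "smper T v \<Longrightarrow> eqT T (curl T v) (lin1 T curlL v)"
  by (simp add: eqT_def curl_def lin1_def curlL_def divg_component Let_def cross3_def sum_3
      vec_eq_iff forall_3 axis_def)

lemma ip_curl:
  assumes "smper T f" "smper T g" "t \<in> {0..T}"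
  shows "ip (lin1 T curlL f t) (g t) = ip (f t) (lin1 T curlL g t)"
proof -
  have bl: "bounded_linear (\<lambda>v. - curlL i v)" for i by (rule bounded_linear_minus[OF bl_ops(1)])
  have "curlL i a \<bullet> b = a \<bullet> - curlL i b" for i a b
    by (simp add: curlL_def cross3_def inner_vec_def sum_3 algebra_simps)
  then have "ip (lin1 T curlL f t) (g t) = - ip (f t) (lin1 T (\<lambda>i v. - curlL i v) g t)"
    by (intro ip_lin1_adjoint bl assms) simp_all
  also have "lin1 T (\<lambda>i v. - curlL i v) g t = (\<lambda>x. - lin1 T curlL g t x)"
    by (simp add: lin1_def[abs_def] sum_negf)
  finally show ?thesis by simp
qed

lemma ip_grad:
  assumes "smper T q" "smper T v" "t \<in> {0..T}"
  shows "ip (lin1 T gradL q t) (v t) = - ip (q t) (lin1 T divL v t)"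
  by (rule ip_lin1_adjoint[OF bl_ops(3) bl_ops(2) _ assms]) (simp add: gradL_def divL_def inner_axis')

lemma curl_div_identity:
  assumes v: "smper T v" and t: "t \<in> {0..T}"
  shows "L2sq (lin1 T curlL v t) + L2sq (lin1 T divL v t) = (\<Sum>i\<in>UNIV. L2sq (pder T (Dx i) v t))"
proof -
  let ?c = "\<lambda>j t x. v t x $ j"
  let ?D = "\<lambda>i j. pder T (Dx i) (?c j)"
  have c: "smper T (?c j)" for j by (rule smper_linear[OF bounded_linear_vec_nth v])
  have cD: "cper (?D i j t)" for i j by (rule smper_cper[OF smper_pder[OF c] t])
  have D: "pder T (Dx i) v t x $ j = ?D i j t x" for i j x using divg_component[OF v t] by simp
  have key: "mean (\<lambda>x. ?D i i t x * ?D j j t x) = mean (\<lambda>x. ?D j i t x * ?D i j t x)" for i j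
  proof -
    have "ip (?D i i t) (?D j j t) = - ip (?c i t) (pder T (Dx i) (?D j j) t)"
      by (rule ip_by_parts[OF c smper_pder[OF c] t])
    also have "pder T (Dx i) (?D j j) t = pder T (Dx j) (?D i j) t"
      by (rule eqT_fun[OF pder_commute[OF c] t])
    also have "- ip (?c i t) (pder T (Dx j) (?D i j) t) = ip (?D j i t) (?D i j t)"
      using ip_by_parts[OF c[of i] smper_pder[OF c[of j], of "Dx i"] t, of j] by simp
    finally show ?thesis by (simp add: ip_def)
  qed
  let ?a = "\<lambda>x. (norm (lin1 T curlL v t x))\<^sup>2" and ?b = "\<lambda>x. (norm (lin1 T divL v t x))\<^sup>2"
  let ?g = "\<lambda>i x. (norm (pder T (Dx i) v t x))\<^sup>2"
  have cab: "cper ?a" "cper ?b" "cper (?g i)" for i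
    by (intro cper_intros smper_cper[OF _ t] smper_lin1 smper_pder v bl_ops)+
  have pt: "?a x + ?b x = (?g 1 x + ?g 2 x + ?g 3 x) + (2 * (?D 1 1 t x * ?D 2 2 t x - ?D 2 1 t x * ?D 1 2 t x)
     + 2 * (?D 1 1 t x * ?D 3 3 t x - ?D 3 1 t x * ?D 1 3 t x) + 2 * (?D 2 2 t x * ?D 3 3 t x - ?D 3 2 t x * ?D 2 3 t x))" for x
    unfolding power2_norm_eq_inner
    by (simp add: lin1_def curlL_def divL_def inner_vec_def sum_3 cross3_def D axis_def algebra_simps)
  have "mean ?a + mean ?b = mean (\<lambda>x. ?a x + ?b x)"
    by (rule mean_add[symmetric]; intro cab)
  also have "\<dots> = mean (?g 1) + mean (?g 2) + mean (?g 3)"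
    unfolding pt using key[of 1 2] key[of 1 3] key[of 2 3]
    by (simp add: mean_add mean_diff cper_intros cab cD)
  finally show ?thesis by (simp add: L2sq_def sum_3)
qed

section \<open>The algebra of the system\<close>

definition com :: "real^3 \<Rightarrow> real^3^3 \<Rightarrow> real^3^3" where
  "com v A = ten v ** A - A ** ten v"

definition pa :: "real^3^3 \<Rightarrow> real^2" where "pa A = vector [A$1$3, A$2$3]"
definition Rv :: "real^2 \<Rightarrow> real^3" where "Rv b = vector [- (b$2), b$1, 0]"
definition perp :: "real^2 \<Rightarrow> real^2" where "perp b = vector [- (b$2), b$1]"
definition hperp :: "real^3 \<Rightarrow> real^2" where "hperp v = vector [- (v$2), v$1]"

lemma aK_pa: "aK K = (\<lambda>t x. pa (K t x))"
  by (simp add: aK_def pa_def fun_eq_iff)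

lemma ten_entry: "ten w = vector [vector [0, - (w$3), w$2], vector [w$3, 0, - (w$1)], vector [- (w$2), w$1, 0]]"
  by (simp add: ten_def matrix_def vec_eq_iff forall_3 cross3_def axis_def)

lemmas mat_simps = vec_eq_iff forall_3 forall_2 sum_3 sum_2 matrix_matrix_mult_def matrix_vector_mult_def
  ten_entry cross3_def Jeq_def inner_vec_def

lemma bounded_bilinear_com: "bounded_bilinear com"
  by (rule bilinear_bounded) (auto simp: bilinear_def com_def mat_simps algebra_simps intro!: linearI)

lemma bounded_bilinear_mv: "bounded_bilinear (\<lambda>(A::real^3^3) (v::real^3). A *v v)"
  by (rule bilinear_bounded) (auto simp: bilinear_def mat_simps algebra_simps intro!: linearI)

lemma bl_pa: "bounded_linear pa"
  by (rule linear_bounded) (auto simp: pa_def mat_simps intro!: linearI)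

lemma bl_Rv: "bounded_linear Rv"
  by (rule linear_bounded) (auto simp: Rv_def mat_simps intro!: linearI)

lemma bl_perp: "bounded_linear perp"
  by (rule linear_bounded) (auto simp: perp_def mat_simps intro!: linearI)

lemma bl_hperp: "bounded_linear hperp"
  by (rule linear_bounded) (auto simp: hperp_def mat_simps intro!: linearI)

lemma com_inner_self: "com w A \<bullet> A = 0"
  by (simp add: com_def mat_simps algebra_simps)

lemma com_axis_Jeq: "com (vector [0, 0, s]) (Jeq lam nu) = 0"
  by (simp add: com_def mat_simps)

lemma pa_com_axis: "pa (com (vector [0, 0, s]) A) = s *\<^sub>R perp (pa A)"
  by (simp add: com_def pa_def perp_def mat_simps)

lemma pa_com_Jeq: "pa (com v (Jeq lam nu)) = - ((nu - lam) *\<^sub>R hperp v)"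
  by (simp add: com_def pa_def hperp_def mat_simps algebra_simps)

lemma cross_axis_mv: "cross3 (vector [0, 0, s]) (A *v vector [0, 0, s]) = s\<^sup>2 *\<^sub>R Rv (pa A)"
  by (simp add: Rv_def pa_def mat_simps power2_eq_square)

lemma cross_axis_Jeq: "cross3 (vector [0, 0, s]) (Jeq lam nu *v vector [0, 0, s]) = 0"
  by (simp add: mat_simps)

definition L0 :: "real \<Rightarrow> real \<Rightarrow> real \<Rightarrow> real^3 \<Rightarrow> real^3" where
  "L0 s lam nu v = cross3 (vector [0, 0, s]) (Jeq lam nu *v v) + cross3 v (Jeq lam nu *v vector [0, 0, s])"

lemma bl_L0: "bounded_linear (L0 s lam nu)"
  by (rule linear_bounded) (auto simp: L0_def mat_simps algebra_simps intro!: linearI)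

lemma L0_inner_self: "L0 s lam nu v \<bullet> v = 0"
  by (simp add: L0_def mat_simps algebra_simps)

lemma bl_Jeq: "bounded_linear (\<lambda>v. Jeq lam nu *v v)"
  by (rule linear_bounded) (auto simp: mat_simps algebra_simps intro!: linearI)

lemma Jeq_inner_bounds:
  assumes "0 < lam" "lam < nu"
  shows "lam * (norm v)\<^sup>2 \<le> (Jeq lam nu *v v) \<bullet> v" "(Jeq lam nu *v v) \<bullet> v \<le> nu * (norm v)\<^sup>2"
proof -
  have "(Jeq lam nu *v v) \<bullet> v = lam * (v$1)\<^sup>2 + lam * (v$2)\<^sup>2 + nu * (v$3)\<^sup>2"
    by (simp add: mat_simps power2_eq_square)
  moreover have "(norm v)\<^sup>2 = (v$1)\<^sup>2 + (v$2)\<^sup>2 + (v$3)\<^sup>2"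
    unfolding power2_norm_eq_inner by (simp add: inner_vec_def sum_3 power2_eq_square)
  moreover have "lam * (v$1)\<^sup>2 \<le> nu * (v$1)\<^sup>2" "lam * (v$2)\<^sup>2 \<le> nu * (v$2)\<^sup>2" "lam * (v$3)\<^sup>2 \<le> nu * (v$3)\<^sup>2"
    using assms by (auto intro!: mult_right_mono)
  ultimately show "lam * (norm v)\<^sup>2 \<le> (Jeq lam nu *v v) \<bullet> v" "(Jeq lam nu *v v) \<bullet> v \<le> nu * (norm v)\<^sup>2"
    by (simp_all add: distrib_left)
qed

lemma Jeq_inner_sym: "(Jeq lam nu *v v) \<bullet> w = v \<bullet> (Jeq lam nu *v w)"
  by (simp add: mat_simps)

lemma Jeq_inverse:
  assumes "0 < lam" "lam < nu"
  shows "Jeq (1 / lam) (1 / nu) *v (Jeq lam nu *v v) = v"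
  using assms by (simp add: mat_simps)

lemma perp_inner_self: "perp b \<bullet> b = 0"
  by (simp add: perp_def mat_simps)

lemma hperp_inner: "b \<bullet> hperp v = - (v \<bullet> Rv b)"
  by (simp add: hperp_def Rv_def mat_simps)

lemma norm_Rv: "norm (Rv b) = norm b"
  by (simp add: norm_eq_sqrt_inner Rv_def mat_simps)

text \<open>Here \<^term>\<open>ft + g\<close> stands for the material derivative of the angular velocity.\<close>

lemma momentum_expand:
  assumes "(Jeq lam nu + K) *v (ft + g) + cross3 (w + th) ((Jeq lam nu + K) *v (w + th)) = r"
    and w: "w = vector [0, 0, s]"
  shows "Jeq lam nu *v ft = r - L0 s lam nu th - s\<^sup>2 *\<^sub>R Rv (pa K)
     - (K *v (ft + g) + Jeq lam nu *v g + cross3 w (K *v th) + cross3 th (K *v w)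
        + cross3 th (Jeq lam nu *v th) + cross3 th (K *v th))"
proof -
  interpret c: bounded_bilinear cross3 by (rule bounded_bilinear_cross3)
  interpret m: bounded_bilinear "\<lambda>(A::real^3^3) (v::real^3). A *v v" by (rule bounded_bilinear_mv)
  show ?thesis
    unfolding assms(1)[symmetric] L0_def
    using cross_axis_mv[of s K] cross_axis_Jeq[of s lam nu]
    by (simp add: w m.add_left m.add_right c.add_left c.add_right)
qed


section \<open>Comparison with the multi-index norms\<close>

lemma SL_mset:
  assumes "set ds \<subseteq> range Dx"
  shows "mset ds = mset (replicate (count_list ds (Dx 1)) (Dx 1) @ replicate (count_list ds (Dx 2)) (Dx 2)
     @ replicate (count_list ds (Dx 3)) (Dx 3))" (is "_ = mset ?r")
    and "count_list ds (Dx 1) + count_list ds (Dx 2) + count_list ds (Dx 3) = length ds"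
proof -
  have "mset ds = mset ?r \<and> count_list ds (Dx 1) + count_list ds (Dx 2) + count_list ds (Dx 3) = length ds"
    using assms
  proof (induction ds)
    case (Cons d ds)
    then obtain i where "d = Dx i" by auto
    then show ?case using Cons exhaust_3[of i] by auto
  qed simp
  then show "mset ds = mset ?r" "count_list ds (Dx 1) + count_list ds (Dx 2) + count_list ds (Dx 3) = length ds"
    by auto
qed

lemma finite_multi_indices [simp]: "finite {(a1::nat,a2::nat,a3::nat). a1 + a2 + a3 \<le> s}"
  by (rule finite_subset[of _ "{..s} \<times> {..s} \<times> {..s}"]) auto

lemma Hs_sq_nonneg [simp]: "0 \<le> Hs_sq T s f t" for f :: "real \<Rightarrow> real^3 \<Rightarrow> 'a::euclidean_space"
  unfolding Hs_sq_def by (intro sum_nonneg) auto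

lemma hn_le_Hs_sq:
  assumes f: "smper T f" and t: "t \<in> {0..T}"
  shows "hn T n f t \<le> real (card (SL n)) * sqrt (Hs_sq T n f t)"
  unfolding hn_def
proof (rule sum_bounded_above)
  fix ds assume ds: "ds \<in> SL n"
  let ?a = "(count_list ds (Dx 1), count_list ds (Dx 2), count_list ds (Dx 3))"
  have s: "set ds \<subseteq> range Dx" using ds by (simp add: SL_def)
  have "pders T ds f t = sder T ?a f t"
    unfolding sder_pders by (rule eqT_fun[OF pders_mset_cong[OF f SL_mset(1)[OF s]] t])
  moreover have "L2sq (sder T ?a f t) \<le> Hs_sq T n f t"
    unfolding Hs_sq_def using SL_mset(2)[OF s] ds
    by (intro member_le_sum) (auto simp: SL_def)
  ultimately show "L2n (pders T ds f t) \<le> sqrt (Hs_sq T n f t)"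
    by (simp add: L2n_def)
qed

lemma Hs_sq_le_hn:
  fixes f :: "real \<Rightarrow> real^3 \<Rightarrow> 'a::euclidean_space"
  shows "Hs_sq T n f t \<le> (hn T n f t)\<^sup>2"
proof -
  let ?r = "\<lambda>(a1,a2,a3). replicate a1 (Dx 1) @ replicate a2 (Dx 2) @ replicate a3 (Dx 3)"
  let ?I = "{(a1::nat,a2::nat,a3::nat). a1 + a2 + a3 \<le> n}"
  have cl: "count_list (replicate m e) d = (if d = e then m else 0)" for m and e d :: dirn
    by (induction m) auto
  have inj: "inj_on ?r ?I"
  proof (rule inj_onI)
    fix a b assume "?r a = ?r b"
    then have "count_list (?r a) d = count_list (?r b) d" for d by simp
    from this[of "Dx 1"] this[of "Dx 2"] this[of "Dx 3"] show "a = b"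
      by (cases a, cases b) (auto simp: cl)
  qed
  have "Hs_sq T n f t = (\<Sum>ds\<in>?r ` ?I. L2sq (pders T ds f t))"
    unfolding Hs_sq_def by (subst sum.reindex[OF inj]) (auto simp: sder_pders intro!: sum.cong)
  also have "\<dots> \<le> (hn T n f t)\<^sup>2"
    by (rule sum_L2sq_le_hn) (auto simp: SL_def)
  finally show ?thesis .
qed

lemma Psq_eq_Hs_sq:
  "Psq T k f t = (\<Sum>j\<le>k div 2. Hs_sq T (k - 2 * j) (ptd T j f) t)"
proof -
  have "{(a0,a1,a2,a3). 2 * a0 + a1 + a2 + a3 \<le> k} =
      (SIGMA j:{..k div 2}. {(a1,a2,a3). a1 + a2 + a3 \<le> k - 2 * j})"
    by auto
  then have "Psq T k f t = sum (\<lambda>(a0,a). L2sq (sder T a (ptd T a0 f) t))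
      (SIGMA j:{..k div 2}. {(a1,a2,a3). a1 + a2 + a3 \<le> k - 2 * j})"
    unfolding Psq_def by simp
  also have "\<dots> = (\<Sum>j\<le>k div 2. Hs_sq T (k - 2 * j) (ptd T j f) t)"
    unfolding Hs_sq_def by (rule sum.Sigma[symmetric]) auto
  finally show ?thesis .
qed

lemma Psq_nonneg [simp]: "0 \<le> Psq T k f t" for f :: "real \<Rightarrow> real^3 \<Rightarrow> 'a::euclidean_space"
  unfolding Psq_eq_Hs_sq by (intro sum_nonneg) auto

lemma Hs_sq_le_Psq:
  fixes f :: "real \<Rightarrow> real^3 \<Rightarrow> 'a::euclidean_space"
  assumes "2 * j + n \<le> k"
  shows "Hs_sq T n (ptd T j f) t \<le> Psq T k f t"
proof -
  have "Hs_sq T n (ptd T j f) t \<le> Hs_sq T (k - 2 * j) (ptd T j f) t"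
    unfolding Hs_sq_def using assms by (intro sum_mono2) auto
  also have "\<dots> \<le> Psq T k f t"
    unfolding Psq_eq_Hs_sq using assms
    by (intro member_le_sum[of j "{..k div 2}" "\<lambda>j. Hs_sq T (k - 2 * j) (ptd T j f) t"]) auto
  finally show ?thesis .
qed

lemma smper_ptd: "smper T f \<Longrightarrow> smper T (ptd T j f)"
  unfolding ptd_pders by (rule smper_pders)

section \<open>Solutions and uniform estimates\<close>

text \<open>An instance bundles a solution, a time and a smallness parameter \<open>kp\<close>.  Estimates whose constants
  do not depend on the solution thus become a relation between real functions of the instance, which is
  required to hold only for small values of \<open>kp\<close>.\<close>

record inst =
  kp :: real
  tT :: real
  fu :: "real \<Rightarrow> real^3 \<Rightarrow> real^3"
  fp :: "real \<Rightarrow> real^3 \<Rightarrow> real"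
  fh :: "real \<Rightarrow> real^3 \<Rightarrow> real^3"
  fK :: "real \<Rightarrow> real^3 \<Rightarrow> real^3^3"
  tm :: real

locale par =
  fixes mu kappa alpha beta gamma tau lam nu :: real and M :: nat
  assumes mu: "mu > 0" and kappa: "kappa > 0" and alpha: "alpha > 0" and beta: "beta > 0"
    and gamma: "gamma > 0" and tau: "tau > 0" and lam: "lam > 0" and nu: "nu > lam" and M: "M \<ge> 4"
begin

definition tt where "tt = tau / (2 * kappa)"
definition mb where "mb = mu + kappa / 2"
definition gt where "gt = beta + gamma"
definition at' where "at' = alpha + 4/3 * beta"
abbreviation w where "w \<equiv> omega_eq tau kappa"
abbreviation J where "J \<equiv> Jeq lam nu"

lemma w_vec: "w = vector [0, 0, tt]"
  by (simp add: omega_eq_def tt_def)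

lemma tt_pos: "tt > 0"
  using tau kappa by (simp add: tt_def)

definition sol :: "real \<Rightarrow> (real \<Rightarrow> real^3 \<Rightarrow> real^3) \<Rightarrow> (real \<Rightarrow> real^3 \<Rightarrow> real) \<Rightarrow>
    (real \<Rightarrow> real^3 \<Rightarrow> real^3) \<Rightarrow> (real \<Rightarrow> real^3 \<Rightarrow> real^3^3) \<Rightarrow> bool" where
  "sol T u p \<theta> K \<longleftrightarrow> smper T u \<and> smper T p \<and> smper T \<theta> \<and> smper T K \<and>
     system_P mu kappa alpha beta gamma tau lam nu T u p \<theta> K \<and> (\<forall>t\<in>{0..T}. mean (u t) = 0)"

definition mat_der :: "real \<Rightarrow> (real \<Rightarrow> real^3 \<Rightarrow> real^3) \<Rightarrow> (real \<Rightarrow> real^3 \<Rightarrow> real^3) \<Rightarrow> real \<Rightarrow> real^3 \<Rightarrow> real^3" where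
  "mat_der T u \<theta> = (\<lambda>t x. pder T Dt \<theta> t x + conv T u \<theta> t x)"

definition Nth :: "real \<Rightarrow> (real \<Rightarrow> real^3 \<Rightarrow> real^3) \<Rightarrow> (real \<Rightarrow> real^3 \<Rightarrow> real^3) \<Rightarrow> (real \<Rightarrow> real^3 \<Rightarrow> real^3^3) \<Rightarrow>
    real \<Rightarrow> real^3 \<Rightarrow> real^3" where
  "Nth T u \<theta> K = (\<lambda>t x. K t x *v mat_der T u \<theta> t x + J *v conv T u \<theta> t x + cross3 w (K t x *v \<theta> t x)
     + cross3 (\<theta> t x) (K t x *v w) + cross3 (\<theta> t x) (J *v \<theta> t x) + cross3 (\<theta> t x) (K t x *v \<theta> t x))"

definition Lth :: "real \<Rightarrow> (real \<Rightarrow> real^3 \<Rightarrow> real^3) \<Rightarrow> (real \<Rightarrow> real^3 \<Rightarrow> real^3) \<Rightarrow> real \<Rightarrow> real^3 \<Rightarrow> real^3" where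
  "Lth T u \<theta> = (\<lambda>t x. kappa *\<^sub>R lin1 T curlL u t x - (2 * kappa) *\<^sub>R \<theta> t x
     + (at' - gt) *\<^sub>R lin1 T gradL (lin1 T divL \<theta>) t x + gt *\<^sub>R lap T \<theta> t x)"

definition Lu :: "real \<Rightarrow> (real \<Rightarrow> real^3 \<Rightarrow> real^3) \<Rightarrow> (real \<Rightarrow> real^3 \<Rightarrow> real^3) \<Rightarrow> real \<Rightarrow> real^3 \<Rightarrow> real^3" where
  "Lu T u \<theta> = (\<lambda>t x. mb *\<^sub>R lap T u t x + kappa *\<^sub>R lin1 T curlL \<theta> t x)"

context
  fixes T u p \<theta> K assumes sol: "sol T u p \<theta> K"
begin

lemma sol_smper: "smper T u" "smper T p" "smper T \<theta>" "smper T K" "smper T (aK K)" "T > 0"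
  using sol smper_linear[OF bl_pa, of T K] by (auto simp: sol_def aK_pa smper_def[of T u])

lemma sol_mean: "t \<in> {0..T} \<Longrightarrow> mean (u t) = 0"
  using sol by (auto simp: sol_def)

lemma sol_div: "t \<in> {0..T} \<Longrightarrow> divg T u t x = 0" "t \<in> {0..T} \<Longrightarrow> lin1 T divL u t x = 0"
  using sol eqTD[OF divg_lin1[OF sol_smper(1)], of t x] by (auto simp: sol_def system_P_def Let_def)

lemma sol_u: "eqT T (pder T Dt u) (\<lambda>t x. Lu T u \<theta> t x - lin1 T gradL p t x - conv T u u t x)"
proof -
  have "pder T Dt u t x + conv T u u t x = mb *\<^sub>R lap T u t x + kappa *\<^sub>R curl T \<theta> t x - grad T p t x"
    if "t \<in> {0..T}" for t x
    using sol that by (auto simp: sol_def system_P_def Let_def mb_def)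
  then show ?thesis using curl_lin1[OF sol_smper(3)]
    by (auto simp: eqT_def Lu_def grad_lin1 eq_diff_eq)
qed

lemma sol_th: "eqT T (\<lambda>t x. J *v pder T Dt \<theta> t x)
   (\<lambda>t x. Lth T u \<theta> t x - L0 tt lam nu (\<theta> t x) - tt\<^sup>2 *\<^sub>R Rv (aK K t x) - Nth T u \<theta> K t x)"
  unfolding eqT_def
proof (intro ballI allI)
  fix t x assume t: "t \<in> {0..T}"
  have "eqT T (grad T (divg T \<theta>)) (lin1 T gradL (lin1 T divL \<theta>))"
    unfolding grad_lin1 by (rule lin1_cong[OF divg_lin1[OF sol_smper(3)]])
  moreover have "(J + K t x) *v (pder T Dt \<theta> t x + conv T u \<theta> t x)
        + cross3 (w + \<theta> t x) ((J + K t x) *v (w + \<theta> t x))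
        = kappa *\<^sub>R curl T u t x - (2 * kappa) *\<^sub>R \<theta> t x
          + (at' - gt) *\<^sub>R grad T (divg T \<theta>) t x + gt *\<^sub>R lap T \<theta> t x"
    using sol t by (auto simp: sol_def system_P_def Let_def at'_def gt_def)
  ultimately have "(J + K t x) *v (pder T Dt \<theta> t x + conv T u \<theta> t x)
        + cross3 (w + \<theta> t x) ((J + K t x) *v (w + \<theta> t x)) = Lth T u \<theta> t x"
    using t curl_lin1[OF sol_smper(1)] by (simp add: Lth_def eqT_def)
  from momentum_expand[OF this w_vec]
  show "J *v pder T Dt \<theta> t x = Lth T u \<theta> t x - L0 tt lam nu (\<theta> t x) - tt\<^sup>2 *\<^sub>R Rv (aK K t x) - Nth T u \<theta> K t x"
    by (simp add: Nth_def mat_der_def aK_pa)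
qed

lemma sol_K: "eqT T (pder T Dt K) (\<lambda>t x. com w (K t x) + com (\<theta> t x) J + com (\<theta> t x) (K t x) - conv T u K t x)"
  unfolding eqT_def
proof (intro ballI allI)
  fix t x assume t: "t \<in> {0..T}"
  interpret c: bounded_bilinear com by (rule bounded_bilinear_com)
  have "pder T Dt K t x + conv T u K t x
        = (ten w + ten (\<theta> t x)) ** (J + K t x) - (J + K t x) ** (ten w + ten (\<theta> t x))"
    using sol t by (auto simp: sol_def system_P_def Let_def)
  also have "ten w + ten (\<theta> t x) = ten (w + \<theta> t x)"
    by (simp add: ten_entry vec_eq_iff forall_3)
  finally have "pder T Dt K t x + conv T u K t x = com (w + \<theta> t x) (J + K t x)"
    by (simp add: com_def)
  then show "pder T Dt K t x = com w (K t x) + com (\<theta> t x) J + com (\<theta> t x) (K t x) - conv T u K t x"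
    using com_axis_Jeq[of tt lam nu] by (simp add: c.add_left c.add_right w_vec eq_diff_eq)
qed

lemma sol_a: "eqT T (pder T Dt (aK K)) (\<lambda>t x. tt *\<^sub>R perp (aK K t x) - (nu - lam) *\<^sub>R hperp (\<theta> t x)
    + pa (com (\<theta> t x) (K t x)) - conv T u (aK K) t x)"
  unfolding eqT_def
proof (intro ballI allI)
  fix t x assume t: "t \<in> {0..T}"
  interpret l: bounded_linear pa by (rule bl_pa)
  have "smooth_on T K" using sol_smper(4) by (simp add: smper_def)
  then have pd: "pder T d (aK K) t x = pa (pder T d K t x)" for d
    unfolding aK_pa using eqTD[OF pder_linear[OF bl_pa sol_smper(6)] t] by blast
  then have "conv T u (aK K) t x = pa (conv T u K t x)"
    by (simp add: conv_def l.sum l.scaleR)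
  then show "pder T Dt (aK K) t x = tt *\<^sub>R perp (aK K t x) - (nu - lam) *\<^sub>R hperp (\<theta> t x)
    + pa (com (\<theta> t x) (K t x)) - conv T u (aK K) t x"
    unfolding pd eqTD[OF sol_K t, of x]
    using pa_com_axis[of tt "K t x"] pa_com_Jeq[of "\<theta> t x" lam nu]
    by (simp add: l.add l.diff aK_pa w_vec)
qed

end

definition Sol :: "inst set" where
  "Sol = {z. sol (tT z) (fu z) (fp z) (fh z) (fK z) \<and> tm z \<in> {0..tT z} \<and> 0 \<le> kp z \<and> kp z \<le> 1 \<and>
     Efull (tT z) M (fu z) (fh z) (fK z) (tm z) \<le> (kp z)\<^sup>2 \<and>
     (hn (tT z) (2*M+1) (fK z) (tm z))\<^sup>2 \<le> (kp z)\<^sup>2 * (1 + tm z)}"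

definition lss :: "(inst \<Rightarrow> real) \<Rightarrow> (inst \<Rightarrow> real) \<Rightarrow> bool" (infix "\<preceq>" 50) where
  "X \<preceq> Y \<longleftrightarrow> (\<exists>C\<ge>0. \<exists>k>0. \<forall>z\<in>Sol. kp z \<le> k \<longrightarrow> X z \<le> C * Y z)"

lemma lssI: "0 \<le> C \<Longrightarrow> (\<And>z. z \<in> Sol \<Longrightarrow> X z \<le> C * Y z) \<Longrightarrow> X \<preceq> Y"
  unfolding lss_def by (intro exI[of _ C] conjI exI[of _ "1::real"]) auto

lemma lss_le: "(\<And>z. z \<in> Sol \<Longrightarrow> X z \<le> Y z) \<Longrightarrow> X \<preceq> Y"
  by (rule lssI[of 1]) auto

lemma lss_refl [simp]: "X \<preceq> X"
  by (rule lss_le) auto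

lemma lss_trans [trans]:
  assumes "X \<preceq> Y" "Y \<preceq> Z" shows "X \<preceq> Z"
proof -
  obtain C k where 1: "C \<ge> 0" "k > 0" "\<And>z. z \<in> Sol \<Longrightarrow> kp z \<le> k \<Longrightarrow> X z \<le> C * Y z"
    using assms(1) unfolding lss_def by blast
  obtain D l where 2: "D \<ge> 0" "l > 0" "\<And>z. z \<in> Sol \<Longrightarrow> kp z \<le> l \<Longrightarrow> Y z \<le> D * Z z"
    using assms(2) unfolding lss_def by blast
  show ?thesis unfolding lss_def
  proof (intro exI conjI ballI impI)
    show "0 \<le> C * D" "0 < min k l" using 1 2 by auto
    fix z assume z: "z \<in> Sol" "kp z \<le> min k l"
    have "X z \<le> C * Y z" using 1 z by auto
    also have "\<dots> \<le> C * (D * Z z)" using 1 2 z by (intro mult_left_mono) auto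
    finally show "X z \<le> C * D * Z z" by (simp add: mult.assoc)
  qed
qed

lemma lss_add:
  assumes "X \<preceq> Z" "Y \<preceq> Z" shows "(\<lambda>z. X z + Y z) \<preceq> Z"
proof -
  obtain C k where 1: "C \<ge> 0" "k > 0" "\<And>z. z \<in> Sol \<Longrightarrow> kp z \<le> k \<Longrightarrow> X z \<le> C * Z z"
    using assms(1) unfolding lss_def by blast
  obtain D l where 2: "D \<ge> 0" "l > 0" "\<And>z. z \<in> Sol \<Longrightarrow> kp z \<le> l \<Longrightarrow> Y z \<le> D * Z z"
    using assms(2) unfolding lss_def by blast
  show ?thesis unfolding lss_def
  proof (intro exI conjI ballI impI)
    show "0 \<le> C + D" "0 < min k l" using 1 2 by auto
    fix z assume z: "z \<in> Sol" "kp z \<le> min k l"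
    show "X z + Y z \<le> (C + D) * Z z" using 1(3)[of z] 2(3)[of z] z by (simp add: distrib_right)
  qed
qed

lemma lss_mult:
  assumes "X \<preceq> Y" "X' \<preceq> Y'" "\<And>z. z \<in> Sol \<Longrightarrow> 0 \<le> X' z" "\<And>z. z \<in> Sol \<Longrightarrow> 0 \<le> Y z"
    and "(\<lambda>z. Y z * Y' z) \<preceq> Z"
  shows "(\<lambda>z. X z * X' z) \<preceq> Z"
proof -
  obtain C k where 1: "C \<ge> 0" "k > 0" "\<And>z. z \<in> Sol \<Longrightarrow> kp z \<le> k \<Longrightarrow> X z \<le> C * Y z"
    using assms(1) unfolding lss_def by blast
  obtain D l where 2: "D \<ge> 0" "l > 0" "\<And>z. z \<in> Sol \<Longrightarrow> kp z \<le> l \<Longrightarrow> X' z \<le> D * Y' z"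
    using assms(2) unfolding lss_def by blast
  have "(\<lambda>z. X z * X' z) \<preceq> (\<lambda>z. Y z * Y' z)" unfolding lss_def
  proof (intro exI conjI ballI impI)
    show "0 \<le> C * D" "0 < min k l" using 1 2 by auto
    fix z assume z: "z \<in> Sol" "kp z \<le> min k l"
    have "X z * X' z \<le> (C * Y z) * (D * Y' z)"
      using 1 2 z assms(3,4) by (intro mult_mono) auto
    then show "X z * X' z \<le> C * D * (Y z * Y' z)" by (simp add: mult_ac)
  qed
  then show ?thesis using assms(5) lss_trans by blast
qed

lemma lss_cmult: "X \<preceq> Z \<Longrightarrow> (\<And>z. z \<in> Sol \<Longrightarrow> 0 \<le> X z) \<Longrightarrow> (\<lambda>z. c * X z) \<preceq> Z"
proof -
  assume a: "X \<preceq> Z" "\<And>z. z \<in> Sol \<Longrightarrow> 0 \<le> X z"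
  have "(\<lambda>z. c * X z) \<preceq> X"
    by (rule lssI[of "\<bar>c\<bar>"]) (use a(2) in \<open>auto intro!: mult_right_mono\<close>)
  then show ?thesis using a lss_trans by blast
qed

lemma lss_sum: "finite I \<Longrightarrow> (\<And>i. i \<in> I \<Longrightarrow> X i \<preceq> Z) \<Longrightarrow> (\<And>z. z \<in> Sol \<Longrightarrow> 0 \<le> Z z) \<Longrightarrow> (\<lambda>z. \<Sum>i\<in>I. X i z) \<preceq> Z"
proof (induction I rule: finite_induct)
  case empty
  then show ?case by (intro lssI[of 1]) auto
next
  case (insert i I)
  then show ?case using lss_add[of "X i" Z "\<lambda>z. \<Sum>i\<in>I. X i z"] by simp
qed

lemma lss_absorb:
  assumes "X \<preceq> (\<lambda>z. Y z + kp z * X z)" "\<And>z. z \<in> Sol \<Longrightarrow> 0 \<le> X z"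
  shows "X \<preceq> Y"
proof -
  obtain C k where 1: "C \<ge> 0" "k > 0" "\<And>z. z \<in> Sol \<Longrightarrow> kp z \<le> k \<Longrightarrow> X z \<le> C * (Y z + kp z * X z)"
    using assms(1) unfolding lss_def by blast
  show ?thesis unfolding lss_def
  proof (intro exI conjI ballI impI)
    show "0 \<le> 2 * C" "0 < min k (1 / (2 * (C + 1)))" using 1 by auto
    fix z assume z: "z \<in> Sol" "kp z \<le> min k (1 / (2 * (C + 1)))"
    have "C * kp z \<le> C * (1 / (2 * (C + 1)))" using z 1 by (intro mult_left_mono) auto
    also have "\<dots> \<le> 1/2" using 1 by (simp add: field_simps)
    finally have "C * kp z * X z \<le> 1/2 * X z" using assms(2)[OF z(1)] by (intro mult_right_mono) auto
    moreover have "X z \<le> C * (Y z + kp z * X z)" using 1 z by auto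
    ultimately show "X z \<le> 2 * C * Y z" by (simp add: algebra_simps)
  qed
qed

definition H :: "nat \<Rightarrow> (inst \<Rightarrow> real \<Rightarrow> real^3 \<Rightarrow> 'a::euclidean_space) \<Rightarrow> inst \<Rightarrow> real" where
  "H n F z = hn (tT z) n (F z) (tm z)"

definition fam :: "(inst \<Rightarrow> real \<Rightarrow> real^3 \<Rightarrow> 'a::euclidean_space) \<Rightarrow> bool" where
  "fam F \<longleftrightarrow> (\<forall>z\<in>Sol. smper (tT z) (F z))"

definition feq :: "(inst \<Rightarrow> real \<Rightarrow> real^3 \<Rightarrow> 'a::euclidean_space) \<Rightarrow> (inst \<Rightarrow> real \<Rightarrow> real^3 \<Rightarrow> 'a) \<Rightarrow> bool" where
  "feq F G \<longleftrightarrow> (\<forall>z\<in>Sol. eqT (tT z) (F z) (G z))"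

lemma H_nonneg [simp]: "0 \<le> H n F z"
  by (simp add: H_def)

lemma Sol_tm: "z \<in> Sol \<Longrightarrow> tm z \<in> {0..tT z}"
  by (simp add: Sol_def)

lemma Sol_kp [simp]: "z \<in> Sol \<Longrightarrow> 0 \<le> kp z" "z \<in> Sol \<Longrightarrow> kp z \<le> 1"
  by (simp_all add: Sol_def)

lemma Sol_sol: "z \<in> Sol \<Longrightarrow> sol (tT z) (fu z) (fp z) (fh z) (fK z)"
  unfolding Sol_def by blast

lemma Sol_tm0 [simp]: "z \<in> Sol \<Longrightarrow> 0 \<le> tm z"
  unfolding Sol_def by auto

lemma Sol_E: "z \<in> Sol \<Longrightarrow> Efull (tT z) M (fu z) (fh z) (fK z) (tm z) \<le> (kp z)\<^sup>2"
    "z \<in> Sol \<Longrightarrow> (hn (tT z) (2*M+1) (fK z) (tm z))\<^sup>2 \<le> (kp z)\<^sup>2 * (1 + tm z)"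
  unfolding Sol_def by blast+

lemma famD: "fam F \<Longrightarrow> z \<in> Sol \<Longrightarrow> smper (tT z) (F z)"
  by (simp add: fam_def)

lemma H_cong: "feq F G \<Longrightarrow> H n G \<preceq> Z \<Longrightarrow> H n F \<preceq> Z"
proof -
  assume a: "feq F G" "H n G \<preceq> Z"
  have "H n F \<preceq> H n G"
  proof (rule lss_le)
    fix z assume z: "z \<in> Sol"
    show "H n F z \<le> H n G z"
      unfolding H_def using a z hn_cong[OF _ Sol_tm[OF z], of "F z" "G z" n] by (simp add: feq_def)
  qed
  then show ?thesis using a lss_trans by blast
qed

lemma H_mono: "H m F \<preceq> Z \<Longrightarrow> n \<le> m \<Longrightarrow> H n F \<preceq> Z"
  using lss_trans[OF lss_le[of "H n F" "H m F"]] by (simp add: H_def hn_mono)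

lemma H_add: "fam F \<Longrightarrow> fam G \<Longrightarrow> H n F \<preceq> Z \<Longrightarrow> H n G \<preceq> Z \<Longrightarrow> H n (\<lambda>z t x. F z t x + G z t x) \<preceq> Z"
  by (rule lss_trans[OF lss_le lss_add[of "H n F" Z "H n G"]])
     (simp_all only: H_def hn_add[OF famD famD Sol_tm])

lemma H_diff: "fam F \<Longrightarrow> fam G \<Longrightarrow> H n F \<preceq> Z \<Longrightarrow> H n G \<preceq> Z \<Longrightarrow> H n (\<lambda>z t x. F z t x - G z t x) \<preceq> Z"
  by (rule lss_trans[OF lss_le lss_add[of "H n F" Z "H n G"]])
     (simp_all only: H_def hn_diff[OF famD famD Sol_tm])

lemma H_linear:
  assumes "bounded_linear L" "fam F" "H n F \<preceq> Z" shows "H n (\<lambda>z t x. L (F z t x)) \<preceq> Z"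
proof -
  obtain C where C: "C \<ge> 0" "\<And>T f t n. smper T f \<Longrightarrow> t \<in> {0..T} \<Longrightarrow> hn T n (\<lambda>t x. L (f t x)) t \<le> C * hn T n f t"
    using hn_linear[OF assms(1)] by blast
  have "H n (\<lambda>z t x. L (F z t x)) \<preceq> H n F"
    by (rule lssI[OF C(1)], unfold H_def) (rule C(2)[OF famD[OF assms(2)] Sol_tm])
  then show ?thesis using assms lss_trans by blast
qed

lemma H_scaleR: "fam F \<Longrightarrow> H n F \<preceq> Z \<Longrightarrow> H n (\<lambda>z t x. c *\<^sub>R F z t x) \<preceq> Z"
  by (rule H_linear[OF bounded_linear_scaleR_right])

lemma H_lin1:
  assumes "\<And>i. bounded_linear (L i)" "fam F" "H (Suc n) F \<preceq> Z" shows "H n (\<lambda>z. lin1 (tT z) L (F z)) \<preceq> Z"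
proof -
  obtain C where C: "C \<ge> 0" "\<And>T f t n. smper T f \<Longrightarrow> t \<in> {0..T} \<Longrightarrow> hn T n (lin1 T L f) t \<le> C * hn T (Suc n) f t"
    using hn_lin1[of L, OF assms(1)] by blast
  have "H n (\<lambda>z. lin1 (tT z) L (F z)) \<preceq> H (Suc n) F"
    by (rule lssI[OF C(1)], unfold H_def) (rule C(2)[OF famD[OF assms(2)] Sol_tm])
  then show ?thesis using assms lss_trans by blast
qed

lemma H_lap:
  assumes "fam F" "H (n + 2) F \<preceq> Z" shows "H n (\<lambda>z. lap (tT z) (F z)) \<preceq> Z"
proof -
  have "H n (\<lambda>z. lap (tT z) (F z)) \<preceq> H (n + 2) F"
    by (rule lssI[of 3], simp, unfold H_def) (rule hn_lap[OF famD[OF assms(1)] Sol_tm])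
  then show ?thesis using assms lss_trans by blast
qed

lemma H_bilinear2:
  fixes B :: "'a::euclidean_space \<Rightarrow> 'b::euclidean_space \<Rightarrow> 'c::euclidean_space"
  assumes B: "bounded_bilinear B" and F: "fam F" and G: "fam G"
    and cov: "\<And>j. j \<le> n \<Longrightarrow> (j \<le> a1 \<and> n - j \<le> b1) \<or> (j \<le> a2 \<and> n - j \<le> b2)"
    and ab: "n + 3 \<le> a1 + b1" "n + 3 \<le> a2 + b2"
    and Z: "(\<lambda>z. H a1 F z * H b1 G z) \<preceq> Z" "(\<lambda>z. H a2 F z * H b2 G z) \<preceq> Z"
  shows "H n (\<lambda>z t x. B (F z t x) (G z t x)) \<preceq> Z"
proof -
  obtain C where C: "C \<ge> 0" "\<And>T f g t. smper T f \<Longrightarrow> smper T g \<Longrightarrow> t \<in> {0..T} \<Longrightarrow>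
    hn T n (\<lambda>t x. B (f t x) (g t x)) t \<le> C * (hn T a1 f t * hn T b1 g t + hn T a2 f t * hn T b2 g t)"
    using product_tame[OF B cov ab] by blast
  have "H n (\<lambda>z t x. B (F z t x) (G z t x)) \<preceq> (\<lambda>z. H a1 F z * H b1 G z + H a2 F z * H b2 G z)"
    by (rule lssI[OF C(1)], unfold H_def) (rule C(2)[OF famD[OF F] famD[OF G] Sol_tm])
  then show ?thesis using lss_add[OF Z] lss_trans by blast
qed

lemma H_bilinear:
  assumes "bounded_bilinear B" "fam F" "fam G" "n \<le> a" "n \<le> b" "n + 3 \<le> a + b" "(\<lambda>z. H a F z * H b G z) \<preceq> Z"
  shows "H n (\<lambda>z t x. B (F z t x) (G z t x)) \<preceq> Z"
  by (rule H_bilinear2[where ?a1.0=a and ?b1.0=b and ?a2.0=a and ?b2.0=b]) (use assms in auto)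

lemma H_conv2:
  assumes F: "fam F" and G: "fam (G :: inst \<Rightarrow> real \<Rightarrow> real^3 \<Rightarrow> 'a::euclidean_space)"
    and cov: "\<And>j. j \<le> n \<Longrightarrow> (j \<le> a1 \<and> Suc (n - j) \<le> b1) \<or> (j \<le> a2 \<and> Suc (n - j) \<le> b2)"
    and ab: "n + 4 \<le> a1 + b1" "n + 4 \<le> a2 + b2" "1 \<le> b1" "1 \<le> b2"
    and Z: "(\<lambda>z. H a1 F z * H b1 G z) \<preceq> Z" "(\<lambda>z. H a2 F z * H b2 G z) \<preceq> Z"
  shows "H n (\<lambda>z. conv (tT z) (F z) (G z)) \<preceq> Z"
proof -
  obtain C where C: "C \<ge> 0" "\<And>T u (v :: real \<Rightarrow> real^3 \<Rightarrow> 'a) t. smper T u \<Longrightarrow> smper T v \<Longrightarrow> t \<in> {0..T} \<Longrightarrow>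
    hn T n (conv T u v) t \<le> C * (hn T a1 u t * hn T b1 v t + hn T a2 u t * hn T b2 v t)"
    using conv_tame[OF cov ab] by blast
  have "H n (\<lambda>z. conv (tT z) (F z) (G z)) \<preceq> (\<lambda>z. H a1 F z * H b1 G z + H a2 F z * H b2 G z)"
    by (rule lssI[OF C(1)], unfold H_def) (rule C(2)[OF famD[OF F] famD[OF G] Sol_tm])
  then show ?thesis using lss_add[OF Z] lss_trans by blast
qed

lemma H_conv:
  assumes "fam F" "fam G" "n \<le> a" "Suc n \<le> b" "n + 4 \<le> a + b" "(\<lambda>z. H a F z * H b G z) \<preceq> Z"
  shows "H n (\<lambda>z. conv (tT z) (F z) (G z)) \<preceq> Z"
  by (rule H_conv2[where ?a1.0=a and ?b1.0=b and ?a2.0=a and ?b2.0=b]) (use assms in auto)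

subsection \<open>The fields of a solution\<close>

abbreviation "U \<equiv> (fu :: inst \<Rightarrow> _)"
abbreviation "P \<equiv> (fp :: inst \<Rightarrow> _)"
abbreviation "Th \<equiv> (fh :: inst \<Rightarrow> _)"
abbreviation "KF \<equiv> (fK :: inst \<Rightarrow> _)"
definition A :: "inst \<Rightarrow> real \<Rightarrow> real^3 \<Rightarrow> real^2" where "A z = aK (fK z)"
definition dt :: "nat \<Rightarrow> (inst \<Rightarrow> real \<Rightarrow> real^3 \<Rightarrow> 'a::euclidean_space) \<Rightarrow> inst \<Rightarrow> real \<Rightarrow> real^3 \<Rightarrow> 'a" where
  "dt j F z = ptd (tT z) j (F z)"

lemma fam_fields [simp]: "fam U" "fam P" "fam Th" "fam KF" "fam A"
  by (auto simp: fam_def A_def intro: sol_smper[OF Sol_sol])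

lemma fam_dt [simp]: "fam F \<Longrightarrow> fam (dt j F)"
  by (auto simp: fam_def dt_def smper_ptd)

lemma fam_add: "fam F \<Longrightarrow> fam G \<Longrightarrow> fam (\<lambda>z t x. F z t x + G z t x)"
  by (auto simp: fam_def intro: smper_add)

lemma fam_diff: "fam F \<Longrightarrow> fam G \<Longrightarrow> fam (\<lambda>z t x. F z t x - G z t x)"
  by (auto simp: fam_def intro: smper_diff)

lemma fam_linear: "bounded_linear L \<Longrightarrow> fam F \<Longrightarrow> fam (\<lambda>z t x. L (F z t x))"
  by (auto simp: fam_def intro: smper_linear)

lemma fam_scaleR: "fam F \<Longrightarrow> fam (\<lambda>z t x. c *\<^sub>R F z t x)"
  by (auto simp: fam_def intro: smper_scaleR)

lemma fam_bilinear: "bounded_bilinear B \<Longrightarrow> fam F \<Longrightarrow> fam G \<Longrightarrow> fam (\<lambda>z t x. B (F z t x) (G z t x))"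
  by (auto simp: fam_def intro: smper_bilinear)

lemma fam_pder: "fam F \<Longrightarrow> fam (\<lambda>z. pder (tT z) d (F z))"
  by (auto simp: fam_def intro: smper_pder)

lemma fam_lin1: "(\<And>i. bounded_linear (L i)) \<Longrightarrow> fam F \<Longrightarrow> fam (\<lambda>z. lin1 (tT z) L (F z))"
  by (auto simp: fam_def intro: smper_lin1)

lemma fam_lap: "fam F \<Longrightarrow> fam (\<lambda>z. lap (tT z) (F z))"
  by (auto simp: fam_def intro: smper_lap)

lemma fam_conv: "fam F \<Longrightarrow> fam G \<Longrightarrow> fam (\<lambda>z. conv (tT z) (F z) (G z))"
  by (auto simp: fam_def intro: smper_conv)

lemma sq_le_kp:
  assumes "fam F" "\<And>z. z \<in> Sol \<Longrightarrow> Hs_sq (tT z) n (F z) (tm z) \<le> Efull (tT z) M (fu z) (fh z) (fK z) (tm z)"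
  shows "H n F \<preceq> kp"
proof (rule lssI)
  fix z assume z: "z \<in> Sol"
  have "Hs_sq (tT z) n (F z) (tm z) \<le> (kp z)\<^sup>2"
    using order_trans[OF assms(2)[OF z] Sol_E(1)[OF z]] .
  then have "sqrt (Hs_sq (tT z) n (F z) (tm z)) \<le> kp z"
    using Sol_kp(1)[OF z] by (rule real_le_lsqrt[rotated])
  then show "H n F z \<le> real (card (SL n)) * kp z"
    unfolding H_def
    by (intro order_trans[OF hn_le_Hs_sq[OF famD[OF assms(1) z] Sol_tm[OF z]]] mult_left_mono) auto
qed simp

lemma EK_nonneg: "0 \<le> EK T M K t" for K :: "real \<Rightarrow> real^3 \<Rightarrow> real^3^3"
  unfolding EK_def by (intro add_nonneg_nonneg sum_nonneg) auto

lemma Psq_le_Efull: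
  fixes u \<theta> :: "real \<Rightarrow> real^3 \<Rightarrow> real^3" and K :: "real \<Rightarrow> real^3 \<Rightarrow> real^3^3"
  shows "Psq T (2*M) u t \<le> Efull T M u \<theta> K t" "Psq T (2*M) \<theta> t \<le> Efull T M u \<theta> K t"
    "Psq T (2*M) (aK K) t \<le> Efull T M u \<theta> K t"
  using EK_nonneg[of T K t] Psq_nonneg[of T "2*M" u t] Psq_nonneg[of T "2*M" \<theta> t] Psq_nonneg[of T "2*M" "aK K" t]
  unfolding Efull_def Ebar_def by linarith+

lemma small_U: "2 * j + n \<le> 2 * M \<Longrightarrow> H n (dt j U) \<preceq> kp"
  by (rule sq_le_kp, simp, unfold dt_def) (rule order_trans[OF Hs_sq_le_Psq Psq_le_Efull(1)])

lemma small_Th: "2 * j + n \<le> 2 * M \<Longrightarrow> H n (dt j Th) \<preceq> kp"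
  by (rule sq_le_kp, simp, unfold dt_def) (rule order_trans[OF Hs_sq_le_Psq Psq_le_Efull(2)])

lemma small_A: "2 * j + n \<le> 2 * M \<Longrightarrow> H n (dt j A) \<preceq> kp"
  by (rule sq_le_kp, simp, unfold dt_def A_def) (rule order_trans[OF Hs_sq_le_Psq Psq_le_Efull(3)])

definition nK :: "nat \<Rightarrow> nat" where
  "nK j = (if j \<le> 2 then 2 * M - 3 else 2 * M - 2 * j + 2)"

lemma small_K:
  assumes "j \<le> M" "n \<le> nK j"
  shows "H n (dt j KF) \<preceq> kp"
proof -
  have "H (nK j) (dt j KF) \<preceq> kp"
  proof (rule sq_le_kp)
    fix z assume "z \<in> Sol"
    let ?T = "tT z" and ?t = "tm z" and ?K = "fK z"
    have 0: "0 \<le> Ebar ?T M (fu z) (fh z) ?K ?t" by (simp add: Ebar_def)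
    have "Hs_sq ?T (nK j) (ptd ?T j ?K) ?t \<le> EK ?T M ?K ?t"
    proof (cases "j \<le> 2")
      case True
      have s: "0 \<le> (\<Sum>j\<in>{3..M}. Hs_sq ?T (2*M-2*j+2) (ptd ?T j ?K) ?t)" by (intro sum_nonneg) auto
      consider "j = 0" | "j = 1" | "j = 2" using True by linarith
      then show ?thesis using s by cases (auto simp: EK_def nK_def ptd_def)
    next
      case False
      then have "Hs_sq ?T (nK j) (ptd ?T j ?K) ?t \<le> (\<Sum>j\<in>{3..M}. Hs_sq ?T (2*M-2*j+2) (ptd ?T j ?K) ?t)"
        using member_le_sum[of j "{3..M}" "\<lambda>j. Hs_sq ?T (2*M-2*j+2) (ptd ?T j ?K) ?t"] assms
        by (simp add: nK_def)
      then show ?thesis unfolding EK_def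
        using Hs_sq_nonneg[of ?T "2*M-3" ?K ?t] Hs_sq_nonneg[of ?T "2*M-3" "ptd ?T 1 ?K" ?t]
          Hs_sq_nonneg[of ?T "2*M-3" "ptd ?T 2 ?K" ?t] by linarith
    qed
    then show "Hs_sq (tT z) (nK j) (dt j KF z) (tm z) \<le> Efull (tT z) M (fu z) (fh z) (fK z) (tm z)"
      using 0 by (simp add: Efull_def dt_def)
  qed simp
  then show ?thesis using assms(2) H_mono by blast
qed

lemma dt_0 [simp]: "dt 0 F = F"
  by (simp add: dt_def ptd_def fun_eq_iff)

lemma small_K_top: "H (2*M+1) KF \<preceq> (\<lambda>z. kp z * sqrt (1 + tm z))"
proof (rule lss_le)
  fix z assume z: "z \<in> Sol"
  then have "H (2*M+1) KF z \<le> sqrt ((kp z)\<^sup>2 * (1 + tm z))"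
    unfolding H_def by (intro real_le_rsqrt Sol_E(2))
  then show "H (2*M+1) KF z \<le> kp z * sqrt (1 + tm z)"
    using z by (simp add: real_sqrt_mult)
qed

end


section \<open>Nonlinear estimates\<close>

context par
begin

definition DD :: "nat \<Rightarrow> inst \<Rightarrow> real" where
  "DD s z = H (s + 1) U z + H (s + 1) Th z + H (s - 1) A z"

definition KD :: "nat \<Rightarrow> inst \<Rightarrow> real" where
  "KD s z = kp z * DD s z"

text \<open>The second term stands for the products in which the highest norm of K appears, which is only
  known to grow at most like the square root of time.\<close>

definition BB :: "nat \<Rightarrow> inst \<Rightarrow> real" where
  "BB s z = kp z * (DD s z + (if 3 \<le> s then sqrt (1 + tm z) * DD (s - 1) z else 0))"

lemma DD_nonneg [simp]: "0 \<le> DD s z"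
  by (simp add: DD_def)

lemma KD_nonneg [simp]: "z \<in> Sol \<Longrightarrow> 0 \<le> KD s z"
  by (simp add: KD_def)

lemma BB_nonneg [simp]: "z \<in> Sol \<Longrightarrow> 0 \<le> BB s z"
  by (simp add: BB_def)

lemma DD_mono: "r \<le> s \<Longrightarrow> DD r \<preceq> DD s"
  by (rule lss_le) (auto simp: DD_def H_def intro!: add_mono hn_mono)

lemma DD_U: "n \<le> s + 1 \<Longrightarrow> H n U \<preceq> DD s"
  by (rule H_mono[of "s + 1"], rule lss_le) (auto simp: DD_def)

lemma DD_Th: "n \<le> s + 1 \<Longrightarrow> H n Th \<preceq> DD s"
  by (rule H_mono[of "s + 1"], rule lss_le) (auto simp: DD_def)

lemma DD_A: "n \<le> s - 1 \<Longrightarrow> H n A \<preceq> DD s"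
  by (rule H_mono[of "s - 1"], rule lss_le) (auto simp: DD_def)

lemma KD_BB: "KD s \<preceq> BB s"
  by (rule lss_le) (auto simp: KD_def BB_def intro!: mult_left_mono)

lemma kp_le: "Z \<preceq> Y \<Longrightarrow> (\<And>z. z \<in> Sol \<Longrightarrow> 0 \<le> Z z) \<Longrightarrow> (\<lambda>z. kp z * Z z) \<preceq> Y"
  by (rule lss_trans[of _ Z], rule lss_le) (auto intro: mult_left_le_one_le)

lemma KD_DD: "KD s \<preceq> DD s"
  unfolding KD_def[abs_def] by (rule kp_le) auto

lemma lss_mult_KD:
  assumes "X \<preceq> kp" "Y \<preceq> DD s" "\<And>z. z \<in> Sol \<Longrightarrow> 0 \<le> Y z"
  shows "(\<lambda>z. X z * Y z) \<preceq> KD s"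
  by (rule lss_mult[OF assms(1,2)]) (auto simp: assms(3) KD_def[abs_def])

lemma lss_mult_KD':
  assumes "X \<preceq> kp" "Y \<preceq> DD s" "\<And>z. z \<in> Sol \<Longrightarrow> 0 \<le> Y z"
  shows "(\<lambda>z. Y z * X z) \<preceq> KD s"
  using lss_mult_KD[OF assms] by (simp add: mult.commute)

lemma lss_mult_BB:
  assumes "3 \<le> s" "Y \<preceq> DD (s - 1)" "X \<preceq> (\<lambda>z. kp z * sqrt (1 + tm z))" "\<And>z. z \<in> Sol \<Longrightarrow> 0 \<le> X z"
  shows "(\<lambda>z. Y z * X z) \<preceq> BB s"
proof (rule lss_mult[OF assms(2,3,4)])
  show "(\<lambda>z. DD (s - 1) z * (kp z * sqrt (1 + tm z))) \<preceq> BB s"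
  proof (rule lss_le)
    fix z assume z: "z \<in> Sol"
    have "DD (s - 1) z * (kp z * sqrt (1 + tm z)) = kp z * (sqrt (1 + tm z) * DD (s - 1) z)"
      by (simp add: mult_ac)
    also have "\<dots> \<le> BB s z" unfolding BB_def using z assms(1) by (intro mult_left_mono) auto
    finally show "DD (s - 1) z * (kp z * sqrt (1 + tm z)) \<le> BB s z" .
  qed
qed auto

lemma small0: "n \<le> 2 * M \<Longrightarrow> H n U \<preceq> kp" "n \<le> 2 * M \<Longrightarrow> H n Th \<preceq> kp" "n \<le> 2 * M \<Longrightarrow> H n A \<preceq> kp"
    "n \<le> 2 * M - 3 \<Longrightarrow> H n KF \<preceq> kp"
  using small_U[of 0 n] small_Th[of 0 n] small_A[of 0 n] small_K[of 0 n] by (simp_all add: nK_def)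

lemma small_A_top: "H (2*M+1) A \<preceq> (\<lambda>z. kp z * sqrt (1 + tm z))"
proof -
  have "A = (\<lambda>z t x. pa (KF z t x))" by (simp add: A_def[abs_def] aK_pa)
  then show ?thesis using H_linear[OF bl_pa fam_fields(4) small_K_top] by simp
qed

lemma est_conv_U:
  assumes "1 \<le> s" "s \<le> 2 * M"
  shows "H (s - 1) (\<lambda>z. conv (tT z) (U z) (U z)) \<preceq> KD s"
    and "H (s - 1) (\<lambda>z. conv (tT z) (U z) (Th z)) \<preceq> KD s"
    and "H (s - 1) (\<lambda>z. conv (tT z) (U z) (A z)) \<preceq> KD s"
proof -
  show "H (s - 1) (\<lambda>z. conv (tT z) (U z) (U z)) \<preceq> KD s"
    by (rule H_conv[where a="2*M" and b="s+1"]) (use assms M in \<open>auto intro!: lss_mult_KD small0 DD_U\<close>)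
  show "H (s - 1) (\<lambda>z. conv (tT z) (U z) (Th z)) \<preceq> KD s"
    by (rule H_conv[where a="2*M" and b="s+1"]) (use assms M in \<open>auto intro!: lss_mult_KD small0 DD_Th\<close>)
  show "H (s - 1) (\<lambda>z. conv (tT z) (U z) (A z)) \<preceq> KD s"
    by (rule H_conv[where a="s+1" and b="2*M"]) (use assms M in \<open>auto intro!: lss_mult_KD' small0 DD_U\<close>)
qed

lemma est_ThK_low:
  assumes "bounded_bilinear B" "n \<le> s + 1" "n \<le> 2 * M - 3"
  shows "H n (\<lambda>z t x. B (Th z t x) (KF z t x)) \<preceq> KD s"
  using assms M
  by (intro H_bilinear[where a="s+1" and b="2*M-3"] lss_mult_KD' small0 DD_Th) auto

lemma est_ThK:
  assumes B: "bounded_bilinear B" and s: "1 \<le> s" "s \<le> 2 * M" and n: "n \<le> s + 1"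
  shows "H n (\<lambda>z t x. B (Th z t x) (KF z t x)) \<preceq> BB s"
proof (cases "n \<le> 2 * M - 3")
  case True
  then show ?thesis using est_ThK_low[OF B n] KD_BB lss_trans by blast
next
  case False
  have BB: "(\<lambda>z. H (s+1) Th z * H (2*M-3) KF z) \<preceq> BB s"
    by (rule lss_trans[OF lss_mult_KD' KD_BB]) (auto intro!: small0 DD_Th)
  have top: "(\<lambda>z. H s Th z * H (2*M+1) KF z) \<preceq> BB s"
    by (rule lss_mult_BB) (use False n M in \<open>auto intro!: DD_Th small_K_top[simplified]\<close>)
  show ?thesis
    by (rule H_bilinear2[OF B _ _ _ _ _ BB top]) (use s n M in auto)
qed

definition Mt :: "inst \<Rightarrow> real \<Rightarrow> real^3 \<Rightarrow> real^3" where
  "Mt z = mat_der (tT z) (fu z) (fh z)"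

definition N1 :: "inst \<Rightarrow> real \<Rightarrow> real^3 \<Rightarrow> real^3" where
  "N1 z = (\<lambda>t x. cross3 w (KF z t x *v Th z t x) + cross3 (Th z t x) (KF z t x *v w)
     + cross3 (Th z t x) (J *v Th z t x) + cross3 (Th z t x) (KF z t x *v Th z t x))"

definition KM :: "inst \<Rightarrow> real \<Rightarrow> real^3 \<Rightarrow> real^3" where
  "KM z = (\<lambda>t x. KF z t x *v Mt z t x)"

lemma bb_vm: "bounded_bilinear (\<lambda>(v::real^3) (A::real^3^3). A *v v)"
  by (rule bounded_bilinear.flip[OF bounded_bilinear_mv])

lemma bl_mv: "bounded_linear (\<lambda>A::real^3^3. A *v v)"
  by (rule bounded_bilinear.bounded_linear_left[OF bounded_bilinear_mv])

lemma bl_cross: "bounded_linear (cross3 v)"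
  by (rule bounded_bilinear.bounded_linear_right[OF bounded_bilinear_cross3])

lemma bb_cross_mv: "bounded_bilinear (\<lambda>v (A::real^3^3). cross3 v (A *v b))"
  by (rule bounded_bilinear.comp[OF bounded_bilinear_cross3 bounded_linear_ident bl_mv])

lemma bb_cross_J: "bounded_bilinear (\<lambda>v b. cross3 v (J *v b))"
  by (rule bounded_bilinear.comp[OF bounded_bilinear_cross3 bounded_linear_ident bl_Jeq])

lemma fam_Mt [simp]: "fam Mt"
  unfolding Mt_def[abs_def] mat_der_def by (intro fam_add fam_pder fam_conv) auto

lemma fam_g: "fam (\<lambda>z t x. KF z t x *v Th z t x)"
  by (intro fam_bilinear[OF bounded_bilinear_mv]) auto

lemma fam_KM [simp]: "fam KM"
  unfolding KM_def[abs_def] by (intro fam_bilinear[OF bounded_bilinear_mv]) auto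

lemma fam_N1 [simp]: "fam N1"
  unfolding N1_def[abs_def]
  by (intro fam_add fam_linear[OF bl_cross] fam_g fam_bilinear[OF bb_cross_mv] fam_bilinear[OF bb_cross_J]
      fam_bilinear[OF bounded_bilinear_cross3]) auto

lemma est_N1:
  assumes n: "n \<le> s - 1" "n \<le> 2 * M"
    and B: "\<And>B. bounded_bilinear B \<Longrightarrow> H n (\<lambda>z t x. B (Th z t x) (KF z t x) :: real^3) \<preceq> Z"
    and Z: "KD s \<preceq> Z" "\<And>z. z \<in> Sol \<Longrightarrow> 0 \<le> Z z"
  shows "H n N1 \<preceq> Z"
proof -
  have g: "H n (\<lambda>z t x. KF z t x *v Th z t x) \<preceq> Z" by (rule B[OF bb_vm])
  have JJ: "H n (\<lambda>z t x. cross3 (Th z t x) (J *v Th z t x)) \<preceq> Z"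
    by (rule lss_trans[OF _ Z(1)], rule H_bilinear[OF bb_cross_J, where a="2*M" and b="s+1"])
       (use n M in \<open>auto intro!: lss_mult_KD small0 DD_Th\<close>)
  have t: "(\<lambda>z. H (2*M) Th z * H n (\<lambda>z t x. KF z t x *v Th z t x) z) \<preceq> Z"
    by (rule lss_mult[OF small0(2) g _ _ kp_le]) (auto simp: Z)
  have tri: "H n (\<lambda>z t x. cross3 (Th z t x) (KF z t x *v Th z t x)) \<preceq> Z"
    by (rule H_bilinear[OF bounded_bilinear_cross3 _ fam_g _ _ _ t]) (use n M in auto)
  show ?thesis
    unfolding N1_def[abs_def]
    by (intro H_add fam_add fam_linear[OF bl_cross] fam_g fam_bilinear[OF bb_cross_mv] fam_bilinear[OF bb_cross_J]
      fam_bilinear[OF bounded_bilinear_cross3] H_linear[OF bl_cross] g JJ tri B[OF bb_cross_mv]) auto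
qed

definition RL :: "inst \<Rightarrow> real \<Rightarrow> real^3 \<Rightarrow> real^3" where
  "RL z = (\<lambda>t x. Lth (tT z) (U z) (Th z) t x - L0 tt lam nu (Th z t x) - tt\<^sup>2 *\<^sub>R Rv (A z t x))"

lemma fam_Lth [simp]: "fam (\<lambda>z. Lth (tT z) (U z) (Th z))"
  unfolding Lth_def by (intro fam_add fam_diff fam_scaleR fam_lin1 fam_lap) auto

lemma fam_RL [simp]: "fam RL"
  unfolding RL_def[abs_def]
  by (intro fam_diff fam_scaleR fam_linear[OF bl_L0] fam_linear[OF bl_Rv]) auto

lemma est_Lth: "H (n + 2) Th \<preceq> Z \<Longrightarrow> H (n + 1) U \<preceq> Z \<Longrightarrow> H n (\<lambda>z. Lth (tT z) (U z) (Th z)) \<preceq> Z"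
  unfolding Lth_def
  by (intro H_add H_diff H_scaleR H_lin1 H_lap fam_add fam_diff fam_scaleR fam_lin1 fam_lap bl_ops fam_fields)
     (auto intro: H_mono simp: numeral_2_eq_2)

lemma est_RL:
  assumes "1 \<le> s"
  shows "H (s - 1) RL \<preceq> DD s"
  unfolding RL_def[abs_def] using assms
  by (intro H_diff H_scaleR fam_diff fam_scaleR fam_linear[OF bl_L0] fam_linear[OF bl_Rv]
      H_linear[OF bl_L0] H_linear[OF bl_Rv] fam_Lth est_Lth fam_fields DD_U DD_Th DD_A) auto

lemma Mt_eq: "feq Mt (\<lambda>z t x. Jeq (1/lam) (1/nu) *v (RL z t x - N1 z t x - KM z t x))"
  unfolding feq_def eqT_def
proof (intro ballI allI)
  fix z t x assume z: "z \<in> Sol" and t: "t \<in> {0..tT z}"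
  have "J *v pder (tT z) Dt (fh z) t x = RL z t x - Nth (tT z) (fu z) (fh z) (fK z) t x"
    using eqTD[OF sol_th[OF Sol_sol[OF z]] t] by (simp add: RL_def A_def)
  then have "J *v Mt z t x = RL z t x - N1 z t x - KM z t x"
    by (simp add: Mt_def KM_def N1_def mat_der_def Nth_def matrix_vector_right_distrib)
  then show "Mt z t x = Jeq (1/lam) (1/nu) *v (RL z t x - N1 z t x - KM z t x)"
    using Jeq_inverse[OF lam nu, of "Mt z t x"] by simp
qed

lemma Mt_split:
  assumes "H n RL \<preceq> Z" "H n N1 \<preceq> Z" "H n KM \<preceq> Z"
  shows "H n Mt \<preceq> Z"
  by (rule H_cong[OF Mt_eq]) (intro H_linear[OF bl_Jeq] H_diff fam_diff assms fam_RL fam_N1 fam_KM)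

lemma est_Mt_low:
  assumes s: "1 \<le> s" "s \<le> 2 * M - 2"
  shows "H (s - 1) Mt \<preceq> DD s"
proof (rule lss_absorb)
  let ?Z = "\<lambda>z. DD s z + kp z * H (s - 1) Mt z"
  have DZ: "DD s \<preceq> ?Z" by (rule lss_le) auto
  have "H (s - 1) N1 \<preceq> DD s"
    by (rule est_N1[where s=s]) (use s M in \<open>auto intro!: KD_DD lss_trans[OF est_ThK_low KD_DD]\<close>)
  moreover have "H (s - 1) KM \<preceq> ?Z"
    unfolding KM_def[abs_def]
  proof (rule H_bilinear[OF bounded_bilinear_mv, where a="2*M-3" and b="s-1"])
    show "(\<lambda>z. H (2*M-3) KF z * H (s - 1) Mt z) \<preceq> ?Z"
      by (rule lss_mult[OF small0(4) lss_refl]) (auto intro!: lss_le)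
  qed (use s M in auto)
  ultimately show "H (s - 1) Mt \<preceq> ?Z"
    using est_RL[OF s(1)] DZ lss_trans by (intro Mt_split) blast+
qed simp

lemma est_KM_split:
  assumes s: "2 \<le> s" "s \<le> 2 * M"
  shows "H (s - 1) KM \<preceq> (\<lambda>z. BB s z + kp z * H (s - 1) Mt z)"
proof (cases "s \<le> 2 * M - 2")
  case True
  show ?thesis unfolding KM_def[abs_def]
  proof (rule H_bilinear[OF bounded_bilinear_mv, where a="2*M-3" and b="s-1"])
    show "(\<lambda>z. H (2*M-3) KF z * H (s - 1) Mt z) \<preceq> (\<lambda>z. BB s z + kp z * H (s - 1) Mt z)"
      by (rule lss_mult[OF small0(4) lss_refl]) (auto intro!: lss_le)
  qed (use s M True in auto)
next
  case False
  have 1: "(\<lambda>z. H (s - 1) Mt z * H (2*M-3) KF z) \<preceq> (\<lambda>z. BB s z + kp z * H (s - 1) Mt z)"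
    by (rule lss_mult[OF lss_refl small0(4)]) (auto intro!: lss_le simp: mult.commute)
  have "H (s - 4) Mt \<preceq> DD (s - 1)"
  proof (rule lss_trans[OF _ DD_mono])
    show "H (s - 4) Mt \<preceq> DD (s - 3)"
      using est_Mt_low[of "s - 3"] False s M by simp
  qed simp
  then have "(\<lambda>z. H (s - 4) Mt z * H (2*M+1) KF z) \<preceq> BB s"
    by (intro lss_mult_BB small_K_top) (use False M in auto)
  then have 2: "(\<lambda>z. H (s - 4) Mt z * H (2*M+1) KF z) \<preceq> (\<lambda>z. BB s z + kp z * H (s - 1) Mt z)"
    by (rule lss_trans) (auto intro!: lss_le)
  have cov: "(j \<le> s - 1 \<and> s - 1 - j \<le> 2*M-3) \<or> (j \<le> s - 4 \<and> s - 1 - j \<le> 2*M+1)" if "j \<le> s - 1" for j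
    using that s M False by linarith
  show ?thesis unfolding KM_def[abs_def]
    by (rule H_bilinear2[OF bb_vm _ _ cov _ _ 1 2]) (use s M False in auto)
qed

lemma est_Mt:
  assumes s: "2 \<le> s" "s \<le> 2 * M"
  shows "H (s - 1) Mt \<preceq> (\<lambda>z. DD s z + BB s z)"
proof (rule lss_absorb)
  let ?Z = "\<lambda>z. DD s z + BB s z + kp z * H (s - 1) Mt z"
  have DZ: "DD s \<preceq> ?Z" "BB s \<preceq> ?Z" "(\<lambda>z. BB s z + kp z * H (s - 1) Mt z) \<preceq> ?Z" by (rule lss_le; auto)+
  have N: "H (s - 1) N1 \<preceq> BB s"
    by (rule est_N1[where s=s]) (use s M in \<open>auto intro!: KD_BB est_ThK\<close>)
  show "H (s - 1) Mt \<preceq> ?Z"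
    using s by (intro Mt_split lss_trans[OF est_RL DZ(1)] lss_trans[OF N DZ(2)] lss_trans[OF est_KM_split[OF s] DZ(3)]) auto
qed simp

lemma est_KM:
  assumes s: "2 \<le> s" "s \<le> 2 * M"
  shows "H (s - 1) KM \<preceq> BB s"
proof (rule lss_trans[OF est_KM_split[OF s]], rule lss_add)
  show "(\<lambda>z. kp z * H (s - 1) Mt z) \<preceq> BB s"
  proof (rule lss_mult[OF lss_refl est_Mt[OF s]])
    show "(\<lambda>z. kp z * (DD s z + BB s z)) \<preceq> BB s"
    proof (rule lssI[of 2])
      fix z assume z: "z \<in> Sol"
      have "kp z * DD s z \<le> BB s z" unfolding BB_def using z by (intro mult_left_mono) auto
      moreover have "kp z * BB s z \<le> BB s z" using z by (intro mult_left_le_one_le) auto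
      ultimately show "kp z * (DD s z + BB s z) \<le> 2 * BB s z" by (simp add: distrib_left)
    qed simp
  qed auto
qed simp

definition NT :: "inst \<Rightarrow> real \<Rightarrow> real^3 \<Rightarrow> real^3" where
  "NT z = Nth (tT z) (fu z) (fh z) (fK z)"

lemma NT_eq: "NT = (\<lambda>z t x. KM z t x + J *v conv (tT z) (U z) (Th z) t x + N1 z t x)"
  by (simp add: NT_def Nth_def KM_def N1_def Mt_def fun_eq_iff add_ac)

lemma fam_NT [simp]: "fam NT"
  unfolding NT_eq by (intro fam_add fam_linear[OF bl_Jeq] fam_conv) auto

lemma est_NT:
  assumes s: "2 \<le> s" "s \<le> 2 * M"
  shows "H (s - 1) NT \<preceq> BB s"
proof -
  have "H (s - 1) N1 \<preceq> BB s"
    by (rule est_N1[where s=s]) (use s M in \<open>auto intro!: KD_BB est_ThK\<close>)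
  moreover have "H (s - 1) (\<lambda>z. conv (tT z) (U z) (Th z)) \<preceq> BB s"
    using est_conv_U(2)[of s] s KD_BB lss_trans by auto
  ultimately show ?thesis unfolding NT_eq using s
    by (intro H_add fam_add fam_linear[OF bl_Jeq] fam_conv H_linear[OF bl_Jeq] est_KM fam_KM fam_N1 fam_fields)
qed

definition NA :: "inst \<Rightarrow> real \<Rightarrow> real^3 \<Rightarrow> real^2" where
  "NA z = (\<lambda>t x. pa (com (Th z t x) (KF z t x)))"

lemma bb_pa_com: "bounded_bilinear (\<lambda>v A. pa (com v A))"
proof -
  interpret bounded_bilinear com by (rule bounded_bilinear_com)
  interpret p: bounded_linear pa by (rule bl_pa)
  show ?thesis
    by (rule bilinear_bounded)
       (auto simp: bilinear_def intro!: linearI simp: add_left add_right scaleR_left scaleR_right p.add p.scaleR)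
qed

lemma fam_NA [simp]: "fam NA"
  unfolding NA_def[abs_def] by (intro fam_bilinear[OF bb_pa_com]) auto

lemma est_NA:
  assumes "1 \<le> s" "s \<le> 2 * M" "n \<le> s + 1"
  shows "H n NA \<preceq> BB s"
  unfolding NA_def[abs_def] by (rule est_ThK[OF bb_pa_com assms])

text \<open>Both the commutators and their first derivatives, since one derivative is moved off the other factor.\<close>

lemma est_comm:
  fixes F :: "inst \<Rightarrow> real \<Rightarrow> real^3 \<Rightarrow> 'a::euclidean_space"
  assumes F: "fam F" and cov: "\<And>j. 1 \<le> j \<Longrightarrow> j \<le> n \<Longrightarrow> (j \<le> a1 \<and> Suc n - j \<le> b1) \<or> (j \<le> a2 \<and> Suc n - j \<le> b2)"
    and ab: "n + 4 \<le> a1 + b1" "n + 4 \<le> a2 + b2" "1 \<le> b1" "1 \<le> b2"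
    and Z: "(\<lambda>z. H a1 U z * H b1 F z) \<preceq> Z" "(\<lambda>z. H a2 U z * H b2 F z) \<preceq> Z"
    and ds: "set es \<subseteq> range Dx" "set ds \<subseteq> range Dx" "length es + length ds \<le> n"
  shows "(\<lambda>z. L2n (pders (tT z) es (comm (tT z) ds (U z) (F z)) (tm z))) \<preceq> Z"
proof -
  obtain C where C: "C \<ge> 0" "\<And>T u (v :: real \<Rightarrow> real^3 \<Rightarrow> 'a) t es ds. smper T u \<Longrightarrow> smper T v \<Longrightarrow> t \<in> {0..T} \<Longrightarrow>
    set es \<subseteq> range Dx \<Longrightarrow> set ds \<subseteq> range Dx \<Longrightarrow> length es + length ds \<le> n \<Longrightarrow>
    L2n (pders T es (comm T ds u v) t) \<le> C * (hn T a1 u t * hn T b1 v t + hn T a2 u t * hn T b2 v t)"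
    using comm_tame[OF cov ab, simplified, where 'a='a] apply (elim exE conjE)
    subgoal for C by (rule that[of C]) auto
    done
  have "(\<lambda>z. L2n (pders (tT z) es (comm (tT z) ds (U z) (F z)) (tm z))) \<preceq> (\<lambda>z. H a1 U z * H b1 F z + H a2 U z * H b2 F z)"
    by (rule lssI[OF C(1)], unfold H_def) (rule C(2)[OF famD[OF fam_fields(1)] famD[OF F] Sol_tm ds])
  then show ?thesis using lss_add[OF Z] lss_trans by blast
qed

lemma est_comm_A:
  assumes s: "2 \<le> s" "s \<le> 2 * M" and ds: "set es \<subseteq> range Dx" "set ds \<subseteq> range Dx" "length es + length ds \<le> s + 1"
  shows "(\<lambda>z. L2n (pders (tT z) es (comm (tT z) ds (U z) (A z)) (tm z))) \<preceq> BB s"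
proof -
  have 1: "(\<lambda>z. H (s + 1) U z * H (2*M) A z) \<preceq> BB s"
    by (rule lss_trans[OF lss_mult_KD' KD_BB]) (auto intro!: small0 DD_U)
  show ?thesis
  proof (cases "s \<le> 2 * M - 1")
    case True
    show ?thesis by (rule est_comm[OF _ _ _ _ _ _ 1 1 ds]) (use s M True in auto)
  next
    case False
    have 2: "(\<lambda>z. H s U z * H (2*M+1) A z) \<preceq> BB s"
      by (rule lss_mult_BB) (use False M in \<open>auto intro!: DD_U small_A_top[simplified]\<close>)
    show ?thesis by (rule est_comm[OF _ _ _ _ _ _ 1 2 ds]) (use s M False in auto)
  qed
qed

end


section \<open>Energy estimates\<close>

context par
begin

definition ca where "ca = tt\<^sup>2 / (nu - lam)"

lemma ca_pos: "ca > 0"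
  using tt_pos nu by (simp add: ca_def)

definition Gr :: "real \<Rightarrow> (real \<Rightarrow> real^3 \<Rightarrow> 'a::euclidean_space) \<Rightarrow> real \<Rightarrow> real" where
  "Gr T v t = (\<Sum>i\<in>UNIV. L2sq (pder T (Dx i) v t))"

lemma Gr_nonneg [simp]: "0 \<le> Gr T v t"
  by (simp add: Gr_def sum_nonneg)

definition c0 where "c0 = min (mu / 2) (min (2 * kappa * mu / (kappa + mu)) (min at' gt))"

lemma c0_pos: "c0 > 0"
  using mu kappa alpha beta gamma by (simp add: c0_def at'_def gt_def)

lemma dissipation:
  assumes v: "smper T v" and \<phi>: "smper T \<phi>" and t: "t \<in> {0..T}"
  shows "ip (Lu T v \<phi> t) (v t) + ip (Lth T v \<phi> t) (\<phi> t) \<le> - c0 * (Gr T v t + L2sq (\<phi> t) + Gr T \<phi> t)"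
proof -
  note c = smper_cper[OF _ t] smper_lap smper_lin1 bl_ops v \<phi>
  have cc: "cper (lap T v t)" "cper (lap T \<phi> t)" "cper (lin1 T curlL v t)" "cper (lin1 T curlL \<phi> t)"
    "cper (lin1 T gradL (lin1 T divL \<phi>) t)" "cper (v t)" "cper (\<phi> t)" "cper (lin1 T divL \<phi> t)"
    by (intro c)+
  have 1: "ip (Lu T v \<phi> t) (v t) = - mb * Gr T v t + kappa * ip (lin1 T curlL v t) (\<phi> t)"
    unfolding Lu_def
    by (simp add: ip_add_left cc cper_scaleR ip_lap[OF v t] ip_curl[OF \<phi> v t] Gr_def ip_commute[of "\<phi> t"])
  have "ip (lin1 T gradL (lin1 T divL \<phi>) t) (\<phi> t) = - L2sq (lin1 T divL \<phi> t)"
    by (simp add: ip_grad[OF smper_lin1[OF bl_ops(2) \<phi>] \<phi> t] L2sq_ip)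
  then have 2: "ip (Lth T v \<phi> t) (\<phi> t) = kappa * ip (lin1 T curlL v t) (\<phi> t) - 2 * kappa * L2sq (\<phi> t)
      - (at' - gt) * L2sq (lin1 T divL \<phi> t) - gt * Gr T \<phi> t"
    unfolding Lth_def
    by (simp add: ip_add_left ip_diff_left cc cper_scaleR cper_add cper_diff ip_lap[OF \<phi> t] Gr_def L2sq_ip[of "\<phi> t"])
  have cv: "L2sq (lin1 T curlL v t) \<le> Gr T v t" and d\<phi>: "L2sq (lin1 T divL \<phi> t) \<le> Gr T \<phi> t"
    using curl_div_identity[OF v t] curl_div_identity[OF \<phi> t]
      L2sq_nonneg[of "lin1 T divL v t"] L2sq_nonneg[of "lin1 T curlL \<phi> t"] unfolding Gr_def by linarith+
  define X Y where "X = L2n (lin1 T curlL v t)" and "Y = L2n (\<phi> t)"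
  have XY: "X\<^sup>2 \<le> Gr T v t" "Y\<^sup>2 = L2sq (\<phi> t)" using cv by (simp_all add: X_def Y_def)
  have "ip (lin1 T curlL v t) (\<phi> t) \<le> X * Y"
    using ip_Cauchy_Schwarz[OF cc(3,7)] by (simp add: X_def Y_def)
  then have "2 * kappa * ip (lin1 T curlL v t) (\<phi> t) \<le> 2 * kappa * (X * Y)"
    using kappa by (intro mult_left_mono) auto
  also have "\<dots> \<le> (kappa + mu) / 2 * X\<^sup>2 + 2 * kappa\<^sup>2 / (kappa + mu) * Y\<^sup>2"
  proof -
    have km: "kappa + mu > 0" using kappa mu by simp
    have "0 \<le> ((kappa + mu) * X - 2 * kappa * Y)\<^sup>2 / (2 * (kappa + mu))" using km by simp
    also have "\<dots> = (kappa + mu) / 2 * X\<^sup>2 + 2 * kappa\<^sup>2 / (kappa + mu) * Y\<^sup>2 - 2 * kappa * (X * Y)"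
      using km by (simp add: power2_eq_square field_simps)
    finally show ?thesis by simp
  qed
  also have "\<dots> \<le> (kappa + mu) / 2 * Gr T v t + 2 * kappa\<^sup>2 / (kappa + mu) * L2sq (\<phi> t)"
    unfolding XY(2)[symmetric] using kappa mu by (intro add_mono mult_left_mono XY(1)) auto
  finally have 3: "2 * kappa * ip (lin1 T curlL v t) (\<phi> t)
      \<le> (kappa + mu) / 2 * Gr T v t + 2 * kappa\<^sup>2 / (kappa + mu) * L2sq (\<phi> t)" .
  have 4: "- (at' - gt) * L2sq (lin1 T divL \<phi> t) - gt * Gr T \<phi> t \<le> - min at' gt * Gr T \<phi> t"
  proof (cases "gt \<le> at'")
    case True
    then have "0 \<le> (at' - gt) * L2sq (lin1 T divL \<phi> t)" by simp
    then show ?thesis using True by (simp add: min_def algebra_simps)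
  next
    case False
    then have "(gt - at') * L2sq (lin1 T divL \<phi> t) \<le> (gt - at') * Gr T \<phi> t"
      by (intro mult_left_mono d\<phi>) simp
    then show ?thesis using False by (simp add: min_def algebra_simps)
  qed
  have 5: "2 * kappa\<^sup>2 / (kappa + mu) - 2 * kappa = - (2 * kappa * mu / (kappa + mu))"
    using kappa mu by (simp add: field_simps power2_eq_square)
  have le: "c0 * Gr T v t \<le> mu / 2 * Gr T v t" "c0 * L2sq (\<phi> t) \<le> 2 * kappa * mu / (kappa + mu) * L2sq (\<phi> t)"
    "c0 * Gr T \<phi> t \<le> min at' gt * Gr T \<phi> t"
    by (intro mult_right_mono; simp add: c0_def min_def)+
  have "ip (Lu T v \<phi> t) (v t) + ip (Lth T v \<phi> t) (\<phi> t) \<le>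
     - mb * Gr T v t + ((kappa + mu) / 2 * Gr T v t + 2 * kappa\<^sup>2 / (kappa + mu) * L2sq (\<phi> t))
      - 2 * kappa * L2sq (\<phi> t) - min at' gt * Gr T \<phi> t"
    using 1 2 3 4 by linarith
  note main = this
  have eq0: "- mb * g + ((kappa + mu) / 2 * g + r * l) - 2 * kappa * l = - (mu / 2 * g) + (r - 2 * kappa) * l" for g l r
    by (simp add: mb_def field_simps)
  note eq = eq0[of "Gr T v t" "2 * kappa\<^sup>2 / (kappa + mu)" "L2sq (\<phi> t)"]
  have "ip (Lu T v \<phi> t) (v t) + ip (Lth T v \<phi> t) (\<phi> t) \<le> - (mu / 2 * Gr T v t)
      + (2 * kappa\<^sup>2 / (kappa + mu) - 2 * kappa) * L2sq (\<phi> t) - min at' gt * Gr T \<phi> t"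
    using main eq by linarith
  then show ?thesis unfolding 5 using le by (simp add: distrib_left)
qed

lemma pders_Lu:
  assumes u: "smper T u" and h: "smper T h"
  shows "eqT T (pders T ds (Lu T u h)) (Lu T (pders T ds u) (pders T ds h))"
  using pders_add[OF smper_scaleR[OF smper_lap[OF u], of mb] smper_scaleR[OF smper_lin1[OF bl_ops(1) h], of kappa], of ds]
    pders_scaleR[OF smper_lap[OF u], of ds mb] pders_scaleR[OF smper_lin1[OF bl_ops(1) h], of ds kappa]
    pders_lap[OF u, of ds] pders_lin1[OF bl_ops(1) h, of ds]
  by (simp add: eqT_def Lu_def)

lemma smper_Lu: "smper T u \<Longrightarrow> smper T h \<Longrightarrow> smper T (Lu T u h)"
  unfolding Lu_def by (intro smper_add smper_scaleR smper_lap smper_lin1 bl_ops)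

lemma smper_Lth: "smper T u \<Longrightarrow> smper T h \<Longrightarrow> smper T (Lth T u h)"
  unfolding Lth_def by (intro smper_add smper_diff smper_scaleR smper_lap smper_lin1 bl_ops)

lemma pders_Lth:
  assumes u: "smper T u" and h: "smper T h"
  shows "eqT T (pders T ds (Lth T u h)) (Lth T (pders T ds u) (pders T ds h))"
proof -
  let ?gd = "lin1 T gradL (lin1 T divL h)"
  have gd: "smper T ?gd" by (intro smper_lin1 bl_ops h)
  have cu: "smper T (lin1 T curlL u)" by (intro smper_lin1 bl_ops u)
  have "eqT T (pders T ds ?gd) (lin1 T gradL (pders T ds (lin1 T divL h)))"
    by (rule pders_lin1[OF bl_ops(3) smper_lin1[OF bl_ops(2) h]])
  also have "eqT T \<dots> (lin1 T gradL (lin1 T divL (pders T ds h)))"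
    by (rule lin1_cong[OF pders_lin1[OF bl_ops(2) h]])
  finally have 1: "eqT T (pders T ds ?gd) (lin1 T gradL (lin1 T divL (pders T ds h)))" .
  note s = smper_scaleR[OF cu, of kappa] smper_scaleR[OF h, of "2*kappa"] smper_scaleR[OF gd, of "at' - gt"]
    smper_scaleR[OF smper_lap[OF h], of gt]
  show ?thesis
    using 1 pders_add[OF smper_add[OF smper_diff[OF s(1,2)] s(3)] s(4), of ds]
      pders_add[OF smper_diff[OF s(1,2)] s(3), of ds] pders_diff[OF s(1,2), of ds]
      pders_scaleR[OF cu, of ds kappa] pders_scaleR[OF h, of ds "2*kappa"] pders_scaleR[OF gd, of ds "at' - gt"]
      pders_scaleR[OF smper_lap[OF h], of ds gt] pders_lap[OF h, of ds] pders_lin1[OF bl_ops(1) u, of ds]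
    by (simp add: eqT_def Lth_def)
qed

definition ee where
  "ee T ds u \<theta> K t = 1/2 * ip (pders T ds u t) (pders T ds u t)
     + 1/2 * ip (\<lambda>x. J *v pders T ds \<theta> t x) (pders T ds \<theta> t)
     + ca/2 * ip (pders T ds (aK K) t) (pders T ds (aK K) t)"

definition ed where
  "ed T ds u \<theta> K t = ip (pders T ds (pder T Dt u) t) (pders T ds u t)
     + ip (\<lambda>x. J *v pders T ds (pder T Dt \<theta>) t x) (pders T ds \<theta> t)
     + ca * ip (pders T ds (pder T Dt (aK K)) t) (pders T ds (aK K) t)"

definition xx where
  "xx T ds \<theta> K t = ip (\<lambda>x. J *v pders T ds \<theta> t x) (\<lambda>x. Rv (pders T ds (aK K) t x))"

definition xd where
  "xd T ds \<theta> K t = ip (\<lambda>x. J *v pders T ds (pder T Dt \<theta>) t x) (\<lambda>x. Rv (pders T ds (aK K) t x))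
     + ip (\<lambda>x. J *v pders T ds \<theta> t x) (\<lambda>x. Rv (pders T ds (pder T Dt (aK K)) t x))"

lemma pder_Dt_pders:
  fixes f :: "real \<Rightarrow> real^3 \<Rightarrow> 'a::euclidean_space"
  shows "smper T f \<Longrightarrow> t \<in> {0..T} \<Longrightarrow> pder T Dt (pders T ds f) t = pders T ds (pder T Dt f) t"
  by (rule eqT_fun[OF eqT_sym[OF pders_pder_commute]])

lemma pder_Dt_linear_pders:
  fixes f :: "real \<Rightarrow> real^3 \<Rightarrow> 'a::euclidean_space" and L :: "'a \<Rightarrow> 'b::euclidean_space"
  assumes L: "bounded_linear L" and f: "smper T f" and t: "t \<in> {0..T}"
  shows "pder T Dt (\<lambda>t x. L (pders T ds f t x)) t = (\<lambda>x. L (pders T ds (pder T Dt f) t x))"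
proof -
  have "pder T Dt (\<lambda>t x. L (pders T ds f t x)) t = (\<lambda>x. L (pder T Dt (pders T ds f) t x))"
    using smper_pders[OF f, of ds] by (intro eqT_fun[OF pder_linear[OF L] t]) (auto simp: smper_def)
  then show ?thesis using pder_Dt_pders[OF f t, of ds] by simp
qed

context
  fixes T u p \<theta> K assumes sol: "sol T u p \<theta> K"
begin

lemmas sm = sol_smper[OF sol]

lemma ee_derivative:
  assumes t: "t \<in> {0..T}"
  shows "((\<lambda>t. ee T ds u \<theta> K t) has_real_derivative ed T ds u \<theta> K t) (at t within {0..T})"
proof -
  note P = smper_pders[OF sm(1), of ds] smper_pders[OF sm(3), of ds] smper_pders[OF sm(5), of ds]
  have JP: "smper T (\<lambda>t x. J *v pders T ds \<theta> t x)" by (rule smper_linear[OF bl_Jeq P(2)])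
  have sym: "ip (\<lambda>x. J *v \<phi> x) \<psi> = ip \<phi> (\<lambda>x. J *v \<psi> x)" for \<phi> \<psi> :: "real^3 \<Rightarrow> real^3"
    by (simp add: ip_def Jeq_inner_sym)
  have d1: "((\<lambda>t. ip (pders T ds u t) (pders T ds u t)) has_real_derivative
      2 * ip (pders T ds (pder T Dt u) t) (pders T ds u t)) (at t within {0..T})"
    using ip_has_derivative[OF P(1) P(1) t] pder_Dt_pders[OF sm(1) t, of ds]
      ip_commute[of "pders T ds u t"] by simp
  have d3: "((\<lambda>t. ip (pders T ds (aK K) t) (pders T ds (aK K) t)) has_real_derivative
      2 * ip (pders T ds (pder T Dt (aK K)) t) (pders T ds (aK K) t)) (at t within {0..T})"
    using ip_has_derivative[OF P(3) P(3) t] pder_Dt_pders[OF sm(5) t, of ds]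
      ip_commute[of "pders T ds (aK K) t"] by simp
  have d2: "((\<lambda>t. ip (\<lambda>x. J *v pders T ds \<theta> t x) (pders T ds \<theta> t)) has_real_derivative
      2 * ip (\<lambda>x. J *v pders T ds (pder T Dt \<theta>) t x) (pders T ds \<theta> t)) (at t within {0..T})"
    using ip_has_derivative[OF JP P(2) t] pder_Dt_pders[OF sm(3) t, of ds]
      pder_Dt_linear_pders[OF bl_Jeq sm(3) t, of lam nu ds]
      sym[of "pders T ds \<theta> t" "pders T ds (pder T Dt \<theta>) t"]
      ip_commute[of "pders T ds \<theta> t" "\<lambda>x. J *v pders T ds (pder T Dt \<theta>) t x"] by simp
  show ?thesis unfolding ee_def ed_def
    by (rule DERIV_cong[OF DERIV_add[OF DERIV_add[OF DERIV_cmult[OF d1] DERIV_cmult[OF d2]] DERIV_cmult[OF d3]]]) simp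
qed

lemma xx_derivative:
  assumes t: "t \<in> {0..T}"
  shows "((\<lambda>t. xx T ds \<theta> K t) has_real_derivative xd T ds \<theta> K t) (at t within {0..T})"
proof -
  note P = smper_pders[OF sm(3), of ds] smper_pders[OF sm(5), of ds]
  show ?thesis unfolding xx_def xd_def
    using ip_has_derivative[OF smper_linear[OF bl_Jeq[of lam nu] P(1)] smper_linear[OF bl_Rv P(2)] t]
      pder_Dt_linear_pders[OF bl_Jeq sm(3) t, of lam nu ds] pder_Dt_linear_pders[OF bl_Rv sm(5) t, of ds] by simp
qed

lemma pders_sol_u:
  assumes t: "t \<in> {0..T}"
  shows "pders T ds (pder T Dt u) t x = Lu T (pders T ds u) (pders T ds \<theta>) t x
    - lin1 T gradL (pders T ds p) t x - pders T ds (conv T u u) t x"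
proof -
  note s = smper_Lu[OF sm(1,3)] smper_lin1[OF bl_ops(3) sm(2)] smper_conv[OF sm(1,1)]
  have "pders T ds (pder T Dt u) t x = pders T ds (\<lambda>t x. Lu T u \<theta> t x - lin1 T gradL p t x - conv T u u t x) t x"
    by (rule eqTD[OF pders_cong[OF sol_u[OF sol]] t])
  then show ?thesis
    using eqTD[OF pders_diff[OF smper_diff[OF s(1,2)] s(3)] t] eqTD[OF pders_diff[OF s(1,2)] t]
      eqTD[OF pders_Lu[OF sm(1,3)] t] eqTD[OF pders_lin1[OF bl_ops(3) sm(2)] t] by simp
qed

lemma smper_Nth: "smper T (Nth T u \<theta> K)"
proof -
  have f: "smper T (mat_der T u \<theta>)"
    unfolding mat_der_def by (intro smper_add smper_pder smper_conv sm)
  show ?thesis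
    unfolding Nth_def
    by (intro smper_add smper_bilinear[OF bounded_bilinear_mv] smper_linear[OF bl_Jeq] smper_linear[OF bl_cross]
        smper_bilinear[OF bb_cross_mv] smper_bilinear[OF bb_cross_J] smper_bilinear[OF bounded_bilinear_cross3] f sm
        smper_conv)
qed

lemma pders_sol_th:
  assumes t: "t \<in> {0..T}"
  shows "J *v pders T ds (pder T Dt \<theta>) t x = Lth T (pders T ds u) (pders T ds \<theta>) t x
    - L0 tt lam nu (pders T ds \<theta> t x) - tt\<^sup>2 *\<^sub>R Rv (pders T ds (aK K) t x) - pders T ds (Nth T u \<theta> K) t x"
proof -
  have R: "bounded_linear (\<lambda>b. tt\<^sup>2 *\<^sub>R Rv b)"
    by (rule bounded_linear_compose[OF bounded_linear_scaleR_right bl_Rv])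
  note s = smper_Lth[OF sm(1,3)] smper_linear[OF bl_L0 sm(3)] smper_linear[OF R sm(5)] smper_Nth
  have "J *v pders T ds (pder T Dt \<theta>) t x = pders T ds (\<lambda>t x. J *v pder T Dt \<theta> t x) t x"
    by (rule eqTD[OF eqT_sym[OF pders_linear[OF bl_Jeq smper_pder[OF sm(3)]]] t])
  also have "\<dots> = pders T ds (\<lambda>t x. Lth T u \<theta> t x - L0 tt lam nu (\<theta> t x) - tt\<^sup>2 *\<^sub>R Rv (aK K t x) - Nth T u \<theta> K t x) t x"
    by (rule eqTD[OF pders_cong[OF sol_th[OF sol]] t])
  finally show ?thesis
    using eqTD[OF pders_diff[OF smper_diff[OF smper_diff[OF s(1,2)] s(3)] s(4)] t]
      eqTD[OF pders_diff[OF smper_diff[OF s(1,2)] s(3)] t] eqTD[OF pders_diff[OF s(1,2)] t]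
      eqTD[OF pders_Lth[OF sm(1,3)] t] eqTD[OF pders_linear[OF bl_L0 sm(3)] t]
      eqTD[OF pders_linear[OF R sm(5)] t] by simp
qed

lemma pders_sol_a:
  assumes t: "t \<in> {0..T}"
  shows "pders T ds (pder T Dt (aK K)) t x = tt *\<^sub>R perp (pders T ds (aK K) t x)
    - (nu - lam) *\<^sub>R hperp (pders T ds \<theta> t x) + pders T ds (\<lambda>t x. pa (com (\<theta> t x) (K t x))) t x
    - pders T ds (conv T u (aK K)) t x"
proof -
  have 1: "bounded_linear (\<lambda>b. tt *\<^sub>R perp b)" "bounded_linear (\<lambda>b. (nu - lam) *\<^sub>R hperp b)"
    by (rule bounded_linear_compose[OF bounded_linear_scaleR_right bl_perp]
        bounded_linear_compose[OF bounded_linear_scaleR_right bl_hperp])+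
  note s = smper_linear[OF 1(1) sm(5)] smper_linear[OF 1(2) sm(3)] smper_bilinear[OF bb_pa_com sm(3,4)] smper_conv[OF sm(1,5)]
  have "pders T ds (pder T Dt (aK K)) t x = pders T ds (\<lambda>t x. tt *\<^sub>R perp (aK K t x) - (nu - lam) *\<^sub>R hperp (\<theta> t x)
    + pa (com (\<theta> t x) (K t x)) - conv T u (aK K) t x) t x"
    by (rule eqTD[OF pders_cong[OF sol_a[OF sol]] t])
  then show ?thesis
    using eqTD[OF pders_diff[OF smper_add[OF smper_diff[OF s(1,2)] s(3)] s(4)] t]
      eqTD[OF pders_add[OF smper_diff[OF s(1,2)] s(3)] t] eqTD[OF pders_diff[OF s(1,2)] t]
      eqTD[OF pders_linear[OF 1(1) sm(5)] t] eqTD[OF pders_linear[OF 1(2) sm(3)] t] by simp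
qed

lemma pders_div: "t \<in> {0..T} \<Longrightarrow> lin1 T divL (pders T ds u) t x = 0"
proof -
  assume t: "t \<in> {0..T}"
  have "eqT T (lin1 T divL u) (\<lambda>t x. 0)" using sol_div(2)[OF sol] by (simp add: eqT_def)
  then have "eqT T (pders T ds (lin1 T divL u)) (pders T ds (\<lambda>t x. 0))" by (rule pders_cong)
  moreover have "eqT T (pders T ds (\<lambda>t x. 0::real)) (\<lambda>t x. 0)"
    using pders_sum[of "{}" T "\<lambda>_ t x. 0::real" ds] sm(6) by simp
  ultimately show ?thesis using pders_lin1[OF bl_ops(2) sm(1), of ds] t by (simp add: eqT_def)
qed

lemma energy_identity:
  assumes t: "t \<in> {0..T}"
  shows "ed T ds u \<theta> K t \<le> - c0 * (Gr T (pders T ds u) t + L2sq (pders T ds \<theta> t) + Gr T (pders T ds \<theta>) t)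
    - ip (pders T ds (conv T u u) t) (pders T ds u t) - ip (pders T ds (Nth T u \<theta> K) t) (pders T ds \<theta> t)
    + ca * ip (pders T ds (\<lambda>t x. pa (com (\<theta> t x) (K t x))) t) (pders T ds (aK K) t)
    - ca * ip (comm T ds u (aK K) t) (pders T ds (aK K) t)"
proof -
  let ?v = "pders T ds u" and ?\<phi> = "pders T ds \<theta>" and ?b = "pders T ds (aK K)"
  let ?NA = "pders T ds (\<lambda>t x. pa (com (\<theta> t x) (K t x)))"
  note s = smper_pders[OF sm(1), of ds] smper_pders[OF sm(3), of ds] smper_pders[OF sm(5), of ds]
    smper_pders[OF sm(2), of ds]
  have cc: "cper (?v t)" "cper (?\<phi> t)" "cper (?b t)" "cper (Lu T ?v ?\<phi> t)" "cper (Lth T ?v ?\<phi> t)"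
    "cper (lin1 T gradL (pders T ds p) t)" "cper (pders T ds (conv T u u) t)"
    "cper (\<lambda>x. L0 tt lam nu (?\<phi> t x))" "cper (\<lambda>x. Rv (?b t x))" "cper (pders T ds (Nth T u \<theta> K) t)"
    "cper (\<lambda>x. perp (?b t x))" "cper (\<lambda>x. hperp (?\<phi> t x))" "cper (?NA t)" "cper (pders T ds (conv T u (aK K)) t)"
    "cper (comm T ds u (aK K) t)" "cper (conv T u ?b t)"
    using s smper_cper[OF smper_Lu[OF s(1,2)] t] smper_cper[OF smper_Lth[OF s(1,2)] t]
      smper_cper[OF smper_lin1[OF bl_ops(3) s(4)] t] smper_cper[OF smper_pders[OF smper_conv[OF sm(1,1)]] t]
      smper_cper[OF smper_linear[OF bl_L0 s(2)] t] smper_cper[OF smper_linear[OF bl_Rv s(3)] t]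
      smper_cper[OF smper_pders[OF smper_Nth] t] smper_cper[OF smper_linear[OF bl_perp s(3)] t]
      smper_cper[OF smper_linear[OF bl_hperp s(2)] t] smper_cper[OF smper_pders[OF smper_bilinear[OF bb_pa_com sm(3,4)]] t]
      smper_cper[OF smper_pders[OF smper_conv[OF sm(1,5)]] t] smper_cper[OF smper_comm[OF sm(1,5)] t]
      smper_cper[OF smper_conv[OF sm(1) s(3)] t] by (auto intro!: smper_cper[OF _ t])
  have 1: "ip (pders T ds (pder T Dt u) t) (?v t) = ip (Lu T ?v ?\<phi> t) (?v t) - ip (pders T ds (conv T u u) t) (?v t)"
  proof -
    have "ip (lin1 T gradL (pders T ds p) t) (?v t) = 0"
      using ip_grad[OF s(4,1) t] pders_div[OF t] by (simp add: ip_def)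
    then show ?thesis
      unfolding pders_sol_u[OF t, abs_def] by (simp add: ip_diff_left cper_diff cc)
  qed
  have 2: "ip (\<lambda>x. J *v pders T ds (pder T Dt \<theta>) t x) (?\<phi> t) = ip (Lth T ?v ?\<phi> t) (?\<phi> t)
      - tt\<^sup>2 * ip (\<lambda>x. Rv (?b t x)) (?\<phi> t) - ip (pders T ds (Nth T u \<theta> K) t) (?\<phi> t)"
  proof -
    have "ip (\<lambda>x. L0 tt lam nu (?\<phi> t x)) (?\<phi> t) = 0" by (simp add: ip_def L0_inner_self)
    then show ?thesis
      unfolding pders_sol_th[OF t, abs_def] by (simp add: ip_diff_left cper_diff cper_scaleR cc)
  qed
  have 3: "ip (pders T ds (pder T Dt (aK K)) t) (?b t) = (nu - lam) * ip (\<lambda>x. Rv (?b t x)) (?\<phi> t)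
      + ip (?NA t) (?b t) - ip (comm T ds u (aK K) t) (?b t)"
  proof -
    have p: "ip (\<lambda>x. perp (?b t x)) (?b t) = 0" by (simp add: ip_def perp_inner_self)
    have h: "ip (\<lambda>x. hperp (?\<phi> t x)) (?b t) = - ip (\<lambda>x. Rv (?b t x)) (?\<phi> t)"
      unfolding ip_def by (subst inner_commute) (simp add: hperp_inner inner_commute)
    have "ip (conv T u ?b t) (?b t) = 0" by (rule ip_conv_zero[OF sm(1) s(3) t sol_div(1)[OF sol t]])
    moreover have "pders T ds (conv T u (aK K)) t = (\<lambda>x. comm T ds u (aK K) t x + conv T u ?b t x)"
      by (simp add: comm_def)
    ultimately have "ip (pders T ds (conv T u (aK K)) t) (?b t) = ip (comm T ds u (aK K) t) (?b t)"
      using ip_add_left[OF cc(15,16,3)] by simp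
    then show ?thesis
      unfolding pders_sol_a[OF t, abs_def]
      by (simp add: ip_diff_left ip_add_left cper_diff cper_add cper_scaleR cc p h)
  qed
  have ca: "ca * (nu - lam) = tt\<^sup>2" using nu by (simp add: ca_def)
  have "ed T ds u \<theta> K t = ip (Lu T ?v ?\<phi> t) (?v t) + ip (Lth T ?v ?\<phi> t) (?\<phi> t)
      + (ca * (nu - lam) - tt\<^sup>2) * ip (\<lambda>x. Rv (?b t x)) (?\<phi> t)
      - ip (pders T ds (conv T u u) t) (?v t) - ip (pders T ds (Nth T u \<theta> K) t) (?\<phi> t)
      + ca * ip (?NA t) (?b t) - ca * ip (comm T ds u (aK K) t) (?b t)"
    unfolding ed_def 1 2 3 by (simp add: algebra_simps)
  then show ?thesis using dissipation[OF s(1,2) t] by (simp add: ca)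
qed

lemma cross_identity:
  assumes t: "t \<in> {0..T}"
  shows "xd T ds \<theta> K t + tt\<^sup>2 * L2sq (pders T ds (aK K) t)
    \<le> (L2n (pders T ds (Lth T u \<theta>) t) + L2n (pders T ds (\<lambda>t x. L0 tt lam nu (\<theta> t x)) t)
        + L2n (pders T ds (Nth T u \<theta> K) t)) * L2n (pders T ds (aK K) t)
     + L2n (pders T ds (\<lambda>t x. J *v \<theta> t x) t) * L2n (pders T ds (\<lambda>t x. Rv (pder T Dt (aK K) t x)) t)"
proof -
  let ?\<phi> = "pders T ds \<theta>" and ?b = "pders T ds (aK K)"
  let ?L = "pders T ds (Lth T u \<theta>)" and ?N = "pders T ds (Nth T u \<theta> K)"
  have L: "pders T ds (\<lambda>t x. L0 tt lam nu (\<theta> t x)) t = (\<lambda>x. L0 tt lam nu (?\<phi> t x))"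
    "pders T ds (\<lambda>t x. J *v \<theta> t x) t = (\<lambda>x. J *v ?\<phi> t x)"
    "pders T ds (\<lambda>t x. Rv (pder T Dt (aK K) t x)) t = (\<lambda>x. Rv (pders T ds (pder T Dt (aK K)) t x))"
    "?L t = Lth T (pders T ds u) ?\<phi> t"
    using eqT_fun[OF pders_linear[OF bl_L0 sm(3)] t] eqT_fun[OF pders_linear[OF bl_Jeq sm(3)] t]
      eqT_fun[OF pders_linear[OF bl_Rv smper_pder[OF sm(5)]] t] eqT_fun[OF pders_Lth[OF sm(1,3)] t] by auto
  have cR: "cper (\<lambda>x. Rv (?b t x))"
    by (rule smper_cper[OF smper_linear[OF bl_Rv smper_pders[OF sm(5)]] t])
  have c: "cper (?L t)" "cper (\<lambda>x. L0 tt lam nu (?\<phi> t x))" "cper (?N t)" "cper (\<lambda>x. J *v ?\<phi> t x)"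
    "cper (\<lambda>x. Rv (pders T ds (pder T Dt (aK K)) t x))"
    using smper_cper[OF smper_pders[OF smper_Lth[OF sm(1,3)]] t] smper_cper[OF smper_linear[OF bl_L0 smper_pders[OF sm(3)]] t]
      smper_cper[OF smper_pders[OF smper_Nth] t] smper_cper[OF smper_linear[OF bl_Jeq smper_pders[OF sm(3)]] t]
      smper_cper[OF smper_linear[OF bl_Rv smper_pders[OF smper_pder[OF sm(5)]]] t] by auto
  have nR: "L2n (\<lambda>x. Rv (?b t x)) = L2n (?b t)" "ip (\<lambda>x. Rv (?b t x)) (\<lambda>x. Rv (?b t x)) = L2sq (?b t)"
    by (simp_all add: L2n_def L2sq_def norm_Rv L2sq_ip[symmetric])
  have "ip (\<lambda>x. J *v pders T ds (pder T Dt \<theta>) t x) (\<lambda>x. Rv (?b t x))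
      = ip (?L t) (\<lambda>x. Rv (?b t x)) - ip (\<lambda>x. L0 tt lam nu (?\<phi> t x)) (\<lambda>x. Rv (?b t x))
        - tt\<^sup>2 * L2sq (?b t) - ip (?N t) (\<lambda>x. Rv (?b t x))"
    unfolding pders_sol_th[OF t, abs_def] L(4)[symmetric]
    by (simp add: ip_diff_left cper_diff cper_scaleR c cR nR)
  moreover have "\<bar>ip (?L t) (\<lambda>x. Rv (?b t x))\<bar> \<le> L2n (?L t) * L2n (?b t)"
    "\<bar>ip (\<lambda>x. L0 tt lam nu (?\<phi> t x)) (\<lambda>x. Rv (?b t x))\<bar> \<le> L2n (\<lambda>x. L0 tt lam nu (?\<phi> t x)) * L2n (?b t)"
    "\<bar>ip (?N t) (\<lambda>x. Rv (?b t x))\<bar> \<le> L2n (?N t) * L2n (?b t)"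
    using ip_Cauchy_Schwarz[OF c(1) cR] ip_Cauchy_Schwarz[OF c(2) cR] ip_Cauchy_Schwarz[OF c(3) cR] by (simp_all add: nR)
  moreover have "\<bar>ip (\<lambda>x. J *v ?\<phi> t x) (\<lambda>x. Rv (pders T ds (pder T Dt (aK K)) t x))\<bar>
      \<le> L2n (\<lambda>x. J *v ?\<phi> t x) * L2n (\<lambda>x. Rv (pders T ds (pder T Dt (aK K)) t x))"
    by (rule ip_Cauchy_Schwarz[OF c(4,5)])
  ultimately show ?thesis unfolding L xd_def by (simp add: distrib_right)
qed

end

lemma ip_pders_shift:
  fixes f g :: "real \<Rightarrow> real^3 \<Rightarrow> 'a::euclidean_space"
  assumes f: "smper T f" and g: "smper T g" and t: "t \<in> {0..T}" and ds: "ds \<in> SL s" and s: "1 \<le> s"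
  shows "\<bar>ip (pders T ds f t) (pders T ds g t)\<bar> \<le> hn T (s - 1) f t * hn T (s + 1) g t"
proof (cases ds)
  case Nil
  have "\<bar>ip (f t) (g t)\<bar> \<le> L2n (f t) * L2n (g t)"
    by (rule ip_Cauchy_Schwarz[OF smper_cper[OF f t] smper_cper[OF g t]])
  also have "\<dots> \<le> hn T (s - 1) f t * hn T (s + 1) g t"
    by (intro mult_mono L2n_le_hn0) auto
  finally show ?thesis by (simp add: Nil)
next
  case (Cons d es)
  then obtain i where d: "d = Dx i" and es: "set es \<subseteq> range Dx" "Suc (length es) \<le> s"
    using ds by (auto simp: SL_def)
  have "ip (pders T ds f t) (pders T ds g t) = - ip (pders T es f t) (pders T (d # ds) g t)"
    using ip_by_parts[OF smper_pders[OF f, of es] smper_pders[OF g, of ds] t, of i] by (simp add: Cons d)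
  also have "\<bar>\<dots>\<bar> \<le> L2n (pders T es f t) * L2n (pders T (d # ds) g t)"
    using ip_Cauchy_Schwarz[OF smper_cper[OF smper_pders[OF f, of es] t] smper_cper[OF smper_pders[OF g, of "d # ds"] t]] by simp
  also have "\<dots> \<le> hn T (s - 1) f t * hn T (s + 1) g t"
    using es d Cons by (intro mult_mono L2n_le_hn) (auto simp: SL_def)
  finally show ?thesis .
qed

lemma ip_comm_shift:
  fixes g :: "real \<Rightarrow> real^3 \<Rightarrow> 'a::euclidean_space"
  assumes u: "smper T u" and g: "smper T g" and t: "t \<in> {0..T}" and ds: "ds \<in> SL s" and s: "1 \<le> s"
  shows "\<bar>ip (comm T ds u g t) (pders T ds g t)\<bar> \<le> (\<Sum>i\<in>UNIV. L2n (pders T [Dx i] (comm T ds u g) t)) * hn T (s - 1) g t"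
proof (cases ds)
  case Nil
  then show ?thesis by (simp add: comm_def ip_def sum_nonneg)
next
  case (Cons d es)
  then obtain i where d: "d = Dx i" and es: "set es \<subseteq> range Dx" "Suc (length es) \<le> s"
    using ds by (auto simp: SL_def)
  have "ip (comm T ds u g t) (pders T ds g t) = - ip (pders T [Dx i] (comm T ds u g) t) (pders T es g t)"
    using ip_by_parts[OF smper_comm[OF u g, of ds] smper_pders[OF g, of es] t, of i]
    by (simp add: Cons d ip_commute)
  also have "\<bar>\<dots>\<bar> \<le> L2n (pders T [Dx i] (comm T ds u g) t) * L2n (pders T es g t)"
    using ip_Cauchy_Schwarz[OF smper_cper[OF smper_pders[OF smper_comm[OF u g, of ds], of "[Dx i]"] t]
        smper_cper[OF smper_pders[OF g, of es] t]] by simp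
  also have "\<dots> \<le> (\<Sum>i\<in>UNIV. L2n (pders T [Dx i] (comm T ds u g) t)) * hn T (s - 1) g t"
    using es by (intro mult_mono L2n_le_hn member_le_sum) (auto simp: SL_def sum_nonneg)
  finally show ?thesis .
qed

end


section \<open>Differential inequalities\<close>

context par
begin

definition UT :: "nat \<Rightarrow> inst \<Rightarrow> real" where
  "UT s z = H (s + 1) U z + H (s + 1) Th z"

lemma UT_nonneg [simp]: "0 \<le> UT s z"
  by (simp add: UT_def)

lemma UT_DD: "UT s z \<le> DD s z" "H (s - 1) A z \<le> DD s z" "DD s z = UT s z + H (s - 1) A z"
  by (simp_all add: UT_def DD_def)

definition edz where "edz ds z = ed (tT z) ds (fu z) (fh z) (fK z) (tm z)"
definition xdz where "xdz ds z = xd (tT z) ds (fh z) (fK z) (tm z)"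

definition Gz :: "dirn list \<Rightarrow> inst \<Rightarrow> real" where
  "Gz ds z = Gr (tT z) (pders (tT z) ds (fu z)) (tm z) + L2sq (pders (tT z) ds (fh z) (tm z))
     + Gr (tT z) (pders (tT z) ds (fh z)) (tm z)"

lemma Gz_nonneg [simp]: "0 \<le> Gz ds z"
  by (simp add: Gz_def)

lemma lss_mult_BBDD:
  assumes "X \<preceq> BB s" "Y \<preceq> DD s" "\<And>z. z \<in> Sol \<Longrightarrow> 0 \<le> Y z"
  shows "(\<lambda>z. X z * Y z) \<preceq> (\<lambda>z. BB s z * DD s z)"
  by (rule lss_mult[OF assms(1,2)]) (auto simp: assms(3))

lemma energy_remainder:
  assumes s: "2 \<le> s" "s \<le> 2 * M" and ds: "ds \<in> SL s"
  shows "(\<lambda>z. edz ds z + c0 * Gz ds z) \<preceq> (\<lambda>z. BB s z * DD s z)"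
proof -
  let ?cu = "\<lambda>z. conv (tT z) (U z) (U z)"
  let ?cm = "\<lambda>z. \<Sum>i\<in>(UNIV::3 set). L2n (pders (tT z) [Dx i] (comm (tT z) ds (U z) (A z)) (tm z))"
  have le: "edz ds z + c0 * Gz ds z \<le> H (s - 1) ?cu z * H (s + 1) U z + H (s - 1) NT z * H (s + 1) Th z
     + ca * (H (s + 1) NA z * H (s - 1) A z) + ca * (?cm z * H (s - 1) A z)" if z: "z \<in> Sol" for z
  proof -
    note sl = Sol_sol[OF z] and t = Sol_tm[OF z]
    note sm = sol_smper[OF sl]
    have s1: "1 \<le> s" using s by simp
    let ?T = "tT z" and ?t = "tm z" and ?u = "fu z" and ?h = "fh z" and ?a = "aK (fK z)"
    let ?na = "\<lambda>t x. pa (com (?h t x) (fK z t x))"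
    have "\<bar>ip (pders ?T ds (conv ?T ?u ?u) ?t) (pders ?T ds ?u ?t)\<bar> \<le> H (s - 1) ?cu z * H (s + 1) U z"
      unfolding H_def by (rule ip_pders_shift[OF smper_conv[OF sm(1,1)] sm(1) t ds s1])
    moreover have "\<bar>ip (pders ?T ds (Nth ?T ?u ?h (fK z)) ?t) (pders ?T ds ?h ?t)\<bar> \<le> H (s - 1) NT z * H (s + 1) Th z"
      unfolding H_def NT_def by (rule ip_pders_shift[OF smper_Nth[OF sl] sm(3) t ds s1])
    moreover have "\<bar>ip (pders ?T ds ?na ?t) (pders ?T ds ?a ?t)\<bar> \<le> H (s + 1) NA z * H (s - 1) A z"
      unfolding H_def NA_def A_def
      using ip_pders_shift[OF sm(5) smper_bilinear[OF bb_pa_com sm(3,4)] t ds s1]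
      by (simp add: ip_commute mult.commute)
    then have "ca * ip (pders ?T ds ?na ?t) (pders ?T ds ?a ?t) \<le> ca * (H (s + 1) NA z * H (s - 1) A z)"
      using ca_pos by (intro mult_left_mono) auto
    moreover have "\<bar>ip (comm ?T ds ?u ?a ?t) (pders ?T ds ?a ?t)\<bar> \<le> ?cm z * H (s - 1) A z"
      unfolding H_def A_def by (rule ip_comm_shift[OF sm(1,5) t ds s1])
    then have "ca * (- ip (comm ?T ds ?u ?a ?t) (pders ?T ds ?a ?t)) \<le> ca * (?cm z * H (s - 1) A z)"
      using ca_pos by (intro mult_left_mono) auto
    ultimately show ?thesis
      using energy_identity[OF sl t, of ds] unfolding edz_def Gz_def by linarith
  qed
  have 1: "(\<lambda>z. H (s - 1) ?cu z * H (s + 1) U z) \<preceq> (\<lambda>z. BB s z * DD s z)"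
    using s by (intro lss_mult_BBDD lss_trans[OF est_conv_U(1) KD_BB] DD_U) auto
  have 2: "(\<lambda>z. H (s - 1) NT z * H (s + 1) Th z) \<preceq> (\<lambda>z. BB s z * DD s z)"
    using s by (intro lss_mult_BBDD est_NT DD_Th) auto
  have 3: "(\<lambda>z. H (s + 1) NA z * H (s - 1) A z) \<preceq> (\<lambda>z. BB s z * DD s z)"
    using s by (intro lss_mult_BBDD est_NA DD_A) auto
  have cm: "?cm \<preceq> BB s"
    by (intro lss_sum est_comm_A s) (use ds in \<open>auto simp: SL_def\<close>)
  have 4: "(\<lambda>z. ?cm z * H (s - 1) A z) \<preceq> (\<lambda>z. BB s z * DD s z)"
    by (intro lss_mult_BBDD cm DD_A) auto
  have 5: "(\<lambda>z. ca * (H (s + 1) NA z * H (s - 1) A z)) \<preceq> (\<lambda>z. BB s z * DD s z)"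
    "(\<lambda>z. ca * (?cm z * H (s - 1) A z)) \<preceq> (\<lambda>z. BB s z * DD s z)"
    using 3 4 by (auto intro!: lss_cmult mult_nonneg_nonneg sum_nonneg)
  show ?thesis
    by (rule lss_trans[OF lss_le[OF le] lss_add[OF lss_add[OF lss_add[OF 1 2] 5(1)] 5(2)]])
qed

definition dA :: "inst \<Rightarrow> real \<Rightarrow> real^3 \<Rightarrow> real^2" where
  "dA z = pder (tT z) Dt (A z)"

lemma dA_eq: "feq dA (\<lambda>z t x. tt *\<^sub>R perp (A z t x) - (nu - lam) *\<^sub>R hperp (Th z t x) + NA z t x - conv (tT z) (U z) (A z) t x)"
  using sol_a[OF Sol_sol] by (simp add: feq_def dA_def A_def NA_def)

lemma fam_dA [simp]: "fam dA"
  unfolding dA_def[abs_def] by (intro fam_pder) auto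

lemma est_dA:
  assumes "H n A \<preceq> Z" "H n Th \<preceq> Z" "H n NA \<preceq> Z" "H n (\<lambda>z. conv (tT z) (U z) (A z)) \<preceq> Z"
  shows "H n dA \<preceq> Z"
  by (rule H_cong[OF dA_eq])
     (intro H_add H_diff H_scaleR fam_add fam_diff fam_scaleR H_linear[OF bl_perp] H_linear[OF bl_hperp]
      fam_linear[OF bl_perp] fam_linear[OF bl_hperp] fam_conv fam_fields fam_NA assms)

lemma UT_Th: "n \<le> s + 1 \<Longrightarrow> H n Th \<preceq> UT s" and UT_U: "n \<le> s + 1 \<Longrightarrow> H n U \<preceq> UT s"
  by (rule H_mono[of "s + 1"], rule lss_le, auto simp: UT_def)+

lemma cross_remainder:
  assumes s: "2 \<le> s" "s \<le> 2 * M" and ds: "ds \<in> SL (s - 1)"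
  shows "(\<lambda>z. xdz ds z + tt\<^sup>2 * L2sq (pders (tT z) ds (A z) (tm z))) \<preceq> (\<lambda>z. UT s z * DD s z + BB s z * DD s z)"
    (is "_ \<preceq> ?Z")
proof -
  let ?L = "\<lambda>z. Lth (tT z) (U z) (Th z)" and ?LZ = "\<lambda>z t x. L0 tt lam nu (Th z t x)"
    and ?J = "\<lambda>z t x. J *v Th z t x" and ?R = "\<lambda>z t x. Rv (dA z t x)"
  have le: "xdz ds z + tt\<^sup>2 * L2sq (pders (tT z) ds (A z) (tm z)) \<le>
     (H (s - 1) ?L z + H (s - 1) ?LZ z + H (s - 1) NT z) * H (s - 1) A z + H (s - 1) ?J z * H (s - 1) ?R z"
    if z: "z \<in> Sol" for z
  proof -
    have "xdz ds z + tt\<^sup>2 * L2sq (pders (tT z) ds (A z) (tm z)) \<le>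
      (L2n (pders (tT z) ds (?L z) (tm z)) + L2n (pders (tT z) ds (?LZ z) (tm z)) + L2n (pders (tT z) ds (NT z) (tm z)))
        * L2n (pders (tT z) ds (A z) (tm z)) + L2n (pders (tT z) ds (?J z) (tm z)) * L2n (pders (tT z) ds (?R z) (tm z))"
      using cross_identity[OF Sol_sol[OF z] Sol_tm[OF z], of ds] unfolding xdz_def NT_def A_def dA_def .
    also have "\<dots> \<le> (H (s - 1) ?L z + H (s - 1) ?LZ z + H (s - 1) NT z) * H (s - 1) A z + H (s - 1) ?J z * H (s - 1) ?R z"
      by (rule add_mono; rule mult_mono) (auto intro!: add_mono L2n_le_hn[OF ds, simplified] simp: H_def)
    finally show ?thesis .
  qed
  have nn: "0 \<le> ?Z z" if "z \<in> Sol" for z using that by simp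
  have Z1: "(\<lambda>z. UT s z * DD s z) \<preceq> ?Z" "(\<lambda>z. BB s z * DD s z) \<preceq> ?Z" by (rule lss_le; simp)+
  have L: "H (s - 1) ?L \<preceq> UT s" using s by (intro est_Lth UT_Th UT_U) auto
  have L0: "H (s - 1) ?LZ \<preceq> UT s" using s by (intro H_linear[OF bl_L0] UT_Th) auto
  have J: "H (s - 1) ?J \<preceq> UT s" using s by (intro H_linear[OF bl_Jeq] UT_Th) auto
  have DB: "DD s \<preceq> (\<lambda>z. DD s z + BB s z)" "BB s \<preceq> (\<lambda>z. DD s z + BB s z)" by (rule lss_le; simp)+
  have KDD: "KD s \<preceq> (\<lambda>z. DD s z + BB s z)" using KD_BB DB(2) lss_trans by blast
  have R: "H (s - 1) ?R \<preceq> (\<lambda>z. DD s z + BB s z)"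
    using s by (intro H_linear[OF bl_Rv] fam_dA est_dA lss_trans[OF DD_A DB(1)] lss_trans[OF DD_Th DB(1)]
        lss_trans[OF est_NA DB(2)] lss_trans[OF est_conv_U(3) KDD]) auto
  have a1: "(\<lambda>z. (H (s - 1) ?L z + H (s - 1) ?LZ z + H (s - 1) NT z) * H (s - 1) A z) \<preceq> ?Z"
  proof -
    have "(\<lambda>z. H (s - 1) ?L z + H (s - 1) ?LZ z + H (s - 1) NT z) \<preceq> (\<lambda>z. UT s z + BB s z)"
      by (intro lss_add lss_trans[OF L] lss_trans[OF L0] lss_trans[OF est_NT[OF s]]; rule lss_le; simp)
    then show ?thesis
      by (rule lss_mult[OF _ DD_A[of "s - 1" s]]) (auto simp: distrib_right)
  qed
  have a2: "(\<lambda>z. H (s - 1) ?J z * H (s - 1) ?R z) \<preceq> ?Z"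
  proof (rule lss_mult[OF J R])
    show "(\<lambda>z. UT s z * (DD s z + BB s z)) \<preceq> ?Z"
    proof (rule lss_le)
      fix z assume "z \<in> Sol"
      then have "UT s z * BB s z \<le> DD s z * BB s z" by (intro mult_right_mono UT_DD) auto
      then show "UT s z * (DD s z + BB s z) \<le> ?Z z" by (simp add: distrib_left mult.commute)
    qed
  qed auto
  show ?thesis by (rule lss_trans[OF lss_le[OF le] lss_add[OF a1 a2]])
qed

lemma sq_sum_le: "(\<Sum>i\<in>I. f i)\<^sup>2 \<le> real (card I) * (\<Sum>i\<in>I. (f i)\<^sup>2)" for f :: "'i \<Rightarrow> real"
  using sum_squared_le_sum_of_squares[of f I] by (simp add: mult.commute)

lemma hn_sq_le: "(hn T n f t)\<^sup>2 \<le> real (card (SL n)) * (\<Sum>ds\<in>SL n. L2sq (pders T ds f t))"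
  unfolding hn_def using sq_sum_le[of "\<lambda>ds. L2n (pders T ds f t)" "SL n"] by simp

lemma SL_Suc: "SL (Suc n) = insert [] (\<Union>i\<in>UNIV. (\<lambda>ds. Dx i # ds) ` SL n)"
proof -
  have "ds \<in> insert [] (\<Union>i\<in>UNIV. (\<lambda>ds. Dx i # ds) ` SL n)" if "ds \<in> SL (Suc n)" for ds
    using that by (cases ds) (auto simp: SL_def)
  moreover have "SL (Suc n) \<supseteq> insert [] (\<Union>i\<in>UNIV. (\<lambda>ds. Dx i # ds) ` SL n)"
    by (auto simp: SL_def)
  ultimately show ?thesis by blast
qed

lemma sum_SL_Suc_le:
  "(\<Sum>ds\<in>SL (Suc n). L2sq (pders T ds f t)) \<le> L2sq (f t) + (\<Sum>ds\<in>SL n. Gr T (pders T ds f) t)"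
proof -
  have "(\<Sum>ds\<in>SL (Suc n). L2sq (pders T ds f t)) = L2sq (f t) + (\<Sum>ds\<in>(\<Union>i\<in>UNIV. (\<lambda>ds. Dx i # ds) ` SL n). L2sq (pders T ds f t))"
    unfolding SL_Suc by (subst sum.insert) auto
  also have "(\<Sum>ds\<in>(\<Union>i\<in>UNIV. (\<lambda>ds. Dx i # ds) ` SL n). L2sq (pders T ds f t))
     = (\<Sum>i\<in>(UNIV::3 set). \<Sum>ds\<in>(\<lambda>ds. Dx i # ds) ` SL n. L2sq (pders T ds f t))"
    by (rule sum.UNION_disjoint) auto
  also have "\<dots> = (\<Sum>i\<in>UNIV. \<Sum>ds\<in>SL n. L2sq (pders T (Dx i # ds) f t))"
    by (rule sum.cong[OF refl]) (subst sum.reindex, auto simp: inj_on_def)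
  also have "\<dots> = (\<Sum>ds\<in>SL n. Gr T (pders T ds f) t)"
    by (subst sum.swap) (simp add: Gr_def)
  finally show ?thesis by simp
qed

lemma card_SL_pos: "real (card (SL n)) > 0"
  using card_gt_0_iff[of "SL n"] Nil_SL[of n] by fastforce

lemma coercive_UT:
  "\<exists>C>0. \<forall>z\<in>Sol. (UT s z)\<^sup>2 \<le> C * (\<Sum>ds\<in>SL s. Gz ds z)"
proof -
  let ?N = "real (card (SL (Suc s)))"
  have N: "?N > 0" by (rule card_SL_pos)
  have "(UT s z)\<^sup>2 \<le> (12 * ?N) * (\<Sum>ds\<in>SL s. Gz ds z)" if z: "z \<in> Sol" for z
  proof -
    let ?T = "tT z" and ?t = "tm z" and ?u = "fu z" and ?h = "fh z"
    note sm = sol_smper[OF Sol_sol[OF z]] and t = Sol_tm[OF z]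
    let ?G = "\<Sum>ds\<in>SL s. Gz ds z"
    have mem: "Gz [] z \<le> ?G" by (intro member_le_sum) auto
    have Gu: "(\<Sum>ds\<in>SL s. Gr ?T (pders ?T ds ?u) ?t) \<le> ?G" and Gh: "(\<Sum>ds\<in>SL s. Gr ?T (pders ?T ds ?h) ?t) \<le> ?G"
      by (intro sum_mono; simp add: Gz_def)+
    have pu: "L2sq (?u ?t) \<le> 3 * ?G" and ph: "L2sq (?h ?t) \<le> ?G"
      using poincare[OF sm(1) t sol_mean[OF Sol_sol[OF z] t]] mem
        Gr_nonneg[of ?T ?u ?t] Gr_nonneg[of ?T ?h ?t] L2sq_nonneg[of "?h ?t"]
      unfolding Gz_def pders_Nil Gr_def by linarith+
    have "(hn ?T (Suc s) ?u ?t)\<^sup>2 \<le> ?N * (4 * ?G)"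
      using order_trans[OF sum_SL_Suc_le[of ?T ?u ?t s] add_mono[OF pu Gu]]
      by (intro order_trans[OF hn_sq_le] mult_left_mono) auto
    moreover have "(hn ?T (Suc s) ?h ?t)\<^sup>2 \<le> ?N * (2 * ?G)"
      using order_trans[OF sum_SL_Suc_le[of ?T ?h ?t s] add_mono[OF ph Gh]]
      by (intro order_trans[OF hn_sq_le] mult_left_mono) auto
    moreover have "(UT s z)\<^sup>2 \<le> 2 * (hn ?T (Suc s) ?u ?t)\<^sup>2 + 2 * (hn ?T (Suc s) ?h ?t)\<^sup>2"
      using sum_squares_bound[of "hn ?T (Suc s) ?u ?t" "hn ?T (Suc s) ?h ?t"]
      by (simp add: UT_def H_def power2_sum)
    moreover have "0 \<le> ?N * ?G" by (simp add: sum_nonneg)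
    ultimately show ?thesis by (simp add: mult.assoc)
  qed
  then show ?thesis using N by (intro exI[of _ "12 * ?N"]) auto
qed

lemma eventually_at_right0I: "0 < b \<Longrightarrow> (\<And>y. 0 < y \<Longrightarrow> y < b \<Longrightarrow> Q y) \<Longrightarrow> eventually Q (at_right (0::real))"
  by (auto simp: eventually_at_right_field)

definition Yd where "Yd s \<epsilon> z = (\<Sum>ds\<in>SL s. edz ds z) + \<epsilon> * (\<Sum>ds\<in>SL (s - 1). xdz ds z)"

lemma lss_bound:
  assumes "X \<preceq> Y" "\<And>z. z \<in> Sol \<Longrightarrow> 0 \<le> Y z"
  obtains C k where "C > 0" "k > 0" "\<And>z. z \<in> Sol \<Longrightarrow> kp z \<le> k \<Longrightarrow> X z \<le> C * Y z"
proof -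
  obtain C k where C: "C \<ge> 0" "k > 0" "\<And>z. z \<in> Sol \<Longrightarrow> kp z \<le> k \<Longrightarrow> X z \<le> C * Y z"
    using assms(1) unfolding lss_def by blast
  show ?thesis
  proof (rule that[of "C + 1" k])
    fix z assume z: "z \<in> Sol" "kp z \<le> k"
    show "X z \<le> (C + 1) * Y z" using C(3)[OF z] assms(2)[OF z(1)] by (simp add: distrib_right)
  qed (use C in auto)
qed

lemma energy_level:
  assumes s: "2 \<le> s" "s \<le> 2 * M"
  shows "\<forall>\<^sub>F \<epsilon> in at_right 0. \<forall>\<^sub>F r in at_right 0. \<forall>z\<in>Sol. kp z \<le> r \<longrightarrow>
    Yd s \<epsilon> z \<le> - r * (DD s z)\<^sup>2 + 1 / r * (BB s z * DD s z)"
proof -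
  let ?E = "\<lambda>z. \<Sum>ds\<in>SL s. Gz ds z" and ?Ya = "\<lambda>z. \<Sum>ds\<in>SL (s - 1). L2sq (pders (tT z) ds (A z) (tm z))"
  let ?X = "\<lambda>z. BB s z * DD s z"
  have "(\<lambda>z. \<Sum>ds\<in>SL s. edz ds z + c0 * Gz ds z) \<preceq> ?X"
    by (intro lss_sum energy_remainder s) auto
  from lss_bound[OF this] obtain A1 k1 where 1: "A1 > 0" "k1 > 0"
    "\<And>z. z \<in> Sol \<Longrightarrow> kp z \<le> k1 \<Longrightarrow> (\<Sum>ds\<in>SL s. edz ds z + c0 * Gz ds z) \<le> A1 * ?X z" by auto
  have "(\<lambda>z. \<Sum>ds\<in>SL (s - 1). xdz ds z + tt\<^sup>2 * L2sq (pders (tT z) ds (A z) (tm z))) \<preceq> (\<lambda>z. UT s z * DD s z + ?X z)"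
    by (intro lss_sum cross_remainder s) auto
  from lss_bound[OF this] obtain A2 k2 where 2: "A2 > 0" "k2 > 0"
    "\<And>z. z \<in> Sol \<Longrightarrow> kp z \<le> k2 \<Longrightarrow> (\<Sum>ds\<in>SL (s - 1). xdz ds z + tt\<^sup>2 * L2sq (pders (tT z) ds (A z) (tm z)))
       \<le> A2 * (UT s z * DD s z + ?X z)" by auto
  obtain C1 where C1: "C1 > 0" "\<And>z. z \<in> Sol \<Longrightarrow> (UT s z)\<^sup>2 \<le> C1 * ?E z" using coercive_UT by blast
  define C2 where "C2 = real (card (SL (s - 1)))"
  have C2: "C2 > 0" "\<And>z. (H (s - 1) A z)\<^sup>2 \<le> C2 * ?Ya z"
    unfolding C2_def H_def by (rule card_SL_pos hn_sq_le)+
  define q where "q = A2\<^sup>2 * C2 / (2 * tt\<^sup>2)"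
  have q: "q > 0" unfolding q_def using 2 C2 tt_pos by simp
  have t2: "tt\<^sup>2 > 0" using tt_pos by simp
  define \<epsilon>0 where "\<epsilon>0 = min 1 (c0 / (2 * (A2 + q) * C1))"
  have \<epsilon>0: "\<epsilon>0 > 0" unfolding \<epsilon>0_def using c0_pos 2 q C1 by simp
  show ?thesis
  proof (rule eventually_at_right0I[OF \<epsilon>0])
    fix \<epsilon> assume \<epsilon>: "0 < \<epsilon>" "\<epsilon> < \<epsilon>0"
    have \<epsilon>c: "\<epsilon> * (A2 + q) * C1 \<le> c0 / 2"
    proof -
      have "\<epsilon> \<le> c0 / (2 * (A2 + q) * C1)" using \<epsilon> by (simp add: \<epsilon>0_def)
      moreover have "0 < 2 * (A2 + q) * C1" using 2 q C1 by simp
      ultimately have "\<epsilon> * (2 * (A2 + q) * C1) \<le> c0" by (simp only: pos_le_divide_eq)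
      then show ?thesis by (simp add: algebra_simps)
    qed
    define r0 where "r0 = Min {k1, k2, c0 / (4 * C1), \<epsilon> * tt\<^sup>2 / (4 * C2), 1 / (A1 + A2)}"
    have r0: "r0 > 0" unfolding r0_def using 1 2 c0_pos C1 C2 \<epsilon> t2 by simp
    show "\<forall>\<^sub>F r in at_right 0. \<forall>z\<in>Sol. kp z \<le> r \<longrightarrow> Yd s \<epsilon> z \<le> - r * (DD s z)\<^sup>2 + 1 / r * (BB s z * DD s z)"
    proof (rule eventually_at_right0I[OF r0], intro ballI impI)
      fix r z assume r: "0 < r" "r < r0" and z: "z \<in> Sol" "kp z \<le> r"
      have rr: "r \<le> k1" "r \<le> k2" "r * (4 * C1) \<le> c0" "r * (4 * C2) \<le> \<epsilon> * tt\<^sup>2" "A1 + A2 \<le> 1 / r"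
      proof -
        have "r \<le> k1" "r \<le> k2" "r \<le> c0 / (4 * C1)" "r \<le> \<epsilon> * tt\<^sup>2 / (4 * C2)" "r \<le> 1 / (A1 + A2)"
          using r by (simp_all add: r0_def)
        then show "r \<le> k1" "r \<le> k2" "r * (4 * C1) \<le> c0" "r * (4 * C2) \<le> \<epsilon> * tt\<^sup>2" "A1 + A2 \<le> 1 / r"
          using 1 2 C1 C2 r by (simp_all add: field_simps)
      qed
      define a b E Ya X where "a = UT s z" and "b = H (s - 1) A z" and "E = ?E z" and "Ya = ?Ya z" and "X = ?X z"
      have nn: "0 \<le> a" "0 \<le> b" "0 \<le> E" "0 \<le> Ya" "0 \<le> X"
        unfolding a_def b_def E_def Ya_def X_def using z by (auto intro!: sum_nonneg)
      have D: "DD s z = a + b" by (simp add: UT_DD(3) a_def b_def)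
      have e1: "(\<Sum>ds\<in>SL s. edz ds z) \<le> - c0 * E + A1 * X"
        using 1(3)[OF z(1)] z rr by (simp add: E_def X_def sum.distrib flip: sum_distrib_left)
      have e2: "(\<Sum>ds\<in>SL (s - 1). xdz ds z) \<le> - tt\<^sup>2 * Ya + A2 * (a * DD s z + X)"
        using 2(3)[OF z(1)] z rr by (simp add: Ya_def X_def a_def sum.distrib flip: sum_distrib_left)
      have a2: "a\<^sup>2 \<le> C1 * E" and b2: "b\<^sup>2 \<le> C2 * Ya"
        using C1(2)[OF z(1)] C2(2)[of z] by (simp_all add: a_def b_def E_def Ya_def)
      have y: "A2 * (a * b) \<le> tt\<^sup>2 / 2 * Ya + q * a\<^sup>2"
      proof -
        have "0 \<le> (tt\<^sup>2 * b - A2 * C2 * a)\<^sup>2 / (2 * C2 * tt\<^sup>2)" using C2 t2 by simp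
        also have "\<dots> = tt\<^sup>2 / (2 * C2) * b\<^sup>2 + q * a\<^sup>2 - A2 * (a * b)"
          unfolding q_def using C2 t2 tt_pos by (simp add: power2_eq_square field_simps)
        finally have "A2 * (a * b) \<le> tt\<^sup>2 / (2 * C2) * b\<^sup>2 + q * a\<^sup>2" by simp
        also have "tt\<^sup>2 / (2 * C2) * b\<^sup>2 \<le> tt\<^sup>2 / (2 * C2) * (C2 * Ya)"
          using b2 C2 t2 by (intro mult_left_mono) auto
        also have "\<dots> = tt\<^sup>2 / 2 * Ya" using C2 by simp
        finally show ?thesis by simp
      qed
      have "(\<Sum>ds\<in>SL (s - 1). xdz ds z) \<le> - tt\<^sup>2 / 2 * Ya + (A2 + q) * a\<^sup>2 + A2 * X"
        using e2 y unfolding D by (simp add: power2_eq_square algebra_simps)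
      then have "\<epsilon> * (\<Sum>ds\<in>SL (s - 1). xdz ds z) \<le> \<epsilon> * (- tt\<^sup>2 / 2 * Ya + (A2 + q) * a\<^sup>2 + A2 * X)"
        using \<epsilon> by (intro mult_left_mono) auto
      also have "\<dots> = - \<epsilon> * tt\<^sup>2 / 2 * Ya + \<epsilon> * (A2 + q) * a\<^sup>2 + \<epsilon> * A2 * X"
        by (simp add: algebra_simps)
      also have "\<dots> \<le> - \<epsilon> * tt\<^sup>2 / 2 * Ya + c0 / 2 * E + A2 * X"
      proof -
        have "\<epsilon> * (A2 + q) * a\<^sup>2 \<le> \<epsilon> * (A2 + q) * (C1 * E)" using \<epsilon> 2 q a2 by (intro mult_left_mono) auto
        also have "\<dots> \<le> c0 / 2 * E" using mult_right_mono[OF \<epsilon>c nn(3)] by (simp add: mult.assoc)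
        finally have i: "\<epsilon> * (A2 + q) * a\<^sup>2 \<le> c0 / 2 * E" .
        have "\<epsilon> \<le> 1" using \<epsilon> by (simp add: \<epsilon>0_def)
        then have "\<epsilon> * (A2 * X) \<le> 1 * (A2 * X)" using 2 nn by (intro mult_right_mono) auto
        with i show ?thesis by (simp add: mult.assoc)
      qed
      finally have "Yd s \<epsilon> z \<le> - (c0 / 2) * E - \<epsilon> * tt\<^sup>2 / 2 * Ya + (A1 + A2) * X"
        using e1 unfolding Yd_def by (simp add: algebra_simps)
      also have "(A1 + A2) * X \<le> 1 / r * X" using rr nn by (intro mult_right_mono) auto
      also have "- (c0 / 2) * E - \<epsilon> * tt\<^sup>2 / 2 * Ya \<le> - r * (a + b)\<^sup>2"
      proof -
        have "r * (a + b)\<^sup>2 \<le> r * (2 * a\<^sup>2 + 2 * b\<^sup>2)"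
          using r sum_squares_bound[of a b] by (intro mult_left_mono) (auto simp: power2_sum)
        also have "\<dots> \<le> r * (2 * (C1 * E) + 2 * (C2 * Ya))"
          using r a2 b2 by (intro mult_left_mono add_mono) auto
        also have "\<dots> = (r * (4 * C1)) * E / 2 + (r * (4 * C2)) * Ya / 2" by (simp add: algebra_simps)
        also have "\<dots> \<le> c0 * E / 2 + \<epsilon> * tt\<^sup>2 * Ya / 2"
          using rr nn by (intro add_mono divide_right_mono mult_right_mono) auto
        finally show ?thesis by simp
      qed
      finally show "Yd s \<epsilon> z \<le> - r * (DD s z)\<^sup>2 + 1 / r * (BB s z * DD s z)"
        by (simp add: D X_def)
    qed
  qed
qed

definition Q :: "nat \<Rightarrow> inst \<Rightarrow> real" where
  "Q s z = (\<Sum>ds\<in>SL s. L2sq (pders (tT z) ds (fu z) (tm z)) + L2sq (pders (tT z) ds (fh z) (tm z))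
     + L2sq (pders (tT z) ds (A z) (tm z)))"

definition Yf where
  "Yf s \<epsilon> z = (\<Sum>ds\<in>SL s. ee (tT z) ds (fu z) (fh z) (fK z) (tm z))
     + \<epsilon> * (\<Sum>ds\<in>SL (s - 1). xx (tT z) ds (fh z) (fK z) (tm z))"

lemma Q_nonneg [simp]: "0 \<le> Q s z"
  unfolding Q_def by (intro sum_nonneg) auto

lemma Q_le_DD: "Q s z \<le> (DD (s + 1) z)\<^sup>2"
proof -
  have "Q s z \<le> (H s U z)\<^sup>2 + (H s Th z)\<^sup>2 + (H s A z)\<^sup>2"
    unfolding Q_def sum.distrib H_def by (intro add_mono sum_L2sq_le_hn) auto
  also have "\<dots> \<le> (H s U z + H s Th z + H s A z)\<^sup>2"
    by (simp add: power2_sum)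
  also have "\<dots> \<le> (DD (s + 1) z)\<^sup>2"
    unfolding DD_def by (intro power_mono add_mono) (auto simp: H_def intro: hn_mono)
  finally show ?thesis .
qed

lemma Jeq_ip:
  assumes "cper \<phi>"
  shows "lam * L2sq \<phi> \<le> ip (\<lambda>x. J *v \<phi> x) \<phi>" "ip (\<lambda>x. J *v \<phi> x) \<phi> \<le> nu * L2sq \<phi>"
proof -
  have c: "cper (\<lambda>x. J *v \<phi> x)" by (rule cper_compose[OF assms linear_continuous_on[OF bl_Jeq]])
  have l: "c * L2sq \<phi> = mean (\<lambda>x. c * (norm (\<phi> x))\<^sup>2)" for c by (simp add: L2sq_def)
  show "lam * L2sq \<phi> \<le> ip (\<lambda>x. J *v \<phi> x) \<phi>" "ip (\<lambda>x. J *v \<phi> x) \<phi> \<le> nu * L2sq \<phi>"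
    unfolding l ip_def using Jeq_inner_bounds[OF lam nu]
    by (intro mean_mono cper_intros c assms; simp)+
qed

lemma Y_bounds:
  "\<exists>\<epsilon>1>0. \<exists>c>0. \<exists>C>0. \<forall>\<epsilon> s. 0 < \<epsilon> \<longrightarrow> \<epsilon> \<le> \<epsilon>1 \<longrightarrow> (\<forall>z\<in>Sol. c * Q s z \<le> Yf s \<epsilon> z \<and> Yf s \<epsilon> z \<le> C * Q s z)"
proof -
  obtain B where B: "B > 0" "\<And>v. norm (J *v v) \<le> norm v * B"
    using bounded_linear.pos_bounded[OF bl_Jeq] by blast
  define cl where "cl = min (1/2) (min (lam/2) (ca/2))"
  have cl: "cl > 0" using lam ca_pos by (simp add: cl_def)
  define cu where "cu = 1/2 + nu/2 + ca/2"
  have cu: "cu > 0" using lam nu ca_pos by (simp add: cu_def)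
  have "cl / 2 * Q s z \<le> Yf s \<epsilon> z \<and> Yf s \<epsilon> z \<le> (cu + cl) * Q s z"
    if \<epsilon>: "0 < \<epsilon>" "\<epsilon> \<le> cl / (2 * B)" and z: "z \<in> Sol" for \<epsilon> s z
  proof -
    let ?T = "tT z" and ?t = "tm z"
    note sm = sol_smper[OF Sol_sol[OF z]] and t = Sol_tm[OF z]
    let ?u = "\<lambda>ds. pders ?T ds (fu z) ?t" and ?h = "\<lambda>ds. pders ?T ds (fh z) ?t" and ?a = "\<lambda>ds. pders ?T ds (A z) ?t"
    have ee: "cl * (L2sq (?u ds) + L2sq (?h ds) + L2sq (?a ds)) \<le> ee ?T ds (fu z) (fh z) (fK z) ?t"
      "ee ?T ds (fu z) (fh z) (fK z) ?t \<le> cu * (L2sq (?u ds) + L2sq (?h ds) + L2sq (?a ds))" for ds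
    proof -
      note J = Jeq_ip[OF smper_cper[OF smper_pders[OF sm(3)] t], of ds]
      have e: "ee ?T ds (fu z) (fh z) (fK z) ?t = 1/2 * L2sq (?u ds) + 1/2 * ip (\<lambda>x. J *v ?h ds x) (?h ds) + ca/2 * L2sq (?a ds)"
        by (simp add: ee_def L2sq_ip A_def)
      have m: "cl * L2sq (?u ds) \<le> 1/2 * L2sq (?u ds)" "cl * L2sq (?h ds) \<le> lam/2 * L2sq (?h ds)"
        "cl * L2sq (?a ds) \<le> ca/2 * L2sq (?a ds)"
        by (intro mult_right_mono; simp add: cl_def min_def)+
      have m': "1/2 * L2sq (?u ds) \<le> cu * L2sq (?u ds)" "nu/2 * L2sq (?h ds) \<le> cu * L2sq (?h ds)"
        "ca/2 * L2sq (?a ds) \<le> cu * L2sq (?a ds)"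
        using lam nu ca_pos by (intro mult_right_mono; simp add: cu_def)+
      show "cl * (L2sq (?u ds) + L2sq (?h ds) + L2sq (?a ds)) \<le> ee ?T ds (fu z) (fh z) (fK z) ?t"
        unfolding e using m J(1) by (simp add: distrib_left)
      show "ee ?T ds (fu z) (fh z) (fK z) ?t \<le> cu * (L2sq (?u ds) + L2sq (?h ds) + L2sq (?a ds))"
        unfolding e using m' J(2) by (simp add: distrib_left)
    qed
    have x: "\<bar>xx ?T ds (fh z) (fK z) ?t\<bar> \<le> B * (L2sq (?u ds) + L2sq (?h ds) + L2sq (?a ds))" for ds
    proof -
      have ch: "cper (?h ds)" and cR: "cper (\<lambda>x. Rv (?a ds x))"
        using smper_cper[OF smper_pders[OF sm(3)] t] smper_cper[OF smper_linear[OF bl_Rv smper_pders[OF sm(5)]] t]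
        by (auto simp: A_def)
      have cJ: "cper (\<lambda>x. J *v ?h ds x)" by (rule cper_compose[OF ch linear_continuous_on[OF bl_Jeq]])
      have "\<bar>xx ?T ds (fh z) (fK z) ?t\<bar> \<le> L2n (\<lambda>x. J *v ?h ds x) * L2n (\<lambda>x. Rv (?a ds x))"
        unfolding xx_def using ip_Cauchy_Schwarz[OF cJ cR] by (simp add: A_def)
      also have "L2n (\<lambda>x. Rv (?a ds x)) = L2n (?a ds)" by (simp add: L2n_def L2sq_def norm_Rv)
      also have "L2n (\<lambda>x. J *v ?h ds x) * L2n (?a ds) \<le> (B * L2n (?h ds)) * L2n (?a ds)"
        using B by (intro mult_right_mono L2n_linear_le[OF ch bl_Jeq]) (auto simp: mult.commute)
      also have "\<dots> \<le> B * (L2sq (?h ds) + L2sq (?a ds))"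
      proof -
        have "2 * L2n (?h ds) * L2n (?a ds) \<le> L2sq (?h ds) + L2sq (?a ds)"
          using sum_squares_bound[of "L2n (?h ds)" "L2n (?a ds)"] by simp
        moreover have "0 \<le> L2n (?h ds) * L2n (?a ds)" by simp
        ultimately have "L2n (?h ds) * L2n (?a ds) \<le> L2sq (?h ds) + L2sq (?a ds)" by linarith
        then show ?thesis using B by (simp add: mult.assoc)
      qed
      also have "\<dots> \<le> B * (L2sq (?u ds) + L2sq (?h ds) + L2sq (?a ds))" using B by (intro mult_left_mono) auto
      finally show ?thesis .
    qed
    have "\<bar>\<Sum>ds\<in>SL (s - 1). xx ?T ds (fh z) (fK z) ?t\<bar> \<le> (\<Sum>ds\<in>SL (s - 1). B * (L2sq (?u ds) + L2sq (?h ds) + L2sq (?a ds)))"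
      by (rule order_trans[OF sum_abs sum_mono[OF x]])
    also have "\<dots> \<le> (\<Sum>ds\<in>SL s. B * (L2sq (?u ds) + L2sq (?h ds) + L2sq (?a ds)))"
      using B by (intro sum_mono2 SL_mono) auto
    also have "\<dots> = B * Q s z" by (simp add: Q_def sum_distrib_left)
    finally have X: "\<bar>\<Sum>ds\<in>SL (s - 1). xx ?T ds (fh z) (fK z) ?t\<bar> \<le> B * Q s z" .
    have "\<bar>\<epsilon> * (\<Sum>ds\<in>SL (s - 1). xx ?T ds (fh z) (fK z) ?t)\<bar> = \<epsilon> * \<bar>\<Sum>ds\<in>SL (s - 1). xx ?T ds (fh z) (fK z) ?t\<bar>"
      using \<epsilon> by (simp add: abs_mult)
    also have "\<dots> \<le> (cl / (2 * B)) * (B * Q s z)"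
      using \<epsilon> X B cl by (intro mult_mono) auto
    also have "\<dots> = cl / 2 * Q s z" using B by simp
    finally have X': "\<bar>\<epsilon> * (\<Sum>ds\<in>SL (s - 1). xx ?T ds (fh z) (fK z) ?t)\<bar> \<le> cl / 2 * Q s z" .
    have E: "cl * Q s z \<le> (\<Sum>ds\<in>SL s. ee ?T ds (fu z) (fh z) (fK z) ?t)"
      "(\<Sum>ds\<in>SL s. ee ?T ds (fu z) (fh z) (fK z) ?t) \<le> cu * Q s z"
      unfolding Q_def sum_distrib_left by (intro sum_mono ee)+
    have "0 \<le> cl * Q s z" using cl by simp
    then show ?thesis unfolding Yf_def using X' E by (auto simp: distrib_right abs_le_iff)
  qed
  then show ?thesis using cl cu B
    by (intro exI[of _ "cl / (2 * B)"] conjI exI[of _ "cl / 2"] exI[of _ "cu + cl"]) auto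
qed


subsection \<open>The time weighted functional\<close>

definition calD :: "inst \<Rightarrow> real" where
  "calD z = (\<Sum>s\<in>{2..2*M}. (1 + tm z) ^ (2*M - s) * (DD s z)\<^sup>2)"

definition Zf where
  "Zf \<rho> \<epsilon> z = (\<Sum>s\<in>{2..2*M}. \<rho> ^ (2*M - s) * ((1 + tm z) ^ (2*M - s) * Yf s \<epsilon> z))"

definition Zd where
  "Zd \<rho> \<epsilon> z = (\<Sum>s\<in>{2..2*M}. \<rho> ^ (2*M - s) * (real (2*M - s) * (1 + tm z) ^ (2*M - s - 1) * Yf s \<epsilon> z
     + (1 + tm z) ^ (2*M - s) * Yd s \<epsilon> z))"

lemma calD_nonneg [simp]: "z \<in> Sol \<Longrightarrow> 0 \<le> calD z"
  unfolding calD_def by (intro sum_nonneg mult_nonneg_nonneg zero_le_power) auto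

lemma calD_ge:
  assumes "z \<in> Sol" "2 \<le> s" "s \<le> 2 * M"
  shows "(1 + tm z) ^ (2*M - s) * (DD s z)\<^sup>2 \<le> calD z"
  unfolding calD_def using assms
  by (intro member_le_sum[of s "{2..2*M}" "\<lambda>s. (1 + tm z) ^ (2*M - s) * (DD s z)\<^sup>2"]) (auto intro!: mult_nonneg_nonneg)

lemma calD_ge_power:
  assumes "z \<in> Sol" "2 \<le> s" "s \<le> 2 * M" "j \<le> 2 * M - s"
  shows "(1 + tm z) ^ j * (DD s z)\<^sup>2 \<le> calD z"
proof -
  have "(1 + tm z) ^ j * (DD s z)\<^sup>2 \<le> (1 + tm z) ^ (2*M - s) * (DD s z)\<^sup>2"
    using assms by (intro mult_right_mono power_increasing) auto
  then show ?thesis using calD_ge[OF assms(1-3)] by linarith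
qed

lemma energy_uniform:
  "\<exists>\<epsilon> c C r. 0 < \<epsilon> \<and> 0 < c \<and> 0 < C \<and> 0 < r \<and>
    (\<forall>s. \<forall>z\<in>Sol. c * Q s z \<le> Yf s \<epsilon> z \<and> Yf s \<epsilon> z \<le> C * Q s z) \<and>
    (\<forall>s\<in>{2..2*M}. \<forall>z\<in>Sol. kp z \<le> r \<longrightarrow> Yd s \<epsilon> z \<le> - r * (DD s z)\<^sup>2 + 1 / r * (BB s z * DD s z))"
proof -
  obtain \<epsilon>1 c C where Y: "\<epsilon>1 > 0" "c > 0" "C > 0"
    "\<And>\<epsilon> s z. 0 < \<epsilon> \<Longrightarrow> \<epsilon> \<le> \<epsilon>1 \<Longrightarrow> z \<in> Sol \<Longrightarrow> c * Q s z \<le> Yf s \<epsilon> z \<and> Yf s \<epsilon> z \<le> C * Q s z"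
    using Y_bounds by blast
  let ?P = "\<lambda>s \<epsilon> r. \<forall>z\<in>Sol. kp z \<le> r \<longrightarrow> Yd s \<epsilon> z \<le> - r * (DD s z)\<^sup>2 + 1 / r * (BB s z * DD s z)"
  have "\<forall>\<^sub>F \<epsilon> in at_right 0. \<forall>s\<in>{2..2*M}. \<forall>\<^sub>F r in at_right 0. ?P s \<epsilon> r"
    by (intro eventually_ball_finite ballI energy_level) auto
  moreover have "\<forall>\<^sub>F \<epsilon> in at_right 0. 0 < \<epsilon> \<and> \<epsilon> \<le> \<epsilon>1"
    by (rule eventually_at_right0I[OF Y(1)]) auto
  ultimately have "\<forall>\<^sub>F \<epsilon> in at_right 0. (\<forall>s\<in>{2..2*M}. \<forall>\<^sub>F r in at_right 0. ?P s \<epsilon> r) \<and> 0 < \<epsilon> \<and> \<epsilon> \<le> \<epsilon>1"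
    by (rule eventually_conj)
  from eventually_happens'[OF trivial_limit_at_right_real this]
  obtain \<epsilon> where \<epsilon>: "(\<forall>s\<in>{2..2*M}. \<forall>\<^sub>F r in at_right 0. ?P s \<epsilon> r) \<and> 0 < \<epsilon> \<and> \<epsilon> \<le> \<epsilon>1" ..
  have "\<forall>\<^sub>F r in at_right 0. \<forall>s\<in>{2..2*M}. ?P s \<epsilon> r"
    using \<epsilon> by (intro eventually_ball_finite) (simp, rule conjunct1)
  moreover have "\<forall>\<^sub>F r::real in at_right 0. 0 < r"
    by (rule eventually_at_right0I[of 1]) auto
  ultimately have "\<forall>\<^sub>F r in at_right 0. (\<forall>s\<in>{2..2*M}. ?P s \<epsilon> r) \<and> 0 < r" by (rule eventually_conj)
  from eventually_happens'[OF trivial_limit_at_right_real this]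
  obtain r where r: "(\<forall>s\<in>{2..2*M}. ?P s \<epsilon> r) \<and> 0 < r" ..
  have "\<forall>s. \<forall>z\<in>Sol. c * Q s z \<le> Yf s \<epsilon> z \<and> Yf s \<epsilon> z \<le> C * Q s z"
    using \<epsilon> by (intro allI ballI Y(4)) auto
  note Y' = this
  show ?thesis
    by (rule exI[of _ \<epsilon>], rule exI[of _ c], rule exI[of _ C], rule exI[of _ r])
      (intro conjI conjunct1[OF r] conjunct2[OF r] Y(2,3) Y' conjunct1[OF conjunct2[OF \<epsilon>]])
qed

lemma Z_inequality:
  "\<exists>\<epsilon> \<rho> c C d k. 0 < \<epsilon> \<and> 0 < \<rho> \<and> \<rho> \<le> 1 \<and> 0 < c \<and> 0 < C \<and> 0 < d \<and> 0 < k \<and>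
    (\<forall>s. \<forall>z\<in>Sol. c * Q s z \<le> Yf s \<epsilon> z \<and> Yf s \<epsilon> z \<le> C * Q s z) \<and>
    (\<forall>z\<in>Sol. kp z \<le> k \<longrightarrow> Zd \<rho> \<epsilon> z \<le> - d * calD z)"
  using energy_uniform
proof (elim exE conjE)
  fix \<epsilon> c C r :: real
  assume E: "0 < \<epsilon>" "0 < c" "0 < C" "0 < r"
    and Y: "\<forall>s. \<forall>z\<in>Sol. c * Q s z \<le> Yf s \<epsilon> z \<and> Yf s \<epsilon> z \<le> C * Q s z"
    and yd0: "\<forall>s\<in>{2..2*M}. \<forall>z\<in>Sol. kp z \<le> r \<longrightarrow> Yd s \<epsilon> z \<le> - r * (DD s z)\<^sup>2 + 1 / r * (BB s z * DD s z)"
  have yd: "Yd s \<epsilon> z \<le> - r * (DD s z)\<^sup>2 + 1 / r * (BB s z * DD s z)"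
    if "s \<in> {2..2*M}" "z \<in> Sol" "kp z \<le> r" for s z
    using yd0[rule_format, OF that] .
  define \<rho> where "\<rho> = min 1 (r / (8 * M * C))"
  have M0: "real M > 0" using M by simp
  have \<rho>: "0 < \<rho>" "\<rho> \<le> 1" "2 * real M * C * \<rho> \<le> r / 4"
  proof -
    show "0 < \<rho>" "\<rho> \<le> 1" unfolding \<rho>_def using E M0 by auto
    have "2 * real M * C * \<rho> \<le> 2 * real M * C * (r / (8 * M * C))"
      using E M0 by (intro mult_left_mono) (auto simp: \<rho>_def)
    also have "\<dots> = r / 4" using E M0 by (simp add: field_simps)
    finally show "2 * real M * C * \<rho> \<le> r / 4" .
  qed
  define k where "k = min r (r\<^sup>2 / (4 * (2 + 1 / \<rho>)))"
  have rp: "0 < 2 + 1 / \<rho>" using \<rho> by (simp add: add_pos_pos)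
  have k: "0 < k" "k \<le> r" unfolding k_def using E rp by auto
  have kk: "x / r * (2 + 1 / \<rho>) \<le> r / 4" if "x \<le> k" for x
  proof -
    have "x \<le> r\<^sup>2 / (4 * (2 + 1 / \<rho>))" using that by (simp add: k_def)
    then have "x * (4 * (2 + 1 / \<rho>)) \<le> r\<^sup>2" using rp by (simp only: pos_le_divide_eq mult_pos_pos zero_less_numeral)
    moreover have "x * (4 * y) \<le> r\<^sup>2 \<Longrightarrow> x / r * y \<le> r / 4" for y
      using E by (simp add: power2_eq_square field_simps)
    ultimately show ?thesis by blast
  qed
  have main: "Zd \<rho> \<epsilon> z \<le> - (r / 2 * \<rho> ^ (2*M)) * calD z" if z: "z \<in> Sol" "kp z \<le> k" for z
  proof -
    let ?w = "1 + tm z"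
    have w: "1 \<le> ?w" using z by simp
    define q where "q s = \<rho> ^ (2*M - s) * (?w ^ (2*M - s) * (DD s z)\<^sup>2)" for s
    have q0: "0 \<le> q s" for s unfolding q_def using \<rho> w by simp
    define x where "x = kp z / r"
    have x0: "0 \<le> x" unfolding x_def using z E by simp
    have lvl: "\<rho> ^ (2*M - s) * (real (2*M - s) * ?w ^ (2*M - s - 1) * Yf s \<epsilon> z + ?w ^ (2*M - s) * Yd s \<epsilon> z)
        \<le> 2 * real M * C * \<rho> * (if s < 2*M then q (Suc s) else 0) - r * q s
          + x * (2 * q s + (if 3 \<le> s then q (s - 1) / \<rho> else 0))" if s: "s \<in> {2..2*M}" for s
    proof -
      let ?m = "2*M - s"
      have a: "\<rho> ^ ?m * (real ?m * ?w ^ (?m - 1) * Yf s \<epsilon> z) \<le> 2 * real M * C * \<rho> * (if s < 2*M then q (Suc s) else 0)"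
      proof (cases "s < 2*M")
        case False then show ?thesis using s by simp
      next
        case True
        then have m: "?m = Suc (?m - 1)" "2*M - Suc s = ?m - 1" by auto
        have "Yf s \<epsilon> z \<le> C * (DD (Suc s) z)\<^sup>2"
          by (rule order_trans[OF conjunct2[OF Y[rule_format, OF z(1)]]])
             (use Q_le_DD[of s z] E in \<open>simp add: mult_left_mono\<close>)
        then have "\<rho> ^ ?m * (real ?m * ?w ^ (?m - 1) * Yf s \<epsilon> z) \<le> \<rho> ^ ?m * (real (2*M) * ?w ^ (?m - 1) * (C * (DD (Suc s) z)\<^sup>2))"
        proof -
          assume y: "Yf s \<epsilon> z \<le> C * (DD (Suc s) z)\<^sup>2"
          have "real ?m * ?w ^ (?m - 1) * Yf s \<epsilon> z \<le> real ?m * ?w ^ (?m - 1) * (C * (DD (Suc s) z)\<^sup>2)"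
            using w by (intro mult_left_mono y) auto
          also have "\<dots> \<le> real (2*M) * ?w ^ (?m - 1) * (C * (DD (Suc s) z)\<^sup>2)"
            using w E by (intro mult_right_mono) auto
          finally show ?thesis using \<rho> by (intro mult_left_mono) auto
        qed
        also have "\<dots> = 2 * real M * C * \<rho> * q (Suc s)"
          unfolding q_def m(2) by (subst m(1)) (simp add: mult_ac)
        finally show ?thesis using True by simp
      qed
      have b: "\<rho> ^ ?m * (?w ^ ?m * Yd s \<epsilon> z) \<le> - r * q s + x * (2 * q s + (if 3 \<le> s then q (s - 1) / \<rho> else 0))"
      proof -
        have "Yd s \<epsilon> z \<le> - r * (DD s z)\<^sup>2 + 1 / r * (BB s z * DD s z)"
          using yd[OF s z(1)] z(2) k by simp
        also have "1 / r * (BB s z * DD s z) = x * ((DD s z)\<^sup>2 + (if 3 \<le> s then sqrt ?w * DD (s - 1) z else 0) * DD s z)"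
          by (simp add: BB_def x_def power2_eq_square distrib_right)
        also have "\<dots> \<le> x * (2 * (DD s z)\<^sup>2 + (if 3 \<le> s then ?w * (DD (s - 1) z)\<^sup>2 else 0))"
        proof (cases "3 \<le> s")
          case True
          have "2 * (sqrt ?w * DD (s - 1) z) * DD s z \<le> ?w * (DD (s - 1) z)\<^sup>2 + (DD s z)\<^sup>2"
            using sum_squares_bound[of "sqrt ?w * DD (s - 1) z" "DD s z"] w by (simp add: power_mult_distrib)
          moreover have "0 \<le> ?w * (DD (s - 1) z)\<^sup>2" "0 \<le> (DD s z)\<^sup>2" using w by auto
          ultimately have "sqrt ?w * DD (s - 1) z * DD s z \<le> ?w * (DD (s - 1) z)\<^sup>2 + (DD s z)\<^sup>2" by linarith
          then show ?thesis using True x0 by (intro mult_left_mono) auto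
        qed (use x0 in \<open>auto intro!: mult_left_mono\<close>)
        finally have "Yd s \<epsilon> z \<le> - r * (DD s z)\<^sup>2 + x * (2 * (DD s z)\<^sup>2 + (if 3 \<le> s then ?w * (DD (s - 1) z)\<^sup>2 else 0))"
          by simp
        then have "\<rho> ^ ?m * (?w ^ ?m * Yd s \<epsilon> z) \<le> \<rho> ^ ?m * (?w ^ ?m * (- r * (DD s z)\<^sup>2 + x * (2 * (DD s z)\<^sup>2 + (if 3 \<le> s then ?w * (DD (s - 1) z)\<^sup>2 else 0))))"
          using \<rho> w by (intro mult_left_mono) auto
        also have "\<dots> = - r * q s + x * (2 * q s + (if 3 \<le> s then q (s - 1) / \<rho> else 0))"
        proof (cases "3 \<le> s")
          case True
          then have m: "2*M - (s - 1) = Suc ?m" using s by auto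
          have "q (s - 1) / \<rho> = \<rho> ^ ?m * (?w ^ ?m * (?w * (DD (s - 1) z)\<^sup>2))"
            unfolding q_def m using \<rho> by (simp add: mult_ac)
          then show ?thesis using True by (simp add: q_def algebra_simps)
        qed (simp add: q_def algebra_simps)
        finally show ?thesis .
      qed
      show ?thesis using a b by (simp add: distrib_left)
    qed
    let ?S = "\<Sum>s\<in>{2..2*M}. q s"
    have up: "(\<Sum>s\<in>{2..2*M}. if s < 2*M then q (Suc s) else 0) \<le> ?S"
    proof -
      have "(\<Sum>s\<in>{2..2*M}. if s < 2*M then q (Suc s) else 0) = (\<Sum>s\<in>{2..<2*M}. q (Suc s))"
        by (rule sum.mono_neutral_cong_right) auto
      also have "\<dots> = (\<Sum>s\<in>Suc ` {2..<2*M}. q s)" by (subst sum.reindex) auto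
      also have "\<dots> \<le> ?S" using q0 by (intro sum_mono2) auto
      finally show ?thesis .
    qed
    have dn: "(\<Sum>s\<in>{2..2*M}. if 3 \<le> s then q (s - 1) / \<rho> else 0) \<le> ?S / \<rho>"
    proof -
      have "(\<Sum>s\<in>{2..2*M}. if 3 \<le> s then q (s - 1) / \<rho> else 0) = (\<Sum>s\<in>{3..2*M}. q (s - 1) / \<rho>)"
        by (rule sum.mono_neutral_cong_right) auto
      also have "\<dots> = (\<Sum>s\<in>(\<lambda>s. s - 1) ` {3..2*M}. q s / \<rho>)"
        by (subst sum.reindex) (auto simp: inj_on_def)
      also have "\<dots> \<le> (\<Sum>s\<in>{2..2*M}. q s / \<rho>)" using q0 \<rho> by (intro sum_mono2) auto
      finally show ?thesis by (simp add: sum_divide_distrib)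
    qed
    have S0: "0 \<le> ?S" using q0 by (intro sum_nonneg) auto
    have "Zd \<rho> \<epsilon> z \<le> (\<Sum>s\<in>{2..2*M}. 2 * real M * C * \<rho> * (if s < 2*M then q (Suc s) else 0) - r * q s
          + x * (2 * q s + (if 3 \<le> s then q (s - 1) / \<rho> else 0)))"
      unfolding Zd_def by (rule sum_mono[OF lvl])
    also have "\<dots> = 2 * real M * C * \<rho> * (\<Sum>s\<in>{2..2*M}. if s < 2*M then q (Suc s) else 0) - r * ?S
          + x * (2 * ?S + (\<Sum>s\<in>{2..2*M}. if 3 \<le> s then q (s - 1) / \<rho> else 0))"
      by (simp only: sum.distrib sum_subtractf sum_distrib_left[symmetric])
    also have "\<dots> \<le> 2 * real M * C * \<rho> * ?S - r * ?S + x * (2 * ?S + ?S / \<rho>)"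
      using up dn x0 E \<rho> M0 by (intro add_mono diff_mono mult_left_mono order_refl) auto
    also have "\<dots> = (2 * real M * C * \<rho> - r + x * (2 + 1 / \<rho>)) * ?S" by (simp add: algebra_simps)
    also have "\<dots> \<le> (- (r / 2)) * ?S"
      by (intro mult_right_mono S0) (use \<rho>(3) kk[OF z(2)] in \<open>unfold x_def, linarith\<close>)
    also have "\<dots> \<le> - (r / 2 * \<rho> ^ (2*M)) * calD z"
    proof -
      have "\<rho> ^ (2*M) * calD z \<le> ?S"
        unfolding calD_def sum_distrib_left q_def using \<rho> w
        by (intro sum_mono mult_right_mono power_decreasing) auto
      then have "r / 2 * (\<rho> ^ (2*M) * calD z) \<le> r / 2 * ?S" using E by (intro mult_left_mono) auto
      then show ?thesis by (simp add: mult.assoc)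
    qed
    finally show ?thesis .
  qed
  show ?thesis
    by (rule exI[of _ \<epsilon>], rule exI[of _ \<rho>], rule exI[of _ c], rule exI[of _ C],
        rule exI[of _ "r / 2 * \<rho> ^ (2*M)"], rule exI[of _ k])
      (intro conjI E \<rho>(1,2) k(1) Y ballI impI main mult_pos_pos zero_less_power, use E \<rho> in auto)
qed

subsection \<open>Transport of the microinertia\<close>

definition Gf :: "nat \<Rightarrow> inst \<Rightarrow> real" where
  "Gf n z = (\<Sum>ds\<in>SL n. L2sq (pders (tT z) ds (fK z) (tm z)))"

definition Gd :: "nat \<Rightarrow> inst \<Rightarrow> real" where
  "Gd n z = (\<Sum>ds\<in>SL n. 2 * ip (pders (tT z) ds (pder (tT z) Dt (fK z)) (tm z)) (pders (tT z) ds (fK z) (tm z)))"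

lemma Gf_nonneg [simp]: "0 \<le> Gf n z"
  unfolding Gf_def by (intro sum_nonneg) auto

lemma H_sq_le_Gf: "(H n KF z)\<^sup>2 \<le> real (card (SL n)) * Gf n z"
  unfolding H_def Gf_def by (rule hn_sq_le)

lemma Gf_le_H: "Gf n z \<le> (H n KF z)\<^sup>2"
  unfolding H_def Gf_def by (rule sum_L2sq_le_hn) simp

lemma bl_com_J: "bounded_linear (\<lambda>v. com v J)"
  by (rule bounded_bilinear.bounded_linear_left[OF bounded_bilinear_com])

lemma bl_com_w: "bounded_linear (com w)"
  by (rule bounded_bilinear.bounded_linear_right[OF bounded_bilinear_com])

lemma pders_sol_K:
  assumes sol: "sol T u p \<theta> K" and t: "t \<in> {0..T}"
  shows "pders T ds (pder T Dt K) t x = com w (pders T ds K t x) + pders T ds (\<lambda>t x. com (\<theta> t x) J) t x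
    + pders T ds (\<lambda>t x. com (\<theta> t x) (K t x)) t x - pders T ds (conv T u K) t x"
proof -
  note sm = sol_smper[OF sol]
  note s = smper_linear[OF bl_com_w sm(4)] smper_linear[OF bl_com_J sm(3)] smper_bilinear[OF bounded_bilinear_com sm(3,4)]
    smper_conv[OF sm(1,4)]
  have "pders T ds (pder T Dt K) t x = pders T ds (\<lambda>t x. com w (K t x) + com (\<theta> t x) J + com (\<theta> t x) (K t x) - conv T u K t x) t x"
    by (rule eqTD[OF pders_cong[OF sol_K[OF sol]] t])
  then show ?thesis
    using eqTD[OF pders_diff[OF smper_add[OF smper_add[OF s(1,2)] s(3)] s(4)] t]
      eqTD[OF pders_add[OF smper_add[OF s(1,2)] s(3)] t] eqTD[OF pders_add[OF s(1,2)] t]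
      eqTD[OF pders_linear[OF bl_com_w sm(4)] t] by simp
qed

lemma transport_identity:
  assumes sol: "sol T u p \<theta> K" and t: "t \<in> {0..T}"
  shows "ip (pders T ds (pder T Dt K) t) (pders T ds K t)
    \<le> (L2n (pders T ds (\<lambda>t x. com (\<theta> t x) J) t) + L2n (pders T ds (\<lambda>t x. com (\<theta> t x) (K t x)) t)
       + L2n (comm T ds u K t)) * L2n (pders T ds K t)"
proof -
  note sm = sol_smper[OF sol]
  let ?k = "pders T ds K" and ?j = "pders T ds (\<lambda>t x. com (\<theta> t x) J)" and ?c = "pders T ds (\<lambda>t x. com (\<theta> t x) (K t x))"
  have c: "cper (\<lambda>x. com w (?k t x))" "cper (?j t)" "cper (?c t)" "cper (comm T ds u K t)" "cper (conv T u ?k t)" "cper (?k t)"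
    using smper_cper[OF smper_linear[OF bl_com_w smper_pders[OF sm(4)]] t] smper_cper[OF smper_pders[OF smper_linear[OF bl_com_J sm(3)]] t]
      smper_cper[OF smper_pders[OF smper_bilinear[OF bounded_bilinear_com sm(3,4)]] t] smper_cper[OF smper_comm[OF sm(1,4)] t]
      smper_cper[OF smper_conv[OF sm(1) smper_pders[OF sm(4)]] t] smper_cper[OF smper_pders[OF sm(4)] t] by auto
  have z: "ip (\<lambda>x. com w (?k t x)) (?k t) = 0" "ip (conv T u ?k t) (?k t) = 0"
    using ip_conv_zero[OF sm(1) smper_pders[OF sm(4)] t sol_div(1)[OF sol t], of ds] by (simp_all add: ip_def com_inner_self)
  have "pders T ds (pder T Dt K) t = (\<lambda>x. com w (?k t x) + ?j t x + ?c t x - (comm T ds u K t x + conv T u ?k t x))"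
    unfolding pders_sol_K[OF sol t, abs_def] by (simp add: comm_def)
  then have "ip (pders T ds (pder T Dt K) t) (?k t) = ip (?j t) (?k t) + ip (?c t) (?k t) - ip (comm T ds u K t) (?k t)"
    by (simp add: ip_diff_left ip_add_left cper_add cper_diff c z)
  then show ?thesis
    using ip_Cauchy_Schwarz[OF c(2,6)] ip_Cauchy_Schwarz[OF c(3,6)] ip_Cauchy_Schwarz[OF c(4,6)]
    by (simp add: distrib_right abs_le_iff)
qed

lemma Gd_le:
  assumes n: "H n (\<lambda>z t x. com (Th z t x) J) \<preceq> X" "H n (\<lambda>z t x. com (Th z t x) (KF z t x)) \<preceq> X"
    "\<And>ds. ds \<in> SL n \<Longrightarrow> (\<lambda>z. L2n (comm (tT z) ds (U z) (KF z) (tm z))) \<preceq> X"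
    and X: "\<And>z. z \<in> Sol \<Longrightarrow> 0 \<le> X z"
  shows "Gd n \<preceq> (\<lambda>z. X z * H n KF z)"
proof -
  have "(\<lambda>z. 2 * ip (pders (tT z) ds (pder (tT z) Dt (fK z)) (tm z)) (pders (tT z) ds (fK z) (tm z)))
     \<preceq> (\<lambda>z. X z * H n KF z)" if ds: "ds \<in> SL n" for ds
  proof (rule lss_trans[of _ "\<lambda>z. (H n (\<lambda>z t x. com (Th z t x) J) z + H n (\<lambda>z t x. com (Th z t x) (KF z t x)) z
       + L2n (comm (tT z) ds (U z) (KF z) (tm z))) * H n KF z"])
    show "(\<lambda>z. (H n (\<lambda>z t x. com (Th z t x) J) z + H n (\<lambda>z t x. com (Th z t x) (KF z t x)) z
       + L2n (comm (tT z) ds (U z) (KF z) (tm z))) * H n KF z) \<preceq> (\<lambda>z. X z * H n KF z)"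
      by (rule lss_mult[OF lss_add[OF lss_add[OF n(1,2)] n(3)[OF ds]] lss_refl]) (auto simp: X)
    show "(\<lambda>z. 2 * ip (pders (tT z) ds (pder (tT z) Dt (fK z)) (tm z)) (pders (tT z) ds (fK z) (tm z)))
     \<preceq> (\<lambda>z. (H n (\<lambda>z t x. com (Th z t x) J) z + H n (\<lambda>z t x. com (Th z t x) (KF z t x)) z
       + L2n (comm (tT z) ds (U z) (KF z) (tm z))) * H n KF z)"
    proof (rule lssI[of 2])
      fix z assume z: "z \<in> Sol"
      have "ip (pders (tT z) ds (pder (tT z) Dt (fK z)) (tm z)) (pders (tT z) ds (fK z) (tm z))
        \<le> (H n (\<lambda>z t x. com (Th z t x) J) z + H n (\<lambda>z t x. com (Th z t x) (KF z t x)) z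
       + L2n (comm (tT z) ds (U z) (KF z) (tm z))) * H n KF z"
        by (rule order_trans[OF transport_identity[OF Sol_sol[OF z] Sol_tm[OF z]]])
           (auto intro!: mult_mono add_mono L2n_le_hn[OF ds] simp: H_def)
      then show "2 * ip (pders (tT z) ds (pder (tT z) Dt (fK z)) (tm z)) (pders (tT z) ds (fK z) (tm z))
        \<le> 2 * ((H n (\<lambda>z t x. com (Th z t x) J) z + H n (\<lambda>z t x. com (Th z t x) (KF z t x)) z
       + L2n (comm (tT z) ds (U z) (KF z) (tm z))) * H n KF z)" by simp
    qed simp
  qed
  then show ?thesis unfolding Gd_def[abs_def] by (intro lss_sum) (auto simp: X)
qed

lemma Gd_top: "Gd (2*M+1) \<preceq> (\<lambda>z. (DD (2*M) z + H (2*M+1) KF z * DD (2*M-1) z) * H (2*M+1) KF z)"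
proof (rule Gd_le)
  let ?X = "\<lambda>z. DD (2*M) z + H (2*M+1) KF z * DD (2*M-1) z"
  have X: "DD (2*M) \<preceq> ?X" "(\<lambda>z. DD (2*M-1) z * H (2*M+1) KF z) \<preceq> ?X" by (rule lss_le; simp)+
  show "H (2*M+1) (\<lambda>z t x. com (Th z t x) J) \<preceq> ?X"
    by (rule H_linear[OF bl_com_J _ lss_trans[OF DD_Th X(1)]]) auto
  have a: "(\<lambda>z. H (2*M+1) F z * H (2*M-3) KF z) \<preceq> ?X" if "H (2*M+1) F \<preceq> DD (2*M)" for F :: "inst \<Rightarrow> real \<Rightarrow> real^3 \<Rightarrow> real^3"
    by (rule lss_trans[OF lss_trans[OF lss_mult_KD' KD_DD] X(1)]) (auto intro!: small0 that[simplified])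
  have b: "(\<lambda>z. H (2*M) F z * H (2*M+1) KF z) \<preceq> ?X" if "H (2*M) F \<preceq> DD (2*M-1)" for F :: "inst \<Rightarrow> real \<Rightarrow> real^3 \<Rightarrow> real^3"
    by (rule lss_mult[OF that lss_refl _ _ X(2)]) auto
  show "H (2*M+1) (\<lambda>z t x. com (Th z t x) (KF z t x)) \<preceq> ?X"
    by (rule H_bilinear2[OF bounded_bilinear_com _ _ _ _ _ a b]) (use M in \<open>auto intro!: DD_Th\<close>)
  have ab: "(\<lambda>z. H (2*M+1) U z * H (2*M-3) KF z) \<preceq> ?X" "(\<lambda>z. H (2*M) U z * H (2*M+1) KF z) \<preceq> ?X"
    by (intro a b DD_U; simp)+
  show "(\<lambda>z. L2n (comm (tT z) ds (U z) (KF z) (tm z))) \<preceq> ?X" if ds: "ds \<in> SL (2*M+1)" for ds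
  proof -
    have cov: "(j \<le> 2*M+1 \<and> Suc (2*M+1) - j \<le> 2*M-3) \<or> (j \<le> 2*M \<and> Suc (2*M+1) - j \<le> 2*M+1)"
      if "1 \<le> j" "j \<le> 2*M+1" for j using that M by linarith
    have "(\<lambda>z. L2n (pders (tT z) [] (comm (tT z) ds (U z) (KF z)) (tm z))) \<preceq> ?X"
      by (rule est_comm[OF _ cov _ _ _ _ ab]) (use ds M in \<open>auto simp: SL_def\<close>)
    then show ?thesis by simp
  qed
qed simp

lemma Gd_low: "Gd (2*M-3) \<preceq> (\<lambda>z. DD (2*M-3) z * H (2*M-3) KF z)"
proof (rule Gd_le)
  show "H (2*M-3) (\<lambda>z t x. com (Th z t x) J) \<preceq> DD (2*M-3)"
    by (rule H_linear[OF bl_com_J _ DD_Th]) auto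
  have a: "(\<lambda>z. H (2*M-2) F z * H (2*M-3) KF z) \<preceq> DD (2*M-3)" if "H (2*M-2) F \<preceq> DD (2*M-3)" for F :: "inst \<Rightarrow> real \<Rightarrow> real^3 \<Rightarrow> real^3"
    by (rule lss_trans[OF lss_mult_KD' KD_DD]) (auto intro!: small0 that[simplified])
  show "H (2*M-3) (\<lambda>z t x. com (Th z t x) (KF z t x)) \<preceq> DD (2*M-3)"
    by (rule H_bilinear[OF bounded_bilinear_com _ _ _ _ _ a]) (use M in \<open>auto intro!: DD_Th\<close>)
  have ab: "(\<lambda>z. H (2*M-2) U z * H (2*M-3) KF z) \<preceq> DD (2*M-3)"
    using M by (intro a DD_U) auto
  show "(\<lambda>z. L2n (comm (tT z) ds (U z) (KF z) (tm z))) \<preceq> DD (2*M-3)" if ds: "ds \<in> SL (2*M-3)" for ds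
  proof -
    have cov: "(j \<le> 2*M-2 \<and> Suc (2*M-3) - j \<le> 2*M-3) \<or> (j \<le> 2*M-2 \<and> Suc (2*M-3) - j \<le> 2*M-3)"
      if "1 \<le> j" "j \<le> 2*M-3" for j using that M by linarith
    have "(\<lambda>z. L2n (pders (tT z) [] (comm (tT z) ds (U z) (KF z)) (tm z))) \<preceq> DD (2*M-3)"
      by (rule est_comm[OF _ cov _ _ _ _ ab ab]) (use ds M in \<open>auto simp: SL_def\<close>)
    then show ?thesis by simp
  qed
qed simp

lemma young_div: "2 * (x * h) \<le> n * x\<^sup>2 + h\<^sup>2 / n" if "0 < n" for n x h :: real
proof -
  have "0 \<le> (n * x - h)\<^sup>2 / n" using that by simp
  also have "\<dots> = n * x\<^sup>2 + h\<^sup>2 / n - 2 * (x * h)"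
    using that by (simp add: power2_eq_square field_simps)
  finally show ?thesis by simp
qed

lemma top_inequality:
  "\<exists>C>0. \<exists>k>0. \<forall>z\<in>Sol. kp z \<le> k \<longrightarrow> Gd (2*M+1) z / (1 + tm z) - Gf (2*M+1) z / (1 + tm z)\<^sup>2 \<le> C * calD z"
proof -
  let ?H = "H (2*M+1) KF" and ?N = "real (card (SL (2*M+1)))"
  obtain C k where C: "C > 0" "k > 0" "\<And>z. z \<in> Sol \<Longrightarrow> kp z \<le> k \<Longrightarrow>
     Gd (2*M+1) z \<le> C * ((DD (2*M) z + ?H z * DD (2*M-1) z) * ?H z)"
    by (rule lss_bound[OF Gd_top]) auto
  have N: "?N > 0" by (rule card_SL_pos)
  have "Gd (2*M+1) z / (1 + tm z) - Gf (2*M+1) z / (1 + tm z)\<^sup>2 \<le> (C\<^sup>2 * ?N) * calD z" if z: "z \<in> Sol" "kp z \<le> k" for z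
  proof -
    let ?w = "1 + tm z"
    have w: "1 \<le> ?w" using z by simp
    define X where "X = DD (2*M) z + ?H z * DD (2*M-1) z"
    define h where "h = ?H z / ?w"
    have X0: "0 \<le> X" by (simp add: X_def)
    have "Gd (2*M+1) z / ?w \<le> C * (X * ?H z) / ?w"
      using C(3)[OF z] w by (intro divide_right_mono) (auto simp: X_def)
    also have "\<dots> = (C * X) * h" by (simp add: h_def)
    also have "\<dots> \<le> ?N * (C * X)\<^sup>2 / 4 + h\<^sup>2 / ?N"
      using young_div[OF N, of "C * X / 2" h] by (simp add: power_divide)
    also have "h\<^sup>2 / ?N \<le> Gf (2*M+1) z / ?w\<^sup>2"
    proof -
      have "h\<^sup>2 / ?N = (?H z)\<^sup>2 / (?w\<^sup>2 * ?N)" by (simp add: h_def power_divide)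
      also have "\<dots> \<le> (?N * Gf (2*M+1) z) / (?w\<^sup>2 * ?N)"
        using H_sq_le_Gf[of "2*M+1" z] w N by (intro divide_right_mono) auto
      also have "\<dots> = Gf (2*M+1) z / ?w\<^sup>2"
        by (subst mult.commute[of _ ?N], rule mult_divide_mult_cancel_left) (use N in linarith)
      finally show ?thesis .
    qed
    finally have 1: "Gd (2*M+1) z / ?w - Gf (2*M+1) z / ?w\<^sup>2 \<le> ?N * (C * X)\<^sup>2 / 4" by linarith
    have "X\<^sup>2 \<le> 2 * (DD (2*M) z)\<^sup>2 + 2 * (?H z * DD (2*M-1) z)\<^sup>2"
      using sum_squares_bound[of "DD (2*M) z" "?H z * DD (2*M-1) z"] unfolding X_def by (simp add: power2_sum)
    also have "(?H z * DD (2*M-1) z)\<^sup>2 \<le> ?w * (DD (2*M-1) z)\<^sup>2"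
    proof -
      have "(?H z)\<^sup>2 \<le> (kp z)\<^sup>2 * ?w" using Sol_E(2)[OF z(1)] by (simp add: H_def)
      also have "\<dots> \<le> 1 * ?w" using z w by (intro mult_right_mono) (auto simp: power_le_one)
      finally show ?thesis by (simp add: power_mult_distrib mult_right_mono)
    qed
    finally have X: "X\<^sup>2 \<le> 2 * (DD (2*M) z)\<^sup>2 + 2 * (?w * (DD (2*M-1) z)\<^sup>2)" by simp
    have m: "2 \<le> 2*M-1" "2 \<le> 2*M" using M by linarith+
    have "X\<^sup>2 \<le> 4 * calD z"
      using X calD_ge_power[OF z(1) m(1), of 1] calD_ge_power[OF z(1) m(2), of 0] M by simp
    then have "?N * C\<^sup>2 / 4 * X\<^sup>2 \<le> ?N * C\<^sup>2 / 4 * (4 * calD z)" using N by (intro mult_left_mono) auto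
    then show ?thesis using 1 by (simp add: power_mult_distrib mult_ac)
  qed
  then show ?thesis using C N by (intro exI[of _ "C\<^sup>2 * ?N"] conjI exI[of _ k]) auto
qed

text \<open>The weight decreases from 2 to 1 and its derivative absorbs the square of the norm that Young's
  inequality produces.\<close>

lemma low_inequality:
  "\<exists>C>0. \<exists>k>0. \<forall>z\<in>Sol. kp z \<le> k \<longrightarrow>
     (1 + 1 / (1 + tm z)) * Gd (2*M-3) z - Gf (2*M-3) z / (1 + tm z)\<^sup>2 \<le> C * calD z"
proof -
  let ?H = "H (2*M-3) KF" and ?N = "real (card (SL (2*M-3)))"
  obtain C k where C: "C > 0" "k > 0" "\<And>z. z \<in> Sol \<Longrightarrow> kp z \<le> k \<Longrightarrow> Gd (2*M-3) z \<le> C * (DD (2*M-3) z * ?H z)"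
    by (rule lss_bound[OF Gd_low]) auto
  have N: "?N > 0" by (rule card_SL_pos)
  have "(1 + 1 / (1 + tm z)) * Gd (2*M-3) z - Gf (2*M-3) z / (1 + tm z)\<^sup>2 \<le> (C\<^sup>2 * ?N) * calD z" if z: "z \<in> Sol" "kp z \<le> k" for z
  proof -
    let ?w = "1 + tm z"
    have w: "1 \<le> ?w" using z by simp
    define X where "X = C * (DD (2*M-3) z * ?w)"
    define h where "h = ?H z / ?w"
    have Xh: "C * (DD (2*M-3) z * ?H z) = X * h" using w by (simp add: X_def h_def)
    have X0: "0 \<le> X * h" using C w by (simp add: X_def h_def)
    have "(1 + 1 / ?w) * Gd (2*M-3) z \<le> (1 + 1 / ?w) * (X * h)"
      using C(3)[OF z] w by (intro mult_left_mono) (auto simp: Xh)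
    also have "\<dots> \<le> 2 * (X * h)" using X0 w by (intro mult_right_mono) auto
    also have "\<dots> \<le> ?N * X\<^sup>2 + h\<^sup>2 / ?N"
      by (rule young_div[OF N])
    also have "h\<^sup>2 / ?N \<le> Gf (2*M-3) z / ?w\<^sup>2"
    proof -
      have "h\<^sup>2 / ?N = (?H z)\<^sup>2 / (?w\<^sup>2 * ?N)" by (simp add: h_def power_divide)
      also have "\<dots> \<le> (?N * Gf (2*M-3) z) / (?w\<^sup>2 * ?N)"
        using H_sq_le_Gf[of "2*M-3" z] w N by (intro divide_right_mono) auto
      also have "\<dots> = Gf (2*M-3) z / ?w\<^sup>2"
        by (subst mult.commute[of _ ?N], rule mult_divide_mult_cancel_left) (use N in linarith)
      finally show ?thesis .
    qed
    finally have 1: "(1 + 1 / ?w) * Gd (2*M-3) z - Gf (2*M-3) z / ?w\<^sup>2 \<le> ?N * X\<^sup>2" by simp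
    have "X\<^sup>2 = C\<^sup>2 * (?w ^ 2 * (DD (2*M-3) z)\<^sup>2)" by (simp add: X_def power_mult_distrib mult_ac)
    also have "\<dots> \<le> C\<^sup>2 * calD z" using M by (intro mult_left_mono calD_ge_power[OF z(1)]) auto
    finally have "?N * X\<^sup>2 \<le> ?N * (C\<^sup>2 * calD z)" using N by (intro mult_left_mono) auto
    then show ?thesis using 1 by (simp add: mult_ac)
  qed
  then show ?thesis using C N by (intro exI[of _ "C\<^sup>2 * ?N"] conjI exI[of _ k]) auto
qed

end


section \<open>Recovery of the time derivatives\<close>

context par
begin

lemma dt_Suc: "dt j (\<lambda>z. pder (tT z) Dt (F z)) = dt (Suc j) F"
  by (simp add: dt_def ptd_def fun_eq_iff funpow_swap1)

lemma dt_dt: "dt i (dt j F) = dt (i + j) F"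
  by (simp add: dt_def ptd_def fun_eq_iff funpow_add)

lemma dt_1: "dt (Suc 0) F = (\<lambda>z. pder (tT z) Dt (F z))"
  by (simp add: dt_def ptd_def fun_eq_iff)

lemma dt_pders: "dt j F z = pders (tT z) (replicate j Dt) (F z)"
  by (simp add: dt_def ptd_pders)

lemma feq_dt: "feq F G \<Longrightarrow> feq (dt j F) (dt j G)"
  by (auto simp: feq_def dt_pders intro: pders_cong)

lemma H_dt_cong: "feq F G \<Longrightarrow> H n (dt j G) \<preceq> Z \<Longrightarrow> H n (dt j F) \<preceq> Z"
  by (rule H_cong[OF feq_dt])

lemma H_dt_add:
  assumes "fam F" "fam G" "H n (dt j F) \<preceq> Z" "H n (dt j G) \<preceq> Z"
  shows "H n (dt j (\<lambda>z t x. F z t x + G z t x)) \<preceq> Z"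
proof (rule H_cong)
  show "feq (dt j (\<lambda>z t x. F z t x + G z t x)) (\<lambda>z t x. dt j F z t x + dt j G z t x)"
    using pders_add[OF famD[OF assms(1)] famD[OF assms(2)]] by (simp add: feq_def dt_pders)
  show "H n (\<lambda>z t x. dt j F z t x + dt j G z t x) \<preceq> Z" by (intro H_add fam_dt assms)
qed

lemma H_dt_diff:
  assumes "fam F" "fam G" "H n (dt j F) \<preceq> Z" "H n (dt j G) \<preceq> Z"
  shows "H n (dt j (\<lambda>z t x. F z t x - G z t x)) \<preceq> Z"
proof (rule H_cong)
  show "feq (dt j (\<lambda>z t x. F z t x - G z t x)) (\<lambda>z t x. dt j F z t x - dt j G z t x)"
    using pders_diff[OF famD[OF assms(1)] famD[OF assms(2)]] by (simp add: feq_def dt_pders)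
  show "H n (\<lambda>z t x. dt j F z t x - dt j G z t x) \<preceq> Z" by (intro H_diff fam_dt assms)
qed

lemma H_dt_linear:
  assumes "bounded_linear L" "fam F" "H n (dt j F) \<preceq> Z"
  shows "H n (dt j (\<lambda>z t x. L (F z t x))) \<preceq> Z"
proof (rule H_cong)
  show "feq (dt j (\<lambda>z t x. L (F z t x))) (\<lambda>z t x. L (dt j F z t x))"
    using pders_linear[OF assms(1) famD[OF assms(2)]] by (simp add: feq_def dt_pders)
  show "H n (\<lambda>z t x. L (dt j F z t x)) \<preceq> Z" by (intro H_linear[OF assms(1)] fam_dt assms)
qed

lemma H_dt_scaleR: "fam F \<Longrightarrow> H n (dt j F) \<preceq> Z \<Longrightarrow> H n (dt j (\<lambda>z t x. c *\<^sub>R F z t x)) \<preceq> Z"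
  by (rule H_dt_linear[OF bounded_linear_scaleR_right])

lemma H_dt_lin1:
  assumes "\<And>i. bounded_linear (L i)" "fam F" "H (Suc n) (dt j F) \<preceq> Z"
  shows "H n (dt j (\<lambda>z. lin1 (tT z) L (F z))) \<preceq> Z"
proof (rule H_cong)
  show "feq (dt j (\<lambda>z. lin1 (tT z) L (F z))) (\<lambda>z. lin1 (tT z) L (dt j F z))"
    using pders_lin1[OF assms(1) famD[OF assms(2)]] by (simp add: feq_def dt_pders)
  show "H n (\<lambda>z. lin1 (tT z) L (dt j F z)) \<preceq> Z" by (intro H_lin1 fam_dt assms)
qed

lemma H_dt_lap:
  assumes "fam F" "H (n + 2) (dt j F) \<preceq> Z"
  shows "H n (dt j (\<lambda>z. lap (tT z) (F z))) \<preceq> Z"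
proof (rule H_cong)
  show "feq (dt j (\<lambda>z. lap (tT z) (F z))) (\<lambda>z. lap (tT z) (dt j F z))"
    using pders_lap[OF famD[OF assms(1)]] by (simp add: feq_def dt_pders)
  show "H n (\<lambda>z. lap (tT z) (dt j F z)) \<preceq> Z" by (intro H_lap fam_dt assms)
qed

lemma H_dt_bilinear:
  assumes B: "bounded_bilinear B"
  shows "fam F \<Longrightarrow> fam G \<Longrightarrow> (\<And>i. i \<le> j \<Longrightarrow> H n (\<lambda>z t x. B (dt i F z t x) (dt (j - i) G z t x)) \<preceq> Z)
    \<Longrightarrow> H n (dt j (\<lambda>z t x. B (F z t x) (G z t x))) \<preceq> Z"
proof (induction j arbitrary: F G)
  case 0
  then show ?case using 0(3)[of 0] by simp
next
  case (Suc j)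
  let ?F = "dt (Suc 0) F" and ?G = "dt (Suc 0) G"
  show ?case
  proof (rule H_cong)
    show "feq (dt (Suc j) (\<lambda>z t x. B (F z t x) (G z t x)))
      (\<lambda>z t x. dt j (\<lambda>z t x. B (F z t x) (?G z t x)) z t x + dt j (\<lambda>z t x. B (?F z t x) (G z t x)) z t x)"
      using pders_bilinear_snoc[OF B famD[OF Suc(2)] famD[OF Suc(3)], where ds="replicate j Dt" and d=Dt]
      by (simp add: feq_def dt_pders replicate_append_same)
    show "H n (\<lambda>z t x. dt j (\<lambda>z t x. B (F z t x) (?G z t x)) z t x + dt j (\<lambda>z t x. B (?F z t x) (G z t x)) z t x) \<preceq> Z"
    proof (intro H_add fam_dt fam_bilinear[OF B] Suc)
      show "H n (\<lambda>z t x. B (dt i F z t x) (dt (j - i) ?G z t x)) \<preceq> Z" if "i \<le> j" for i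
        using Suc(4)[of i] that by (simp add: dt_dt Suc_diff_le)
      show "H n (\<lambda>z t x. B (dt i ?F z t x) (dt (j - i) G z t x)) \<preceq> Z" if "i \<le> j" for i
        using Suc(4)[of "Suc i"] that by (simp add: dt_dt)
    qed
  qed
qed

lemma H_dt_conv:
  "fam F \<Longrightarrow> fam G \<Longrightarrow> (\<And>i. i \<le> j \<Longrightarrow> H n (\<lambda>z. conv (tT z) (dt i F z) (dt (j - i) G z)) \<preceq> Z)
    \<Longrightarrow> H n (dt j (\<lambda>z. conv (tT z) (F z) (G z))) \<preceq> Z"
proof (induction j arbitrary: F G)
  case 0
  then show ?case using 0(3)[of 0] by simp
next
  case (Suc j)
  let ?F = "dt (Suc 0) F" and ?G = "dt (Suc 0) G"
  have e: "feq (\<lambda>z. pder (tT z) Dt (conv (tT z) (F z) (G z))) (\<lambda>z t x. conv (tT z) (?F z) (G z) t x + conv (tT z) (F z) (?G z) t x)"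
    using pder_conv[OF famD[OF Suc(2)] famD[OF Suc(3)]] by (simp add: feq_def dt_1)
  have "H n (dt j (\<lambda>z t x. conv (tT z) (?F z) (G z) t x + conv (tT z) (F z) (?G z) t x)) \<preceq> Z"
  proof (intro H_dt_add fam_dt fam_conv Suc)
    show "H n (\<lambda>z. conv (tT z) (dt i F z) (dt (j - i) ?G z)) \<preceq> Z" if "i \<le> j" for i
      using Suc(4)[of i] that by (simp add: dt_dt Suc_diff_le)
    show "H n (\<lambda>z. conv (tT z) (dt i ?F z) (dt (j - i) G z)) \<preceq> Z" if "i \<le> j" for i
      using Suc(4)[of "Suc i"] that by (simp add: dt_dt)
  qed
  from H_dt_cong[OF e this] show ?case unfolding dt_Suc .
qed

text \<open>The gradient of the pressure is orthogonal to the divergence free time derivative of the velocity,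
  hence no estimate of the pressure is needed.\<close>

lemma H_dt_Suc_U:
  assumes "H n (dt j (\<lambda>z. Lu (tT z) (U z) (Th z))) \<preceq> Z" "H n (dt j (\<lambda>z. conv (tT z) (U z) (U z))) \<preceq> Z"
  shows "H n (dt (Suc j) U) \<preceq> Z"
proof -
  let ?L = "\<lambda>z. Lu (tT z) (U z) (Th z)" and ?C = "\<lambda>z. conv (tT z) (U z) (U z)"
  have "H n (dt (Suc j) U) z \<le> H n (dt j ?L) z + H n (dt j ?C) z" if z: "z \<in> Sol" for z
  proof -
    let ?T = "tT z" and ?t = "tm z" and ?u = "fu z"
    note sl = Sol_sol[OF z] and t = Sol_tm[OF z]
    note sm = sol_smper[OF sl]
    have "L2n (pders ?T ds (dt (Suc j) U z) ?t) \<le> L2n (pders ?T ds (dt j ?L z) ?t) + L2n (pders ?T ds (dt j ?C z) ?t)" for ds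
    proof -
      let ?es = "ds @ replicate j Dt"
      let ?v = "pders ?T ?es (pder ?T Dt ?u) ?t"
      let ?l = "pders ?T ?es (Lu ?T ?u (fh z)) ?t" and ?c = "pders ?T ?es (conv ?T ?u ?u) ?t"
      have v: "pders ?T ds (dt (Suc j) U z) ?t = ?v"
        unfolding dt_Suc[symmetric] by (simp add: dt_pders pders_append)
      have cc: "cper ?v" "cper ?l" "cper ?c" "cper (lin1 ?T gradL (pders ?T ?es (fp z)) ?t)"
        using smper_cper[OF smper_pders[OF smper_pder[OF sm(1)]] t] smper_cper[OF smper_pders[OF smper_Lu[OF sm(1,3)]] t]
          smper_cper[OF smper_pders[OF smper_conv[OF sm(1,1)]] t]
          smper_cper[OF smper_lin1[of gradL, OF bl_ops(3) smper_pders[OF sm(2)]] t] by simp_all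
      have dv: "lin1 ?T divL (pders ?T ?es (pder ?T Dt ?u)) ?t x = 0" for x
        using pders_div[OF sl t, of "?es @ [Dt]" x] by (simp add: pders_append)
      have g0: "ip (lin1 ?T gradL (pders ?T ?es (fp z)) ?t) ?v = 0"
        using ip_grad[OF smper_pders[OF sm(2)] smper_pders[OF smper_pder[OF sm(1)]] t, of ?es ?es Dt] dv
        by (simp add: ip_def)
      have "pders ?T ?es (pder ?T Dt ?u) ?t = (\<lambda>x. ?l x - lin1 ?T gradL (pders ?T ?es (fp z)) ?t x - ?c x)"
        using pders_sol_u[OF sl t, of ?es] eqTD[OF pders_Lu[OF sm(1,3)] t, of ?es] by (simp add: fun_eq_iff)
      then have "ip ?v ?v = ip (\<lambda>x. ?l x - lin1 ?T gradL (pders ?T ?es (fp z)) ?t x - ?c x) ?v" by simp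
      also have "\<dots> = ip ?l ?v - ip ?c ?v" by (simp add: ip_diff_left cper_diff cc g0)
      also have "\<dots> \<le> L2n ?l * L2n ?v + L2n ?c * L2n ?v"
        using ip_Cauchy_Schwarz[OF cc(2,1)] ip_Cauchy_Schwarz[OF cc(3,1)] by (simp add: abs_le_iff)
      finally have "L2n ?v * L2n ?v \<le> (L2n ?l + L2n ?c) * L2n ?v"
        by (simp add: distrib_right L2sq_ip[symmetric] flip: L2n_sq power2_eq_square)
      then have "L2n ?v \<le> L2n ?l + L2n ?c"
        by (cases "L2n ?v = 0") (auto simp: less_le intro: mult_right_le_imp_le)
      then show ?thesis unfolding v by (simp add: dt_pders pders_append)
    qed
    then show ?thesis unfolding H_def hn_def sum.distrib[symmetric] by (intro sum_mono)
  qed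
  then show ?thesis by (rule lss_trans[OF lss_le lss_add[OF assms]])
qed

lemma fam_Lu [simp]: "fam (\<lambda>z. Lu (tT z) (U z) (Th z))"
  unfolding Lu_def by (intro fam_add fam_scaleR fam_lap fam_lin1 bl_ops fam_fields)

lemma H_dt_Lu: "H (n + 2) (dt j U) \<preceq> Z \<Longrightarrow> H (n + 1) (dt j Th) \<preceq> Z \<Longrightarrow> H n (dt j (\<lambda>z. Lu (tT z) (U z) (Th z))) \<preceq> Z"
  unfolding Lu_def
  by (intro H_dt_add H_dt_scaleR H_dt_lap H_dt_lin1 fam_scaleR fam_lap fam_lin1 bl_ops fam_fields) auto

lemma H_dt_Lth: "H (n + 2) (dt j Th) \<preceq> Z \<Longrightarrow> H (n + 1) (dt j U) \<preceq> Z \<Longrightarrow> H n (dt j (\<lambda>z. Lth (tT z) (U z) (Th z))) \<preceq> Z"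
  unfolding Lth_def
  by (intro H_dt_add H_dt_diff H_dt_scaleR H_dt_lin1 H_dt_lap fam_add fam_diff fam_scaleR fam_lin1 fam_lap bl_ops fam_fields)
     (auto intro: H_mono simp: numeral_2_eq_2)

lemma H_dt_RL:
  "H (n + 2) (dt j Th) \<preceq> Z \<Longrightarrow> H (n + 1) (dt j U) \<preceq> Z \<Longrightarrow> H n (dt j A) \<preceq> Z \<Longrightarrow> H n (dt j RL) \<preceq> Z"
  unfolding RL_def[abs_def]
  by (intro H_dt_diff H_dt_scaleR fam_diff fam_scaleR fam_linear[OF bl_L0] fam_linear[OF bl_Rv]
      H_dt_linear[OF bl_L0] H_dt_linear[OF bl_Rv] fam_Lth H_dt_Lth fam_fields) (auto intro: H_mono)

lemma dt_Suc_Th: "feq (\<lambda>z. pder (tT z) Dt (Th z)) (\<lambda>z t x. Mt z t x - conv (tT z) (U z) (Th z) t x)"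
  by (simp add: feq_def eqT_def Mt_def mat_der_def)

lemma H_dt_Mt:
  assumes "H n (dt j RL) \<preceq> Z" "H n (dt j N1) \<preceq> Z" "H n (dt j KM) \<preceq> Z"
  shows "H n (dt j Mt) \<preceq> Z"
  by (rule H_dt_cong[OF Mt_eq]) (intro H_dt_linear[OF bl_Jeq] H_dt_diff fam_diff assms fam_RL fam_N1 fam_KM)

lemma H_dt_Suc_Th:
  assumes "H n (dt j Mt) \<preceq> Z" "H n (dt j (\<lambda>z. conv (tT z) (U z) (Th z))) \<preceq> Z"
  shows "H n (dt (Suc j) Th) \<preceq> Z"
  unfolding dt_Suc[symmetric]
  by (rule H_dt_cong[OF dt_Suc_Th]) (intro H_dt_diff fam_conv fam_fields fam_Mt assms)

lemma H_dt_Suc_A: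
  assumes "H n (dt j A) \<preceq> Z" "H n (dt j Th) \<preceq> Z" "H n (dt j NA) \<preceq> Z" "H n (dt j (\<lambda>z. conv (tT z) (U z) (A z))) \<preceq> Z"
  shows "H n (dt (Suc j) A) \<preceq> Z"
proof -
  have "H n (dt j dA) \<preceq> Z"
    by (rule H_dt_cong[OF dA_eq])
       (intro H_dt_add H_dt_diff H_dt_scaleR fam_add fam_diff fam_scaleR H_dt_linear[OF bl_perp] H_dt_linear[OF bl_hperp]
        fam_linear[OF bl_perp] fam_linear[OF bl_hperp] fam_conv fam_fields fam_NA assms)
  then show ?thesis by (simp add: dA_def[abs_def] dt_Suc)
qed

lemma dK_eq: "feq (\<lambda>z. pder (tT z) Dt (KF z)) (\<lambda>z t x. com w (KF z t x) + com (Th z t x) J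
    + com (Th z t x) (KF z t x) - conv (tT z) (U z) (KF z) t x)"
  using sol_K[OF Sol_sol] by (simp add: feq_def)

lemma H_dt_Suc_K:
  assumes "H n (dt j KF) \<preceq> Z" "H n (dt j Th) \<preceq> Z" "H n (dt j (\<lambda>z t x. com (Th z t x) (KF z t x))) \<preceq> Z"
    "H n (dt j (\<lambda>z. conv (tT z) (U z) (KF z))) \<preceq> Z"
  shows "H n (dt (Suc j) KF) \<preceq> Z"
  unfolding dt_Suc[symmetric]
  by (rule H_dt_cong[OF dK_eq])
     (intro H_dt_add H_dt_diff fam_add fam_diff H_dt_linear[OF bl_com_w] H_dt_linear[OF bl_com_J]
      fam_linear[OF bl_com_w] fam_linear[OF bl_com_J] fam_conv fam_fields fam_bilinear[OF bounded_bilinear_com] assms)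

definition PP :: "nat \<Rightarrow> inst \<Rightarrow> real" where
  "PP s z = (\<Sum>j\<le>s div 2. H (s - 2 * j) (dt j U) z + H (s - 2 * j) (dt j Th) z)"

definition base :: "nat \<Rightarrow> inst \<Rightarrow> real" where
  "base s z = H s U z + H s Th z + H (s - 2) A z + kp z * (sqrt (1 + tm z) * DD 5 z)"

lemma PP_nonneg [simp]: "0 \<le> PP s z"
  unfolding PP_def by (intro sum_nonneg) auto

lemma base_nonneg [simp]: "z \<in> Sol \<Longrightarrow> 0 \<le> base s z"
  by (simp add: base_def)

lemma PP_member:
  assumes "2 * j + n \<le> s"
  shows "H n (dt j U) \<preceq> PP s" "H n (dt j Th) \<preceq> PP s"
proof -
  have "H n (dt j U) z \<le> PP s z" "H n (dt j Th) z \<le> PP s z" for z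
  proof -
    have "H (s - 2 * j) (dt j U) z + H (s - 2 * j) (dt j Th) z \<le> PP s z"
      unfolding PP_def using assms
      by (intro member_le_sum[of j "{..s div 2}" "\<lambda>j. H (s - 2 * j) (dt j U) z + H (s - 2 * j) (dt j Th) z"]) auto
    moreover have "H n (dt j U) z \<le> H (s - 2 * j) (dt j U) z" "H n (dt j Th) z \<le> H (s - 2 * j) (dt j Th) z"
      unfolding H_def using assms by (intro hn_mono; simp)+
    ultimately show "H n (dt j U) z \<le> PP s z" "H n (dt j Th) z \<le> PP s z"
      using H_nonneg[of "s - 2*j" "dt j U" z] H_nonneg[of "s - 2*j" "dt j Th" z] by linarith+
  qed
  then show "H n (dt j U) \<preceq> PP s" "H n (dt j Th) \<preceq> PP s" by (auto intro: lss_le)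
qed

lemma lss_kp_mult:
  assumes "X \<preceq> kp" "Y \<preceq> W" "(\<lambda>z. kp z * W z) \<preceq> Z" "\<And>z. z \<in> Sol \<Longrightarrow> 0 \<le> Y z"
  shows "(\<lambda>z. X z * Y z) \<preceq> Z" "(\<lambda>z. Y z * X z) \<preceq> Z"
proof -
  show "(\<lambda>z. X z * Y z) \<preceq> Z"
    by (rule lss_mult[OF assms(1,2)]) (auto simp: assms)
  then show "(\<lambda>z. Y z * X z) \<preceq> Z" by (simp add: mult.commute)
qed


lemma lss_kp_base: "Y \<preceq> DD 5 \<Longrightarrow> X \<preceq> (\<lambda>z. kp z * sqrt (1 + tm z)) \<Longrightarrow> (\<And>z. z \<in> Sol \<Longrightarrow> 0 \<le> X z) \<Longrightarrow> (\<lambda>z. Y z * X z) \<preceq> base s"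
  by (rule lss_mult[where Y="DD 5" and Y'="\<lambda>z. kp z * sqrt (1 + tm z)"])
     (auto intro!: lss_le simp: base_def mult_ac)

lemma base_member: "n \<le> s \<Longrightarrow> H n U \<preceq> base s" "n \<le> s \<Longrightarrow> H n Th \<preceq> base s" "n \<le> s - 2 \<Longrightarrow> H n A \<preceq> base s"
  by (rule H_mono[of s], rule lss_le; simp add: base_def; fail | rule H_mono[of "s - 2"], rule lss_le; simp add: base_def; fail)+

context
  fixes s :: nat assumes s: "s = 2 * M \<or> s = 2 * M + 1"
begin

lemma dt_conv_U:
  assumes "2 * j + n + 2 \<le> s"
  shows "H n (dt j (\<lambda>z. conv (tT z) (U z) (U z))) \<preceq> (\<lambda>z. kp z * PP s z)"
    and "H n (dt j (\<lambda>z. conv (tT z) (U z) (Th z))) \<preceq> (\<lambda>z. kp z * PP s z)"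
    and "H n (dt j (\<lambda>z. conv (tT z) (U z) (A z))) \<preceq> (\<lambda>z. kp z * PP s z)"
proof -
  show "H n (dt j (\<lambda>z. conv (tT z) (U z) (U z))) \<preceq> (\<lambda>z. kp z * PP s z)"
  proof (rule H_dt_conv)
    fix i assume i: "i \<le> j"
    show "H n (\<lambda>z. conv (tT z) (dt i U z) (dt (j - i) U z)) \<preceq> (\<lambda>z. kp z * PP s z)"
      by (rule H_conv[where a="2*M-2*i" and b="s-2*(j-i)"], simp, simp)
        (use assms i s M in \<open>auto intro!: lss_kp_mult(1)[OF small_U PP_member(1)]\<close>)
  qed auto
  show "H n (dt j (\<lambda>z. conv (tT z) (U z) (Th z))) \<preceq> (\<lambda>z. kp z * PP s z)"
  proof (rule H_dt_conv)
    fix i assume i: "i \<le> j"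
    show "H n (\<lambda>z. conv (tT z) (dt i U z) (dt (j - i) Th z)) \<preceq> (\<lambda>z. kp z * PP s z)"
      by (rule H_conv[where a="2*M-2*i" and b="s-2*(j-i)"], simp, simp)
        (use assms i s M in \<open>auto intro!: lss_kp_mult(1)[OF small_U PP_member(2)]\<close>)
  qed auto
  show "H n (dt j (\<lambda>z. conv (tT z) (U z) (A z))) \<preceq> (\<lambda>z. kp z * PP s z)"
  proof (rule H_dt_conv)
    fix i assume i: "i \<le> j"
    show "H n (\<lambda>z. conv (tT z) (dt i U z) (dt (j - i) A z)) \<preceq> (\<lambda>z. kp z * PP s z)"
      by (rule H_conv[where a="s-2*i" and b="2*M-2*(j-i)"], simp, simp)
        (use assms i s M in \<open>auto intro!: lss_kp_mult(2)[OF small_A PP_member(1)]\<close>)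
  qed auto
qed

lemma dt_Mt_PP:
  assumes "2 * l + n + 2 \<le> s"
  shows "H n (dt l Mt) \<preceq> PP s"
  unfolding Mt_def[abs_def] mat_der_def
proof (rule H_dt_add)
  show "H n (dt l (\<lambda>z. pder (tT z) Dt (Th z))) \<preceq> PP s"
    unfolding dt_Suc by (rule PP_member) (use assms in simp)
  show "H n (dt l (\<lambda>z. conv (tT z) (U z) (Th z))) \<preceq> PP s"
    by (rule lss_trans[OF dt_conv_U(2)[OF assms] kp_le]) auto
qed (auto intro: fam_pder fam_conv)

context
  fixes Z :: "inst \<Rightarrow> real"
  assumes Zb: "base s \<preceq> Z" and Zp: "(\<lambda>z. kp z * PP s z) \<preceq> Z" and Z0: "\<And>z. z \<in> Sol \<Longrightarrow> 0 \<le> Z z"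
begin

lemma dt_ThK:
  assumes B: "bounded_bilinear B" and jn: "2 * j + n + 2 \<le> s"
  shows "H n (dt j (\<lambda>z t x. B (Th z t x) (KF z t x))) \<preceq> Z"
proof (cases "j = 0")
  case True
  have 1: "(\<lambda>z. H s Th z * H (2*M-3) KF z) \<preceq> Z"
    by (rule lss_kp_mult(2)[OF small0(4) PP_member(2)[of 0, simplified] Zp]) auto
  have 2: "(\<lambda>z. H 4 Th z * H (2*M+1) KF z) \<preceq> Z"
    by (rule lss_trans[OF lss_kp_base[OF DD_Th small_K_top] Zb]) auto
  have "H n (\<lambda>z t x. B (Th z t x) (KF z t x)) \<preceq> Z"
    by (rule H_bilinear2[OF B _ _ _ _ _ 1 2]) (use jn True s M in auto)
  then show ?thesis using True by simp
next
  case False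
  show ?thesis
  proof (rule H_dt_bilinear[OF B])
    fix i assume i: "i \<le> j"
    have n: "n \<le> nK (j - i)" "n + 3 \<le> s - 2 * i + nK (j - i)" "j - i \<le> M" using jn i False s M unfolding nK_def by auto
    show "H n (\<lambda>z t x. B (dt i Th z t x) (dt (j - i) KF z t x)) \<preceq> Z"
      by (rule H_bilinear[OF B, where a="s-2*i" and b="nK (j-i)"], simp, simp)
        (use jn i n s in \<open>auto intro!: lss_kp_mult(2)[OF small_K PP_member(2) Zp]\<close>)
  qed auto
qed

lemma dt_N1:
  assumes jn: "2 * j + n + 2 \<le> s"
  shows "H n (dt j N1) \<preceq> Z"
proof -
  let ?g = "\<lambda>z t x. KF z t x *v Th z t x"
  have g: "H n (dt j ?g) \<preceq> Z" if "2 * j + n + 2 \<le> s" for j n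
    by (rule dt_ThK[OF bb_vm that])
  have JJ: "H n (dt j (\<lambda>z t x. cross3 (Th z t x) (J *v Th z t x))) \<preceq> Z"
  proof (rule H_dt_bilinear[OF bb_cross_J])
    fix i assume i: "i \<le> j"
    show "H n (\<lambda>z t x. cross3 (dt i Th z t x) (J *v dt (j - i) Th z t x)) \<preceq> Z"
      by (rule H_bilinear[OF bb_cross_J, where a="2*M-2*i" and b="s-2*(j-i)"], simp, simp)
        (use jn i s M in \<open>auto intro!: lss_kp_mult(1)[OF small_Th PP_member(2) Zp]\<close>)
  qed auto
  have tri: "H n (dt j (\<lambda>z t x. cross3 (Th z t x) (?g z t x))) \<preceq> Z"
  proof (rule H_dt_bilinear[OF bounded_bilinear_cross3])
    fix i assume i: "i \<le> j"
    have "(\<lambda>z. H (2*M-2*i) (dt i Th) z * H (s-2*(j-i)-2) (dt (j-i) ?g) z) \<preceq> Z"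
      by (rule lss_kp_mult(1)[OF small_Th g kp_le]) (use jn i s Z0 in auto)
    then show "H n (\<lambda>z t x. cross3 (dt i Th z t x) (dt (j - i) ?g z t x)) \<preceq> Z"
      by (rule H_bilinear[OF bounded_bilinear_cross3, rotated -1]) (use jn i s M fam_g in auto)
  qed (auto intro: fam_g)
  show ?thesis
    unfolding N1_def[abs_def]
    by (intro H_dt_add fam_add fam_linear[OF bl_cross] fam_g fam_bilinear[OF bb_cross_mv] fam_bilinear[OF bb_cross_J]
      fam_bilinear[OF bounded_bilinear_cross3] H_dt_linear[OF bl_cross] g[OF jn] JJ tri dt_ThK[OF bb_cross_mv jn]) auto
qed

lemma dt_KM:
  assumes jn: "2 * j + n + 2 \<le> s"
  shows "H n (dt j KM) \<preceq> Z"
proof (cases "j = 0")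
  case True
  have 1: "(\<lambda>z. H (s - 2) Mt z * H (2*M-3) KF z) \<preceq> Z"
    by (rule lss_kp_mult(2)[OF small0(4) dt_Mt_PP[of 0, simplified] Zp]) (use s M in auto)
  have "H 4 Mt \<preceq> DD 5" using est_Mt_low[of 5] M by simp
  then have 2: "(\<lambda>z. H 4 Mt z * H (2*M+1) KF z) \<preceq> Z"
    by (rule lss_trans[OF lss_kp_base[OF _ small_K_top] Zb]) auto
  have "H n KM \<preceq> Z" unfolding KM_def[abs_def]
    by (rule H_bilinear2[OF bb_vm _ _ _ _ _ 1 2]) (use jn True s M in auto)
  then show ?thesis using True by simp
next
  case False
  show ?thesis unfolding KM_def[abs_def]
  proof (rule H_dt_bilinear[OF bounded_bilinear_mv])
    fix i assume i: "i \<le> j"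
    have n: "n \<le> nK i" "n + 3 \<le> nK i + (s - 2 * (j - i) - 2)" "i \<le> M" using jn i False s M unfolding nK_def by auto
    show "H n (\<lambda>z t x. dt i KF z t x *v dt (j - i) Mt z t x) \<preceq> Z"
      by (rule H_bilinear[OF bounded_bilinear_mv, where a="nK i" and b="s - 2 * (j - i) - 2"], simp, simp)
        (use jn i n s in \<open>auto intro!: lss_kp_mult(1)[OF small_K dt_Mt_PP Zp]\<close>)
  qed auto
qed

lemma dt_A_step:
  assumes "2 * j + n + 2 \<le> s" "H n (dt j A) \<preceq> Z" "H n (dt j Th) \<preceq> Z"
  shows "H n (dt (Suc j) A) \<preceq> Z"
  by (rule H_dt_Suc_A[OF assms(2,3) _ lss_trans[OF dt_conv_U(3)[OF assms(1)] Zp]])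
     (unfold NA_def[abs_def], rule dt_ThK[OF bb_pa_com assms(1)])

lemma dt_recover:
  "2 * j \<le> s \<Longrightarrow> H (s - 2*j) (dt j U) \<preceq> Z \<and> H (s - 2*j) (dt j Th) \<preceq> Z \<and> (2 * j + 2 \<le> s \<longrightarrow> H (s - 2*j - 2) (dt j A) \<preceq> Z)"
proof (induction j)
  case 0
  then show ?case using lss_trans[OF base_member(1) Zb] lss_trans[OF base_member(2) Zb] lss_trans[OF base_member(3) Zb] by simp
next
  case (Suc j)
  define n where "n = s - 2 * Suc j"
  have n: "2 * j + n + 2 \<le> s" "n + 2 = s - 2 * j" using Suc(2) by (auto simp: n_def)
  have u: "H (n + 2) (dt j U) \<preceq> Z" and h: "H (n + 2) (dt j Th) \<preceq> Z" and a: "H n (dt j A) \<preceq> Z"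
    using Suc n by (auto simp: n_def)
  have "H n (dt (Suc j) U) \<preceq> Z"
    by (rule H_dt_Suc_U[OF H_dt_Lu[OF u H_mono[OF h]] lss_trans[OF dt_conv_U(1)[OF n(1)] Zp]]) simp
  moreover have "H n (dt (Suc j) Th) \<preceq> Z"
    by (rule H_dt_Suc_Th[OF H_dt_Mt[OF H_dt_RL[OF h H_mono[OF u] a] dt_N1[OF n(1)] dt_KM[OF n(1)]] lss_trans[OF dt_conv_U(2)[OF n(1)] Zp]]) simp
  moreover have "H (n - 2) (dt (Suc j) A) \<preceq> Z"
    by (rule dt_A_step) (use n in \<open>auto intro: H_mono[OF a] H_mono[OF h]\<close>)
  ultimately show ?case by (simp add: n_def)
qed

end

lemma PP_le_base: "PP s \<preceq> base s"
proof (rule lss_absorb)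
  let ?Z = "\<lambda>z. base s z + kp z * PP s z"
  have Z: "base s \<preceq> ?Z" "(\<lambda>z. kp z * PP s z) \<preceq> ?Z" "\<And>z. z \<in> Sol \<Longrightarrow> 0 \<le> ?Z z" by (auto intro!: lss_le)
  show "PP s \<preceq> ?Z" unfolding PP_def[abs_def]
    by (rule lss_sum) (use dt_recover[OF Z] Z(3) in \<open>auto intro!: lss_add simp: PP_def[abs_def]\<close>)
qed simp

lemma kp_PP_base: "(\<lambda>z. kp z * PP s z) \<preceq> base s"
  by (rule kp_le[OF PP_le_base]) simp

lemmas base_facts = lss_refl kp_PP_base base_nonneg

lemma dt_base:
  assumes "2 * j + n \<le> s"
  shows "H n (dt j U) \<preceq> base s" "H n (dt j Th) \<preceq> base s" "2 \<le> n \<Longrightarrow> H (n - 2) (dt j A) \<preceq> base s"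
    "0 < j \<Longrightarrow> H n (dt j A) \<preceq> base s"
proof -
  have r: "H (s - 2*j) (dt j U) \<preceq> base s" "H (s - 2*j) (dt j Th) \<preceq> base s"
    "2 * j + 2 \<le> s \<Longrightarrow> H (s - 2*j - 2) (dt j A) \<preceq> base s" if "2 * j \<le> s" for j
    using dt_recover[of "base s" j, OF base_facts that] by auto
  show "H n (dt j U) \<preceq> base s" "H n (dt j Th) \<preceq> base s" "2 \<le> n \<Longrightarrow> H (n - 2) (dt j A) \<preceq> base s"
    using assms by (auto intro: H_mono[OF r(1)] H_mono[OF r(2)] H_mono[OF r(3)])
  assume "0 < j"
  then obtain i where i: "j = Suc i" by (cases j) auto
  show "H n (dt j A) \<preceq> base s" unfolding i
    by (rule dt_A_step[of "base s", OF base_facts]) (use assms i in \<open>auto intro!: H_mono[OF r(2)] H_mono[OF r(3)]\<close>)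
qed

end

lemma small_dt_A: "j \<le> M \<Longrightarrow> n \<le> nK j \<Longrightarrow> H n (dt j A) \<preceq> kp"
  using H_dt_linear[OF bl_pa fam_fields(4) small_K] by (simp add: A_def[abs_def] aK_pa)

lemma dt_A_dissipation:
  assumes "j \<le> M" "2 \<le> j"
  shows "H (if j = 2 then 2*M-3 else if j = 3 then 2*M-4 else 2*M-2*j+3) (dt j A) \<preceq> base (2*M+1)"
  using assms(2,1)
proof (induction j rule: dec_induct)
  case base
  show ?case using dt_base(4)[of "2*M+1" 2 "2*M-3"] M by simp
next
  case (step j)
  define n where "n = (if j = 2 then 2*M-4 else 2*M-2*j+1)"
  have n: "2 * j + n \<le> 2*M+1" "n \<le> 2*M-4" "j \<le> M" using step M unfolding n_def by auto
  have Zp: "(\<lambda>z. kp z * base (2*M+1) z) \<preceq> base (2*M+1)" by (rule kp_le) auto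
  have "H n (dt (Suc j) A) \<preceq> base (2*M+1)"
  proof (rule H_dt_Suc_A)
    show "H n (dt j A) \<preceq> base (2*M+1)" using step(3) by (rule H_mono) (use step M n_def in auto)
    show "H n (dt j Th) \<preceq> base (2*M+1)" by (rule dt_base) (use n in auto)
    show "H n (dt j NA) \<preceq> base (2*M+1)" unfolding NA_def[abs_def]
    proof (rule H_dt_bilinear[OF bb_pa_com])
      fix i assume i: "i \<le> j"
      have k: "n \<le> nK (j - i)" "n + 3 \<le> 2*M+1 - 2 * i + nK (j - i)" "j - i \<le> M" using n i step(1) M unfolding nK_def by auto
      show "H n (\<lambda>z t x. pa (com (dt i Th z t x) (dt (j - i) KF z t x))) \<preceq> base (2*M+1)"
        by (rule H_bilinear[OF bb_pa_com, where a="2*M+1-2*i" and b="nK (j-i)"], simp, simp)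
          (use n i k in \<open>auto intro!: lss_kp_mult(2)[OF small_K dt_base(2) Zp[simplified]]\<close>)
    qed auto
    show "H n (dt j (\<lambda>z. conv (tT z) (U z) (A z))) \<preceq> base (2*M+1)"
    proof (rule H_dt_conv)
      fix i assume i: "i \<le> j"
      have k: "Suc n \<le> nK (j - i)" "n + 4 \<le> 2*M+1 - 2 * i + nK (j - i)" "j - i \<le> M" using n i step(1) M unfolding nK_def by auto
      show "H n (\<lambda>z. conv (tT z) (dt i U z) (dt (j - i) A z)) \<preceq> base (2*M+1)"
        by (rule H_conv[where a="2*M+1-2*i" and b="nK (j-i)"], simp, simp)
          (use n i k in \<open>auto intro!: lss_kp_mult(2)[OF small_dt_A dt_base(1) Zp[simplified]]\<close>)
    qed auto
  qed
  then show ?case by (rule H_mono) (use step M n_def in auto)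
qed

lemma dt_K_top:
  assumes "H (2*M+1) KF \<preceq> Z" "H (2*M) Th \<preceq> Z" and Z0: "\<And>z. z \<in> Sol \<Longrightarrow> 0 \<le> Z z"
  shows "H (2*M) (dt 1 KF) \<preceq> Z"
proof -
  have Zp: "(\<lambda>z. kp z * Z z) \<preceq> Z" by (rule kp_le) (auto simp: Z0)
  have 1: "(\<lambda>z. H (2*M) Th z * H (2*M+1) KF z) \<preceq> Z" "(\<lambda>z. H (2*M) U z * H (2*M+1) KF z) \<preceq> Z"
    by (rule lss_kp_mult(1)[OF _ assms(1) Zp]; simp add: small0)+
  have "H (2*M) (\<lambda>z t x. com (Th z t x) (KF z t x)) \<preceq> Z"
    by (rule H_bilinear[OF bounded_bilinear_com _ _ _ _ _ 1(1)]) (use M in auto)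
  moreover have "H (2*M) (\<lambda>z. conv (tT z) (U z) (KF z)) \<preceq> Z"
    by (rule H_conv[OF _ _ _ _ _ 1(2)]) (use M in auto)
  ultimately show ?thesis
    using H_dt_Suc_K[of "2*M" 0 Z] H_mono[OF assms(1), of "2*M"] assms(2) by simp
qed

lemma dt_K_top2:
  assumes Z: "H (2*M+1) KF \<preceq> Z" "base (2*M) \<preceq> Z" and Z0: "\<And>z. z \<in> Sol \<Longrightarrow> 0 \<le> Z z"
  shows "H (2*M-2) (dt 2 KF) \<preceq> Z"
proof -
  have Zp: "(\<lambda>z. kp z * Z z) \<preceq> Z" by (rule kp_le) (auto simp: Z0)
  have h: "2*j+n \<le> 2*M \<Longrightarrow> H n (dt j Th) \<preceq> Z" for j n
    using lss_trans[OF dt_base(2)[of "2*M"] Z(2)] by simp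
  have k1: "H (2*M) (dt 1 KF) \<preceq> Z" by (rule dt_K_top[OF Z(1) _ Z0]) (use h[of 0] in auto)
  have "H (2*M-2) (dt (Suc 1) KF) \<preceq> Z"
  proof (rule H_dt_Suc_K)
    show "H (2*M-2) (dt 1 KF) \<preceq> Z" using k1 by (rule H_mono) simp
    show "H (2*M-2) (dt 1 Th) \<preceq> Z" by (rule h) (use M in simp)
    show "H (2*M-2) (dt 1 (\<lambda>z t x. com (Th z t x) (KF z t x))) \<preceq> Z"
    proof (rule H_dt_bilinear[OF bounded_bilinear_com])
      fix i :: nat assume "i \<le> 1"
      then consider "i = 0" | "i = 1" by linarith
      then show "H (2*M-2) (\<lambda>z t x. com (dt i Th z t x) (dt (1 - i) KF z t x)) \<preceq> Z"
      proof cases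
        case 1
        have "(\<lambda>z. H (2*M) Th z * H (2*M) (dt 1 KF) z) \<preceq> Z" by (rule lss_kp_mult(1)[OF _ k1 Zp]) (auto simp: small0)
        then have "H (2*M-2) (\<lambda>z t x. com (Th z t x) (dt 1 KF z t x)) \<preceq> Z"
          by (rule H_bilinear[OF bounded_bilinear_com, rotated -1]) (use M in auto)
        then show ?thesis using 1 by simp
      next
        case 2
        have "(\<lambda>z. H (2*M-2) (dt 1 Th) z * H (2*M+1) KF z) \<preceq> Z"
          by (rule lss_kp_mult(1)[OF small_Th Z(1) Zp]) (use M in auto)
        then have "H (2*M-2) (\<lambda>z t x. com (dt 1 Th z t x) (KF z t x)) \<preceq> Z"
          by (rule H_bilinear[OF bounded_bilinear_com, rotated -1]) (use M in auto)
        then show ?thesis using 2 by simp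
      qed
    qed auto
    show "H (2*M-2) (dt 1 (\<lambda>z. conv (tT z) (U z) (KF z))) \<preceq> Z"
    proof (rule H_dt_conv)
      fix i :: nat assume "i \<le> 1"
      then consider "i = 0" | "i = 1" by linarith
      then show "H (2*M-2) (\<lambda>z. conv (tT z) (dt i U z) (dt (1 - i) KF z)) \<preceq> Z"
      proof cases
        case 1
        have "(\<lambda>z. H (2*M) U z * H (2*M) (dt 1 KF) z) \<preceq> Z" by (rule lss_kp_mult(1)[OF _ k1 Zp]) (auto simp: small0)
        then have "H (2*M-2) (\<lambda>z. conv (tT z) (U z) (dt 1 KF z)) \<preceq> Z"
          by (rule H_conv[rotated -1]) (use M in auto)
        then show ?thesis using 1 by simp
      next
        case 2
        have "(\<lambda>z. H (2*M-2) (dt 1 U) z * H (2*M+1) KF z) \<preceq> Z"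
          by (rule lss_kp_mult(1)[OF small_U Z(1) Zp]) (use M in auto)
        then have "H (2*M-2) (\<lambda>z. conv (tT z) (dt 1 U z) (KF z)) \<preceq> Z"
          by (rule H_conv[rotated -1]) (use M in auto)
        then show ?thesis using 2 by simp
      qed
    qed auto
  qed
  then show ?thesis by (simp add: numeral_2_eq_2)
qed


lemma dt_U_low: "H 3 (dt 1 U) \<preceq> DD 5"
proof -
  have c: "H 3 (\<lambda>z. conv (tT z) (U z) (U z)) \<preceq> DD 5"
    by (rule H_mono[OF lss_trans[OF est_conv_U(1)[of 5] KD_DD]]) (use M in auto)
  have l: "H 3 (dt 0 (\<lambda>z. Lu (tT z) (U z) (Th z))) \<preceq> DD 5" by (rule H_dt_Lu) (auto intro!: DD_U DD_Th)
  show ?thesis using H_dt_Suc_U[OF l] c by simp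
qed

lemma small_dt_K_top: "H (2*M) (dt 1 KF) \<preceq> (\<lambda>z. kp z * sqrt (1 + tm z))"
proof (rule dt_K_top[OF small_K_top])
  have "kp \<preceq> (\<lambda>z. kp z * sqrt (1 + tm z))"
  proof (rule lss_le)
    fix z assume "z \<in> Sol"
    then show "kp z \<le> kp z * sqrt (1 + tm z)" using mult_left_mono[of 1 "sqrt (1 + tm z)" "kp z"] by simp
  qed
  from lss_trans[OF small0(2) this] show "H (2*M) Th \<preceq> (\<lambda>z. kp z * sqrt (1 + tm z))" by simp
qed simp

lemma dt_K_low:
  assumes Z: "H (2*M-3) KF \<preceq> Z" "base (2*M) \<preceq> Z" and Z0: "\<And>z. z \<in> Sol \<Longrightarrow> 0 \<le> Z z"
  shows "j \<le> M \<Longrightarrow> H (nK j) (dt j KF) \<preceq> Z"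
proof -
  have Zp: "(\<lambda>z. kp z * Z z) \<preceq> Z" by (rule kp_le) (auto simp: Z0)
  have h: "2*j+n \<le> 2*M \<Longrightarrow> H n (dt j Th) \<preceq> Z" and u: "2*j+n \<le> 2*M \<Longrightarrow> H n (dt j U) \<preceq> Z" for j n
    using lss_trans[OF dt_base(2)[of "2*M"] Z(2)] lss_trans[OF dt_base(1)[of "2*M"] Z(2)] by simp_all
  let ?n = "2*M-3"
  have com1: "H ?n (dt j (\<lambda>z t x. com (Th z t x) (KF z t x))) \<preceq> Z" if j: "j \<le> 1" for j
  proof (rule H_dt_bilinear[OF bounded_bilinear_com])
    fix i assume i: "i \<le> j"
    show "H ?n (\<lambda>z t x. com (dt i Th z t x) (dt (j - i) KF z t x)) \<preceq> Z"
      by (rule H_bilinear[OF bounded_bilinear_com, where a="2*M-2*i" and b="?n"], simp, simp)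
        (use j i M in \<open>auto intro!: lss_kp_mult(2)[OF small_K h Zp] simp: nK_def\<close>)
  qed auto
  have conv1: "H ?n (\<lambda>z. conv (tT z) (F z) (G z)) \<preceq> Z"
    if "fam F" "fam G" "H (2*M-2) F \<preceq> Z" "H ?n G \<preceq> kp" "H 3 F \<preceq> DD 5" "H (2*M) G \<preceq> (\<lambda>z. kp z * sqrt (1 + tm z))"
    for F and G :: "inst \<Rightarrow> real \<Rightarrow> real^3 \<Rightarrow> real^3^3"
  proof -
    have 1: "(\<lambda>z. H (2*M-2) F z * H ?n G z) \<preceq> Z" by (rule lss_kp_mult(2)[OF that(4,3) Zp]) simp
    have 2: "(\<lambda>z. H 3 F z * H (2*M) G z) \<preceq> Z" by (rule lss_trans[OF lss_kp_base[OF that(5,6)] Z(2)]) simp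
    show ?thesis by (rule H_conv2[OF that(1,2) _ _ _ _ _ 1 2]) (use M in auto)
  qed
  have k1: "H ?n (dt 1 KF) \<preceq> Z"
  proof -
    have "H ?n (dt 0 (\<lambda>z t x. com (Th z t x) (KF z t x))) \<preceq> Z" by (rule com1) simp
    moreover have "H ?n (\<lambda>z. conv (tT z) (U z) (KF z)) \<preceq> Z"
      by (rule conv1) (use u[of 0] small0(4) H_mono[OF small_K_top] in \<open>auto intro!: DD_U\<close>)
    ultimately show ?thesis using H_dt_Suc_K[of ?n 0 Z] Z(1) h[of 0 ?n] by simp
  qed
  have k2: "H ?n (dt 2 KF) \<preceq> Z"
  proof -
    have "H ?n (dt (Suc 1) KF) \<preceq> Z"
    proof (rule H_dt_Suc_K[OF k1])
      show "H ?n (dt 1 Th) \<preceq> Z" by (rule h) (use M in simp)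
      show "H ?n (dt 1 (\<lambda>z t x. com (Th z t x) (KF z t x))) \<preceq> Z" by (rule com1) simp
      show "H ?n (dt 1 (\<lambda>z. conv (tT z) (U z) (KF z))) \<preceq> Z"
      proof (rule H_dt_conv)
        fix i :: nat assume "i \<le> 1"
        then consider "i = 0" | "i = 1" by linarith
        then show "H ?n (\<lambda>z. conv (tT z) (dt i U z) (dt (1 - i) KF z)) \<preceq> Z"
        proof cases
          case 1
          have "H ?n (\<lambda>z. conv (tT z) (U z) (dt 1 KF z)) \<preceq> Z"
            by (rule conv1) (use u[of 0] small_K[of 1 ?n] small_dt_K_top M in \<open>auto intro!: DD_U simp: nK_def\<close>)
          then show ?thesis using 1 by simp
        next
          case 2
          have "H ?n (\<lambda>z. conv (tT z) (dt 1 U z) (KF z)) \<preceq> Z"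
            by (rule conv1) (use u[of 1 "2*M-2"] small0(4) dt_U_low H_mono[OF small_K_top] M in auto)
          then show ?thesis using 2 by simp
        qed
      qed auto
    qed
    then show ?thesis by (simp add: numeral_2_eq_2)
  qed
  have *: "H (nK j) (dt j KF) \<preceq> Z" if "2 \<le> j" "j \<le> M" for j
    using that
  proof (induction j rule: dec_induct)
    case base
    show ?case using k2 by (simp add: nK_def)
  next
    case (step j)
    define n where "n = 2*M-2*j"
    have n: "2 * j + n \<le> 2*M" "n \<le> 2*M-4" "j \<le> M" using step M unfolding n_def by auto
    have "H n (dt (Suc j) KF) \<preceq> Z"
    proof (rule H_dt_Suc_K)
      show "H n (dt j KF) \<preceq> Z" using step(3) by (rule H_mono) (use step M n_def in \<open>auto simp: nK_def\<close>)
      show "H n (dt j Th) \<preceq> Z" by (rule h) (use n in auto)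
      show "H n (dt j (\<lambda>z t x. com (Th z t x) (KF z t x))) \<preceq> Z"
      proof (rule H_dt_bilinear[OF bounded_bilinear_com])
        fix i assume i: "i \<le> j"
        have k: "n \<le> nK (j - i)" "n + 3 \<le> 2*M - 2 * i + nK (j - i)" "j - i \<le> M" using n i step(1) M unfolding nK_def by auto
        show "H n (\<lambda>z t x. com (dt i Th z t x) (dt (j - i) KF z t x)) \<preceq> Z"
          by (rule H_bilinear[OF bounded_bilinear_com, where a="2*M-2*i" and b="nK (j-i)"], simp, simp)
            (use n i k in \<open>auto intro!: lss_kp_mult(2)[OF small_K h Zp]\<close>)
      qed auto
      show "H n (dt j (\<lambda>z. conv (tT z) (U z) (KF z))) \<preceq> Z"
      proof (rule H_dt_conv)
        fix i assume i: "i \<le> j"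
        have k: "Suc n \<le> nK (j - i)" "n + 4 \<le> 2*M - 2 * i + nK (j - i)" "j - i \<le> M" using n i step(1) M unfolding nK_def by auto
        show "H n (\<lambda>z. conv (tT z) (dt i U z) (dt (j - i) KF z)) \<preceq> Z"
          by (rule H_conv[where a="2*M-2*i" and b="nK (j-i)"], simp, simp)
            (use n i k in \<open>auto intro!: lss_kp_mult(2)[OF small_K u Zp]\<close>)
      qed auto
    qed
    then show ?case by (rule H_mono) (use step M n_def in \<open>auto simp: nK_def\<close>)
  qed
  assume j: "j \<le> M"
  consider "j = 0" | "j = 1" | "2 \<le> j" by linarith
  then show ?thesis using Z(1) k1 *[OF _ j] by cases (auto simp: nK_def)
qed

definition EL :: "inst \<Rightarrow> real" where "EL z = H 2 U z + H 2 Th z + H 2 A z"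

lemma EL_nonneg [simp]: "0 \<le> EL z"
  by (simp add: EL_def)

lemma EL_members: "n \<le> 2 \<Longrightarrow> H n U \<preceq> EL" "n \<le> 2 \<Longrightarrow> H n Th \<preceq> EL" "n \<le> 2 \<Longrightarrow> H n A \<preceq> EL" "DD 1 \<preceq> EL"
proof -
  have e: "H 2 U \<preceq> EL" "H 2 Th \<preceq> EL" "H 2 A \<preceq> EL" by (rule lss_le; simp add: EL_def)+
  then show "n \<le> 2 \<Longrightarrow> H n U \<preceq> EL" "n \<le> 2 \<Longrightarrow> H n Th \<preceq> EL" and a: "n \<le> 2 \<Longrightarrow> H n A \<preceq> EL" for n
    by (auto intro: H_mono)
  show "DD 1 \<preceq> EL" unfolding DD_def[abs_def] using e a[of 0] by (auto intro!: lss_add simp: numeral_2_eq_2)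
qed

lemma dt_low: "H 0 (dt 1 U) \<preceq> EL" "H 0 (dt 1 Th) \<preceq> EL" "H 1 (dt 1 A) \<preceq> EL" "H 0 (dt 2 A) \<preceq> EL"
proof -
  have kd: "KD 1 \<preceq> EL" by (rule lss_trans[OF KD_DD EL_members(4)])
  have Zp: "(\<lambda>z. kp z * EL z) \<preceq> EL" by (rule kp_le) auto
  have l: "H 0 (dt 0 (\<lambda>z. Lu (tT z) (U z) (Th z))) \<preceq> EL" by (rule H_dt_Lu) (auto intro: EL_members)
  show u: "H 0 (dt 1 U) \<preceq> EL"
    using H_dt_Suc_U[OF l] lss_trans[OF est_conv_U(1)[of 1] kd] M by simp
  show h: "H 0 (dt 1 Th) \<preceq> EL"
    using H_dt_Suc_Th[of 0 0 EL] lss_trans[OF est_conv_U(2)[of 1] kd] lss_trans[OF est_Mt_low[of 1] EL_members(4)] M by simp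
  show a: "H 1 (dt 1 A) \<preceq> EL"
  proof -
    have "H 1 NA \<preceq> EL" unfolding NA_def[abs_def]
      by (rule lss_trans[OF est_ThK_low[OF bb_pa_com] kd]) (use M in auto)
    moreover have "(\<lambda>z. H 2 U z * H (2*M) A z) \<preceq> EL"
      by (rule lss_kp_mult(2)[OF small0(3) EL_members(1) Zp]) auto
    then have "H 1 (\<lambda>z. conv (tT z) (U z) (A z)) \<preceq> EL"
      by (rule H_conv[rotated -1]) (use M in auto)
    ultimately show ?thesis using H_dt_Suc_A[of 1 0 EL] EL_members(2,3)[of 1] by simp
  qed
  have "H 0 (dt (Suc 1) A) \<preceq> EL"
  proof (rule H_dt_Suc_A)
    show "H 0 (dt 1 A) \<preceq> EL" using a by (rule H_mono) simp
    show "H 0 (dt 1 Th) \<preceq> EL" by (rule h)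
    have h': "H (2 - 2*i) (dt i Th) \<preceq> EL" and u': "H (2 - 2*i) (dt i U) \<preceq> EL" if "i \<le> 1" for i
      using that h u EL_members(1,2)[of 2] by (cases i; simp)+
    show "H 0 (dt 1 NA) \<preceq> EL" unfolding NA_def[abs_def]
    proof (rule H_dt_bilinear[OF bb_pa_com])
      fix i :: nat assume i: "i \<le> 1"
      have "(\<lambda>z. H (2 - 2*i) (dt i Th) z * H (2*M-3) (dt (1-i) KF) z) \<preceq> EL"
        by (rule lss_kp_mult(2)[OF small_K h'[OF i] Zp]) (use i M in \<open>auto simp: nK_def\<close>)
      then show "H 0 (\<lambda>z t x. pa (com (dt i Th z t x) (dt (1 - i) KF z t x))) \<preceq> EL"
        by (rule H_bilinear[OF bb_pa_com, rotated -1]) (use M in auto)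
    qed auto
    show "H 0 (dt 1 (\<lambda>z. conv (tT z) (U z) (A z))) \<preceq> EL"
    proof (rule H_dt_conv)
      fix i :: nat assume i: "i \<le> 1"
      have "(\<lambda>z. H (2 - 2*i) (dt i U) z * H (2*M-2) (dt (1-i) A) z) \<preceq> EL"
        by (rule lss_kp_mult(2)[OF small_A u'[OF i] Zp]) (use i M in auto)
      then show "H 0 (\<lambda>z. conv (tT z) (dt i U z) (dt (1 - i) A z)) \<preceq> EL"
        by (rule H_conv[rotated -1]) (use M in auto)
    qed auto
  qed
  then show "H 0 (dt 2 A) \<preceq> EL" by (simp add: numeral_2_eq_2)
qed

end


section \<open>Comparison of the functionals\<close>

context par
begin

lemma lss_sq: "X \<preceq> Y \<Longrightarrow> (\<And>z. z \<in> Sol \<Longrightarrow> 0 \<le> X z) \<Longrightarrow> (\<And>z. z \<in> Sol \<Longrightarrow> 0 \<le> Y z) \<Longrightarrow> (\<lambda>z. (X z)\<^sup>2) \<preceq> (\<lambda>z. (Y z)\<^sup>2)"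
  unfolding power2_eq_square by (rule lss_mult) auto

lemma Hs_lss:
  fixes F :: "inst \<Rightarrow> real \<Rightarrow> real^3 \<Rightarrow> 'a::euclidean_space"
  assumes "H n F \<preceq> Y" "\<And>z. z \<in> Sol \<Longrightarrow> 0 \<le> Y z"
  shows "(\<lambda>z. Hs_sq (tT z) n (F z) (tm z)) \<preceq> (\<lambda>z. (Y z)\<^sup>2)"
proof (rule lss_trans[OF lss_le lss_sq[OF assms(1)]])
  show "Hs_sq (tT z) n (F z) (tm z) \<le> (H n F z)\<^sup>2" for z unfolding H_def by (rule Hs_sq_le_hn)
qed (auto simp: assms(2))

lemma Psq_lss:
  fixes F :: "inst \<Rightarrow> real \<Rightarrow> real^3 \<Rightarrow> 'a::euclidean_space"
  assumes "\<And>j. 2 * j \<le> k \<Longrightarrow> H (k - 2 * j) (dt j F) \<preceq> Y" "\<And>z. z \<in> Sol \<Longrightarrow> 0 \<le> Y z"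
  shows "(\<lambda>z. Psq (tT z) k (F z) (tm z)) \<preceq> (\<lambda>z. (Y z)\<^sup>2)"
  unfolding Psq_eq_Hs_sq
proof (rule lss_sum)
  fix j assume "j \<in> {..k div 2}"
  then have "H (k - 2 * j) (dt j F) \<preceq> Y" by (intro assms(1)) auto
  from Hs_lss[OF this assms(2)] show "(\<lambda>z. Hs_sq (tT z) (k - 2 * j) (ptd (tT z) j (F z)) (tm z)) \<preceq> (\<lambda>z. (Y z)\<^sup>2)"
    by (simp add: dt_def)
qed auto

lemma Elow_lss: "(\<lambda>z. Elow (tT z) (fu z) (fh z) (fK z) (tm z)) \<preceq> (\<lambda>z. (EL z)\<^sup>2)"
proof -
  have j: "j = 0 \<or> j = 1" if "2 * j \<le> 2" for j :: nat using that by auto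
  have a0: "H 0 (dt 1 A) \<preceq> EL" using dt_low(3) by (rule H_mono) simp
  have P: "(\<lambda>z. Psq (tT z) 2 (F z) (tm z)) \<preceq> (\<lambda>z. (EL z)\<^sup>2)" if "H 2 F \<preceq> EL" "H 0 (dt 1 F) \<preceq> EL" for F :: "inst \<Rightarrow> real \<Rightarrow> real^3 \<Rightarrow> 'a::euclidean_space"
    by (rule Psq_lss) (use j that in fastforce)+
  show ?thesis unfolding Elow_def
    using P[OF EL_members(1) dt_low(1)] P[OF EL_members(2) dt_low(2)] P[OF EL_members(3) a0]
      Hs_lss[OF dt_low(3)] Hs_lss[OF dt_low(4)]
    by (auto intro!: lss_add simp: A_def dt_def)
qed

lemma Ebar_lss: "(\<lambda>z. Ebar (tT z) M (fu z) (fh z) (fK z) (tm z)) \<preceq> (\<lambda>z. (base (2*M) z + H (2*M) A z)\<^sup>2)"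
proof -
  let ?Y = "\<lambda>z. base (2*M) z + H (2*M) A z"
  have b: "base (2*M) \<preceq> ?Y" "H (2*M) A \<preceq> ?Y" by (rule lss_le; simp)+
  have Y: "z \<in> Sol \<Longrightarrow> 0 \<le> ?Y z" for z by simp
  have a: "H (2*M-2*j) (dt j A) \<preceq> ?Y" if "2 * j \<le> 2*M" for j
    using lss_trans[OF dt_base(4)[of "2*M" j "2*M-2*j"] b(1)] b(2) that by (cases "j = 0") auto
  have u: "H (2*M-2*j) (dt j U) \<preceq> ?Y" "H (2*M-2*j) (dt j Th) \<preceq> ?Y" if "2 * j \<le> 2*M" for j
    using lss_trans[OF dt_base(1)[of "2*M" j "2*M-2*j"] b(1)] lss_trans[OF dt_base(2)[of "2*M" j "2*M-2*j"] b(1)] that by auto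
  show ?thesis unfolding Ebar_def
    using Psq_lss[of "2*M" A, OF a Y] Psq_lss[of "2*M" U, OF u(1) Y] Psq_lss[of "2*M" Th, OF u(2) Y]
    by (auto intro!: lss_add simp: A_def)
qed

lemma Ffun_lss: "(\<lambda>z. Ffun (tT z) M (fK z) (tm z)) \<preceq> (\<lambda>z. (H (2*M+1) KF z + base (2*M) z)\<^sup>2)"
proof -
  let ?Y = "\<lambda>z. H (2*M+1) KF z + base (2*M) z"
  have b: "H (2*M+1) KF \<preceq> ?Y" "base (2*M) \<preceq> ?Y" by (rule lss_le; simp)+
  have Y: "z \<in> Sol \<Longrightarrow> 0 \<le> ?Y z" for z by simp
  have "H (2*M) (dt 1 KF) \<preceq> ?Y"
    by (rule dt_K_top[OF b(1) lss_trans[OF base_member(2) b(2)] Y]) auto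
  then show ?thesis unfolding Ffun_def
    using Hs_lss[OF b(1) Y] Hs_lss[OF dt_K_top2[OF b Y] Y] Hs_lss[of "2*M" "dt 1 KF" ?Y, OF _ Y]
    by (auto intro!: lss_add simp: dt_def)
qed

lemma EK_lss: "(\<lambda>z. EK (tT z) M (fK z) (tm z)) \<preceq> (\<lambda>z. (H (2*M-3) KF z + base (2*M) z)\<^sup>2)"
proof -
  let ?Y = "\<lambda>z. H (2*M-3) KF z + base (2*M) z"
  have b: "H (2*M-3) KF \<preceq> ?Y" "base (2*M) \<preceq> ?Y" by (rule lss_le; simp)+
  have Y: "z \<in> Sol \<Longrightarrow> 0 \<le> ?Y z" for z by simp
  have k: "(\<lambda>z. Hs_sq (tT z) (nK j) (ptd (tT z) j (fK z)) (tm z)) \<preceq> (\<lambda>z. (?Y z)\<^sup>2)" if "j \<le> M" for j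
    using Hs_lss[OF dt_K_low[OF b Y that] Y] by (simp add: dt_def)
  have "(\<lambda>z. \<Sum>j\<in>{3..M}. Hs_sq (tT z) (2*M-2*j+2) (ptd (tT z) j (fK z)) (tm z)) \<preceq> (\<lambda>z. (?Y z)\<^sup>2)"
  proof (rule lss_sum)
    fix j assume "j \<in> {3..M}"
    then show "(\<lambda>z. Hs_sq (tT z) (2*M-2*j+2) (ptd (tT z) j (fK z)) (tm z)) \<preceq> (\<lambda>z. (?Y z)\<^sup>2)"
      using k[of j] by (simp add: nK_def)
  qed auto
  then show ?thesis unfolding EK_def
    using k[of 0] k[of 1] k[of 2] M by (auto intro!: lss_add simp: nK_def ptd_def)
qed

lemma Dfull_lss: "(\<lambda>z. Dfull (tT z) M (fu z) (fh z) (fK z) (tm z)) \<preceq> (\<lambda>z. (base (2*M+1) z)\<^sup>2)"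
proof -
  let ?Y = "base (2*M+1)"
  have Y: "z \<in> Sol \<Longrightarrow> 0 \<le> ?Y z" for z by simp
  have u: "H (2*M+1-2*j) (dt j U) \<preceq> ?Y" "H (2*M+1-2*j) (dt j Th) \<preceq> ?Y" if "2 * j \<le> 2*M+1" for j
    using dt_base(1)[of "2*M+1" j "2*M+1-2*j"] dt_base(2)[of "2*M+1" j "2*M+1-2*j"] that by auto
  have a1: "H (2*M-j-1) (dt j A) \<preceq> ?Y" if "j \<in> {0..3}" for j
  proof -
    have "j < 4" using that by simp
    then consider "j = 0" | "j = 1" | "j = 2" | "j = 3" by linarith
    then show ?thesis
      using base_member(3)[of "2*M-1" "2*M+1"] dt_base(4)[of "2*M+1" 1 "2*M-2"] dt_A_dissipation[of 2] dt_A_dissipation[of 3] M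
      by cases (auto simp: numeral_2_eq_2[symmetric])
  qed
  have a2: "H (2*M-2*j+3) (dt j A) \<preceq> ?Y" if "j \<in> {4..M}" for j
    using dt_A_dissipation[of j] that by simp
  have s1: "(\<lambda>z. \<Sum>j\<in>{0..3}. Hs_sq (tT z) (2*M-j-1) (ptd (tT z) j (aK (fK z))) (tm z)) \<preceq> (\<lambda>z. (?Y z)\<^sup>2)"
    by (rule lss_sum) (use Hs_lss[OF a1 Y] in \<open>auto simp: dt_def A_def\<close>)
  have s2: "(\<lambda>z. \<Sum>j\<in>{4..M}. Hs_sq (tT z) (2*M-2*j+3) (ptd (tT z) j (aK (fK z))) (tm z)) \<preceq> (\<lambda>z. (?Y z)\<^sup>2)"
    by (rule lss_sum) (use Hs_lss[OF a2 Y] in \<open>auto simp: dt_def A_def\<close>)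
  show ?thesis unfolding Dfull_def Dbar_def
    by (intro lss_add s1 s2 Psq_lss u Y)
qed

definition RR :: "nat \<Rightarrow> inst \<Rightarrow> real" where "RR s z = H s U z + H s Th z + H s A z"

lemma sum2_sq_le: "(a + b)\<^sup>2 \<le> 2 * (a\<^sup>2 + b\<^sup>2)" for a b :: real
  using sum_squares_bound[of a b] by (simp add: power2_sum)

lemma sum3_sq_le: "(a + b + c)\<^sup>2 \<le> 3 * (a\<^sup>2 + b\<^sup>2 + c\<^sup>2)" for a b c :: real
  using sum_squares_bound[of a b] sum_squares_bound[of a c] sum_squares_bound[of b c]
  by (simp add: power2_eq_square algebra_simps)

lemma RR_sq: "(RR s z)\<^sup>2 \<le> 3 * real (card (SL s)) * Q s z"
proof -
  have "(RR s z)\<^sup>2 \<le> 3 * ((H s U z)\<^sup>2 + (H s Th z)\<^sup>2 + (H s A z)\<^sup>2)"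
    unfolding RR_def by (rule sum3_sq_le)
  also have "(H s U z)\<^sup>2 + (H s Th z)\<^sup>2 + (H s A z)\<^sup>2 \<le> real (card (SL s)) * Q s z"
    unfolding Q_def sum.distrib distrib_left H_def by (intro add_mono hn_sq_le)
  finally show ?thesis by simp
qed

lemma base_sq_calD: "(\<lambda>z. (base (2*M+1) z)\<^sup>2) \<preceq> calD"
proof (rule lssI[of 4])
  fix z assume z: "z \<in> Sol"
  let ?w = "1 + tm z"
  have "base (2*M+1) z \<le> DD (2*M) z + sqrt ?w * DD 5 z"
    using z mult_right_mono[of "kp z" 1 "sqrt ?w * DD 5 z"] by (simp add: base_def DD_def)
  then have "(base (2*M+1) z)\<^sup>2 \<le> (DD (2*M) z + sqrt ?w * DD 5 z)\<^sup>2" using z by (intro power_mono) auto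
  also have "\<dots> \<le> 2 * (DD (2*M) z)\<^sup>2 + 2 * (?w * (DD 5 z)\<^sup>2)"
    using sum_squares_bound[of "DD (2*M) z" "sqrt ?w * DD 5 z"] z by (simp add: power2_sum power_mult_distrib)
  also have "\<dots> \<le> 4 * calD z"
  proof -
    have "1 \<le> 2*M - 5" using M by linarith
    then show ?thesis using calD_ge_power[OF z, of "2*M" 0] calD_ge_power[OF z, of 5 1] M by simp
  qed
  finally show "(base (2*M+1) z)\<^sup>2 \<le> 4 * calD z" .
qed simp

context
  fixes \<epsilon> \<rho> c C :: real
  assumes c: "0 < \<epsilon>" "0 < \<rho>" "\<rho> \<le> 1" "0 < c" "0 < C"
    and Q_Yf: "\<forall>s. \<forall>z\<in>Sol. c * Q s z \<le> Yf s \<epsilon> z \<and> Yf s \<epsilon> z \<le> C * Q s z"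
begin

lemma Yb: "z \<in> Sol \<Longrightarrow> c * Q s z \<le> Yf s \<epsilon> z" "z \<in> Sol \<Longrightarrow> Yf s \<epsilon> z \<le> C * Q s z"
  using Q_Yf by blast+

lemma Yf_nonneg: "z \<in> Sol \<Longrightarrow> 0 \<le> Yf s \<epsilon> z"
  by (rule order_trans[OF _ Yb(1)]) (use c in simp_all)

lemma Zf_nonneg: "z \<in> Sol \<Longrightarrow> 0 \<le> Zf \<rho> \<epsilon> z"
  unfolding Zf_def using c by (intro sum_nonneg mult_nonneg_nonneg zero_le_power Yf_nonneg) auto

lemma Q_le_Zf:
  assumes "2 \<le> s" "s \<le> 2*M" "j \<le> 2*M - s"
  shows "(\<lambda>z. (1 + tm z) ^ j * Q s z) \<preceq> Zf \<rho> \<epsilon>"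
proof (rule lssI[of "1 / (\<rho> ^ (2*M) * c)"])
  fix z assume z: "z \<in> Sol"
  let ?w = "1 + tm z"
  have w: "1 \<le> ?w" using z by simp
  have "\<rho> ^ (2*M) * c * (?w ^ j * Q s z) = \<rho> ^ (2*M) * (?w ^ j * (c * Q s z))" by (simp add: mult_ac)
  also have "\<dots> \<le> \<rho> ^ (2*M - s) * (?w ^ (2*M - s) * Yf s \<epsilon> z)"
    using c w assms Yb(1)[OF z, of s] by (intro mult_mono power_decreasing power_increasing) auto
  also have "\<dots> \<le> Zf \<rho> \<epsilon> z"
    unfolding Zf_def
    by (rule member_le_sum[of s "{2..2*M}" "\<lambda>s. \<rho> ^ (2*M - s) * (?w ^ (2*M - s) * Yf s \<epsilon> z)"])
       (use assms c w Yf_nonneg[OF z] in auto)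
  finally show "?w ^ j * Q s z \<le> 1 / (\<rho> ^ (2*M) * c) * Zf \<rho> \<epsilon> z"
    using c by (simp add: field_simps)
qed (use c in simp)

lemma RR_le_Zf:
  assumes "2 \<le> s" "s \<le> 2*M" "j \<le> 2*M - s"
  shows "(\<lambda>z. (1 + tm z) ^ j * (RR s z)\<^sup>2) \<preceq> Zf \<rho> \<epsilon>"
proof (rule lss_trans[OF _ Q_le_Zf[OF assms]], rule lssI[of "3 * real (card (SL s))"])
  fix z assume "z \<in> Sol"
  then show "(1 + tm z) ^ j * (RR s z)\<^sup>2 \<le> 3 * real (card (SL s)) * ((1 + tm z) ^ j * Q s z)"
    using mult_left_mono[OF RR_sq[of s z], of "(1 + tm z) ^ j"] by (simp add: mult_ac)
qed simp

lemma base_sq_Zf: "(\<lambda>z. (base (2*M) z + H (2*M) A z)\<^sup>2) \<preceq> Zf \<rho> \<epsilon>"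
proof -
  have "(\<lambda>z. (base (2*M) z + H (2*M) A z)\<^sup>2) \<preceq> (\<lambda>z. (1 + tm z) ^ 0 * (RR (2*M) z)\<^sup>2 + (1 + tm z) ^ 1 * (RR 6 z)\<^sup>2)"
  proof (rule lssI[of 8])
    fix z assume z: "z \<in> Sol"
    let ?w = "1 + tm z"
    have "H (2*M-2) A z \<le> H (2*M) A z" "H 4 A z \<le> H 6 A z" unfolding H_def by (rule hn_mono; simp)+
    moreover have "kp z * (sqrt ?w * DD 5 z) \<le> sqrt ?w * DD 5 z" using z mult_right_mono[of "kp z" 1 "sqrt ?w * DD 5 z"] by simp
    moreover have "sqrt ?w * DD 5 z \<le> sqrt ?w * RR 6 z"
      using z \<open>H 4 A z \<le> H 6 A z\<close> by (intro mult_left_mono) (auto simp: DD_def RR_def)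
    ultimately have "base (2*M) z + H (2*M) A z \<le> 2 * RR (2*M) z + sqrt ?w * RR 6 z"
      using H_nonneg[of "2*M" U z] H_nonneg[of "2*M" Th z] unfolding base_def RR_def[of "2*M"] by argo
    then have "(base (2*M) z + H (2*M) A z)\<^sup>2 \<le> (2 * RR (2*M) z + sqrt ?w * RR 6 z)\<^sup>2"
      using z by (intro power_mono) auto
    also have "\<dots> \<le> 2 * (2 * RR (2*M) z)\<^sup>2 + 2 * (?w * (RR 6 z)\<^sup>2)"
      using sum_squares_bound[of "2 * RR (2*M) z" "sqrt ?w * RR 6 z"] z by (simp add: power2_sum power_mult_distrib)
    also have "\<dots> \<le> 8 * (?w ^ 0 * (RR (2*M) z)\<^sup>2 + ?w ^ 1 * (RR 6 z)\<^sup>2)" using z by (simp add: power_mult_distrib)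
    finally show "(base (2*M) z + H (2*M) A z)\<^sup>2 \<le> 8 * (?w ^ 0 * (RR (2*M) z)\<^sup>2 + ?w ^ 1 * (RR 6 z)\<^sup>2)" .
  qed simp
  then show ?thesis
    by (rule lss_trans) (intro lss_add RR_le_Zf, use M in auto)
qed

lemma Zf_initial: "z \<in> Sol \<Longrightarrow> tm z = 0 \<Longrightarrow> Zf \<rho> \<epsilon> z \<le> (2 * real M * C) * Q (2*M) z"
proof -
  assume z: "z \<in> Sol" "tm z = 0"
  have "Zf \<rho> \<epsilon> z \<le> (\<Sum>s\<in>{2..2*M}. C * Q (2*M) z)"
    unfolding Zf_def
  proof (rule sum_mono)
    fix s assume s: "s \<in> {2..2*M}"
    have "\<rho> ^ (2*M - s) * ((1 + tm z) ^ (2*M - s) * Yf s \<epsilon> z) \<le> 1 * Yf s \<epsilon> z"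
      using z c Yf_nonneg[OF z(1)] by (simp add: mult_left_le_one_le power_le_one)
    also have "\<dots> \<le> C * Q s z" using Yb(2)[OF z(1)] by simp
    also have "\<dots> \<le> C * Q (2*M) z" unfolding Q_def using c s
      by (intro mult_left_mono sum_mono2 SL_mono) auto
    finally show "\<rho> ^ (2*M - s) * ((1 + tm z) ^ (2*M - s) * Yf s \<epsilon> z) \<le> C * Q (2*M) z" .
  qed
  also have "\<dots> \<le> (2 * real M) * (C * Q (2*M) z)"
    using c mult_right_mono[of "real (2*M-1)" "2 * real M" "C * Q (2*M) z"] M by (simp add: of_nat_diff)
  finally show ?thesis by (simp add: mult_ac)
qed

lemma Ebar_Zf: "(\<lambda>z. Ebar (tT z) M (fu z) (fh z) (fK z) (tm z)) \<preceq> Zf \<rho> \<epsilon>"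
  by (rule lss_trans[OF Ebar_lss base_sq_Zf])

lemma Elow_Zf: "(\<lambda>z. Elow (tT z) (fu z) (fh z) (fK z) (tm z) * (1 + tm z) ^ (2*M - 2)) \<preceq> Zf \<rho> \<epsilon>"
  by (rule lss_mult[OF Elow_lss lss_refl])
     (use RR_le_Zf[of 2 "2*M-2"] M in \<open>auto simp: EL_def RR_def[abs_def] mult.commute\<close>)

lemma KF_base:
  assumes "(\<lambda>z. X z) \<preceq> (\<lambda>z. (H n KF z + base (2*M) z)\<^sup>2)"
  shows "X \<preceq> (\<lambda>z. Gf n z + Zf \<rho> \<epsilon> z)"
proof (rule lss_trans[OF assms])
  let ?Y = "\<lambda>z. Gf n z + Zf \<rho> \<epsilon> z"
  have "(\<lambda>z. (H n KF z)\<^sup>2) \<preceq> ?Y"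
  proof (rule lssI[of "real (card (SL n))"])
    fix z assume z: "z \<in> Sol"
    show "(H n KF z)\<^sup>2 \<le> real (card (SL n)) * ?Y z"
      by (rule order_trans[OF H_sq_le_Gf mult_left_mono]) (use Zf_nonneg[OF z] in auto)
  qed simp
  moreover have "(\<lambda>z. (base (2*M) z + H (2*M) A z)\<^sup>2) \<preceq> ?Y"
    by (rule lss_trans[OF base_sq_Zf]) (auto intro: lss_le)
  moreover have "(\<lambda>z. (H n KF z + base (2*M) z)\<^sup>2) \<preceq> (\<lambda>z. (H n KF z)\<^sup>2 + (base (2*M) z + H (2*M) A z)\<^sup>2)"
  proof (rule lssI[of 2])
    fix z assume z: "z \<in> Sol"
    have "(H n KF z + base (2*M) z)\<^sup>2 \<le> (H n KF z + (base (2*M) z + H (2*M) A z))\<^sup>2"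
      using z by (intro power_mono) auto
    also have "\<dots> \<le> 2 * ((H n KF z)\<^sup>2 + (base (2*M) z + H (2*M) A z)\<^sup>2)"
      by (rule sum2_sq_le)
    finally show "(H n KF z + base (2*M) z)\<^sup>2 \<le> 2 * ((H n KF z)\<^sup>2 + (base (2*M) z + H (2*M) A z)\<^sup>2)" .
  qed simp
  ultimately show "(\<lambda>z. (H n KF z + base (2*M) z)\<^sup>2) \<preceq> ?Y"
    by (rule lss_trans[OF _ lss_add, rotated])
qed

lemmas Ffun_Zf = KF_base[OF Ffun_lss]
lemmas EK_Zf = KF_base[OF EK_lss]

end

lemma Dfull_calD: "(\<lambda>z. Dfull (tT z) M (fu z) (fh z) (fK z) (tm z)) \<preceq> calD"
  by (rule lss_trans[OF Dfull_lss base_sq_calD])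

lemma H_sq_le_Hs: "fam F \<Longrightarrow> z \<in> Sol \<Longrightarrow> (H n F z)\<^sup>2 \<le> (real (card (SL n)))\<^sup>2 * Hs_sq (tT z) n (F z) (tm z)"
  for F :: "inst \<Rightarrow> real \<Rightarrow> real^3 \<Rightarrow> 'a::euclidean_space"
  using power_mono[OF hn_le_Hs_sq[OF famD Sol_tm], of F z n 2] by (simp add: H_def power_mult_distrib)

lemma Q_le_Ebar:
  assumes z: "z \<in> Sol"
  shows "Q (2*M) z \<le> (real (card (SL (2*M))))\<^sup>2 * Ebar (tT z) M (fu z) (fh z) (fK z) (tm z)"
proof -
  let ?N = "(real (card (SL (2*M))))\<^sup>2"
  have "Q (2*M) z \<le> (H (2*M) U z)\<^sup>2 + (H (2*M) Th z)\<^sup>2 + (H (2*M) A z)\<^sup>2"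
    unfolding Q_def sum.distrib H_def by (intro add_mono sum_L2sq_le_hn) auto
  also have "\<dots> \<le> ?N * Psq (tT z) (2*M) (fu z) (tm z) + ?N * Psq (tT z) (2*M) (fh z) (tm z) + ?N * Psq (tT z) (2*M) (A z) (tm z)"
  proof -
    have P: "(H (2*M) F z)\<^sup>2 \<le> ?N * Psq (tT z) (2*M) (F z) (tm z)" if "fam F" for F :: "inst \<Rightarrow> real \<Rightarrow> real^3 \<Rightarrow> 'a::euclidean_space"
      by (rule order_trans[OF H_sq_le_Hs[OF that z] mult_left_mono])
         (use Hs_sq_le_Psq[of 0 "2*M" "2*M" "tT z" "F z" "tm z"] in \<open>auto simp: ptd_def\<close>)
    show ?thesis by (intro add_mono P) auto
  qed
  finally show ?thesis by (simp add: Ebar_def A_def distrib_left)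
qed

lemma Gf_le_Ffun:
  assumes z: "z \<in> Sol"
  shows "Gf (2*M+1) z \<le> (real (card (SL (2*M+1))))\<^sup>2 * Ffun (tT z) M (fK z) (tm z)"
  by (rule order_trans[OF order_trans[OF Gf_le_H H_sq_le_Hs[OF fam_fields(4) z]] mult_left_mono]) (auto simp: Ffun_def)

end


section \<open>The bootstrap argument\<close>

lemma L2sq_has_derivative:
  fixes f :: "real \<Rightarrow> real^3 \<Rightarrow> 'a::euclidean_space"
  assumes "smper T f" "t \<in> {0..T}"
  shows "((\<lambda>t. L2sq (f t)) has_real_derivative 2 * ip (pder T Dt f t) (f t)) (at t within {0..T})"
  using ip_has_derivative[OF assms(1,1,2)] by (simp add: L2sq_ip ip_commute[of "f t"])

lemma continuous_on_L2sq:
  fixes f :: "real \<Rightarrow> real^3 \<Rightarrow> 'a::euclidean_space"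
  shows "smper T f \<Longrightarrow> continuous_on {0..T} (\<lambda>t. L2sq (f t))"
  by (rule DERIV_continuous_on[OF L2sq_has_derivative])

lemma continuous_on_hn:
  fixes f :: "real \<Rightarrow> real^3 \<Rightarrow> 'a::euclidean_space"
  shows "smper T f \<Longrightarrow> continuous_on {0..T} (hn T n f)"
  unfolding hn_def[abs_def] L2n_def
  by (intro continuous_on_sum continuous_on_real_sqrt continuous_on_L2sq smper_pders)

lemma continuous_on_Hs_sq:
  fixes f :: "real \<Rightarrow> real^3 \<Rightarrow> 'a::euclidean_space"
  assumes "smper T f" shows "continuous_on {0..T} (Hs_sq T n f)"
  unfolding Hs_sq_def[abs_def]
proof (intro continuous_on_sum)
  fix a :: "nat \<times> nat \<times> nat"
  show "continuous_on {0..T} (\<lambda>t. L2sq (sder T a f t))"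
    by (cases a) (simp add: sder_pders continuous_on_L2sq smper_pders assms)
qed

lemma continuous_on_Psq:
  fixes f :: "real \<Rightarrow> real^3 \<Rightarrow> 'a::euclidean_space"
  shows "smper T f \<Longrightarrow> continuous_on {0..T} (Psq T n f)"
  unfolding Psq_eq_Hs_sq[abs_def] by (intro continuous_on_sum continuous_on_Hs_sq smper_ptd)

lemma continuation:
  fixes g :: "real \<Rightarrow> real"
  assumes g: "continuous_on {0..T} g" and b: "b' < b" "g 0 < b"
    and step: "\<And>\<tau>. \<tau> \<in> {0..T} \<Longrightarrow> (\<And>t. t \<in> {0..\<tau>} \<Longrightarrow> g t \<le> b) \<Longrightarrow> g \<tau> \<le> b'"
    and t: "t \<in> {0..T}"
  shows "g t \<le> b"
proof (rule ccontr)
  assume nt: "\<not> g t \<le> b"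
  let ?S = "{0..T} \<inter> g -` {b..}"
  have "closed ?S" by (rule continuous_closed_preimage[OF g]) auto
  then have "compact ?S" using compact_Int_closed[of "{0..T}" ?S] by (simp add: Int_absorb1)
  moreover have "t \<in> ?S" using nt t by simp
  ultimately obtain \<tau> where \<tau>: "\<tau> \<in> ?S" "\<And>s. s \<in> ?S \<Longrightarrow> \<tau> \<le> s" using compact_attains_inf[of ?S] by blast
  have lt: "g s < b" if "s \<in> {0..T}" "s < \<tau>" for s
    using \<tau>(2)[of s] that by fastforce
  have "g \<tau> \<le> b"
  proof (rule ccontr)
    assume "\<not> g \<tau> \<le> b"
    moreover have "continuous_on {0..\<tau>} g" using \<tau>(1) by (intro continuous_on_subset[OF g]) auto
    ultimately obtain s where "0 \<le> s" "s \<le> \<tau>" "g s = b"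
      using IVT'[of g 0 b \<tau>] b \<tau>(1) by auto
    then show False using \<tau> lt[of s] \<open>\<not> g \<tau> \<le> b\<close> by (cases "s = \<tau>") auto
  qed
  then have "g s \<le> b" if "s \<in> {0..\<tau>}" for s
    using lt[of s] \<tau>(1) that by (cases "s = \<tau>") auto
  then have "g \<tau> \<le> b'" using step[of \<tau>] \<tau>(1) by auto
  then show False using \<tau>(1) b by auto
qed

lemma nonincreasing_within:
  fixes f :: "real \<Rightarrow> real"
  assumes "0 \<le> \<tau>" "\<And>t. t \<in> {0..\<tau>} \<Longrightarrow> (f has_real_derivative f' t) (at t within {0..\<tau>})" "\<And>t. t \<in> {0..\<tau>} \<Longrightarrow> f' t \<le> 0"
  shows "f \<tau> \<le> f 0"
proof (cases "\<tau> = 0")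
  case False
  then obtain x where "x \<in> {0<..<\<tau>}" "f \<tau> - f 0 = f' x * (\<tau> - 0)"
    using mvt_simple[of 0 \<tau> f "\<lambda>t x. f' t * x"] assms(1,2) by (auto simp: has_field_derivative_def mult_commute_abs)
  moreover have "f' x * (\<tau> - 0) \<le> 0" using assms(3)[of x] calculation(1) by (intro mult_nonpos_nonneg) auto
  ultimately show ?thesis by linarith
qed simp

context par
begin

definition zz where
  "zz \<kappa> T u p \<theta> K t = \<lparr>kp = \<kappa>, tT = T, fu = u, fp = p, fh = \<theta>, fK = K, tm = t\<rparr>"

lemma zz_simps [simp]: "kp (zz \<kappa> T u p \<theta> K t) = \<kappa>" "tT (zz \<kappa> T u p \<theta> K t) = T" "fu (zz \<kappa> T u p \<theta> K t) = u"
  "fp (zz \<kappa> T u p \<theta> K t) = p" "fh (zz \<kappa> T u p \<theta> K t) = \<theta>" "fK (zz \<kappa> T u p \<theta> K t) = K" "tm (zz \<kappa> T u p \<theta> K t) = t"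
  by (simp_all add: zz_def)

context
  fixes T u p \<theta> K and \<kappa> :: real assumes sol: "sol T u p \<theta> K"
begin

abbreviation (input) "zt \<equiv> zz \<kappa> T u p \<theta> K"

lemma Yf_derivative:
  assumes t: "t \<in> {0..T}"
  shows "((\<lambda>t. Yf s \<epsilon> (zt t)) has_real_derivative Yd s \<epsilon> (zt t)) (at t within {0..T})"
  unfolding Yf_def Yd_def edz_def xdz_def zz_simps
  by (intro DERIV_add DERIV_cmult DERIV_sum ee_derivative[OF sol t] xx_derivative[OF sol t])

lemma Zf_derivative:
  assumes t: "t \<in> {0..T}"
  shows "((\<lambda>t. Zf \<rho> \<epsilon> (zt t)) has_real_derivative Zd \<rho> \<epsilon> (zt t)) (at t within {0..T})"
  unfolding Zf_def Zd_def zz_simps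
proof (intro DERIV_sum DERIV_cmult)
  fix s
  have "((\<lambda>t. (1 + t) ^ (2*M - s)) has_real_derivative real (2*M - s) * (1 + t) ^ (2*M - s - 1)) (at t within {0..T})"
    by (auto intro!: derivative_eq_intros)
  from DERIV_mult[OF this Yf_derivative[OF t, of s \<epsilon>]]
  show "((\<lambda>t. (1 + t) ^ (2*M - s) * Yf s \<epsilon> (zt t)) has_real_derivative
    real (2*M - s) * (1 + t) ^ (2*M - s - 1) * Yf s \<epsilon> (zt t) + (1 + t) ^ (2*M - s) * Yd s \<epsilon> (zt t)) (at t within {0..T})"
    by (simp add: mult.commute)
qed

lemma Gf_derivative:
  assumes t: "t \<in> {0..T}"
  shows "((\<lambda>t. Gf n (zt t)) has_real_derivative Gd n (zt t)) (at t within {0..T})"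
  unfolding Gf_def Gd_def zz_simps
proof (intro DERIV_sum)
  fix ds
  show "((\<lambda>t. L2sq (pders T ds K t)) has_real_derivative 2 * ip (pders T ds (pder T Dt K) t) (pders T ds K t)) (at t within {0..T})"
    using L2sq_has_derivative[OF smper_pders[OF sol_smper(4)[OF sol]] t, of ds] pder_Dt_pders[OF sol_smper(4)[OF sol] t, of ds] by simp
qed

lemma Gf_weighted_derivative:
  assumes t: "t \<in> {0..T}"
  shows "((\<lambda>t. Gf n (zt t) / (1 + t)) has_real_derivative Gd n (zt t) / (1 + t) - Gf n (zt t) / (1 + t)\<^sup>2) (at t within {0..T})"
    and "((\<lambda>t. (1 + 1 / (1 + t)) * Gf n (zt t)) has_real_derivative
      (1 + 1 / (1 + t)) * Gd n (zt t) - Gf n (zt t) / (1 + t)\<^sup>2) (at t within {0..T})"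
proof -
  have t1: "1 + t \<noteq> 0" using t by auto
  then have i: "((\<lambda>t. 1 / (1 + t)) has_real_derivative - 1 / (1 + t)\<^sup>2) (at t within {0..T})"
    by (auto intro!: derivative_eq_intros simp: power2_eq_square)
  have j: "((\<lambda>t. 1 + 1 / (1 + t)) has_real_derivative - 1 / (1 + t)\<^sup>2) (at t within {0..T})"
    using DERIV_add[OF DERIV_const i] by simp
  show "((\<lambda>t. Gf n (zt t) / (1 + t)) has_real_derivative Gd n (zt t) / (1 + t) - Gf n (zt t) / (1 + t)\<^sup>2) (at t within {0..T})"
    using DERIV_mult[OF Gf_derivative[OF t, of n] i] by (simp add: algebra_simps)
  show "((\<lambda>t. (1 + 1 / (1 + t)) * Gf n (zt t)) has_real_derivative
      (1 + 1 / (1 + t)) * Gd n (zt t) - Gf n (zt t) / (1 + t)\<^sup>2) (at t within {0..T})"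
    using DERIV_mult[OF j Gf_derivative[OF t, of n]] by (simp add: algebra_simps)
qed

lemma continuous_on_calD: "continuous_on {0..T} (\<lambda>t. calD (zt t))"
  unfolding calD_def DD_def H_def A_def zz_simps
  by (intro continuous_intros continuous_on_hn sol_smper[OF sol])

lemma continuous_on_Dbar: "continuous_on {0..T} (Dbar T M u \<theta>)"
  unfolding Dbar_def[abs_def] by (intro continuous_intros continuous_on_Psq sol_smper[OF sol])

lemma continuous_on_Dfull: "continuous_on {0..T} (Dfull T M u \<theta> K)"
  unfolding Dfull_def[abs_def]
  by (intro continuous_intros continuous_on_Dbar continuous_on_Hs_sq smper_ptd sol_smper[OF sol])

end


lemma zz_Sol:
  assumes "sol T u p \<theta> K" "t \<in> {0..T}" "0 \<le> \<kappa>" "\<kappa> \<le> 1" "Efull T M u \<theta> K t \<le> \<kappa>\<^sup>2"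
    "(hn T (2*M+1) K t)\<^sup>2 \<le> \<kappa>\<^sup>2 * (1 + t)"
  shows "zz \<kappa> T u p \<theta> K t \<in> Sol"
  unfolding Sol_def mem_Collect_eq zz_simps using assms by (intro conjI)

lemma integrated_inequality:
  assumes sol: "sol T u p \<theta> K" and \<tau>: "\<tau> \<in> {0..T}"
    and f: "\<And>t. t \<in> {0..T} \<Longrightarrow> (f has_real_derivative f' t) (at t within {0..T})"
    and le: "\<And>t. t \<in> {0..\<tau>} \<Longrightarrow> f' t \<le> c * calD (zz \<kappa> T u p \<theta> K t)"
  shows "f \<tau> \<le> f 0 + c * integral {0..\<tau>} (\<lambda>t. calD (zz \<kappa> T u p \<theta> K t))"
proof -
  let ?d = "\<lambda>t. calD (zz \<kappa> T u p \<theta> K t)"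
  have sub: "{0..\<tau>} \<subseteq> {0..T}" using \<tau> by auto
  have "f \<tau> - c * integral {0..\<tau>} ?d \<le> f 0 - c * integral {0..0} ?d"
  proof (rule nonincreasing_within[where f' = "\<lambda>t. f' t - c * ?d t"])
    fix t assume t: "t \<in> {0..\<tau>}"
    have "((\<lambda>t. integral {0..t} ?d) has_real_derivative ?d t) (at t within {0..\<tau>})"
      using t by (intro integral_has_real_derivative continuous_on_subset[OF continuous_on_calD[OF sol] sub])
    then show "((\<lambda>t. f t - c * integral {0..t} ?d) has_real_derivative f' t - c * ?d t) (at t within {0..\<tau>})"
      using t sub by (intro DERIV_diff DERIV_cmult DERIV_subset[OF f]) auto
  qed (use \<tau> le in auto)
  then show ?thesis by simp
qed

lemma lss_ex:
  assumes "X \<preceq> Y" "\<forall>z\<in>Sol. 0 \<le> Y z"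
  shows "\<exists>C>0. \<exists>k>0. \<forall>z\<in>Sol. kp z \<le> k \<longrightarrow> X z \<le> C * Y z"
  using lss_bound[OF assms(1) bspec[OF assms(2)]] by metis

theorem a_priori_estimate:
  "\<exists>\<eta> \<delta> C. \<eta> \<in> {0<..1} \<and> \<delta> \<in> {0<..1} \<and> C > 0 \<and>
    (\<forall>T u p \<theta> K. sol T u p \<theta> K \<and> Efull T M u \<theta> K 0 + Ffun T M K 0 \<le> \<eta> \<and>
      (\<forall>t\<in>{0..T}. Efull T M u \<theta> K t + integral {0..T} (Dbar T M u \<theta>) \<le> \<delta>) \<longrightarrow>
      (\<forall>t\<in>{0..T}.
         Elow T u \<theta> K t * (1 + t) ^ (2*M - 2) + Ebar T M u \<theta> K t + Ffun T M K t / (1 + t)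
           + integral {0..T} (Dfull T M u \<theta> K)
         \<le> C * (Ebar T M u \<theta> K 0 + Ffun T M K 0)) \<and>
      (\<forall>t\<in>{0..T}. EK T M K t \<le> C * (Efull T M u \<theta> K 0 + Ffun T M K 0)))"
  using Z_inequality
proof (elim exE conjE)
  fix \<epsilon> \<rho> c C d k1 assume c: "0 < \<epsilon>" "0 < \<rho>" "\<rho> \<le> 1" "0 < c" "0 < C" "0 < d" "0 < k1"
    and Yb: "\<forall>s. \<forall>z\<in>Sol. c * Q s z \<le> Yf s \<epsilon> z \<and> Yf s \<epsilon> z \<le> C * Q s z"
    and Zi: "\<forall>z\<in>Sol. kp z \<le> k1 \<longrightarrow> Zd \<rho> \<epsilon> z \<le> - d * calD z"
  note Zfacts = c(1-5) Yb
  let ?Z = "Zf \<rho> \<epsilon>"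
  have Z0: "\<And>z. z \<in> Sol \<Longrightarrow> 0 \<le> ?Z z" by (rule Zf_nonneg[OF Zfacts])
  then have Z0': "\<forall>z\<in>Sol. 0 \<le> ?Z z" by blast
  obtain C2 k2 where 2: "0 < C2" "0 < k2"
    and r2: "\<forall>z\<in>Sol. kp z \<le> k2 \<longrightarrow> Gd (2*M+1) z / (1 + tm z) - Gf (2*M+1) z / (1 + tm z)\<^sup>2 \<le> C2 * calD z"
    using top_inequality by (elim exE conjE) (rule that)
  note b2 = mp[OF bspec[OF r2]]
  obtain C3 k3 where 3: "0 < C3" "0 < k3"
    and r3: "\<forall>z\<in>Sol. kp z \<le> k3 \<longrightarrow> (1 + 1 / (1 + tm z)) * Gd (2*M-3) z - Gf (2*M-3) z / (1 + tm z)\<^sup>2 \<le> C3 * calD z"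
    using low_inequality by (elim exE conjE) (rule that)
  note b3 = mp[OF bspec[OF r3]]
  obtain C4 k4 where 4: "0 < C4" "0 < k4"
    and r4: "\<forall>z\<in>Sol. kp z \<le> k4 \<longrightarrow> Ebar (tT z) M (fu z) (fh z) (fK z) (tm z) \<le> C4 * ?Z z"
    using lss_ex[OF Ebar_Zf[OF Zfacts] Z0'] by (elim exE conjE) (rule that)
  note b4 = mp[OF bspec[OF r4]]
  obtain C5 k5 where 5: "0 < C5" "0 < k5"
    and r5: "\<forall>z\<in>Sol. kp z \<le> k5 \<longrightarrow> Elow (tT z) (fu z) (fh z) (fK z) (tm z) * (1 + tm z) ^ (2*M - 2) \<le> C5 * ?Z z"
    using lss_ex[OF Elow_Zf[OF Zfacts] Z0'] by (elim exE conjE) (rule that)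
  note b5 = mp[OF bspec[OF r5]]
  have GZ: "\<forall>z\<in>Sol. 0 \<le> Gf n z + ?Z z" for n using Z0 by simp
  obtain C6 k6 where 6: "0 < C6" "0 < k6"
    and r6: "\<forall>z\<in>Sol. kp z \<le> k6 \<longrightarrow> Ffun (tT z) M (fK z) (tm z) \<le> C6 * (Gf (2*M+1) z + ?Z z)"
    using lss_ex[OF Ffun_Zf[OF Zfacts] GZ] by (elim exE conjE) (rule that)
  note b6 = mp[OF bspec[OF r6]]
  obtain C7 k7 where 7: "0 < C7" "0 < k7"
    and r7: "\<forall>z\<in>Sol. kp z \<le> k7 \<longrightarrow> EK (tT z) M (fK z) (tm z) \<le> C7 * (Gf (2*M-3) z + ?Z z)"
    using lss_ex[OF EK_Zf[OF Zfacts] GZ] by (elim exE conjE) (rule that)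
  note b7 = mp[OF bspec[OF r7]]
  have cD: "\<forall>z\<in>Sol. 0 \<le> calD z" by simp
  obtain C8 k8 where 8: "0 < C8" "0 < k8"
    and r8: "\<forall>z\<in>Sol. kp z \<le> k8 \<longrightarrow> Dfull (tT z) M (fu z) (fh z) (fK z) (tm z) \<le> C8 * calD z"
    using lss_ex[OF Dfull_calD cD] by (elim exE conjE) (rule that)
  note b8 = mp[OF bspec[OF r8]]
  define \<kappa> where "\<kappa> = Min {1, k1, k2, k3, k4, k5, k6, k7, k8}"
  have \<kappa>: "0 < \<kappa>" "\<kappa> \<le> 1" "\<kappa> \<le> k1" "\<kappa> \<le> k2" "\<kappa> \<le> k3" "\<kappa> \<le> k4" "\<kappa> \<le> k5" "\<kappa> \<le> k6" "\<kappa> \<le> k7" "\<kappa> \<le> k8"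
  proof -
    show "0 < \<kappa>" unfolding \<kappa>_def by (subst Min_gr_iff) (use c(7) 2(2) 3(2) 4(2) 5(2) 6(2) 7(2) 8(2) in auto)
  qed (unfold \<kappa>_def, (rule Min_le, simp, simp)+)
  define e where "e = d / (2 * C2)"
  have e: "0 < e" "e * C2 = d / 2" using c 2 by (simp_all add: e_def)
  define N where "N = real (card (SL (2*M+1)))"
  have N: "0 < N" unfolding N_def by (rule card_SL_pos)
  define CW where "CW = 2 * real M * C * (real (card (SL (2*M))))\<^sup>2 + e * N\<^sup>2"
  have CW: "0 < CW" unfolding CW_def using N e c by (intro add_nonneg_pos) auto
  define B where "B = N\<^sup>2 + N / e * CW"
  have B: "0 < B" "N\<^sup>2 \<le> B" "N / e * CW \<le> B" proof -
    have "0 < N\<^sup>2" "0 < N / e * CW" using N e(1) CW by simp_all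
    then show "0 < B" "N\<^sup>2 \<le> B" "N / e * CW \<le> B" unfolding B_def by linarith+
  qed
  define \<eta> where "\<eta> = min 1 (\<kappa>\<^sup>2 / (2 * B))"
  have \<eta>: "0 < \<eta>" "\<eta> \<le> 1" "B * \<eta> < \<kappa>\<^sup>2"
  proof -
    show "0 < \<eta>" "\<eta> \<le> 1" using \<kappa> B by (auto simp: \<eta>_def)
    have "B * \<eta> \<le> B * (\<kappa>\<^sup>2 / (2 * B))" using B by (intro mult_left_mono) (auto simp: \<eta>_def)
    also have "\<dots> = \<kappa>\<^sup>2 / 2" using B by simp
    also have "\<dots> < \<kappa>\<^sup>2" using \<kappa> by simp
    finally show "B * \<eta> < \<kappa>\<^sup>2" .
  qed
  define D1 where "D1 = (C5 + C4 + C6 * (1 / e + 1) + C8 * (2 / d)) * CW"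
  define D2 where "D2 = C7 * (2 * N\<^sup>2 + (C3 * (2 / d) + 1) * CW)"
  have D: "0 < D1" "0 < D2" unfolding D1_def D2_def using 3 4 5 6 7 8 e(1) c(6) CW N
    by (auto intro!: mult_pos_pos add_pos_pos)
  show ?thesis
  proof (rule exI[of _ \<eta>], rule exI[of _ "\<kappa>\<^sup>2"], rule exI[of _ "D1 + D2"], intro conjI allI impI)
    show "\<eta> \<in> {0<..1}" "\<kappa>\<^sup>2 \<in> {0<..1}" "0 < D1 + D2" using \<eta> \<kappa> D by (auto simp: power_le_one)
    fix T u p \<theta> K
    assume *: "sol T u p \<theta> K \<and> Efull T M u \<theta> K 0 + Ffun T M K 0 \<le> \<eta> \<and>
      (\<forall>t\<in>{0..T}. Efull T M u \<theta> K t + integral {0..T} (Dbar T M u \<theta>) \<le> \<kappa>\<^sup>2)"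
    then have sol: "sol T u p \<theta> K" and ini: "Efull T M u \<theta> K 0 + Ffun T M K 0 \<le> \<eta>" by auto
    have T: "0 < T" by (rule sol_smper(6)[OF sol])
    have EF: "Efull T M u \<theta> K t \<le> \<kappa>\<^sup>2" if "t \<in> {0..T}" for t
    proof -
      have "0 \<le> integral {0..T} (Dbar T M u \<theta>)"
        by (intro integral_nonneg integrable_continuous_real continuous_on_Dbar[OF sol]) (simp add: Dbar_def)
      then show ?thesis using * that by fastforce
    qed
    let ?z = "zz \<kappa> T u p \<theta> K"
    define I where "I = Ebar T M u \<theta> K 0 + Ffun T M K 0"
    have nonneg: "0 \<le> Ebar T M u \<theta> K t" "0 \<le> Ffun T M K t" "0 \<le> EK T M K t" for t
      by (simp_all add: Ebar_def Ffun_def EK_nonneg)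
    have I: "0 \<le> I" "I \<le> Efull T M u \<theta> K 0 + Ffun T M K 0" "I \<le> \<eta>" "Ffun T M K 0 \<le> I"
      using ini nonneg[of 0] by (auto simp: I_def Efull_def)
    define g where "g t = (hn T (2*M+1) K t)\<^sup>2 / (1 + t)" for t
    have zS: "?z t \<in> Sol" if "t \<in> {0..T}" "g t \<le> \<kappa>\<^sup>2" for t
      using that \<kappa> EF[OF that(1)] by (intro zz_Sol[OF sol]) (auto simp: g_def field_simps)
    define W where "W t = ?Z (?z t) + e * (Gf (2*M+1) (?z t) / (1 + t))" for t
    let ?I = "\<lambda>\<tau>. integral {0..\<tau>} (\<lambda>t. calD (?z t))"
    have g0: "g 0 \<le> N\<^sup>2 * I"
    proof -
      have "hn T (2*M+1) K 0 \<le> N * sqrt (Hs_sq T (2*M+1) K 0)"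
        unfolding N_def using T by (intro hn_le_Hs_sq sol_smper[OF sol]) auto
      then have "(hn T (2*M+1) K 0)\<^sup>2 \<le> (N * sqrt (Hs_sq T (2*M+1) K 0))\<^sup>2" by (intro power_mono) auto
      also have "\<dots> = N\<^sup>2 * Hs_sq T (2*M+1) K 0" by (simp add: power_mult_distrib)
      also have "\<dots> \<le> N\<^sup>2 * I" by (intro mult_left_mono order_trans[OF _ I(4)]) (simp_all add: Ffun_def)
      finally show ?thesis by (simp add: g_def)
    qed
    have NI: "N\<^sup>2 * I \<le> B * \<eta>" by (intro mult_mono B I) (use B I in auto)
    have g0': "g 0 < \<kappa>\<^sup>2" using g0 NI \<eta> by linarith
    have S0: "?z 0 \<in> Sol" by (rule zS) (use T g0' in auto)
    have G0: "Gf (2*M+1) (?z 0) \<le> N\<^sup>2 * Ffun T M K 0" using Gf_le_Ffun[OF S0] by (simp add: N_def)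
    have W0: "W 0 \<le> CW * I"
    proof -
      have "?Z (?z 0) \<le> 2 * real M * C * Q (2*M) (?z 0)" by (rule Zf_initial[OF Zfacts S0]) simp
      also have "\<dots> \<le> 2 * real M * C * ((real (card (SL (2*M))))\<^sup>2 * Ebar T M u \<theta> K 0)"
        using Q_le_Ebar[OF S0] c by (intro mult_left_mono) auto
      also have "\<dots> \<le> 2 * real M * C * ((real (card (SL (2*M))))\<^sup>2 * I)"
        using c nonneg[of 0] by (intro mult_left_mono) (auto simp: I_def)
      finally have "?Z (?z 0) \<le> 2 * real M * C * (real (card (SL (2*M))))\<^sup>2 * I" by (simp add: mult.assoc)
      moreover have "e * Gf (2*M+1) (?z 0) \<le> e * (N\<^sup>2 * I)"
        using order_trans[OF G0 mult_left_mono[OF I(4)]] e by (intro mult_left_mono) auto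
      ultimately show ?thesis by (simp add: W_def CW_def distrib_right)
    qed
    have decay: "W \<tau> + d / 2 * ?I \<tau> \<le> W 0" if \<tau>: "\<tau> \<in> {0..T}" and S: "\<And>t. t \<in> {0..\<tau>} \<Longrightarrow> ?z t \<in> Sol" for \<tau>
    proof -
      have "W \<tau> \<le> W 0 + (- (d / 2)) * ?I \<tau>"
      proof (rule integrated_inequality[OF sol \<tau>, where f' = "\<lambda>t. Zd \<rho> \<epsilon> (?z t) + e * (Gd (2*M+1) (?z t) / (1 + t) - Gf (2*M+1) (?z t) / (1 + t)\<^sup>2)"])
        fix t assume "t \<in> {0..T}"
        then show "(W has_real_derivative Zd \<rho> \<epsilon> (?z t) + e * (Gd (2*M+1) (?z t) / (1 + t) - Gf (2*M+1) (?z t) / (1 + t)\<^sup>2)) (at t within {0..T})"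
          unfolding W_def[abs_def] by (intro DERIV_add DERIV_cmult Zf_derivative[OF sol] Gf_weighted_derivative(1)[OF sol])
      next
        fix t assume t: "t \<in> {0..\<tau>}"
        have "Zd \<rho> \<epsilon> (?z t) \<le> - d * calD (?z t)" using Zi S[OF t] \<kappa>(3) by simp
        moreover have "e * (Gd (2*M+1) (?z t) / (1 + t) - Gf (2*M+1) (?z t) / (1 + t)\<^sup>2) \<le> e * (C2 * calD (?z t))"
          using b2[OF S[OF t]] \<kappa>(4) e by (intro mult_left_mono) auto
        moreover have "e * (C2 * calD (?z t)) = d / 2 * calD (?z t)" by (simp add: e(2) flip: mult.assoc)
        moreover have "- (d / 2) * calD (?z t) = - d * calD (?z t) + d / 2 * calD (?z t)" by (simp add: field_simps)
        ultimately show "Zd \<rho> \<epsilon> (?z t) + e * (Gd (2*M+1) (?z t) / (1 + t) - Gf (2*M+1) (?z t) / (1 + t)\<^sup>2) \<le> - (d / 2) * calD (?z t)"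
          using add_mono by metis
      qed
      then show ?thesis by simp
    qed
    have I0: "0 \<le> ?I \<tau>" if "\<tau> \<in> {0..T}" "\<And>t. t \<in> {0..\<tau>} \<Longrightarrow> ?z t \<in> Sol" for \<tau>
      using that
      by (intro integral_nonneg integrable_continuous_real continuous_on_subset[OF continuous_on_calD[OF sol]] calD_nonneg) auto
    have gle: "g t \<le> \<kappa>\<^sup>2" if "t \<in> {0..T}" for t
    proof (rule continuation[of T g "B * \<eta>" "\<kappa>\<^sup>2" t])
      show "continuous_on {0..T} g" unfolding g_def[abs_def]
        by (intro continuous_intros continuous_on_hn sol_smper[OF sol]) auto
      fix \<tau> assume \<tau>: "\<tau> \<in> {0..T}" and le: "\<And>t. t \<in> {0..\<tau>} \<Longrightarrow> g t \<le> \<kappa>\<^sup>2"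
      have S: "?z t \<in> Sol" if "t \<in> {0..\<tau>}" for t by (rule zS) (use that \<tau> le in auto)
      have "W \<tau> \<le> W 0" using decay[OF \<tau> S] mult_nonneg_nonneg[OF _ I0[OF \<tau> S], of "d / 2"] c by simp
      then have "e * (Gf (2*M+1) (?z \<tau>) / (1 + \<tau>)) \<le> CW * I" using W0 Z0[OF S, of \<tau>] \<tau> unfolding W_def by simp
      then have G: "Gf (2*M+1) (?z \<tau>) / (1 + \<tau>) \<le> CW * I / e" using e by (simp add: field_simps)
      have "g \<tau> \<le> N * Gf (2*M+1) (?z \<tau>) / (1 + \<tau>)"
        unfolding g_def N_def using H_sq_le_Gf[of "2*M+1" "?z \<tau>"] \<tau> by (intro divide_right_mono) (auto simp: H_def)
      also have "\<dots> \<le> N * (CW * I / e)" using mult_left_mono[OF G, of N] N by simp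
      also have "\<dots> = (N / e * CW) * I" by simp
      also have "\<dots> \<le> B * \<eta>" by (intro mult_mono B I) (use B I in auto)
      finally show "g \<tau> \<le> B * \<eta>" .
    qed (use that g0' \<eta> in auto)
    have S: "?z t \<in> Sol" if "t \<in> {0..T}" for t by (rule zS[OF that gle[OF that]])
    have It: "d / 2 * ?I t \<le> CW * I" and Zt: "?Z (?z t) \<le> CW * I"
      and Gt: "Gf (2*M+1) (?z t) / (1 + t) \<le> 1 / e * (CW * I)" if t: "t \<in> {0..T}" for t
    proof -
      have S': "?z s \<in> Sol" if "s \<in> {0..t}" for s using S[of s] that t by auto
      have a: "0 \<le> d / 2 * ?I t" using I0[OF t S'] c by simp
      have b: "0 \<le> e * (Gf (2*M+1) (?z t) / (1 + t))" using e t by simp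
      have "W t + d / 2 * ?I t \<le> W 0" by (rule decay[OF t S'])
      note f = this W0 Z0[OF S[OF t]]
      show "d / 2 * ?I t \<le> CW * I" using f b unfolding W_def[of t] by argo
      show "?Z (?z t) \<le> CW * I" using f a b unfolding W_def[of t] by argo
      have "e * (Gf (2*M+1) (?z t) / (1 + t)) \<le> CW * I" using f a unfolding W_def[of t] by argo
      then show "Gf (2*M+1) (?z t) / (1 + t) \<le> 1 / e * (CW * I)" using e by (simp add: field_simps)
    qed
    have IT: "?I t \<le> 2 / d * (CW * I)" if "t \<in> {0..T}" for t
      using It[OF that] c by (simp add: field_simps)
    have DI: "integral {0..T} (Dfull T M u \<theta> K) \<le> C8 * (2 / d * (CW * I))"
    proof -
      have "integral {0..T} (Dfull T M u \<theta> K) \<le> integral {0..T} (\<lambda>t. C8 * calD (?z t))"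
        using b8[OF S] \<kappa>
        by (intro integral_le integrable_continuous_real continuous_on_Dfull[OF sol] continuous_intros continuous_on_calD[OF sol]) auto
      also have "\<dots> = C8 * ?I T" by simp
      also have "\<dots> \<le> C8 * (2 / d * (CW * I))" using IT[of T] T 8 by (intro mult_left_mono) auto
      finally show ?thesis .
    qed
    show "\<forall>t\<in>{0..T}. Elow T u \<theta> K t * (1 + t) ^ (2*M - 2) + Ebar T M u \<theta> K t + Ffun T M K t / (1 + t)
           + integral {0..T} (Dfull T M u \<theta> K) \<le> (D1 + D2) * (Ebar T M u \<theta> K 0 + Ffun T M K 0)"
    proof
      fix t assume t: "t \<in> {0..T}"
      note z = S[OF t]
      have "Elow T u \<theta> K t * (1 + t) ^ (2*M - 2) \<le> C5 * (CW * I)"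
        using order_trans[OF b5[OF z] mult_left_mono[OF Zt[OF t]]] 5 \<kappa> by simp
      moreover have "Ebar T M u \<theta> K t \<le> C4 * (CW * I)"
        using order_trans[OF b4[OF z] mult_left_mono[OF Zt[OF t]]] 4 \<kappa> by simp
      moreover have "Ffun T M K t / (1 + t) \<le> C6 * ((1 / e + 1) * (CW * I))"
      proof -
        have "Ffun T M K t / (1 + t) \<le> C6 * (Gf (2*M+1) (?z t) + ?Z (?z t)) / (1 + t)"
          using b6[OF z] \<kappa> t by (intro divide_right_mono) auto
        also have "\<dots> = C6 * (Gf (2*M+1) (?z t) / (1 + t) + ?Z (?z t) / (1 + t))" by (simp only: add_divide_distrib times_divide_eq_right distrib_left)
        also have "\<dots> \<le> C6 * (1 / e * (CW * I) + CW * I)"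
        proof -
          have "?Z (?z t) / (1 + t) \<le> ?Z (?z t)" using t Z0[OF z] divide_left_mono[of 1 "1 + t" "?Z (?z t)"] by simp
          then show ?thesis using 6 Gt[OF t] Zt[OF t] by (intro mult_left_mono add_mono) auto
        qed
        finally show ?thesis by (simp add: distrib_right)
      qed
      ultimately have "Elow T u \<theta> K t * (1 + t) ^ (2*M - 2) + Ebar T M u \<theta> K t + Ffun T M K t / (1 + t)
           + integral {0..T} (Dfull T M u \<theta> K) \<le> C5 * (CW * I) + C4 * (CW * I) + C6 * ((1 / e + 1) * (CW * I)) + C8 * (2 / d * (CW * I))"
        using DI by (intro add_mono)
      also have "\<dots> = D1 * I" unfolding D1_def by (simp only: distrib_right mult.assoc)
      also have "\<dots> \<le> (D1 + D2) * I" using D I by (intro mult_right_mono) auto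
      finally show "Elow T u \<theta> K t * (1 + t) ^ (2*M - 2) + Ebar T M u \<theta> K t + Ffun T M K t / (1 + t)
           + integral {0..T} (Dfull T M u \<theta> K) \<le> (D1 + D2) * (Ebar T M u \<theta> K 0 + Ffun T M K 0)"
        unfolding I_def .
    qed
    show "\<forall>t\<in>{0..T}. EK T M K t \<le> (D1 + D2) * (Efull T M u \<theta> K 0 + Ffun T M K 0)"
    proof
      fix t assume t: "t \<in> {0..T}"
      note z = S[OF t]
      let ?g = "\<lambda>t. (1 + 1 / (1 + t)) * Gf (2*M-3) (?z t)"
      have "?g t \<le> ?g 0 + C3 * ?I t"
      proof (rule integrated_inequality[OF sol t Gf_weighted_derivative(2)[OF sol]])
        fix s assume "s \<in> {0..t}"
        then have "?z s \<in> Sol" using S t by auto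
        from b3[OF this] show "(1 + 1 / (1 + s)) * Gd (2*M-3) (?z s) - Gf (2*M-3) (?z s) / (1 + s)\<^sup>2 \<le> C3 * calD (?z s)"
          using \<kappa> by simp
      qed
      moreover have "Gf (2*M-3) (?z t) \<le> ?g t" using t by (simp add: mult_le_cancel_right1 not_less)
      moreover have "?g 0 \<le> 2 * (N\<^sup>2 * I)"
      proof -
        have "Gf (2*M-3) (?z 0) \<le> Gf (2*M+1) (?z 0)" unfolding Gf_def by (intro sum_mono2 SL_mono) auto
        also have "\<dots> \<le> N\<^sup>2 * I" using order_trans[OF G0 mult_left_mono[OF I(4)]] by simp
        finally show ?thesis by simp
      qed
      moreover have "C3 * ?I t \<le> C3 * (2 / d * (CW * I))" using IT[OF t] 3 by (intro mult_left_mono) auto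
      ultimately have G3: "Gf (2*M-3) (?z t) \<le> 2 * (N\<^sup>2 * I) + C3 * (2 / d * (CW * I))" by argo
      have "EK T M K t \<le> C7 * (Gf (2*M-3) (?z t) + ?Z (?z t))" using b7[OF z] \<kappa> by simp
      also have "\<dots> \<le> C7 * (2 * (N\<^sup>2 * I) + C3 * (2 / d * (CW * I)) + CW * I)"
        using 7 G3 Zt[OF t] by (intro mult_left_mono add_mono) auto
      also have "\<dots> = D2 * I" unfolding D2_def by (simp only: distrib_right distrib_left mult.assoc mult_1_left)
      also have "\<dots> \<le> (D1 + D2) * I" using D I by (intro mult_right_mono) auto
      also have "\<dots> \<le> (D1 + D2) * (Efull T M u \<theta> K 0 + Ffun T M K 0)" using D I by (intro mult_left_mono) auto
      finally show "EK T M K t \<le> (D1 + D2) * (Efull T M u \<theta> K 0 + Ffun T M K 0)" .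
    qed
  qed
qed

end

theorem theorem4p33:
  fixes mu kappa alpha beta gamma tau lam nu :: real and M :: nat
  assumes "mu > 0" "kappa > 0" "alpha > 0" "beta > 0" "gamma > 0" "tau > 0"
    and "lam > 0" "nu > lam" and "M \<ge> 4"
  shows "\<exists>eta delta C. eta \<in> {0<..1} \<and> delta \<in> {0<..1} \<and> C > 0 \<and>
    (\<forall>T (u :: real \<Rightarrow> real^3 \<Rightarrow> real^3) (p :: real \<Rightarrow> real^3 \<Rightarrow> real)
        (\<theta> :: real \<Rightarrow> real^3 \<Rightarrow> real^3) (K :: real \<Rightarrow> real^3 \<Rightarrow> real^3^3).
      T > 0 \<and>
      smooth_on T u \<and> smooth_on T p \<and> smooth_on T \<theta> \<and> smooth_on T K \<and>
      periodic u \<and> periodic p \<and> periodic \<theta> \<and> periodic K \<and>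
      system_P mu kappa alpha beta gamma tau lam nu T u p \<theta> K \<and>
      (\<forall>t\<in>{0..T}. integral (cbox 0 1) (u t) = 0) \<and>
      (\<forall>x s. det (s *\<^sub>R mat 1 - (Jeq lam nu + K 0 x)) = (s - lam)^2 * (s - nu)) \<and>
      Efull T M u \<theta> K 0 + Ffun T M K 0 \<le> eta \<and>
      (\<forall>t\<in>{0..T}. Efull T M u \<theta> K t + integral {0..T} (Dbar T M u \<theta>) \<le> delta)
      \<longrightarrow>
      (\<forall>t\<in>{0..T}.
         Elow T u \<theta> K t * (1 + t) ^ (2*M - 2) + Ebar T M u \<theta> K t + Ffun T M K t / (1 + t)
           + integral {0..T} (Dfull T M u \<theta> K)
         \<le> C * (Ebar T M u \<theta> K 0 + Ffun T M K 0)) \<and>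
      (\<forall>t\<in>{0..T}. EK T M K t \<le> C * (Efull T M u \<theta> K 0 + Ffun T M K 0)))"
proof -
  interpret par mu kappa alpha beta gamma tau lam nu M using assms by unfold_locales
  have s: "sol T u p \<theta> K" if "T > 0" "smooth_on T u" "smooth_on T p" "smooth_on T \<theta>" "smooth_on T K"
    "periodic u" "periodic p" "periodic \<theta>" "periodic K" "system_P mu kappa alpha beta gamma tau lam nu T u p \<theta> K"
    "\<forall>t\<in>{0..T}. integral (cbox 0 1) (u t) = 0" for T u p \<theta> K
    using that unfolding sol_def smper_def by (intro conjI)
  obtain \<eta> \<delta> C where h: "\<eta> \<in> {0<..1}" "\<delta> \<in> {0<..1}" "C > 0"
    and r: "\<forall>T u p \<theta> K. sol T u p \<theta> K \<and> Efull T M u \<theta> K 0 + Ffun T M K 0 \<le> \<eta> \<and>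
      (\<forall>t\<in>{0..T}. Efull T M u \<theta> K t + integral {0..T} (Dbar T M u \<theta>) \<le> \<delta>) \<longrightarrow>
      (\<forall>t\<in>{0..T}.
         Elow T u \<theta> K t * (1 + t) ^ (2*M - 2) + Ebar T M u \<theta> K t + Ffun T M K t / (1 + t)
           + integral {0..T} (Dfull T M u \<theta> K)
         \<le> C * (Ebar T M u \<theta> K 0 + Ffun T M K 0)) \<and>
      (\<forall>t\<in>{0..T}. EK T M K t \<le> C * (Efull T M u \<theta> K 0 + Ffun T M K 0))"
    using a_priori_estimate by (elim exE conjE) (rule that)
  show ?thesis
  proof (rule exI[of _ \<eta>], rule exI[of _ \<delta>], rule exI[of _ C], intro conjI[OF h(1)] conjI[OF h(2)] conjI[OF h(3)] allI impI, elim conjE)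
    fix T u p \<theta> K
    assume a: "T > 0" "smooth_on T u" "smooth_on T p" "smooth_on T \<theta>" "smooth_on T K"
      "periodic u" "periodic p" "periodic \<theta>" "periodic K" "system_P mu kappa alpha beta gamma tau lam nu T u p \<theta> K"
      "\<forall>t\<in>{0..T}. integral (cbox 0 1) (u t) = 0"
      and b: "Efull T M u \<theta> K 0 + Ffun T M K 0 \<le> \<eta>" "\<forall>t\<in>{0..T}. Efull T M u \<theta> K t + integral {0..T} (Dbar T M u \<theta>) \<le> \<delta>"
    show "(\<forall>t\<in>{0..T}.
         Elow T u \<theta> K t * (1 + t) ^ (2*M - 2) + Ebar T M u \<theta> K t + Ffun T M K t / (1 + t)
           + integral {0..T} (Dfull T M u \<theta> K)
         \<le> C * (Ebar T M u \<theta> K 0 + Ffun T M K 0)) \<and>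
      (\<forall>t\<in>{0..T}. EK T M K t \<le> C * (Efull T M u \<theta> K 0 + Ffun T M K 0))"
      by (rule mp[OF spec[OF spec[OF spec[OF spec[OF spec[OF r]]]]] conjI[OF s[OF a] conjI[OF b]]])
  qed
qed

end
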